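(* Let $\chi$ be a primitive Dirichlet character modulo $q$, and let $k \geq 1$ and $\ell > 0$ be real numbers. Then the generalized Riemann hypothesis for $L(s,\chi)$ (i.e., all non-trivial zeros of $L(s,\chi)$ lie on the line $\Re(s) = \frac{1}{2}$) holds if and only if for every $\epsilon > 0$, $$P_{k,\ell,\chi}(x) := \sum_{n=1}^{\infty} \frac{\chi(n)\mu(n)}{n^{k}} \exp\left(-\frac{x}{n^{\ell}}\right) = O_{\epsilon,k,\ell}\left(x^{-\frac{k}{\ell} + \frac{1}{2\ell} + \epsilon}\right) \quad \text{as } x \to \infty.$$
   Context: $\mu(n)$ is the Möbius function and $L(s,\chi)=\sum_{n\ge1}\chi(n)n^{-s}$ is the Dirichlet $L$-function of $\chi$. The non-trivial zeros of $L(s,\chi)$ are its zeros in the strip $0<\Re(s)<1$. *)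

theory Defs
  imports
    "HOL-Complex_Analysis.Complex_Analysis"
    "HOL-Computational_Algebra.Computational_Algebra"
    "HOL-Library.Landau_Symbols"
begin

definition moebius :: "nat \<Rightarrow> int" where
  "moebius n = (if squarefree n then (-1) ^ card (prime_factors n) else 0)"

definition dirichlet_character :: "nat \<Rightarrow> (int \<Rightarrow> complex) \<Rightarrow> bool" where
  "dirichlet_character q chi \<longleftrightarrow>
     q > 0 \<and>
     (\<forall>m n. chi (m * n) = chi m * chi n) \<and>
     (\<forall>n. chi (n + int q) = chi n) \<and>
     (\<forall>n. chi n \<noteq> 0 \<longleftrightarrow> coprime n (int q))"

text \<open>A character is primitive if no character to a proper divisor of the modulus induces it.
  The trivial character modulo \<open>1\<close>, whose \<open>L\<close>-function is the Riemann zeta function,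
  is primitive.\<close>

definition induced_by :: "nat \<Rightarrow> (int \<Rightarrow> complex) \<Rightarrow> (int \<Rightarrow> complex) \<Rightarrow> bool" where
  "induced_by q chi chi' \<longleftrightarrow> (\<forall>n. coprime n (int q) \<longrightarrow> chi n = chi' n)"

definition primitive_dirichlet_character :: "nat \<Rightarrow> (int \<Rightarrow> complex) \<Rightarrow> bool" where
  "primitive_dirichlet_character q chi \<longleftrightarrow>
     dirichlet_character q chi \<and>
     \<not> (\<exists>d chi'. d dvd q \<and> d < q \<and> dirichlet_character d chi' \<and> induced_by q chi chi')"

text \<open>The Dirichlet series defines \<open>L(s,chi)\<close> for \<open>Re s > 1\<close>; elsewhere \<open>L(s,chi)\<close> is its
  analytic continuation, holomorphic except possibly for a pole at \<open>1\<close>. The condition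
  \<open>nicely_meromorphic_on\<close> only fixes the value at \<open>1\<close>: the removable value, or \<open>0\<close> at a pole.\<close>

definition is_dirichlet_L :: "(int \<Rightarrow> complex) \<Rightarrow> (complex \<Rightarrow> complex) \<Rightarrow> bool" where
  "is_dirichlet_L chi f \<longleftrightarrow>
     f holomorphic_on (- {1}) \<and> f nicely_meromorphic_on UNIV \<and>
     (\<forall>s. Re s > 1 \<longrightarrow> f s = (\<Sum>n. chi (int (Suc n)) * of_nat (Suc n) powr (- s)))"

definition dirichlet_L :: "(int \<Rightarrow> complex) \<Rightarrow> complex \<Rightarrow> complex" where
  "dirichlet_L chi = (THE f. is_dirichlet_L chi f)"

lemma is_dirichlet_L_unique:
  assumes f: "is_dirichlet_L chi f" and g: "is_dirichlet_L chi g"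
  shows "f = g"
proof -
  have off: "f z = g z" if "z \<noteq> 1" for z
  proof -
    have "f z - g z = 0"
    proof (rule analytic_continuation_open[where s = "{s. Re s > 1}" and s' = "- {1}"
            and f = "\<lambda>z. f z - g z" and g = "\<lambda>_. 0"])
      show "open {s. Re s > 1}" by (rule open_halfspace_Re_gt)
      have "2 \<in> {s. Re s > 1}" by simp
      then show "{s. Re s > 1} \<noteq> {}" by blast
      show "connected (- {1 :: complex})" by (rule connected_punctured_universe) simp
    qed (use f g that in \<open>auto simp: is_dirichlet_L_def intro!: holomorphic_intros\<close>)
    then show ?thesis by simp
  qed
  have ev: "\<forall>\<^sub>F z in at 1. f z = g z"
    using off by (auto simp: eventually_at_filter)
  have pole: "is_pole f 1 \<longleftrightarrow> is_pole g 1"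
    using ev by (rule is_pole_cong) simp
  have lim: "f \<midarrow>1\<rightarrow> c \<longleftrightarrow> g \<midarrow>1\<rightarrow> c" for c
    using ev by (rule tendsto_cong)
  have "is_pole f 1 \<and> f 1 = 0 \<or> f \<midarrow>1\<rightarrow> f 1" "is_pole g 1 \<and> g 1 = 0 \<or> g \<midarrow>1\<rightarrow> g 1"
    using f g by (auto simp: is_dirichlet_L_def nicely_meromorphic_on_def)
  moreover have "\<not> (is_pole f 1 \<and> f \<midarrow>1\<rightarrow> c)" for c
    unfolding is_pole_def using not_tendsto_and_filterlim_at_infinity[of "at (1::complex)" f c]
    by auto
  ultimately have "f 1 = g 1"
    using pole lim tendsto_unique[of "at (1::complex)" f "f 1" "g 1"] by auto
  then show ?thesis using off by (metis ext)
qed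

definition nontrivial_zeros :: "(int \<Rightarrow> complex) \<Rightarrow> complex set" where
  "nontrivial_zeros chi = {s. 0 < Re s \<and> Re s < 1 \<and> dirichlet_L chi s = 0}"

definition GRH :: "(int \<Rightarrow> complex) \<Rightarrow> bool" where
  "GRH chi \<longleftrightarrow> (\<forall>s\<in>nontrivial_zeros chi. Re s = 1 / 2)"

text \<open>For \<open>k = 1\<close> the series converges only conditionally; \<open>suminf\<close> is the limit of
  its ordered partial sums.\<close>

definition riesz_P :: "real \<Rightarrow> real \<Rightarrow> (int \<Rightarrow> complex) \<Rightarrow> real \<Rightarrow> complex" where
  "riesz_P k l chi x =
     (\<Sum>n. chi (int (Suc n)) * of_int (moebius (Suc n)) / of_real (real (Suc n) powr k)
            * of_real (exp (- (x / real (Suc n) powr l))))"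

end

theory Submission
  imports Defs "HOL-Complex_Analysis.Complex_Analysis" "HOL-Probability.Probability"
    "HOL-Number_Theory.Number_Theory" "HOL-Real_Asymp.Real_Asymp"
begin

text \<open>Let \<open>A(s) = 1 / L(s, \<chi>)\<close>. The power series of the exponential gives
  \<open>P(x) = (\<Sum>m. (-x)^m / m! * A(k + l m))\<close>, which is the sum of the residues of
  \<open>\<Gamma>(s) x^(-s) A(k - l s)\<close> at the poles of \<open>\<Gamma>\<close>. Under the Riemann hypothesis \<open>A\<close> grows polynomially on
  \<open>Re s \<ge> 1/2 + \<eta>\<close> (Borel--Caratheodory applied to \<open>log L\<close>), so \<open>2 \<pi> P(x)\<close> is the integral of this function over the
  line \<open>Re s = (k - 1/2 - \<eta>) / l\<close>, on which \<open>x^(-s)\<close> has the required size. Conversely, the Mellin transform of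
  \<open>P - A(k)\<close> equals \<open>\<Gamma>(s) A(k - l s)\<close> on \<open>-1 < Re s < 0\<close>; by the bound on \<open>P\<close> it continues to
  \<open>Re s < (k - 1/2) / l\<close> with a simple pole at \<open>0\<close>; hence \<open>L\<close> has no zeros with real part in \<open>(1/2, 1)\<close>, and the functional equation excludes those
  with real part in \<open>(0, 1/2)\<close>. For \<open>k = 1\<close> the conditional convergence of \<open>\<Sum> \<chi>(n) \<mu>(n) / n\<close>
  comes from the non-vanishing of \<open>L\<close> on \<open>Re s = 1\<close> by Newman's Tauberian argument. The functional equation is obtained from
  Poisson summation for Fourier eigenfunctions that vanish at \<open>0\<close>, so that the Mellin transform of the theta function has no boundary terms.\<close>

section \<open>Holomorphic parameter integrals\<close>

text \<open>Writing \<open>x = exp u\<close> turns Mellin transforms into two-sided Laplace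
  transforms against Lebesgue measure on the line, so that a rescaling of the variable is a
  translation and each term of a Dirichlet series contributes a translate of one fixed function.
  Subtracting \<open>A(k) = P(0)\<close> serves twice: it removes the term \<open>m = 0\<close>,
  whose series converges only conditionally for \<open>k = 1\<close>, and it leaves a function that
  is \<open>O(x)\<close> at \<open>0\<close>, which opens the strip \<open>-1 < Re s < 0\<close>;
  there \<open>Re (k - l s) > 1\<close> and all sums converge absolutely. In the converse no
  quotient is continued. Multiplying by \<open>s\<close>, by \<open>1 / \<Gamma>(s + 1)\<close> and
  by \<open>L(k - l s)\<close> gives an identity between holomorphic functions whose right-hand side
  is \<open>1\<close> or \<open>k - l s - 1\<close>, so a zero of \<open>L\<close> in the continued
  strip contradicts it at once, whatever the value of \<open>A(k)\<close>. In the direct part only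
  the region next to the critical line is conditional: on the lines \<open>Re s = - M - 1/2\<close>
  the argument of \<open>A\<close> lies in the region of absolute convergence, and the factorial
  decay of \<Gamma> beats \<open>x^M\<close>.\<close>

lemma deriv_bound_on_ball:
  assumes hol: "f holomorphic_on ball s (r::real)" and r: "r > 0"
    and bnd: "\<And>z. z \<in> ball s r \<Longrightarrow> norm (f z) \<le> B"
    and z: "z \<in> ball s (r/2)"
  shows "norm (deriv f z) \<le> 4 * B / r"
proof -
  \<comment> \<open>A point of the half ball is at distance more than \<open>r/2\<close> from the
    complement, so the closed disc of radius \<open>r/4\<close> fits; this radius is the source of
    the factor \<open>4 / r\<close>.\<close>
  have sub: "cball z (r/4) \<subseteq> ball s r"
  proof
    fix w assume "w \<in> cball z (r/4)"
    then have "dist s w \<le> dist s z + r/4"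
      using dist_triangle[of s w z] by simp
    then show "w \<in> ball s r" using z r by simp
  qed
  have "norm ((deriv ^^ 1) f z) \<le> fact 1 * B / (r/4)^1"
  proof (rule Cauchy_inequality)
    show "f holomorphic_on ball z (r/4)"
      using hol sub by (meson ball_subset_cball holomorphic_on_subset order_trans)
    show "continuous_on (cball z (r/4)) f"
      using hol sub holomorphic_on_imp_continuous_on continuous_on_subset by blast
    show "r/4 > 0" using r by simp
    show "norm (f x) \<le> B" if "norm (z - x) = r/4" for x
      using that sub by (intro bnd) (auto simp: dist_norm subset_iff)
  qed
  then show ?thesis by (simp add: mult.commute)
qed

lemma difference_bound_on_ball:
  assumes hol: "f holomorphic_on ball s (r::real)" and r: "r > 0"
    and bnd: "\<And>z. z \<in> ball s r \<Longrightarrow> norm (f z) \<le> B"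
    and z: "z \<in> ball s (r/2)"
  shows "norm (f z - f s) \<le> 4 * B / r * norm (z - s)"
proof (rule field_differentiable_bound[where S = "ball s (r/2)" and f' = "deriv f"])
  show "(f has_field_derivative deriv f w) (at w within ball s (r/2))" if "w \<in> ball s (r/2)" for w
    using that r hol
    by (intro has_field_derivative_at_within[OF holomorphic_derivI[of f "ball s r"]]) auto
  show "norm (deriv f w) \<le> 4 * B / r" if "w \<in> ball s (r/2)" for w
    using deriv_bound_on_ball[OF hol r bnd that] .
qed (use z r in auto)

text \<open>Only the function itself is assumed to have a local majorant. Cauchy's estimate on a
  smaller ball turns it into a majorant of the difference quotients, and dominated convergence,
  applied along every sequence tending to the point, gives the derivative under the
  integral.\<close>

lemma holomorphic_on_lebesgue_integral:
  fixes f :: "complex \<Rightarrow> 'a \<Rightarrow> complex"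
  assumes hol: "\<And>x. x \<in> space M \<Longrightarrow> (\<lambda>s. f s x) holomorphic_on S"
    and meas: "\<And>s. s \<in> S \<Longrightarrow> f s \<in> borel_measurable M"
    and bnd: "\<And>s. s \<in> S \<Longrightarrow> \<exists>r>0. \<exists>g. ball s r \<subseteq> S \<and> integrable M g \<and>
                 (\<forall>z\<in>ball s r. \<forall>x\<in>space M. norm (f z x) \<le> g x)"
  shows "(\<lambda>s. integral\<^sup>L M (f s)) holomorphic_on S"
    and "\<And>s. s \<in> S \<Longrightarrow> integrable M (f s)"
proof -
  show int: "integrable M (f s)" if s: "s \<in> S" for s
  proof -
    obtain r g where r: "r > 0" "ball s r \<subseteq> S" "integrable M g"
      "\<And>z x. z \<in> ball s r \<Longrightarrow> x \<in> space M \<Longrightarrow> norm (f z x) \<le> g x"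
      using bnd[OF s] by blast
    show ?thesis
      by (rule Bochner_Integration.integrable_bound[OF r(3) meas[OF s]])
         (use r in \<open>auto intro!: AE_I2 order_trans[OF _ abs_ge_self]\<close>)
  qed
  show "(\<lambda>s. integral\<^sup>L M (f s)) holomorphic_on S"
    unfolding holomorphic_on_def
  proof
    fix s assume s: "s \<in> S"
    obtain r g where r: "r > 0" "ball s r \<subseteq> S" "integrable M g"
      and g: "\<And>z x. z \<in> ball s r \<Longrightarrow> x \<in> space M \<Longrightarrow> norm (f z x) \<le> g x"
      using bnd[OF s] by blast
    have hol': "(\<lambda>s. f s x) holomorphic_on ball s r" if "x \<in> space M" for x
      using hol[OF that] r(2) holomorphic_on_subset by blast
    define D where "D = (\<lambda>x. deriv (\<lambda>s. f s x) s)"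
    have seq: "(\<lambda>n. (integral\<^sup>L M (f (X n)) - integral\<^sup>L M (f s)) / (X n - s)) \<longlonglongrightarrow> integral\<^sup>L M D"
      if X: "\<And>n. X n \<in> ball s (r/2) - {s}" "X \<longlonglongrightarrow> s" for X
    proof -
      have XS: "X n \<in> S" "X n \<in> ball s r" "X n \<noteq> s" for n
        using X(1)[of n] r by (auto simp: subset_iff)
      have eq: "(integral\<^sup>L M (f (X n)) - integral\<^sup>L M (f s)) / (X n - s)
            = integral\<^sup>L M (\<lambda>x. (f (X n) x - f s x) / (X n - s))" for n
        using int[OF s] int[OF XS(1)[of n]] by simp
      have lim: "(\<lambda>n. (f (X n) x - f s x) / (X n - s)) \<longlonglongrightarrow> D x" if x: "x \<in> space M" for x
      proof -
        have "((\<lambda>s. f s x) has_field_derivative D x) (at s)"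
          unfolding D_def using hol'[OF x] r(1) by (intro holomorphic_derivI[of _ "ball s r"]) auto
        then have "((\<lambda>z. (f z x - f s x) / (z - s)) \<longlongrightarrow> D x) (at s)"
          by (simp add: has_field_derivative_iff)
        then show ?thesis
          using X(2) XS(3) unfolding tendsto_at_iff_sequentially
          by (auto simp: comp_def)
      qed
      have m: "(\<lambda>x. (f (X n) x - f s x) / (X n - s)) \<in> borel_measurable M" for n
        using meas[OF s] meas[OF XS(1)[of n]] by measurable
      have "(\<lambda>n. integral\<^sup>L M (\<lambda>x. (f (X n) x - f s x) / (X n - s))) \<longlonglongrightarrow> integral\<^sup>L M D"
      proof (rule integral_dominated_convergence)
        show "D \<in> borel_measurable M"
          by (rule borel_measurable_LIMSEQ_metric[OF m lim])
        show "integrable M (\<lambda>x. 4 / r * g x)" using r(3) by simp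
        show "AE x in M. norm ((f (X n) x - f s x) / (X n - s)) \<le> 4 / r * g x" for n
        proof (rule AE_I2)
          fix x assume x: "x \<in> space M"
          have "norm (f (X n) x - f s x) \<le> 4 * g x / r * norm (X n - s)"
            using difference_bound_on_ball[OF hol'[OF x] r(1), of "g x" "X n"] g x X(1)[of n] by auto
          then show "norm ((f (X n) x - f s x) / (X n - s)) \<le> 4 / r * g x"
            using XS(3)[of n] r(1) by (simp add: norm_divide divide_simps mult_ac)
        qed
      qed (use m lim in \<open>auto intro!: AE_I2\<close>)
      then show ?thesis by (simp add: eq)
    qed
    have "((\<lambda>z. (integral\<^sup>L M (f z) - integral\<^sup>L M (f s)) / (z - s)) \<longlongrightarrow> integral\<^sup>L M D)
            (at s within ball s (r/2))"
      unfolding tendsto_at_iff_sequentially using seq by (auto simp: comp_def)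
    then have "((\<lambda>s. integral\<^sup>L M (f s)) has_field_derivative integral\<^sup>L M D) (at s within ball s (r/2))"
      by (simp add: has_field_derivative_iff)
    then have "((\<lambda>s. integral\<^sup>L M (f s)) has_field_derivative integral\<^sup>L M D) (at s)"
      using r(1) by (simp add: at_within_open[of s "ball s (r/2)"])
    then show "(\<lambda>s. integral\<^sup>L M (f s)) field_differentiable at s within S"
      unfolding field_differentiable_def using has_field_derivative_at_within by blast
  qed
qed

section \<open>Integrals along vertical lines\<close>

lemma inverse_1_plus_square_lborel:
  "integrable lborel (\<lambda>t::real. 1 / (1 + t\<^sup>2))" "(LINT t|lborel. 1 / (1 + t\<^sup>2)) = pi"
proof -
  show "integrable lborel (\<lambda>t::real. 1 / (1 + t\<^sup>2))"
    using Sinc_Integral.integrable_inverse_1_plus_square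
    by (simp add: set_integrable_def einterval_eq_UNIV divide_inverse)
  show "(LINT t|lborel. 1 / (1 + t\<^sup>2)) = pi"
    using Sinc_Integral.LBINT_inverse_1_plus_square
    by (simp add: interval_lebesgue_integral_def set_lebesgue_integral_def einterval_eq_UNIV divide_inverse)
qed

lemma inverse_square_plus_square_lborel:
  assumes "c > 0"
  shows "integrable lborel (\<lambda>t::real. 1 / (c\<^sup>2 + t\<^sup>2))" "(LINT t|lborel. 1 / (c\<^sup>2 + t\<^sup>2)) = pi / c"
proof -
  have eq: "1 / (c\<^sup>2 + (0 + c * t)\<^sup>2) = 1 / c\<^sup>2 * (1 / (1 + t\<^sup>2))" for t
    using assms by (simp add: power_mult_distrib divide_simps algebra_simps)
  have "integrable lborel (\<lambda>t. 1 / (c\<^sup>2 + (0 + c * t)\<^sup>2))"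
    unfolding eq using inverse_1_plus_square_lborel(1) by (intro integrable_mult_right) auto
  then show "integrable lborel (\<lambda>t::real. 1 / (c\<^sup>2 + t\<^sup>2))"
    using lborel_integrable_real_affine_iff[of c "\<lambda>t. 1 / (c\<^sup>2 + t\<^sup>2)" 0] assms by simp
  have "(LINT t|lborel. 1 / (c\<^sup>2 + t\<^sup>2)) = \<bar>c\<bar> *\<^sub>R (LINT t|lborel. 1 / (c\<^sup>2 + (0 + c * t)\<^sup>2))"
    using assms by (intro lborel_integral_real_affine) auto
  also have "\<dots> = c * (1 / c\<^sup>2 * pi)"
    unfolding eq integral_mult_right_zero inverse_1_plus_square_lborel(2) using assms by simp
  finally show "(LINT t|lborel. 1 / (c\<^sup>2 + t\<^sup>2)) = pi / c"
    using assms by (simp add: power2_eq_square)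
qed

lemma inverse_1_plus_shifted_square_integrable:
  "integrable lborel (\<lambda>t::real. C / (1 + (a + t)\<^sup>2))"
proof -
  have "integrable lborel (\<lambda>t::real. 1 / (1 + (a + 1 * t)\<^sup>2))"
    by (rule lborel_integrable_real_affine) (auto simp: inverse_1_plus_square_lborel(1))
  then have "integrable lborel (\<lambda>t::real. C * (1 / (1 + (a + 1 * t)\<^sup>2)))"
    by (rule integrable_mult_right)
  then show ?thesis by simp
qed

lemma one_plus_square_shift_le:
  fixes u v :: real
  assumes "\<bar>u - v\<bar> \<le> 1"
  shows "1 + v\<^sup>2 \<le> 3 * (1 + u\<^sup>2)"
proof -
  have "v\<^sup>2 \<le> 2 * u\<^sup>2 + 2 * (u - v)\<^sup>2"
    using sum_squares_ge_zero[of "2*u - v" 0] by (simp add: power2_eq_square algebra_simps)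
  moreover have "(u - v)\<^sup>2 \<le> 1" using assms by (simp add: abs_square_le_1)
  ultimately have "v\<^sup>2 \<le> 2 * u\<^sup>2 + 2" by linarith
  also have "2 * u\<^sup>2 + 2 \<le> 3 * u\<^sup>2 + 2" by simp
  finally show ?thesis by (simp add: algebra_simps)
qed

lemma open_vertical_strip: "open {z. a < Re z \<and> Re z < b}"
  by (intro open_Collect_conj open_halfspace_Re_gt open_halfspace_Re_lt)

lemma convex_vertical_strip: "convex {z. a < Re z \<and> Re z < b}"
proof -
  have "{z. a < Re z \<and> Re z < b} = {z. Re z > a} \<inter> {z. Re z < b}" by auto
  then show ?thesis by (simp add: convex_Int convex_halfspace_Re_gt convex_halfspace_Re_lt)
qed

text \<open>As a function of \<open>s\<close>, the integral of \<open>F (s + i t)\<close> over \<open>t\<close> is holomorphic, and translation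
  invariance of the measure makes it constant on vertical lines; so its derivative vanishes.\<close>

lemma vertical_integral_shift:
  assumes hol: "F holomorphic_on {z. a < Re z \<and> Re z < b}"
    and bnd: "\<And>z. a < Re z \<Longrightarrow> Re z < b \<Longrightarrow> norm (F z) \<le> C / (1 + (Im z)\<^sup>2)"
    and c: "a < c" "c < b" and d: "a < d" "d < b"
  shows "(LINT t|lborel. F (Complex c t)) = (LINT t|lborel. F (Complex d t))"
    and "integrable lborel (\<lambda>t. F (Complex c t))"
proof -
  let ?S = "{z. a < Re z \<and> Re z < b}"
  define f where "f = (\<lambda>s t. F (s + \<i> * complex_of_real t))"
  have C: "C \<ge> 0"
  proof -
    have "0 \<le> norm (F (of_real c))" by simp
    also have "\<dots> \<le> C" using bnd[of "of_real c"] c by simp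
    finally show ?thesis .
  qed
  have Finf: "(\<lambda>t. F (s + \<i> * complex_of_real t)) \<in> borel_measurable lborel" if "s \<in> ?S" for s
  proof -
    have "continuous_on UNIV (\<lambda>t. F (s + \<i> * complex_of_real t))"
      using that
      by (intro continuous_on_compose2[OF holomorphic_on_imp_continuous_on[OF hol]] continuous_intros) auto
    then show ?thesis by (simp add: borel_measurable_continuous_onI)
  qed
  have hol1: "(\<lambda>s. integral\<^sup>L lborel (f s)) holomorphic_on ?S"
    and int: "\<And>s. s \<in> ?S \<Longrightarrow> integrable lborel (f s)"
  proof -
    have 1: "(\<lambda>s. f s x) holomorphic_on ?S" for x
      unfolding f_def
      by (rule holomorphic_on_compose_gen[OF _ hol, of "\<lambda>s. s + \<i> * complex_of_real x", unfolded comp_def])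
         (auto intro!: holomorphic_intros)
    have 2: "f s \<in> borel_measurable lborel" if "s \<in> ?S" for s
      unfolding f_def by (rule Finf[OF that])
    have 3: "\<exists>r>0. \<exists>g. ball s r \<subseteq> ?S \<and> integrable lborel g \<and>
                 (\<forall>z\<in>ball s r. \<forall>x\<in>space lborel. norm (f z x) \<le> g x)" if s: "s \<in> ?S" for s
    proof -
      obtain r where r: "r > 0" "ball s r \<subseteq> ?S"
        using s open_contains_ball open_vertical_strip by blast
      define r' where "r' = min r 1"
      \<comment> \<open>In a ball of radius at most 1 the imaginary part moves by at most 1, which
        changes \<open>1 + t^2\<close> by a factor of at most 3; hence one majorant serves the whole
        ball.\<close>
      have "norm (f z t) \<le> 3 * C / (1 + (Im s + t)\<^sup>2)" if z: "z \<in> ball s r'" for z t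
      proof -
        have zS: "z \<in> ?S" using z r unfolding r'_def by auto
        have "\<bar>Im z - Im s\<bar> \<le> 1"
          using z abs_Im_le_cmod[of "z - s"] by (auto simp: r'_def dist_norm norm_minus_commute)
        then have *: "1 + (Im s + t)\<^sup>2 \<le> 3 * (1 + (Im z + t)\<^sup>2)"
          by (intro one_plus_square_shift_le) auto
        have "norm (f z t) \<le> C / (1 + (Im z + t)\<^sup>2)"
          unfolding f_def using bnd[of "z + \<i> * complex_of_real t"] zS by simp
        also have "\<dots> \<le> 3 * C / (1 + (Im s + t)\<^sup>2)"
        proof -
          have "1 + (Im s + t)\<^sup>2 > 0" "1 + (Im z + t)\<^sup>2 > 0" by (simp_all add: add_pos_nonneg)
          then show ?thesis using mult_left_mono[OF * C] by (simp add: divide_simps mult_ac)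
        qed
        finally show ?thesis .
      qed
      moreover have "ball s r' \<subseteq> ?S" "r' > 0" using r by (auto simp: r'_def subset_iff)
      ultimately show ?thesis
        by (intro exI[of _ r'] conjI exI[of _ "\<lambda>t. 3 * C / (1 + (Im s + t)\<^sup>2)"]
              inverse_1_plus_shifted_square_integrable) auto
    qed
    show "(\<lambda>s. integral\<^sup>L lborel (f s)) holomorphic_on ?S"
      by (rule holomorphic_on_lebesgue_integral(1)[OF 1 2 3])
    show "\<And>s. s \<in> ?S \<Longrightarrow> integrable lborel (f s)"
      by (rule holomorphic_on_lebesgue_integral(2)[OF 1 2 3])
  qed
  have inv: "integral\<^sup>L lborel (f (s + \<i> * of_real u)) = integral\<^sup>L lborel (f s)" for s u
  proof -
    have "integral\<^sup>L lborel (f s) = \<bar>1::real\<bar> *\<^sub>R integral\<^sup>L lborel (\<lambda>t. f s (u + 1 * t))"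
      by (rule lborel_integral_real_affine) auto
    then show ?thesis by (simp add: f_def algebra_simps)
  qed
  have der: "((\<lambda>s. integral\<^sup>L lborel (f s)) has_field_derivative 0) (at s)" if s: "s \<in> ?S" for s
  proof -
    obtain D where D: "((\<lambda>s. integral\<^sup>L lborel (f s)) has_field_derivative D) (at s)"
      using hol1 s open_vertical_strip holomorphic_on_imp_differentiable_at field_differentiable_def by blast
    then have lim: "((\<lambda>z. (integral\<^sup>L lborel (f z) - integral\<^sup>L lborel (f s)) / (z - s)) \<longlongrightarrow> D) (at s)"
      by (simp add: has_field_derivative_iff)
    have "((\<lambda>x. s + \<i> * complex_of_real x) \<longlongrightarrow> s + \<i> * complex_of_real 0) (at 0)"
      by (intro tendsto_intros)
    then have "filterlim (\<lambda>x. s + \<i> * complex_of_real x) (at s) (at 0)"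
      by (auto simp: filterlim_at eventually_at_filter)
    from filterlim_compose[OF lim this]
    have "((\<lambda>x::real. 0) \<longlongrightarrow> D) (at 0)" unfolding inv by simp
    then have "D = 0" by (simp add: tendsto_const_iff)
    then show ?thesis using D by simp
  qed
  have "\<exists>K. \<forall>s\<in>?S. integral\<^sup>L lborel (f s) = K"
    by (rule has_field_derivative_zero_constant[OF convex_vertical_strip])
       (rule has_field_derivative_at_within[OF der])
  then obtain K where K: "\<And>s. s \<in> ?S \<Longrightarrow> integral\<^sup>L lborel (f s) = K" by blast
  have cplx: "f (of_real x) = (\<lambda>t. F (Complex x t))" for x
    by (auto simp: f_def Complex_eq)
  show "(LINT t|lborel. F (Complex c t)) = (LINT t|lborel. F (Complex d t))"
    using K[of "of_real c"] K[of "of_real d"] c d by (simp add: cplx)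
  show "integrable lborel (\<lambda>t. F (Complex c t))"
    using int[of "of_real c"] c by (simp add: cplx)
qed

text \<open>Each of the two factors has modulus at least the square root of
  \<open>e^2 + (Im w)^2\<close>. The case \<open>e = 0\<close> is included for points far from the
  real axis whose real part may come close to a pole.\<close>

lemma kernel_denominator_bound:
  fixes w :: complex and m e :: real
  assumes "\<bar>Re w\<bar> \<ge> e" "\<bar>m - Re w\<bar> \<ge> e" "e \<ge> 0"
  shows "e\<^sup>2 + (Im w)\<^sup>2 \<le> norm (w * (of_real m - w))"
proof -
  have 1: "e\<^sup>2 + (Im w)\<^sup>2 \<le> (norm w)\<^sup>2"
    using assms(1,3) by (simp add: cmod_power2 abs_le_square_iff[symmetric])
  have 2: "e\<^sup>2 + (Im w)\<^sup>2 \<le> (norm (of_real m - w))\<^sup>2"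
    using assms(2,3) by (simp add: cmod_power2 abs_le_square_iff[symmetric])
  have "(e\<^sup>2 + (Im w)\<^sup>2)\<^sup>2 \<le> (norm w)\<^sup>2 * (norm (of_real m - w))\<^sup>2"
    unfolding power2_eq_square[of "e\<^sup>2 + (Im w)\<^sup>2"] using 1 2 by (intro mult_mono) auto
  then have "(e\<^sup>2 + (Im w)\<^sup>2)\<^sup>2 \<le> (norm (w * (of_real m - w)))\<^sup>2"
    by (simp add: norm_mult power_mult_distrib)
  then show ?thesis by (rule power2_le_imp_le) simp
qed

lemma square_plus_le_one_plus:
  fixes e t :: real
  assumes "e > 0"
  shows "min (e\<^sup>2) 1 * (1 + t\<^sup>2) \<le> e\<^sup>2 + t\<^sup>2"
proof -
  have "min (e\<^sup>2) 1 * t\<^sup>2 \<le> 1 * t\<^sup>2" by (intro mult_right_mono) auto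
  then show ?thesis by (simp add: algebra_simps min.coboundedI1)
qed

lemma kernel_bound:
  fixes w :: complex and m e :: real
  assumes "\<bar>Re w\<bar> \<ge> e" "\<bar>m - Re w\<bar> \<ge> e" "e > 0" "m \<ge> 0"
  shows "norm (of_real m / (w * (of_real m - w))) \<le> m / min (e\<^sup>2) 1 / (1 + (Im w)\<^sup>2)"
proof -
  have 1: "min (e\<^sup>2) 1 * (1 + (Im w)\<^sup>2) \<le> norm (w * (of_real m - w))"
    using kernel_denominator_bound[of e w m] square_plus_le_one_plus[of e "Im w"] assms by simp
  have 2: "min (e\<^sup>2) 1 * (1 + (Im w)\<^sup>2) > 0"
    using assms by (intro mult_pos_pos add_pos_nonneg) auto
  have "m / norm (w * (of_real m - w)) \<le> m / (min (e\<^sup>2) 1 * (1 + (Im w)\<^sup>2))"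
    using assms(4) by (intro divide_left_mono[OF 1] mult_pos_pos[OF 2] order.strict_trans2[OF 2 1] mult_pos_pos[OF order.strict_trans2[OF 2 1] 2])
  then show ?thesis using assms by (simp add: norm_divide)
qed

text \<open>The line can be moved to the axis of symmetry \<open>Re w = m / 2\<close>, where
  \<open>w (m - w)\<close> is real and equals \<open>(m/2)^2 + t^2\<close>, so that an arctangent
  integral remains.\<close>

lemma kernel_integral_right:
  assumes "0 < c" "c < m"
  shows "(LINT t|lborel. of_real m / (Complex c t * (of_real m - Complex c t))) = 2 * of_real pi"
    and "integrable lborel (\<lambda>t. of_real m / (Complex c t * (of_real m - Complex c t)))"
proof -
  define h where "h = (\<lambda>w::complex. of_real m / (w * (of_real m - w)))"
  define e where "e = min c (m - c) / 2"
  have e: "e > 0" "e < c" "c < m - e" "e < m / 2"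
    using assms by (auto simp: e_def min_def field_simps)
  have hol: "h holomorphic_on {z. e < Re z \<and> Re z < m - e}"
    unfolding h_def using e by (intro holomorphic_intros) (auto simp: complex_eq_iff)
  have bnd: "norm (h z) \<le> m / min (e\<^sup>2) 1 / (1 + (Im z)\<^sup>2)" if "e < Re z" "Re z < m - e" for z
    unfolding h_def using that e assms by (intro kernel_bound) auto
  note sh = vertical_integral_shift[OF hol bnd, of c "m/2"]
  have "(LINT t|lborel. h (Complex c t)) = (LINT t|lborel. h (Complex (m/2) t))"
    using e assms by (intro sh) auto
  also have "(\<lambda>t. h (Complex (m/2) t)) = (\<lambda>t. complex_of_real (m * (1 / ((m/2)\<^sup>2 + t\<^sup>2))))"
  proof
    fix t
    have *: "Complex (m/2) t * (of_real m - Complex (m/2) t) = of_real ((m/2)\<^sup>2 + t\<^sup>2)"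
      by (simp add: complex_eq_iff power2_eq_square)
    show "h (Complex (m/2) t) = complex_of_real (m * (1 / ((m/2)\<^sup>2 + t\<^sup>2)))"
      unfolding h_def * by simp
  qed
  also have "(LINT t|lborel. complex_of_real (m * (1 / ((m/2)\<^sup>2 + t\<^sup>2)))) = of_real (m * (pi / (m/2)))"
    using inverse_square_plus_square_lborel(2)[of "m/2"] assms
    by (subst integral_complex_of_real, subst integral_mult_right_zero) simp
  also have "m * (pi / (m/2)) = 2 * pi" using assms by simp
  finally show "(LINT t|lborel. of_real m / (Complex c t * (of_real m - Complex c t))) = 2 * of_real pi"
    by (simp add: h_def)
  show "integrable lborel (\<lambda>t. of_real m / (Complex c t * (of_real m - Complex c t)))"
    using vertical_integral_shift(2)[OF hol bnd, of c c] e unfolding h_def by simp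
qed

text \<open>There is no pole to the left of \<open>0\<close>, so the value does not depend on the
  line; on \<open>Re w = - x\<close> it is at most \<open>m pi / x\<close>, and \<open>x\<close> can
  be taken arbitrarily large.\<close>

lemma kernel_integral_left:
  assumes "c < 0" "m > 0"
  shows "(LINT t|lborel. of_real m / (Complex c t * (of_real m - Complex c t))) = 0"
    and "integrable lborel (\<lambda>t. of_real m / (Complex c t * (of_real m - Complex c t)))"
proof -
  define h where "h = (\<lambda>w::complex. of_real m / (w * (of_real m - w)))"
  define e where "e = - c / 2"
  have e: "e > 0" "c < -e" using assms by (auto simp: e_def)
  have hol: "h holomorphic_on {z. d < Re z \<and> Re z < - e}" for d
    unfolding h_def using e assms by (intro holomorphic_intros) (auto simp: complex_eq_iff)
  have bnd: "norm (h z) \<le> m / min (e\<^sup>2) 1 / (1 + (Im z)\<^sup>2)" if "d < Re z" "Re z < - e" for z d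
    unfolding h_def using that e assms by (intro kernel_bound) auto
  have eq: "(LINT t|lborel. h (Complex c t)) = (LINT t|lborel. h (Complex d t))" if "d \<le> c" for d
    using e that by (intro vertical_integral_shift(1)[OF hol[of "d - 1"] bnd[of "d - 1"]]) auto
  have small: "norm (LINT t|lborel. h (Complex c t)) \<le> m * (pi / x)" if x: "x \<ge> - c" for x
  proof -
    have xp: "x > 0" using x assms by simp
    have "norm (LINT t|lborel. h (Complex (-x) t)) \<le> (LINT t|lborel. m * (1 / (x\<^sup>2 + t\<^sup>2)))"
    proof (rule Bochner_Integration.integral_norm_bound_integral)
      show "integrable lborel (\<lambda>t. h (Complex (-x) t))"
        using e x by (intro vertical_integral_shift(2)[OF hol[of "-x - 1"] bnd[of "-x - 1"]]) auto
      show "integrable lborel (\<lambda>t. m * (1 / (x\<^sup>2 + t\<^sup>2)))"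
        using inverse_square_plus_square_lborel(1)[OF xp] by (intro integrable_mult_right) auto
      show "norm (h (Complex (-x) t)) \<le> m * (1 / (x\<^sup>2 + t\<^sup>2))" for t
      proof -
        have "x\<^sup>2 + t\<^sup>2 \<le> norm (Complex (-x) t * (of_real m - Complex (-x) t))"
          using kernel_denominator_bound[of x "Complex (-x) t" m] xp assms by simp
        moreover have "x\<^sup>2 + t\<^sup>2 > 0" using xp by (intro add_pos_nonneg) auto
        ultimately have "m / norm (Complex (-x) t * (of_real m - Complex (-x) t)) \<le> m / (x\<^sup>2 + t\<^sup>2)"
          using assms by (intro divide_left_mono mult_pos_pos) auto
        then show ?thesis using assms by (simp add: h_def norm_divide)
      qed
    qed
    also have "\<dots> = m * (pi / x)"
      by (subst integral_mult_right_zero) (simp add: inverse_square_plus_square_lborel(2)[OF xp])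
    finally show ?thesis using eq[of "-x"] x by simp
  qed
  have "((\<lambda>x. m * (pi / x)) \<longlongrightarrow> 0) at_top" by real_asymp
  then have "norm (LINT t|lborel. h (Complex c t)) \<le> 0"
    by (rule tendsto_lowerbound) (use small in \<open>auto intro!: eventually_at_top_linorderI[of "-c"]\<close>)
  then show "(LINT t|lborel. of_real m / (Complex c t * (of_real m - Complex c t))) = 0"
    by (simp add: h_def)
  show "integrable lborel (\<lambda>t. of_real m / (Complex c t * (of_real m - Complex c t)))"
    using vertical_integral_shift(2)[OF hol[of "c-1"] bnd[of "c-1"], of c c] e unfolding h_def by simp
qed

text \<open>Subtracting \<open>H p\<close> times the kernel \<open>m / ((z - p) (m - (z - p)))\<close> removes the pole; the two line
  integrals of the kernel differ by \<open>2 \<pi>\<close>.\<close>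

lemma vertical_integral_crossing:
  fixes p :: real
  assumes hol: "H holomorphic_on {z. a < Re z \<and> Re z < b}"
    and bnd: "\<And>z. a < Re z \<Longrightarrow> Re z < b \<Longrightarrow> \<bar>Im z\<bar> \<ge> 1 \<Longrightarrow>
                norm (H z / (z - of_real p)) \<le> C / (1 + (Im z)\<^sup>2)"
    and c: "a < c" "c < p" and d: "p < d" "d < b"
  shows "(LINT t|lborel. H (Complex d t) / (Complex d t - of_real p)) =
         (LINT t|lborel. H (Complex c t) / (Complex c t - of_real p)) + 2 * of_real pi * H (of_real p)"
proof -
  \<comment> \<open>The second pole of the kernel then sits at \<open>p + m = 2 b - p\<close>, to
    the right of the strip.\<close>
  define m where "m = 2 * (b - p)"
  have m: "m > 0" using d by (simp add: m_def)
  define P where "P = complex_of_real p"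
  define r where "r = H P"
  \<comment> \<open>The divided difference removes the singularity at \<open>p\<close>; the other
    term is the partial fraction of the kernel whose pole lies outside the strip.\<close>
  define F0 where "F0 = (\<lambda>z. (if z = P then deriv H P else (H z - H P) / (z - P)) - r / (of_real m - (z - P)))"
  \<comment> \<open>The assumed bound concerns \<open>|Im z| >= 1\<close>. Below that height
    compactness is used, which requires a strip whose closure lies in the open one.\<close>
  define a' where "a' = (a + c) / 2"
  define b' where "b' = (b + d) / 2"
  have ab: "a < a'" "a' < c" "d < b'" "b' < b" using c d by (auto simp: a'_def b'_def)
  have hol0: "F0 holomorphic_on {z. a < Re z \<and> Re z < b}"
    unfolding F0_def using d
    by (intro holomorphic_intros pole_lemma_open[OF hol open_vertical_strip])
       (auto simp: complex_eq_iff m_def P_def)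
  have F0_eq: "F0 z = H z / (z - P) - r * (of_real m / ((z - P) * (of_real m - (z - P))))"
    if "z \<noteq> P" "Re z < b" for z
  proof -
    have "of_real m - (z - P) \<noteq> 0"
      using that d by (auto simp: complex_eq_iff m_def P_def)
    moreover have "z - P \<noteq> 0" using that by simp
    ultimately have "r * (of_real m / ((z - P) * (of_real m - (z - P)))) = r / (z - P) + r / (of_real m - (z - P))"
      by (simp add: add_frac_eq) (simp add: algebra_simps)
    then show ?thesis using that by (simp add: F0_def r_def diff_divide_distrib)
  qed
  have "compact (F0 ` cbox (Complex a' (-1)) (Complex b' 1))"
    using ab by (intro compact_continuous_image continuous_on_subset[OF holomorphic_on_imp_continuous_on[OF hol0]])
       (auto simp: in_cbox_complex_iff)
  then obtain K where K: "\<And>z. z \<in> cbox (Complex a' (-1)) (Complex b' 1) \<Longrightarrow> norm (F0 z) \<le> K"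
    by (metis bounded_iff compact_imp_bounded image_eqI)
  define C' where "C' = max (2 * K) (C + norm r * (2 * m))"
  have bnd0: "norm (F0 z) \<le> C' / (1 + (Im z)\<^sup>2)" if z: "a' < Re z" "Re z < b'" for z
  proof (cases "\<bar>Im z\<bar> \<le> 1")
    case True
    have "norm (F0 z) \<le> K" using True z by (intro K) (auto simp: in_cbox_complex_iff)
    moreover have K0: "K \<ge> 0" using calculation norm_ge_zero order_trans by blast
    moreover have "K * (1 + (Im z)\<^sup>2) \<le> 2 * K"
      using mult_left_mono[OF _ K0, of "1 + (Im z)\<^sup>2" 2] True by (simp add: abs_square_le_1)
    ultimately have "norm (F0 z) * (1 + (Im z)\<^sup>2) \<le> 2 * K"
      using mult_right_mono[of "norm (F0 z)" K "1 + (Im z)\<^sup>2"] by simp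
    moreover have "2 * K \<le> C'" by (simp add: C'_def)
    ultimately show ?thesis by (simp add: pos_le_divide_eq add_pos_nonneg)
  next
    case False
    then have zP: "z \<noteq> P" by (auto simp: P_def)
    let ?w = "z - P"
    have Im2: "(Im z)\<^sup>2 \<ge> 1" using False using power_mono[of 1 "\<bar>Im z\<bar>" 2] by simp
    have "(Im z)\<^sup>2 \<le> norm (?w * (of_real m - ?w))"
      using kernel_denominator_bound[of 0 ?w m] by (simp add: P_def)
    then have "norm (of_real m / (?w * (of_real m - ?w))) \<le> m / (Im z)\<^sup>2"
      using m Im2 unfolding norm_divide by (auto intro!: divide_left_mono mult_pos_pos)
    also have "\<dots> \<le> 2 * m / (1 + (Im z)\<^sup>2)"
    proof -
      have "m * (1 + (Im z)\<^sup>2) \<le> m * (2 * (Im z)\<^sup>2)" using Im2 m by (intro mult_left_mono) auto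
      moreover have "(Im z)\<^sup>2 > 0" "1 + (Im z)\<^sup>2 > 0" using Im2 by auto
      ultimately show ?thesis by (simp add: divide_simps mult_ac)
    qed
    finally have 2: "norm (of_real m / (?w * (of_real m - ?w))) \<le> 2 * m / (1 + (Im z)\<^sup>2)" .
    have "norm (F0 z) \<le> norm (H z / ?w) + norm r * norm (of_real m / (?w * (of_real m - ?w)))"
      using F0_eq[OF zP] z ab norm_triangle_ineq4 by (simp only: norm_mult[symmetric]) force
    also have "\<dots> \<le> C / (1 + (Im z)\<^sup>2) + norm r * (2 * m / (1 + (Im z)\<^sup>2))"
      using bnd[of z] z ab False 2 by (intro add_mono mult_left_mono) (auto simp: P_def)
    also have "\<dots> = (C + norm r * (2 * m)) / (1 + (Im z)\<^sup>2)"
      by (simp add: add_divide_distrib)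
    also have "\<dots> \<le> C' / (1 + (Im z)\<^sup>2)"
      by (intro divide_right_mono) (auto simp: C'_def)
    finally show ?thesis .
  qed
  have hol1: "F0 holomorphic_on {z. a' < Re z \<and> Re z < b'}"
    using ab by (intro holomorphic_on_subset[OF hol0]) auto
  have sh: "(LINT t|lborel. F0 (Complex d t)) = (LINT t|lborel. F0 (Complex c t))"
    using ab c d by (intro vertical_integral_shift(1)[OF hol1 bnd0]) auto
  have split: "(LINT t|lborel. H (Complex x t) / (Complex x t - P)) =
      (LINT t|lborel. F0 (Complex x t)) + r * (LINT t|lborel. of_real m / (Complex (x - p) t * (of_real m - Complex (x - p) t)))"
    if x: "x \<noteq> p" "a' < x" "x < b'" and i: "integrable lborel (\<lambda>t. of_real m / (Complex (x - p) t * (of_real m - Complex (x - p) t)))"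
    for x
  proof -
    have ne: "Complex x t \<noteq> P" for t using x by (auto simp: P_def complex_eq_iff)
    have sub: "Complex x t - P = Complex (x - p) t" for t by (simp add: P_def complex_eq_iff)
    have "(LINT t|lborel. H (Complex x t) / (Complex x t - P)) =
      (LINT t|lborel. F0 (Complex x t) + r * (of_real m / (Complex (x - p) t * (of_real m - Complex (x - p) t))))"
      using F0_eq[OF ne] x ab by (intro Bochner_Integration.integral_cong) (auto simp: sub)
    also have "\<dots> = (LINT t|lborel. F0 (Complex x t)) + (LINT t|lborel. r * (of_real m / (Complex (x - p) t * (of_real m - Complex (x - p) t))))"
      using vertical_integral_shift(2)[OF hol1 bnd0, of x x] x i
      by (intro Bochner_Integration.integral_add integrable_mult_right) auto
    finally show ?thesis by (simp only: integral_mult_right_zero)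
  qed
  have 1: "c - p < 0" "0 < d - p" "d - p < m" using c d by (auto simp: m_def)
  show ?thesis
    using split[of d, OF _ _ _ kernel_integral_right(2)[OF 1(2,3)]]
      split[of c, OF _ _ _ kernel_integral_left(2)[OF 1(1) m]] sh
      kernel_integral_right(1)[OF 1(2,3)] kernel_integral_left(1)[OF 1(1) m] ab c d
    by (simp add: r_def P_def)
qed

section \<open>Zeros and lower bounds of holomorphic functions\<close>

lemma entire_factor_zero:
  fixes f :: "complex \<Rightarrow> complex"
  assumes "f holomorphic_on UNIV" "f a = 0"
  obtains g where "g holomorphic_on UNIV" "\<And>z. f z = (z - a) * g z"
proof
  show "(\<lambda>z. if z = a then deriv f a else (f z - f a)/(z - a)) holomorphic_on UNIV"
    using assms by (intro pole_lemma_open) auto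
qed (use assms in auto)

text \<open>With a logarithm \<open>h\<close> of \<open>g\<close>, the function
  \<open>\<phi> = ln M - h\<close> has positive real part. Composing it with the Cayley map that
  sends \<open>\<phi> z0\<close> to \<open>0\<close> and applying Schwarz's lemma gives Harnack's
  inequality for the positive harmonic function \<open>ln M - ln |g|\<close>, with Harnack's
  constant as the factor.\<close>

lemma borel_caratheodory_lower_bound:
  fixes g :: "complex \<Rightarrow> complex"
  assumes hol: "g holomorphic_on ball z0 R" and nz: "\<And>z. z \<in> ball z0 R \<Longrightarrow> g z \<noteq> 0"
    and bnd: "\<And>z. z \<in> ball z0 R \<Longrightarrow> norm (g z) < M"
    and r: "norm (z - z0) \<le> r" "r < R"
  shows "ln M - ln (norm (g z)) \<le> (R + r) / (R - r) * (ln M - ln (norm (g z0)))"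
proof -
  have r0: "r \<ge> 0" using r norm_ge_zero order_trans by blast
  have R: "R > 0" using r0 r by simp
  have Mpos: "M > 0" using bnd[of z0] R order.strict_trans1[OF norm_ge_zero] by simp
  obtain h where h: "h holomorphic_on ball z0 R" "\<And>z. z \<in> ball z0 R \<Longrightarrow> g z = exp (h z)"
    by (rule holomorphic_logarithm_exists[of "ball z0 R" g z0]) (use hol nz R in auto)
  define \<phi> where "\<phi> = (\<lambda>z. of_real (ln M) - h z)"
  have Re\<phi>: "Re (\<phi> z) = ln M - ln (norm (g z))" "Re (\<phi> z) > 0" if "z \<in> ball z0 R" for z
  proof -
    have "ln (norm (g z)) = Re (h z)" using h(2)[OF that] by simp
    moreover have "ln (norm (g z)) < ln M" using bnd[OF that] nz[OF that] Mpos by simp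
    ultimately show "Re (\<phi> z) = ln M - ln (norm (g z))" "Re (\<phi> z) > 0" by (auto simp: \<phi>_def)
  qed
  define A where "A = \<phi> z0"
  have A: "Re A > 0" using Re\<phi>[of z0] R by (simp add: A_def)
  define w where "w = (\<lambda>u. (\<phi> (z0 + of_real R * u) - A) / (\<phi> (z0 + of_real R * u) + cnj A))"
  have inb: "z0 + of_real R * u \<in> ball z0 R" if "u \<in> ball 0 1" for u
    using that R by (simp add: dist_norm norm_mult)
  have hol\<phi>: "(\<lambda>u. \<phi> (z0 + of_real R * u)) holomorphic_on ball 0 1"
    unfolding \<phi>_def
    by (intro holomorphic_intros holomorphic_on_compose_gen[OF _ h(1), unfolded comp_def])
       (use inb in auto)
  have nz2: "\<phi> (z0 + of_real R * u) + cnj A \<noteq> 0" if "u \<in> ball 0 1" for u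
    using Re\<phi>(2)[OF inb[OF that]] A by (auto simp: complex_eq_iff)
  have "norm (w u0) \<le> norm u0" if u0: "norm u0 < 1" for u0
  proof (rule Schwarz_Lemma(1))
    show "w holomorphic_on ball 0 1"
      unfolding w_def using nz2 by (intro holomorphic_intros hol\<phi>) auto
    show "w 0 = 0" by (simp add: w_def A_def)
    show "norm (w u) < 1" if "norm u < 1" for u
    proof -
      let ?f = "\<phi> (z0 + of_real R * u)"
      have f: "Re ?f > 0" using Re\<phi>(2)[OF inb] that by simp
      have "(norm (?f + cnj A))\<^sup>2 - (norm (?f - A))\<^sup>2 = 4 * Re ?f * Re A"
        unfolding cmod_power2 by (simp add: power2_eq_square algebra_simps)
      also have "\<dots> > 0" using f A by simp
      finally have "norm (?f - A) < norm (?f + cnj A)"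
        by (simp add: power2_less_imp_less)
      then show ?thesis unfolding w_def norm_divide
        by (subst divide_less_eq_1_pos) (auto intro: order.strict_trans1[OF norm_ge_zero])
    qed
  qed (use u0 in auto)
  note schw = this
  define u where "u = (z - z0) / of_real R"
  have zu: "z0 + of_real R * u = z" using R by (simp add: u_def)
  define \<rho> where "\<rho> = r / R"
  have \<rho>: "0 \<le> \<rho>" "\<rho> < 1" "norm u \<le> \<rho>" using r r0 R by (auto simp: \<rho>_def u_def norm_divide divide_right_mono)
  have zb: "z \<in> ball z0 R" using r by (auto simp: dist_norm norm_minus_commute)
  have "norm (\<phi> z - A) \<le> \<rho> * norm (\<phi> z + cnj A)"
  proof -
    have "norm (\<phi> z - A) / norm (\<phi> z + cnj A) \<le> \<rho>"
      using schw[of u] \<rho> by (simp add: w_def zu norm_divide)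
    moreover have "norm (\<phi> z + cnj A) > 0" using nz2[of u] \<rho> zu by simp
    ultimately show ?thesis by (simp add: pos_divide_le_eq)
  qed
  then have "(norm (\<phi> z - A))\<^sup>2 \<le> \<rho>\<^sup>2 * (norm (\<phi> z + cnj A))\<^sup>2"
    using power_mono[OF _ norm_ge_zero, of "\<phi> z - A" "\<rho> * norm (\<phi> z + cnj A)" 2]
    by (simp add: power_mult_distrib)
  then have sq: "(Re (\<phi> z) - Re A)\<^sup>2 + (Im (\<phi> z) - Im A)\<^sup>2
      \<le> \<rho>\<^sup>2 * (Re (\<phi> z) + Re A)\<^sup>2 + \<rho>\<^sup>2 * (Im (\<phi> z) - Im A)\<^sup>2"
    by (simp add: cmod_power2 algebra_simps)
  have "\<rho>\<^sup>2 * (Im (\<phi> z) - Im A)\<^sup>2 \<le> 1 * (Im (\<phi> z) - Im A)\<^sup>2"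
    using \<rho> by (intro mult_right_mono) (auto simp: abs_square_le_1)
  with sq have "(Re (\<phi> z) - Re A)\<^sup>2 \<le> (\<rho> * (Re (\<phi> z) + Re A))\<^sup>2"
    by (simp add: power_mult_distrib)
  then have "Re (\<phi> z) - Re A \<le> \<rho> * (Re (\<phi> z) + Re A)"
    using \<rho> A Re\<phi>(2)[OF zb] by (intro power2_le_imp_le[of "Re (\<phi> z) - Re A"]) auto
  then have "Re (\<phi> z) * (1 - \<rho>) \<le> (1 + \<rho>) * Re A" by (simp add: algebra_simps)
  then have "Re (\<phi> z) \<le> (1 + \<rho>) * Re A / (1 - \<rho>)" using \<rho> by (simp add: pos_le_divide_eq)
  also have "(1 + \<rho>) * Re A / (1 - \<rho>) = (R + r) / (R - r) * Re A"
    using R r by (simp add: \<rho>_def divide_simps)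
  finally show ?thesis using Re\<phi>(1)[OF zb] Re\<phi>(1)[of z0] R by (simp add: A_def)
qed

section \<open>Dirichlet series\<close>

text \<open>Absolute convergence allows the double family over pairs \<open>(d, e)\<close> to be
  regrouped along the hyperbolas \<open>d * e = n\<close>, which are parametrized by the divisors
  \<open>d\<close> of \<open>n\<close>.\<close>

lemma dirichlet_product_has_sum:
  fixes a b :: "nat \<Rightarrow> complex"
  assumes a: "(\<lambda>n. norm (a n)) summable_on {0<..}" and b: "(\<lambda>n. norm (b n)) summable_on {0<..}"
  shows "((\<lambda>n. \<Sum>d | d dvd n. a d * b (n div d)) has_sum (infsum a {0<..} * infsum b {0<..})) {0<..}"
proof -
  let ?P = "{0::nat<..}"
  have a': "(a has_sum infsum a ?P) ?P" and b': "(b has_sum infsum b ?P) ?P"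
    using abs_summable_summable[OF a] abs_summable_summable[OF b] by (auto intro!: has_sum_infsum)
  have row: "((\<lambda>e. a d * b e) has_sum a d * infsum b ?P) ?P" for d
    by (rule has_sum_cmult_right[OF b'])
  have "(\<lambda>x. norm (case x of (d, e) \<Rightarrow> a d * b e)) summable_on ?P \<times> ?P"
    unfolding Infinite_Sum.abs_summable_on_Sigma_iff
  proof (intro conjI ballI)
    show "(\<lambda>e. norm (case (d, e) of (d, e) \<Rightarrow> a d * b e)) summable_on ?P" for d
      using summable_on_cmult_right[OF b, of "norm (a d)"] by (simp add: norm_mult)
    have "(\<Sum>\<^sub>\<infinity>e\<in>?P. norm (a d * b e)) = norm (a d) * (\<Sum>\<^sub>\<infinity>e\<in>?P. norm (b e))" for d
      by (simp add: norm_mult infsum_cmult_right' )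
    then show "(\<lambda>d. norm (\<Sum>\<^sub>\<infinity>e\<in>?P. norm (case (d, e) of (d, e) \<Rightarrow> a d * b e))) summable_on ?P"
      using summable_on_cmult_left[OF a, of "norm (\<Sum>\<^sub>\<infinity>e\<in>?P. norm (b e))"] by (simp add: norm_mult abs_mult)
  qed
  then have "(\<lambda>(d, e). a d * b e) summable_on ?P \<times> ?P"
    by (rule abs_summable_summable)
  then obtain S where S: "((\<lambda>(d, e). a d * b e) has_sum S) (?P \<times> ?P)"
    by (auto simp: summable_on_def)
  have "((\<lambda>d. a d * infsum b ?P) has_sum S) ?P"
    using has_sum_SigmaD[OF S, of "\<lambda>d. a d * infsum b ?P"] row by simp
  then have "S = infsum a ?P * infsum b ?P"
    using has_sum_cmult_left[OF a', of "infsum b ?P"] has_sum_unique by blast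
  with S have hs: "((\<lambda>(d, e). a d * b e) has_sum (infsum a ?P * infsum b ?P)) (?P \<times> ?P)" by simp
  have bij: "bij_betw (\<lambda>(n, d). (d, n div d)) (SIGMA n:?P. {d. d dvd n}) (?P \<times> ?P)"
    by (rule bij_betwI[where g = "\<lambda>(d, e). (d * e, d)"])
       (auto simp: dvd_div_mult_self dvd_imp_le intro!: Nat.gr0I)
  have "((\<lambda>(n, d). a d * b (n div d)) has_sum (infsum a ?P * infsum b ?P)) (SIGMA n:?P. {d. d dvd n})"
    using hs has_sum_reindex_bij_betw[OF bij, of "\<lambda>(d, e). a d * b e"] by (simp add: case_prod_unfold)
  then show ?thesis
    by (rule has_sum_SigmaD) (auto intro!: has_sum_finiteI)
qed

lemma has_sum_suc_shift:
  fixes f :: "nat \<Rightarrow> complex"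
  shows "((\<lambda>n. f (Suc n)) has_sum S) UNIV \<longleftrightarrow> (f has_sum S) {0<..}"
  by (rule has_sum_reindex_bij_betw) (rule bij_betwI[where g = "\<lambda>n. n - 1"], auto)

lemma infsum_pos_eq_suminf:
  fixes f :: "nat \<Rightarrow> complex"
  assumes "(\<lambda>n. norm (f n)) summable_on {0<..}"
  shows "infsum f {0<..} = (\<Sum>n. f (Suc n))" "summable (\<lambda>n. norm (f (Suc n)))"
proof -
  have "((\<lambda>n. f (Suc n)) has_sum (infsum f {0<..})) UNIV"
    unfolding has_sum_suc_shift using abs_summable_summable[OF assms] by (rule has_sum_infsum)
  then have "(\<lambda>n. f (Suc n)) sums (infsum f {0<..})" by (rule has_sum_imp_sums)
  then show "infsum f {0<..} = (\<Sum>n. f (Suc n))" by (simp add: sums_iff)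
  have "(\<lambda>n. of_real (norm (f n)) :: complex) summable_on {0<..}"
    using assms by (rule summable_on_of_real)
  then have "(\<lambda>n. of_real (norm (f (Suc n))) :: complex) summable_on UNIV"
    using has_sum_suc_shift[of "\<lambda>n. of_real (norm (f n))"] unfolding summable_on_def by blast
  then have "(\<lambda>n. of_real (norm (f (Suc n))) :: complex) sums (infsum (\<lambda>n. of_real (norm (f (Suc n)))) UNIV)"
    by (rule has_sum_imp_sums[OF has_sum_infsum])
  then have "summable (\<lambda>n. of_real (norm (f (Suc n))) :: complex)" by (simp add: sums_iff)
  then show "summable (\<lambda>n. norm (f (Suc n)))" by (simp only: summable_of_real_iff)
qed

lemma abs_summable_pos_iff:
  fixes f :: "nat \<Rightarrow> complex"
  shows "(\<lambda>n. norm (f n)) summable_on {0<..} \<longleftrightarrow> summable (\<lambda>n. norm (f (Suc n)))"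
proof
  assume "summable (\<lambda>n. norm (f (Suc n)))"
  then have "(\<lambda>n. norm (f (Suc n))) summable_on UNIV"
    by (intro norm_summable_imp_summable_on) simp
  then have "(\<lambda>n. of_real (norm (f (Suc n))) :: complex) summable_on UNIV" by (rule summable_on_of_real)
  then have "(\<lambda>n. of_real (norm (f n)) :: complex) summable_on {0<..}"
    using has_sum_suc_shift[of "\<lambda>n. of_real (norm (f n))"] unfolding summable_on_def by blast
  then have "(\<lambda>n. Re (of_real (norm (f n)) :: complex)) summable_on {0<..}" by (rule summable_on_Re)
  then show "(\<lambda>n. norm (f n)) summable_on {0<..}" by simp
qed (rule infsum_pos_eq_suminf)

lemma dirichlet_product_suminf:
  fixes a b :: "nat \<Rightarrow> complex"
  assumes a: "summable (\<lambda>n. norm (a (Suc n)))" and b: "summable (\<lambda>n. norm (b (Suc n)))"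
  shows "(\<lambda>n. \<Sum>d | d dvd Suc n. a d * b (Suc n div d)) sums ((\<Sum>n. a (Suc n)) * (\<Sum>n. b (Suc n)))"
proof -
  note a' = a[folded abs_summable_pos_iff] and b' = b[folded abs_summable_pos_iff]
  show ?thesis
    using dirichlet_product_has_sum[OF a' b']
    unfolding infsum_pos_eq_suminf(1)[OF a'] infsum_pos_eq_suminf(1)[OF b'] has_sum_suc_shift[symmetric]
    by (rule has_sum_imp_sums)
qed

section \<open>Arithmetic functions and characters\<close>

text \<open>Only squarefree divisors count, and they are the products of the subsets
  \<open>S\<close> of the set of prime factors. The sum of \<open>(-1) ^ card S\<close> over all
  subsets is the expansion of a product of factors \<open>-1 + 1\<close>, which is empty exactly for
  \<open>n = 1\<close>.\<close>

lemma sum_moebius_divisors: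
  assumes "n > 0"
  shows "(\<Sum>d | d dvd n. moebius d) = (if n = 1 then 1 else 0)"
proof -
  define P where "P = prime_factors n"
  have fin: "finite P" by (simp add: P_def)
  have primeP: "prime p" if "p \<in> P" for p using that by (auto simp: P_def)
  have pf: "prime_factors (\<Prod>S) = S" "squarefree (\<Prod>S)" if S: "S \<subseteq> P" for S
  proof -
    have fS: "finite S" using S fin finite_subset by blast
    have pS: "prime p" if "p \<in> S" for p using that S primeP by auto
    have mult: "multiplicity p (\<Prod>S) = (if p \<in> S then 1 else 0)" if p: "prime p" for p
    proof -
      have "multiplicity p (prod (\<lambda>x. x) S) = (\<Sum>x\<in>S. multiplicity p x)"
        using p pS fS by (intro prime_elem_multiplicity_prod_distrib) (auto dest: prime_gt_0_nat)
      also have "\<dots> = (\<Sum>x\<in>S. if x = p then 1 else 0)"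
        using p pS by (intro sum.cong) (auto intro: prime_multiplicity_other)
      finally show ?thesis using fS by simp
    qed
    have nz: "\<Prod>S \<noteq> 0" using fS pS by (auto dest: prime_gt_0_nat)
    show "prime_factors (\<Prod>S) = S"
    proof (intro equalityI subsetI)
      fix p assume "p \<in> prime_factors (\<Prod>S)"
      then show "p \<in> S" using mult[of p] by (auto simp: prime_factors_multiplicity split: if_splits)
    next
      fix p assume "p \<in> S"
      then show "p \<in> prime_factors (\<Prod>S)" using mult[of p] pS by (auto simp: prime_factors_multiplicity)
    qed
    show "squarefree (\<Prod>S)"
      unfolding squarefree_factorial_semiring'[OF nz]
      using mult by (auto simp: prime_factors_multiplicity)
  qed
  have "(\<Sum>d | d dvd n. moebius d) = (\<Sum>d | d dvd n \<and> squarefree d. (-1) ^ card (prime_factors d))"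
    using assms by (intro sum.mono_neutral_cong_right) (auto simp: moebius_def)
  also have "\<dots> = (\<Sum>S\<in>Pow P. (-1) ^ card S)"
  proof (rule sum.reindex_bij_witness[of _ "\<lambda>S. \<Prod>S" prime_factors])
    fix d assume d: "d \<in> {d. d dvd n \<and> squarefree d}"
    then have d0: "d > 0" using assms by (auto intro!: Nat.gr0I)
    show "prime_factors d \<in> Pow P"
      using d assms by (auto simp: P_def intro: dvd_prime_factors[THEN subsetD])
    have "d = (\<Prod>p\<in>prime_factors d. p ^ multiplicity p d)"
      using d0 by (simp add: prod_prime_factors)
    also have "\<dots> = (\<Prod>p\<in>prime_factors d. p)"
      using d d0 squarefree_factorial_semiring'[of d] by (intro prod.cong) auto
    finally show "\<Prod>(prime_factors d) = d" by simp
  next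
    fix S assume S: "S \<in> Pow P"
    show "prime_factors (\<Prod>S) = S" using pf S by auto
    have "\<Prod>S dvd (\<Prod>p\<in>P. p ^ multiplicity p n)"
      using S fin by (intro prod_dvd_prod_subset2) (auto simp: P_def prime_factors_multiplicity)
    also have "\<dots> = n" using assms by (simp add: P_def prod_prime_factors)
    finally show "\<Prod>S \<in> {d. d dvd n \<and> squarefree d}" using pf(2) S by auto
  qed auto
  also have "\<dots> = (\<Prod>p\<in>P. (-1) + 1)"
    using fin by (subst prod_add) auto
  also have "\<dots> = (if n = 1 then 1 else 0)"
  proof (cases "n = 1")
    case False
    then have "P \<noteq> {}" using assms prime_factorization_empty_iff[of n] by (auto simp: P_def)
    then show ?thesis using fin False by (auto simp: card_gt_0_iff power_0_left)
  qed (simp add: P_def)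
  finally show ?thesis .
qed

lemma abs_moebius_le: "\<bar>moebius n\<bar> \<le> 1"
  by (simp add: moebius_def)

section \<open>Values of Dirichlet characters\<close>

context
  fixes q :: nat and chi :: "int \<Rightarrow> complex"
  assumes chi: "dirichlet_character q chi"
begin

lemma char_modulus_pos: "q > 0" and char_mult: "chi (m * n) = chi m * chi n"
  and char_periodic: "chi (n + int q) = chi n" and char_nonzero_iff: "chi n \<noteq> 0 \<longleftrightarrow> coprime n (int q)"
  using chi by (auto simp: dirichlet_character_def)

lemma char_1: "chi 1 = 1"
proof -
  have "chi 1 * chi 1 = chi 1" using char_mult[of 1 1] by simp
  moreover have "chi 1 \<noteq> 0" using char_nonzero_iff[of 1] by simp
  ultimately show ?thesis by simp
qed

lemma char_add_mult: "chi (n + k * int q) = chi n"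
proof -
  have nat: "chi (n + int j * int q) = chi n" for n j
  proof (induction j)
    case (Suc j)
    then show ?case using char_periodic[of "n + int j * int q"] by (simp add: algebra_simps)
  qed auto
  show ?thesis
  proof (cases "k \<ge> 0")
    case True then show ?thesis using nat[of n "nat k"] by simp
  next
    case False then show ?thesis using nat[of "n + k * int q" "nat (-k)"] by simp
  qed
qed

lemma char_cong: "[m = n] (mod int q) \<Longrightarrow> chi m = chi n"
  by (metis cong_iff_lin char_add_mult mult.commute)

lemma char_power: "chi (n ^ k) = chi n ^ k"
  by (induction k) (auto simp: char_1 char_mult)

text \<open>The value is a root of unity by Euler's theorem, applied to the nonnegative
  representative of the residue class.\<close>

lemma norm_char_coprime:
  assumes "coprime n (int q)"
  shows "norm (chi n) = 1"
proof -
  define m where "m = nat (n mod int q)"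
  have m: "int m = n mod int q" using char_modulus_pos by (simp add: m_def)
  then have "coprime (int m) (int q)" using assms by (simp add: coprime_mod_left_iff char_modulus_pos)
  then have "[m ^ totient q = 1] (mod q)" by (intro euler_theorem) simp
  then have "[int m ^ totient q = 1] (mod int q)" by (metis cong_int_iff of_nat_1 of_nat_power)
  then have "chi (int m) ^ totient q = 1" by (metis char_cong char_power char_1)
  moreover have "chi (int m) = chi n" by (intro char_cong) (simp add: m cong_def)
  ultimately have "chi n ^ totient q = 1" by simp
  moreover have "totient q > 0" using char_modulus_pos by simp
  ultimately show ?thesis using power_eq_1_iff by fastforce
qed

lemma norm_char_le: "norm (chi n) \<le> 1"
  using norm_char_coprime[of n] char_nonzero_iff[of n] by fastforce

end

text \<open>The primes of \<open>q\<close> that do not divide \<open>n\<close> are collected in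
  \<open>T\<close>, and \<open>d\<close> times their product is added to \<open>n\<close>. A prime
  of \<open>q\<close> then divides exactly one of the two summands: if it divides \<open>n\<close>,
  it divides neither \<open>d\<close> nor the product.\<close>

lemma exists_coprime_lift:
  fixes n :: int and d q :: nat
  assumes "coprime n (int d)" "q > 0"
  shows "\<exists>m. coprime m (int q) \<and> [m = n] (mod int d)"
proof -
  define T where "T = {p. prime p \<and> p dvd q \<and> \<not> int p dvd n}"
  have fT: "finite T" using assms(2) by (rule finite_subset[rotated, OF finite_divisors_nat]) (auto simp: T_def)
  define t where "t = int (\<Prod>T)"
  define m where "m = n + int d * t"
  have t: "int p dvd t \<longleftrightarrow> p \<in> T" if p: "prime p" for p
  proof -
    have "int p dvd t \<longleftrightarrow> (\<exists>x\<in>T. p dvd x)"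
      unfolding t_def int_dvd_int_iff using p fT by (simp add: prime_dvd_prod_iff)
    also have "\<dots> \<longleftrightarrow> p \<in> T" using p by (auto simp: T_def dest: primes_dvd_imp_eq)
    finally show ?thesis .
  qed
  have "coprime m (int q)"
  proof (rule ccontr)
    assume "\<not> coprime m (int q)"
    then have "gcd m (int q) \<noteq> 1" by (simp add: coprime_iff_gcd_eq_1)
    then have "nat (gcd m (int q)) \<noteq> 1" by (metis nat_1 int_eq_iff gcd_ge_0_int nat_int of_nat_1)
    then obtain p where p: "prime p" "p dvd nat (gcd m (int q))" using prime_factor_nat by blast
    then have "int p dvd gcd m (int q)" by (metis gcd_ge_0_int int_dvd_int_iff nat_0_le)
    then have pm: "int p dvd m" and pq: "p dvd q" by auto
    show False
    proof (cases "int p dvd n")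
      case True
      then have "\<not> int p dvd int d"
        using assms(1) p(1) by (metis coprime_common_divisor not_prime_unit prime_int_iff prime_nat_int_transfer)
      moreover have "\<not> int p dvd t" using t[OF p(1)] True by (simp add: T_def)
      moreover have "int p dvd int d * t" using pm True by (simp add: m_def dvd_add_right_iff)
      moreover have "prime (int p)" using p(1) by simp
      ultimately show False by (metis prime_dvd_mult_iff)
    next
      case False
      then have "int p dvd t" using t[OF p(1)] pq p(1) by (simp add: T_def)
      then have "int p dvd n" using pm by (simp add: m_def dvd_add_left_iff)
      then show False using False by simp
    qed
  qed
  moreover have "[m = n] (mod int d)" by (simp add: m_def cong_def)
  ultimately show ?thesis by blast
qed

text \<open>If chi were trivial on the units modulo \<open>q\<close> that are \<open>1\<close>
  modulo \<open>d\<close>, it would depend only on the class modulo \<open>d\<close> and would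
  therefore be induced by a character modulo \<open>d\<close>.\<close>

lemma primitive_detects_divisor:
  assumes prim: "primitive_dirichlet_character q chi" and d: "d dvd q" "d < q"
  shows "\<exists>c. coprime c (int q) \<and> [c = 1] (mod int d) \<and> chi c \<noteq> 1"
proof (rule ccontr)
  assume contra: "\<not> ?thesis"
  have dc: "dirichlet_character q chi" using prim by (simp add: primitive_dirichlet_character_def)
  note cm = char_mult[OF dc] and q0 = char_modulus_pos[OF dc]
  have dpos: "d > 0" using d q0 by (auto intro!: Nat.gr0I)
  have down: "coprime n (int d)" if "coprime n (int q)" for n
    using that d(1) by (meson coprime_divisors dvd_refl of_nat_dvd_iff)
  have wd: "chi m1 = chi m2"
    if w: "coprime m1 (int q)" "coprime m2 (int q)" "[m1 = m2] (mod int d)" for m1 m2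
  proof -
    obtain u where u: "[m2 * u = 1] (mod int q)" using cong_solve_coprime_int[OF w(2)] by blast
    have cu: "coprime u (int q)" using u by (metis cong_imp_coprime cong_sym coprime_1_left coprime_mult_left_iff)
    have ud: "[m2 * u = 1] (mod int d)" using u d(1) by (meson cong_dvd_modulus of_nat_dvd_iff)
    have "[m1 * u = m2 * u] (mod int d)" using w(3) by (rule cong_mult[OF _ cong_refl])
    then have "[m1 * u = 1] (mod int d)" using ud cong_trans by blast
    moreover have "coprime (m1 * u) (int q)" using w(1) cu by simp
    ultimately have "chi (m1 * u) = 1" using contra by blast
    moreover have "chi (m2 * u) = 1" using char_cong[OF dc u] char_1[OF dc] by simp
    moreover have "chi u \<noteq> 0" using cu char_nonzero_iff[OF dc] by simp
    ultimately show ?thesis by (metis cm mult_right_cancel)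
  qed
  \<comment> \<open>A class of units modulo \<open>d\<close> is represented by an integer prime to
    \<open>q\<close>, where chi does not vanish; by \<open>wd\<close> the choice does not affect the
    value.\<close>
  define rep where "rep = (\<lambda>n. SOME m. coprime m (int q) \<and> [m = n] (mod int d))"
  have rep: "coprime (rep n) (int q)" "[rep n = n] (mod int d)" if "coprime n (int d)" for n
    using someI_ex[OF exists_coprime_lift[OF that q0]] by (auto simp: rep_def)
  define chi' where "chi' = (\<lambda>n. if coprime n (int d) then chi (rep n) else 0)"
  have "dirichlet_character d chi'"
    unfolding dirichlet_character_def
  proof (intro conjI allI)
    show "chi' (m * n) = chi' m * chi' n" for m n
    proof (cases "coprime m (int d) \<and> coprime n (int d)")
      case True
      then have "chi (rep (m * n)) = chi (rep m * rep n)"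
      proof (intro wd)
        have mn: "coprime (m * n) (int d)" using True by simp
        show "coprime (rep (m * n)) (int q)" "coprime (rep m * rep n) (int q)" using rep(1) mn True by auto
        have "[rep m * rep n = m * n] (mod int d)" using rep(2) True by (intro cong_mult) auto
        then show "[rep (m * n) = rep m * rep n] (mod int d)" using rep(2)[OF mn] by (meson cong_trans cong_sym)
      qed
      then show ?thesis using True by (simp add: chi'_def cm)
    qed (auto simp: chi'_def)
    show "chi' (n + int d) = chi' n" for n
    proof (cases "coprime n (int d)")
      case True
      then have T2: "coprime (n + int d) (int d)" by (simp add: coprime_iff_gcd_eq_1)
      have "[n + int d = n] (mod int d)" by (simp add: cong_def)
      then have "[rep (n + int d) = rep n] (mod int d)"
        using rep(2)[OF True] rep(2)[OF T2] by (meson cong_trans cong_sym)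
      then have "chi (rep (n + int d)) = chi (rep n)"
        using rep True T2 by (intro wd) auto
      then show ?thesis using True T2 by (simp add: chi'_def)
    next
      case False
      then have "\<not> coprime (n + int d) (int d)" by (simp add: coprime_iff_gcd_eq_1)
      then show ?thesis using False by (simp add: chi'_def)
    qed
    show "(chi' n \<noteq> 0) = coprime n (int d)" for n
      using rep(1)[of n] char_nonzero_iff[OF dc] by (auto simp: chi'_def)
  qed (use dpos in auto)
  moreover have "induced_by q chi chi'"
    unfolding induced_by_def
  proof (intro allI impI)
    fix n assume n: "coprime n (int q)"
    have "chi (rep n) = chi n" using rep[OF down[OF n]] n by (intro wd) auto
    then show "chi n = chi' n" using down[OF n] by (simp add: chi'_def)
  qed
  ultimately show False using prim d unfolding primitive_dirichlet_character_def by blast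
qed

lemma cnj_dirichlet_character:
  "dirichlet_character q chi \<Longrightarrow> dirichlet_character q (\<lambda>n. cnj (chi n))"
  by (simp add: dirichlet_character_def)

lemma cnj_primitive_character:
  assumes "primitive_dirichlet_character q chi"
  shows "primitive_dirichlet_character q (\<lambda>n. cnj (chi n))"
proof -
  have "induced_by q chi (\<lambda>n. cnj (chi' n))" if "induced_by q (\<lambda>n. cnj (chi n)) chi'" for chi'
    using that unfolding induced_by_def by (metis complex_cnj_cnj)
  then show ?thesis
    using assms cnj_dirichlet_character unfolding primitive_dirichlet_character_def by blast
qed

lemma sum_residues_reindex:
  fixes F :: "int \<Rightarrow> complex"
  assumes per: "\<And>n k. F (n + k * int q) = F n" and c: "coprime c (int q)" and q: "q > 0"
  shows "(\<Sum>b\<in>{0..<int q}. F (c * b)) = (\<Sum>b\<in>{0..<int q}. F b)"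
proof -
  have Fmod: "F (n mod int q) = F n" for n
    using per[of "n mod int q" "n div int q"] by (simp add: mult.commute)
  have inj: "inj_on (\<lambda>b. (c * b) mod int q) {0..<int q}"
  proof (rule inj_onI)
    fix x y assume xy: "x \<in> {0..<int q}" "y \<in> {0..<int q}" "(c * x) mod int q = (c * y) mod int q"
    then have "[x = y] (mod int q)" using c by (simp add: cong_def[symmetric] cong_mult_lcancel)
    then show "x = y" using xy by (simp add: cong_def)
  qed
  have "bij_betw (\<lambda>b. (c * b) mod int q) {0..<int q} {0..<int q}"
    unfolding bij_betw_def
    using inj q by (intro conjI endo_inj_surj) auto
  from sum.reindex_bij_betw[OF this, of F] show ?thesis by (simp add: Fmod)
qed

section \<open>Additive characters and Gauss sums\<close>

definition unity_exp :: "complex \<Rightarrow> complex" where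
  "unity_exp z = exp (2 * of_real pi * \<i> * z)"

lemma unity_exp_add: "unity_exp (x + y) = unity_exp x * unity_exp y"
  by (simp add: unity_exp_def exp_add ring_distribs)

lemma unity_exp_of_int [simp]: "unity_exp (of_int n) = 1"
  using exp_integer_2pi[of "of_int n"] by (simp add: unity_exp_def mult_ac)

lemma unity_exp_0 [simp]: "unity_exp 0 = 1" by (simp add: unity_exp_def)

lemma norm_unity_exp [simp]: "norm (unity_exp (of_real x)) = 1"
  by (simp add: unity_exp_def)

definition gauss_sum :: "nat \<Rightarrow> (int \<Rightarrow> complex) \<Rightarrow> int \<Rightarrow> complex" where
  "gauss_sum q chi n = (\<Sum>b\<in>{0..<int q}. chi b * unity_exp (of_int (b * n) / of_nat q))"

text \<open>For \<open>n\<close> prime to \<open>q\<close>, replacing \<open>b\<close> by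
  \<open>n b\<close> pulls out the conjugate value. Otherwise let \<open>g = gcd n q\<close>:
  primitivity supplies \<open>c\<close> with \<open>c = 1\<close> modulo \<open>q / g\<close> and
  \<open>chi c \<noteq> 1\<close>. The substitution \<open>b -> c b\<close> leaves the exponentials
  unchanged, since \<open>(c - 1) n\<close> is divisible by \<open>q\<close>, and multiplies the sum
  by \<open>chi c\<close>, so it vanishes.\<close>

lemma gauss_sum_separable:
  assumes prim: "primitive_dirichlet_character q chi"
  shows "gauss_sum q chi n = cnj (chi n) * gauss_sum q chi 1"
proof -
  have dc: "dirichlet_character q chi" using prim by (simp add: primitive_dirichlet_character_def)
  note cm = char_mult[OF dc] and q0 = char_modulus_pos[OF dc]
  have per: "chi (b + k * int q) * unity_exp (of_int ((b + k * int q) * n) / of_nat q)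
      = chi b * unity_exp (of_int (b * n) / of_nat q)" for b k n
  proof -
    have "of_int ((b + k * int q) * n) / of_nat q = of_int (b * n) / of_nat q + (of_int (k * n) :: complex)"
      using q0 by (simp add: divide_simps algebra_simps)
    then show ?thesis by (simp add: unity_exp_add char_add_mult[OF dc] del: of_int_mult)
  qed
  show ?thesis
  proof (cases "coprime n (int q)")
    case True
    have "chi n * gauss_sum q chi n = (\<Sum>b\<in>{0..<int q}. chi (n * b) * unity_exp (of_int ((n * b) * 1) / of_nat q))"
      unfolding gauss_sum_def sum_distrib_left by (intro sum.cong) (auto simp: cm mult_ac)
    also have "\<dots> = gauss_sum q chi 1"
      unfolding gauss_sum_def by (rule sum_residues_reindex[OF per True q0])
    finally have *: "chi n * gauss_sum q chi n = gauss_sum q chi 1" .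
    have "cnj (chi n) * chi n = 1"
      using norm_char_coprime[OF dc True] complex_norm_square[of "chi n"] by (simp add: mult.commute)
    then show ?thesis using * by (metis mult.assoc mult_1)
  next
    case False
    define g where "g = gcd n (int q)"
    define d where "d = q div nat g"
    have g: "g > 1"
    proof -
      have "g > 0" using q0 by (simp add: g_def)
      moreover have "g \<noteq> 1" using False by (simp add: g_def coprime_iff_gcd_eq_1)
      ultimately show ?thesis by linarith
    qed
    have gq: "nat g dvd q"
    proof -
      have "int (nat g) dvd int q" using g by (simp add: g_def)
      then show ?thesis by (simp only: int_dvd_int_iff)
    qed
    have qd: "q = d * nat g" using gq by (simp add: d_def)
    have "d dvd q" using qd by (metis dvd_triv_left)
    moreover have "d < q" using g q0 by (simp add: d_def)
    ultimately obtain c where c: "coprime c (int q)" "[c = 1] (mod int d)" "chi c \<noteq> 1"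
      using primitive_detects_divisor[OF prim] by blast
    have "int d dvd c - 1" using c(2) by (simp add: cong_iff_dvd_diff)
    moreover have "g dvd n" by (simp add: g_def)
    ultimately have "int d * g dvd (c - 1) * n" by (rule mult_dvd_mono)
    moreover have "int d * g = int q" using qd g by simp
    ultimately obtain j where j: "(c - 1) * n = int q * j" by (metis dvdE)
    have e: "unity_exp (of_int (c * b * n) / of_nat q) = unity_exp (of_int (b * n) / of_nat q)" for b
    proof -
      have "c * b * n = b * n + b * ((c - 1) * n)" by (simp add: algebra_simps)
      also have "\<dots> = b * n + int q * (j * b)" by (simp add: j)
      finally have "of_int (c * b * n) / of_nat q = of_int (b * n) / of_nat q + (of_int (j * b) :: complex)"
        using q0 by (simp add: divide_simps algebra_simps)
      then show ?thesis by (simp only: unity_exp_add unity_exp_of_int mult_1_right)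
    qed
    have "chi c * gauss_sum q chi n = (\<Sum>b\<in>{0..<int q}. chi (c * b) * unity_exp (of_int ((c * b) * n) / of_nat q))"
      unfolding gauss_sum_def sum_distrib_left by (intro sum.cong refl) (simp only: e, simp only: cm mult_ac)
    also have "\<dots> = gauss_sum q chi n"
      unfolding gauss_sum_def by (rule sum_residues_reindex[OF per c(1) q0])
    finally have "gauss_sum q chi n = 0" using c(3) by simp
    moreover have "chi n = 0" using False char_nonzero_iff[OF dc] by blast
    ultimately show ?thesis by simp
  qed
qed

text \<open>The sum over a period is the Gauss sum at frequency \<open>0\<close>, and
  \<open>chi 0 = 0\<close> for \<open>q \<noteq> 1\<close>.\<close>

lemma primitive_sum_period:
  assumes prim: "primitive_dirichlet_character q chi" and "q \<noteq> 1"
  shows "(\<Sum>b\<in>{0..<int q}. chi b) = 0"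
proof -
  have dc: "dirichlet_character q chi" using prim by (simp add: primitive_dirichlet_character_def)
  have "chi 0 = 0" using char_nonzero_iff[OF dc, of 0] assms(2) by auto
  then show ?thesis using gauss_sum_separable[OF prim, of 0] by (simp add: gauss_sum_def)
qed

lemma char_minus_1:
  assumes dc: "dirichlet_character q chi"
  shows "chi (-1) = 1 \<or> chi (-1) = -1"
proof -
  have "chi (-1) * chi (-1) = 1" using char_mult[OF dc, of "-1" "-1"] char_1[OF dc] by simp
  then show ?thesis by (metis power2_eq_square power2_eq_1_iff)
qed

lemma char_uminus: "dirichlet_character q chi \<Longrightarrow> chi (- n) = chi (-1) * chi n"
  using char_mult[of q chi "-1" n] by simp

section \<open>Poisson summation\<close>

lemma summable_on_int_inverse_square:
  "(\<lambda>k::int. C / (1 + (real_of_int k)\<^sup>2)) summable_on UNIV"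
proof -
  have s: "summable (\<lambda>n::nat. 1 / (1 + (real n)\<^sup>2))"
  proof (rule summable_comparison_test_ev)
    show "summable (\<lambda>n. 1 / real n ^ 2)"
      using inverse_power_summable[of 2] by (simp add: divide_inverse)
    show "\<forall>\<^sub>F n in sequentially. norm (1 / (1 + (real n)\<^sup>2)) \<le> 1 / real n ^ 2"
      using eventually_gt_at_top[of 0] by eventually_elim (auto intro!: divide_left_mono mult_pos_pos add_pos_nonneg)
  qed
  have n: "(\<lambda>n::nat. 1 / (1 + (real n)\<^sup>2)) summable_on UNIV"
    by (rule norm_summable_imp_summable_on) (use s in simp)
  have 1: "(\<lambda>k::int. 1 / (1 + (real_of_int k)\<^sup>2)) summable_on (range int)"
    by (subst summable_on_reindex) (use n in \<open>auto simp: o_def inj_on_def\<close>)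
  have 2: "(\<lambda>k::int. 1 / (1 + (real_of_int k)\<^sup>2)) summable_on (range (\<lambda>n. - int n))"
    by (subst summable_on_reindex) (use n in \<open>auto simp: o_def inj_on_def\<close>)
  have "range int \<union> range (\<lambda>n. - int n) = UNIV"
  proof -
    have "k \<in> range int \<union> range (\<lambda>n. - int n)" for k
      by (cases k rule: int_cases2) auto
    then show ?thesis by blast
  qed
  then have "(\<lambda>k::int. 1 / (1 + (real_of_int k)\<^sup>2)) summable_on UNIV"
    using summable_on_union[OF 1 2] by simp
  from summable_on_cmult_right[OF this, of C] show ?thesis by simp
qed

lemma filterlim_symmetric_int_intervals:
  "filterlim (\<lambda>N::nat. {- int N..int N}) (finite_subsets_at_top UNIV) sequentially"
  unfolding filterlim_finite_subsets_at_top
proof (intro allI impI)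
  fix X :: "int set" assume X: "finite X \<and> X \<subseteq> UNIV"
  then obtain M where M: "\<And>x. x \<in> X \<Longrightarrow> \<bar>x\<bar> \<le> M"
    by (metis bdd_above_finite finite_imageI bdd_above.unfold image_eqI)
  show "\<forall>\<^sub>F N in sequentially. finite {- int N..int N} \<and> X \<subseteq> {- int N..int N} \<and> {- int N..int N} \<subseteq> UNIV"
    using eventually_ge_at_top[of "nat M"]
  proof eventually_elim
    case (elim N)
    then show ?case using M by (fastforce simp: abs_le_iff)
  qed
qed

lemma unity_exp_eq_1_iff: "unity_exp z = 1 \<longleftrightarrow> z \<in> \<int>"
proof
  assume "unity_exp z = 1"
  then obtain n :: int where "Re (2 * of_real pi * \<i> * z) = 0" "Im (2 * of_real pi * \<i> * z) = of_int (2 * n) * pi"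
    unfolding unity_exp_def exp_eq_1 by blast
  then have "z = of_int n" by (auto simp: complex_eq_iff)
  then show "z \<in> \<int>" by simp
qed (auto elim: Ints_cases)

lemma unity_exp_has_field_derivative:
  "((\<lambda>x. unity_exp (c * x)) has_field_derivative (2 * of_real pi * \<i> * c * unity_exp (c * x))) (at x within S)"
  unfolding unity_exp_def by (auto intro!: derivative_eq_intros)

lemma holomorphic_on_unity_exp [holomorphic_intros]:
  "f holomorphic_on S \<Longrightarrow> (\<lambda>z. unity_exp (f z)) holomorphic_on S"
  unfolding unity_exp_def by (intro holomorphic_intros)

lemma continuous_on_unity_exp [continuous_intros]:
  "continuous_on S f \<Longrightarrow> continuous_on S (\<lambda>z. unity_exp (f z))"
  unfolding unity_exp_def by (intro continuous_intros)

text \<open>Chernoff's argument: if \<open>G\<close> is periodic and \<open>G - G 0 = (e - 1) q\<close>, the Fourier coefficients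
  of \<open>G - G 0\<close> telescope, and those of \<open>q\<close> tend to \<open>0\<close>.\<close>

lemma fourier_series_at_0:
  assumes hol: "G holomorphic_on UNIV" and per: "\<And>z. G (z + 1) = G z"
  shows "(\<lambda>N::nat. \<Sum>m\<in>{- int N..int N}. integral {-1/2..1/2} (\<lambda>x. G (of_real x) * unity_exp (- of_int m * of_real x)))
           \<longlonglongrightarrow> G 0"
proof -
  define S where "S = {z. - 1 < Re z \<and> Re z < 1}"
  have oS: "open S" unfolding S_def by (rule open_vertical_strip)
  define h1 where "h1 = (\<lambda>z. if z = 0 then deriv G 0 else (G z - G 0) / (z - 0))"
  \<comment> \<open>In the strip the only zero of \<open>unity_exp z - 1\<close> is
    \<open>0\<close>, and it is simple; dividing both differences by \<open>z\<close> makes their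
    quotient holomorphic there.\<close>
  define h2 where "h2 = (\<lambda>z. if z = 0 then deriv unity_exp 0 else (unity_exp z - unity_exp 0) / (z - 0))"
  have d0: "deriv unity_exp 0 = 2 * of_real pi * \<i>"
    using unity_exp_has_field_derivative[of 1 0 UNIV] by (intro DERIV_imp_deriv) simp
  have h1: "h1 holomorphic_on UNIV" unfolding h1_def by (rule pole_lemma_open[OF hol open_UNIV])
  have h2: "h2 holomorphic_on UNIV" unfolding h2_def by (intro pole_lemma_open holomorphic_intros open_UNIV)
  have h2nz: "h2 z \<noteq> 0" if "z \<in> S" for z
  proof (cases "z = 0")
    case False
    then have "z \<notin> \<int>" using that by (auto simp: S_def elim!: Ints_cases)
    then show ?thesis using False unity_exp_eq_1_iff by (simp add: h2_def)
  qed (simp add: h2_def d0)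
  define q where "q = (\<lambda>z. h1 z / h2 z)"
  have q: "q holomorphic_on S"
    unfolding q_def using h2nz
    by (intro holomorphic_on_divide holomorphic_on_subset[OF h1] holomorphic_on_subset[OF h2]) auto
  have Gq: "G z - G 0 = (unity_exp z - 1) * q z" if "z \<in> S" for z
    using h2nz[OF that] by (auto simp: q_def h1_def h2_def)
  \<comment> \<open>The end points differ by the period, and equal values of \<open>q\<close> there
    make the boundary terms of the later integration by parts cancel.\<close>
  have qper: "q (1/2) = q (-1/2)"
  proof -
    have "unity_exp (1/2) = unity_exp (-1/2)"
      using unity_exp_add[of "-1/2" 1] unity_exp_of_int[of 1] by simp
    moreover have "G (1/2) = G (-1/2)" using per[of "-1/2"] by simp
    moreover have "unity_exp (1/2) \<noteq> 1"
      unfolding unity_exp_eq_1_iff by (auto elim!: Ints_cases simp: complex_eq_iff field_simps simp flip: of_int_mult)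
    moreover have "1/2 \<in> S" "-1/2 \<in> S" by (auto simp: S_def)
    ultimately show ?thesis using Gq[of "1/2"] Gq[of "-1/2"] by auto
  qed
  define c where "c = (\<lambda>m::int. integral {-1/2..1/2} (\<lambda>x. q (of_real x) * unity_exp (- of_int m * of_real x)))"
  have inS: "of_real x \<in> S" if "x \<in> {-1/2..1/2}" for x using that by (auto simp: S_def)
  have contq: "continuous_on {-1/2..1/2::real} (\<lambda>x. q (of_real x))"
    by (intro continuous_on_compose2[OF holomorphic_on_imp_continuous_on[OF q]] continuous_intros) (use inS in auto)
  have contG: "continuous_on {-1/2..1/2::real} (\<lambda>x. G (of_real x))"
    by (intro continuous_on_compose2[OF holomorphic_on_imp_continuous_on[OF hol]] continuous_intros) auto
  have half: "unity_exp (- of_int m * (1/2)) = unity_exp (- of_int m * (-1/2))" for m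
    using unity_exp_add[of "- of_int m * (1/2)" "of_int m"] by simp
  have coeff: "integral {-1/2..1/2} (\<lambda>x. G (of_real x) * unity_exp (- of_int m * of_real x))
      = (c (m - 1) - c m) + (if m = 0 then G 0 else 0)" for m
  proof -
    have eq: "G (of_real x) * unity_exp (- of_int m * of_real x) =
       q (of_real x) * unity_exp (- of_int (m - 1) * of_real x) - q (of_real x) * unity_exp (- of_int m * of_real x)
        + G 0 * unity_exp (- of_int m * of_real x)" if "x \<in> {-1/2..1/2}" for x :: real
    proof -
      have "unity_exp (- of_int (m - 1) * of_real x) = unity_exp (of_real x) * unity_exp (- of_int m * of_real x)"
        by (subst unity_exp_add[symmetric]) (simp add: algebra_simps)
      moreover have "G (of_real x) = (unity_exp (of_real x) - 1) * q (of_real x) + G 0"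
        using Gq[OF inS[OF that]] by (simp add: algebra_simps)
      ultimately show ?thesis by (simp only: ring_distribs left_diff_distrib mult_ac) simp
    qed
    have int0: "integral {-1/2..1/2} (\<lambda>x::real. G 0 * unity_exp (- of_int m * of_real x)) = (if m = 0 then G 0 else 0)"
    proof (cases "m = 0")
      case False
      define k where "k = - (2 * complex_of_real pi * \<i> * of_int m)"
      have k: "k \<noteq> 0" using False by (simp add: k_def)
      have "((\<lambda>x. unity_exp (- of_int m * of_real x)) has_integral
           (unity_exp (- of_int m * of_real (1/2)) / k - unity_exp (- of_int m * of_real (-1/2)) / k)) {-1/2..1/2}"
      proof (rule fundamental_theorem_of_calculus)
        show "((\<lambda>x. unity_exp (- of_int m * of_real x) / k) has_vector_derivative unity_exp (- of_int m * of_real x)) (at x within {-1/2..1/2})" for x :: real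
        proof -
          have "((\<lambda>z. unity_exp (- of_int m * z) / k) has_field_derivative unity_exp (- of_int m * of_real x)) (at (of_real x))"
            using DERIV_cdivide[OF unity_exp_has_field_derivative[of "- of_int m" "of_real x" UNIV], of k] k
            by (simp add: k_def)
          from has_vector_derivative_real_field[OF this, of UNIV]
          have "((\<lambda>x. unity_exp (- of_int m * of_real x) / k) has_vector_derivative unity_exp (- of_int m * of_real x)) (at x)"
            by (simp add: o_def)
          then show ?thesis by (rule has_vector_derivative_at_within)
        qed
      qed auto
      then have "integral {-1/2..1/2} (\<lambda>x::real. unity_exp (- of_int m * of_real x)) = 0"
        using half[of m] by (simp add: integral_unique)
      then show ?thesis using False by simp
    qed simp
    have "integral {-1/2..1/2} (\<lambda>x. G (of_real x) * unity_exp (- of_int m * of_real x)) =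
       integral {-1/2..1/2} (\<lambda>x. q (of_real x) * unity_exp (- of_int (m - 1) * of_real x) - q (of_real x) * unity_exp (- of_int m * of_real x)
        + G 0 * unity_exp (- of_int m * of_real x))"
      by (rule integral_cong) (rule eq)
    also have "\<dots> = (c (m - 1) - c m) + (if m = 0 then G 0 else 0)"
      unfolding c_def int0[symmetric]
      by (subst Henstock_Kurzweil_Integration.integral_add, (intro integrable_continuous_interval continuous_intros contq)+)
         (subst Henstock_Kurzweil_Integration.integral_diff, (intro integrable_continuous_interval continuous_intros contq)+, simp)
    finally show ?thesis .
  qed
  have tele: "(\<Sum>m\<in>{- int N..int N}. integral {-1/2..1/2} (\<lambda>x. G (of_real x) * unity_exp (- of_int m * of_real x)))
     = c (- int N - 1) - c (int N) + G 0" for N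
  proof -
    have "(\<Sum>m\<in>{- int N..int N}. c (m - 1) - c m) = c (- int N - 1) - c (int N)"
    proof (induction N)
      case (Suc N)
      have *: "{- int (Suc N)..int (Suc N)} = insert (int N + 1) (insert (- int N - 1) {- int N..int N})" by auto
      show ?case unfolding * using Suc by (simp add: algebra_simps)
    qed simp
    then show ?thesis unfolding coeff by (simp add: sum.distrib)
  qed
  obtain B where B: "\<And>x. x \<in> {-1/2..1/2} \<Longrightarrow> norm (deriv q (of_real x)) \<le> B"
  proof -
    have "continuous_on {-1/2..1/2::real} (\<lambda>x. deriv q (of_real x))"
      by (intro continuous_on_compose2[OF holomorphic_on_imp_continuous_on[OF holomorphic_deriv[OF q oS]]] continuous_intros)
         (use inS in auto)
    then have "compact ((\<lambda>x. deriv q (of_real x)) ` {-1/2..1/2})" by (intro compact_continuous_image) auto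
    then show ?thesis using that by (metis bounded_iff compact_imp_bounded image_eqI)
  qed
  \<comment> \<open>One integration by parts gives decay like \<open>1 / |m|\<close>. Since the sum
    has telescoped to its two ends, this suffices.\<close>
  have cbound: "norm (c m) \<le> B / (2 * pi * \<bar>of_int m\<bar>)" if "m \<noteq> 0" for m
  proof -
    define k where "k = - (2 * complex_of_real pi * \<i> * of_int m)"
    have k: "k \<noteq> 0" "norm k = 2 * pi * \<bar>of_int m\<bar>" using that by (auto simp: k_def norm_mult)
    define e where "e = (\<lambda>x::real. unity_exp (- of_int m * of_real x))"
    have contd: "continuous_on {-1/2..1/2::real} (\<lambda>x. deriv q (of_real x) * e x)"
      unfolding e_def
      by (intro continuous_intros continuous_on_compose2[OF holomorphic_on_imp_continuous_on[OF holomorphic_deriv[OF q oS]]])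
         (use inS in auto)
    have "((\<lambda>x. deriv q (of_real x) * e x + k * (q (of_real x) * e x)) has_integral
        (q (of_real (1/2)) * e (1/2) - q (of_real (-1/2)) * e (-1/2))) {-1/2..1/2}"
    proof (rule fundamental_theorem_of_calculus)
      fix x :: real assume x: "x \<in> {-1/2..1/2}"
      have "(q has_field_derivative deriv q (of_real x)) (at (of_real x))"
        using q oS inS[OF x] by (rule holomorphic_derivI)
      from DERIV_mult[OF this unity_exp_has_field_derivative[of "- of_int m"]]
      have "((\<lambda>z. q z * unity_exp (- of_int m * z)) has_field_derivative
          (deriv q (of_real x) * e x + k * (q (of_real x) * e x))) (at (of_real x))"
        by (simp add: e_def k_def algebra_simps)
      from has_vector_derivative_real_field[OF this, of UNIV]
      have "((\<lambda>x. q (of_real x) * e x) has_vector_derivative (deriv q (of_real x) * e x + k * (q (of_real x) * e x))) (at x)"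
        by (simp add: o_def e_def)
      then show "((\<lambda>x. q (of_real x) * e x) has_vector_derivative (deriv q (of_real x) * e x + k * (q (of_real x) * e x))) (at x within {-1/2..1/2})"
        by (rule has_vector_derivative_at_within)
    qed auto
    moreover have cm: "c m = integral {-1/2..1/2} (\<lambda>x. q (of_real x) * e x)" by (simp add: c_def e_def)
    ultimately have "integral {-1/2..1/2} (\<lambda>x. deriv q (of_real x) * e x + k * (q (of_real x) * e x)) = 0"
      using qper half[of m] by (simp add: integral_unique e_def)
    moreover have "integral {-1/2..1/2} (\<lambda>x. deriv q (of_real x) * e x + k * (q (of_real x) * e x))
        = integral {-1/2..1/2} (\<lambda>x. deriv q (of_real x) * e x) + k * c m"
      unfolding cm Henstock_Kurzweil_Integration.integral_mult_right[symmetric]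
      by (intro Henstock_Kurzweil_Integration.integral_add integrable_continuous_interval contd)
         (unfold e_def, intro continuous_intros contq)
    ultimately have "k * c m = - integral {-1/2..1/2} (\<lambda>x. deriv q (of_real x) * e x)"
      by (simp add: add_eq_0_iff)
    then have "norm k * norm (c m) = norm (integral {-1/2..1/2} (\<lambda>x. deriv q (of_real x) * e x))"
      by (metis norm_minus_cancel norm_mult)
    also have "\<dots> \<le> B * (1/2 - (-1/2))"
    proof (rule integral_bound)
      show "norm (deriv q (of_real x) * e x) \<le> B" if "x \<in> {-1/2..1/2}" for x
        using B[OF that] norm_unity_exp[of "- of_int m * x"] by (simp add: norm_mult e_def)
    qed (use contd in auto)
    finally show ?thesis using k that by (simp add: pos_le_divide_eq mult.commute)
  qed
  have lim0: "(\<lambda>N. B / (2 * pi * real N)) \<longlonglongrightarrow> 0" by real_asymp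
  have "(\<lambda>N. c (int N)) \<longlonglongrightarrow> 0"
  proof (rule Lim_null_comparison[OF _ lim0])
    show "\<forall>\<^sub>F N in sequentially. norm (c (int N)) \<le> B / (2 * pi * real N)"
      using eventually_gt_at_top[of 0]
    proof eventually_elim
      case (elim N)
      then show ?case using cbound[of "int N"] by simp
    qed
  qed
  moreover have "(\<lambda>N. c (- int N - 1)) \<longlonglongrightarrow> 0"
  proof (rule Lim_null_comparison[OF _ LIMSEQ_Suc[OF lim0]])
    have "norm (c (- int N - 1)) \<le> B / (2 * pi * real (Suc N))" for N
      using cbound[of "- int N - 1"] by (simp add: abs_if add.commute)
    then show "\<forall>\<^sub>F N in sequentially. norm (c (- int N - 1)) \<le> B / (2 * pi * real (Suc N))" by simp
  qed
  ultimately have "(\<lambda>N. c (- int N - 1) - c (int N) + G 0) \<longlonglongrightarrow> 0 - 0 + G 0"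
    by (intro tendsto_intros)
  then show ?thesis unfolding tele by simp
qed

lemma shifted_square_bound:
  fixes x y R :: real
  assumes "\<bar>x\<bar> \<le> R"
  shows "1 / (1 + (x + y)\<^sup>2) \<le> (2 + 2 * R\<^sup>2) / (1 + y\<^sup>2)"
proof -
  have "0 \<le> (2 * x + y)\<^sup>2" by simp
  then have "y\<^sup>2 \<le> 2 * (x + y)\<^sup>2 + 2 * x\<^sup>2" by (simp add: power2_eq_square algebra_simps)
  moreover have "x\<^sup>2 \<le> R\<^sup>2" using power_mono[OF assms, of 2] by simp
  moreover have "(2 + 2 * R\<^sup>2) * (1 + (x + y)\<^sup>2) = 2 + 2 * R\<^sup>2 + 2 * (x + y)\<^sup>2 + 2 * (R * (x + y))\<^sup>2"
    by (simp only: power_mult_distrib) (simp add: algebra_simps)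
  moreover have "0 \<le> (R * (x + y))\<^sup>2" by simp
  ultimately have "1 + y\<^sup>2 \<le> (2 + 2 * R\<^sup>2) * (1 + (x + y)\<^sup>2)" by linarith
  moreover have "1 + y\<^sup>2 > 0" "1 + (x + y)\<^sup>2 > 0" by (simp_all add: add_pos_nonneg)
  ultimately show ?thesis by (simp add: divide_simps mult.commute)
qed

text \<open>Decay in every horizontal strip makes the periodization entire, so that its Fourier
  series converges to it at \<open>0\<close>; unfolding turns the coefficients into Fourier
  integrals of \<open>f\<close>. The dual side is a limit of symmetric partial sums, as the Fourier
  series delivers it.\<close>

theorem poisson_summation:
  fixes f :: "complex \<Rightarrow> complex"
  assumes hol: "f holomorphic_on UNIV"
    and decay: "\<And>B. \<exists>C. \<forall>z. \<bar>Im z\<bar> \<le> B \<longrightarrow> norm (f z) \<le> C / (1 + (Re z)\<^sup>2)"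
  shows "(\<lambda>k::int. norm (f (of_int k))) summable_on UNIV"
    and "(\<lambda>N::nat. \<Sum>m\<in>{- int N..int N}. LINT x|lborel. f (of_real x) * unity_exp (- of_int m * of_real x))
            \<longlonglongrightarrow> (\<Sum>\<^sub>\<infinity>k::int. f (of_int k))"
proof -
  define S where "S = (\<lambda>(N::nat) z. \<Sum>k\<in>{- int N..int N}. f (z + of_int k))"
  define G where "G = (\<lambda>z. \<Sum>\<^sub>\<infinity>k::int. f (z + of_int k))"
  have bound: "\<exists>C. \<forall>z k. \<bar>Re z\<bar> \<le> R \<longrightarrow> \<bar>Im z\<bar> \<le> R \<longrightarrow> norm (f (z + of_int k)) \<le> C / (1 + (real_of_int k)\<^sup>2)" for R
  proof -
    obtain C where C: "\<And>z. \<bar>Im z\<bar> \<le> R \<Longrightarrow> norm (f z) \<le> C / (1 + (Re z)\<^sup>2)" using decay by blast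
    define C' where "C' = max C 0"
    have C': "norm (f z) \<le> C' * (1 / (1 + (Re z)\<^sup>2))" if "\<bar>Im z\<bar> \<le> R" for z
      using order_trans[OF C[OF that], of "C' / (1 + (Re z)\<^sup>2)"] by (simp add: C'_def divide_right_mono)
    have "norm (f (z + of_int k)) \<le> C' * (2 + 2 * R\<^sup>2) / (1 + (real_of_int k)\<^sup>2)"
      if "\<bar>Re z\<bar> \<le> R" "\<bar>Im z\<bar> \<le> R" for z k
    proof -
      have "norm (f (z + of_int k)) \<le> C' * (1 / (1 + (Re z + of_int k)\<^sup>2))" using C'[of "z + of_int k"] that by simp
      also have "\<dots> \<le> C' * ((2 + 2 * R\<^sup>2) / (1 + (real_of_int k)\<^sup>2))"
        by (intro mult_left_mono shifted_square_bound that) (simp add: C'_def)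
      finally show ?thesis by simp
    qed
    then show ?thesis by blast
  qed
  have summ: "(\<lambda>k::int. norm (f (z + of_int k))) summable_on UNIV" for z
  proof -
    obtain C where C: "\<And>w k. \<bar>Re w\<bar> \<le> norm z \<Longrightarrow> \<bar>Im w\<bar> \<le> norm z \<Longrightarrow> norm (f (w + of_int k)) \<le> C / (1 + (real_of_int k)\<^sup>2)"
      using bound by blast
    show ?thesis
      by (rule summable_on_comparison_test[OF summable_on_int_inverse_square[of C]])
         (use C[of z] abs_Re_le_cmod abs_Im_le_cmod in auto)
  qed
  show "(\<lambda>k::int. norm (f (of_int k))) summable_on UNIV" using summ[of 0] by simp
  have unif: "uniform_limit {z. \<bar>Re z\<bar> \<le> R \<and> \<bar>Im z\<bar> \<le> R} S G sequentially" for R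
  proof -
    obtain C where C: "\<And>z k. \<bar>Re z\<bar> \<le> R \<Longrightarrow> \<bar>Im z\<bar> \<le> R \<Longrightarrow> norm (f (z + of_int k)) \<le> C / (1 + (real_of_int k)\<^sup>2)"
      using bound by blast
    have "uniform_limit {z. \<bar>Re z\<bar> \<le> R \<and> \<bar>Im z\<bar> \<le> R} (\<lambda>X z. \<Sum>k\<in>X. f (z + of_int k)) G (finite_subsets_at_top UNIV)"
      unfolding G_def
      by (rule Weierstrass_m_test_general[OF _ summable_on_int_inverse_square[of C]]) (use C in auto)
    from filterlim_compose[OF this filterlim_symmetric_int_intervals]
    show ?thesis unfolding S_def .
  qed
  have holS: "S N holomorphic_on UNIV" for N
    unfolding S_def
    by (intro holomorphic_intros holomorphic_on_compose_gen[OF _ hol, unfolded comp_def]) auto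
  have holG: "G holomorphic_on UNIV"
  proof (rule holomorphic_uniform_sequence[OF open_UNIV holS])
    fix z :: complex
    show "\<exists>d>0. cball z d \<subseteq> UNIV \<and> uniform_limit (cball z d) S G sequentially"
    proof (intro exI[of _ 1] conjI uniform_limit_on_subset[OF unif[of "norm z + 1"]])
      show "cball z 1 \<subseteq> {w. \<bar>Re w\<bar> \<le> norm z + 1 \<and> \<bar>Im w\<bar> \<le> norm z + 1}"
      proof safe
        fix w assume "w \<in> cball z 1"
        then have "norm w \<le> norm z + 1" using norm_triangle_ineq2[of w z] by (simp add: dist_norm norm_minus_commute)
        then show "\<bar>Re w\<bar> \<le> norm z + 1" "\<bar>Im w\<bar> \<le> norm z + 1"
          using abs_Re_le_cmod[of w] abs_Im_le_cmod[of w] by linarith+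
      qed
    qed auto
  qed
  have per: "G (z + 1) = G z" for z
  proof -
    have "bij_betw (\<lambda>k::int. k + 1) UNIV UNIV" by (rule bij_betwI[where g = "\<lambda>k. k - 1"]) auto
    from infsum_reindex_bij_betw[OF this, of "\<lambda>k. f (z + of_int k)"]
    show ?thesis by (simp add: G_def algebra_simps)
  qed
  have coeff: "integral {-1/2..1/2} (\<lambda>x. G (of_real x) * unity_exp (- of_int m * of_real x))
      = (LINT x|lborel. f (of_real x) * unity_exp (- of_int m * of_real x))" for m
  proof -
    define e where "e = (\<lambda>x::real. unity_exp (- of_int m * of_real x))"
    define F where "F = (\<lambda>x::real. f (of_real x) * e x)"
    have ne: "norm (e x) = 1" for x using norm_unity_exp[of "- of_int m * x"] by (simp add: e_def)
    have conte: "continuous_on A e" for A unfolding e_def by (intro continuous_intros)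
    have contF: "continuous_on A F" for A
      unfolding F_def by (intro continuous_intros conte continuous_on_compose2[OF holomorphic_on_imp_continuous_on[OF hol]]) auto
    have eper: "e (x + of_int k) = e x" for x k
      using unity_exp_add[of "- of_int m * of_real x" "of_int (- m * k)"] unity_exp_of_int[of "- m * k"]
      by (simp add: e_def algebra_simps del: unity_exp_of_int)
    have SF: "S N (of_real x) * e x = (\<Sum>k\<in>{- int N..int N}. F (x + of_int k))" for N x
      unfolding S_def sum_distrib_right F_def by (simp add: eper)
    have int_i: "F integrable_on {a..b}" for a b by (rule integrable_continuous_interval[OF contF])
    have shift: "integral {-1/2..1/2} (\<lambda>x. F (x + c)) = integral {c - 1/2..c + 1/2} F" for c
      using integral_shift[OF contF, of "-1/2" "1/2" c] by (simp add: o_def add.commute)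
    \<comment> \<open>In the induction the two new terms \<open>k = N + 1\<close> and
      \<open>k = - N - 1\<close> prolong the interval of integration by one unit at each
      end.\<close>
    have SN: "integral {-1/2..1/2} (\<lambda>x. S N (of_real x) * e x) = integral {- real N - 1/2..real N + 1/2} F" for N
    proof (induction N)
      case 0
      then show ?case using shift[of 0] by (simp add: SF)
    next
      case (Suc N)
      have *: "{- int (Suc N)..int (Suc N)} = insert (int N + 1) (insert (- int N - 1) {- int N..int N})" by auto
      have ci: "(\<lambda>x. F (x + c)) integrable_on {-1/2..1/2}" for c
        by (intro integrable_continuous_interval continuous_on_compose2[OF contF[of UNIV]] continuous_intros) auto
      have ci2: "(\<lambda>x. \<Sum>k\<in>{- int N..int N}. F (x + of_int k)) integrable_on {-1/2..1/2}"
        by (intro integrable_sum ci) auto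
      have "integral {-1/2..1/2} (\<lambda>x. S (Suc N) (of_real x) * e x) =
          integral {-1/2..1/2} (\<lambda>x. F (x + (real N + 1)) + (F (x + (- real N - 1)) + (\<Sum>k\<in>{- int N..int N}. F (x + of_int k))))"
        unfolding SF * by (simp add: algebra_simps)
      also have "\<dots> = integral {real N + 1/2..real N + 3/2} F + (integral {- real N - 3/2..- real N - 1/2} F
          + integral {- real N - 1/2..real N + 1/2} F)"
      proof -
        have a: "a - 1/2 = a - 1 + 1/2" "a + 1 + 1/2 = a + 3/2" "a + 1 - 1/2 = a + 1/2" "a - 1 - 1/2 = a - 3/2" "a - 1 + 1/2 = a - 1/2" for a :: real
          by simp_all
        show ?thesis
          unfolding Henstock_Kurzweil_Integration.integral_add[OF ci Henstock_Kurzweil_Integration.integrable_add[OF ci ci2]]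
            Henstock_Kurzweil_Integration.integral_add[OF ci ci2] shift Suc[symmetric] SF a(2-5) ..
      qed
      also have "\<dots> = integral {- real N - 3/2..real N + 3/2} F"
        using Henstock_Kurzweil_Integration.integral_combine[OF _ _ int_i, of "- real N - 3/2" "- real N - 1/2" "real N + 1/2"]
          Henstock_Kurzweil_Integration.integral_combine[OF _ _ int_i, of "- real N - 3/2" "real N + 1/2" "real N + 3/2"]
        by (simp add: algebra_simps)
      finally show ?case by (simp add: algebra_simps)
    qed
    have lim1: "(\<lambda>N. integral {-1/2..1/2} (\<lambda>x. S N (of_real x) * e x)) \<longlonglongrightarrow> integral {-1/2..1/2} (\<lambda>x. G (of_real x) * e x)"
    proof -
      have u1: "uniform_limit {-1/2..1/2::real} (\<lambda>N x. S N (of_real x)) (\<lambda>x. G (of_real x)) sequentially"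
        by (rule uniform_limit_compose'[OF unif[of "1/2"]]) (auto simp: Pi_iff abs_le_iff)
      have u: "uniform_limit {-1/2..1/2} (\<lambda>N x. S N (of_real x) * e x) (\<lambda>x. G (of_real x) * e x) sequentially"
      proof (rule uniform_lim_mult[OF u1 uniform_limit_const])
        have "continuous_on {-1/2..1/2::real} (\<lambda>x. G (of_real x))"
          by (intro continuous_on_compose2[OF holomorphic_on_imp_continuous_on[OF holG]] continuous_intros) auto
        then show "bounded ((\<lambda>x. G (of_real x)) ` {-1/2..1/2::real})"
          by (intro compact_imp_bounded compact_continuous_image) auto
        show "bounded (e ` {-1/2..1/2})" using ne by (auto simp: bounded_iff)
      qed
      have c: "continuous_on {-1/2..1/2} (\<lambda>x. S N (of_real x) * e x)" for N
        by (intro continuous_intros conte continuous_on_compose2[OF holomorphic_on_imp_continuous_on[OF holS]]) auto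
      obtain I J where IJ: "\<And>N. ((\<lambda>x. S N (of_real x) * e x) has_integral I N) {-1/2..1/2}"
         "((\<lambda>x. G (of_real x) * e x) has_integral J) {-1/2..1/2}" "I \<longlonglongrightarrow> J"
        by (rule uniform_limit_integral[OF u c]) auto
      have "integral {-1/2..1/2} (\<lambda>x. S N (of_real x) * e x) = I N" for N
        using IJ(1) by (rule integral_unique)
      moreover have "integral {-1/2..1/2} (\<lambda>x. G (of_real x) * e x) = J"
        using IJ(2) by (rule integral_unique)
      ultimately show ?thesis using IJ(3) by (simp only:)
    qed
    obtain C where C: "\<And>z. \<bar>Im z\<bar> \<le> 0 \<Longrightarrow> norm (f z) \<le> C / (1 + (Re z)\<^sup>2)" using decay by blast
    have nF: "norm (F x) \<le> C / (1 + x\<^sup>2)" for x using C[of "of_real x"] by (simp add: F_def norm_mult ne)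
    have Fint: "integrable lborel F"
    proof (rule Bochner_Integration.integrable_bound)
      show "integrable lborel (\<lambda>x. C / (1 + (0 + x)\<^sup>2))" by (rule inverse_1_plus_shifted_square_integrable)
      show "F \<in> borel_measurable lborel" using contF[of UNIV] by (simp add: borel_measurable_continuous_onI)
      show "AE x in lborel. norm (F x) \<le> norm (C / (1 + (0 + x)\<^sup>2))"
        using order_trans[OF nF abs_ge_self] by (intro AE_I2) (simp only: add_0_left real_norm_def)
    qed
    have lim2: "(\<lambda>N. integral {- real N - 1/2..real N + 1/2} F) \<longlonglongrightarrow> integral\<^sup>L lborel F"
    proof -
      have eq: "integral {- real N - 1/2..real N + 1/2} F = (LINT x|lborel. indicator {- real N - 1/2..real N + 1/2} x *\<^sub>R F x)" for N
      proof -
        have "set_integrable lborel {- real N - 1/2..real N + 1/2} F"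
          unfolding set_integrable_def using Fint by (intro integrable_mult_indicator) auto
        from set_borel_integral_eq_integral(2)[OF this] show ?thesis by (simp add: set_lebesgue_integral_def)
      qed
      show ?thesis unfolding eq
      proof (rule integral_dominated_convergence[where w = "\<lambda>x. norm (F x)"])
        show "AE x in lborel. (\<lambda>N. indicator {- real N - 1/2..real N + 1/2} x *\<^sub>R F x) \<longlonglongrightarrow> F x"
        proof (rule AE_I2, rule tendsto_eventually)
          fix x :: real
          show "\<forall>\<^sub>F N in sequentially. indicator {- real N - 1/2..real N + 1/2} x *\<^sub>R F x = F x"
            using eventually_ge_at_top[of "nat \<lceil>\<bar>x\<bar>\<rceil>"]
          proof eventually_elim
            case (elim N)
            then have "\<bar>x\<bar> \<le> real N" by linarith
            then show ?case by (auto simp: indicator_def)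
          qed
        qed
      qed (use Fint borel_measurable_integrable[OF Fint] in \<open>auto intro!: AE_I2 simp: indicator_def\<close>)
    qed
    show ?thesis
      using LIMSEQ_unique[OF lim1 lim2[folded SN]] by (simp add: F_def e_def)
  qed
  have "(\<Sum>\<^sub>\<infinity>k::int. f (of_int k)) = G 0" by (simp add: G_def)
  then show "(\<lambda>N::nat. \<Sum>m\<in>{- int N..int N}. LINT x|lborel. f (of_real x) * unity_exp (- of_int m * of_real x))
            \<longlonglongrightarrow> (\<Sum>\<^sub>\<infinity>k::int. f (of_int k))"
    using fourier_series_at_0[OF holG per] unfolding coeff by simp
qed

section \<open>Theta functions of characters\<close>

text \<open>Eigenfunctions of the Fourier transform vanishing at \<open>0\<close>. The even one is
  proportional to \<open>(D\<^sup>2 - 1/16)\<close> applied to the Gaussian in the variable \<open>log x\<^sup>2\<close>, and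
  kills the constant terms of the Jacobi theta function.\<close>

definition theta_kernel :: "bool \<Rightarrow> complex \<Rightarrow> complex" where
  "theta_kernel od z = (if od then z else of_real (pi\<^sup>2) * z ^ 4 - of_real (3 / 2 * pi) * z\<^sup>2) * exp (- of_real pi * z\<^sup>2)"

text \<open>The eigenvalue of \<open>theta_kernel od\<close> under the Fourier transform. Hermite
  functions of degree \<open>n\<close> have eigenvalue \<open>(-i)^n\<close>; the odd kernel is the
  one of degree \<open>1\<close>, and the ratio of the coefficients \<open>pi^2\<close> and
  \<open>3/2 pi\<close> makes the even kernel a combination of degrees \<open>0\<close> and
  \<open>4\<close> alone.\<close>

definition theta_sign :: "bool \<Rightarrow> complex" where
  "theta_sign od = (if od then - \<i> else 1)"

lemma holomorphic_theta_kernel: "theta_kernel od holomorphic_on UNIV"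
  by (cases od) (auto simp: theta_kernel_def[abs_def] intro!: holomorphic_intros)

lemma power_le_fact_exp:
  fixes u :: real
  assumes "u \<ge> 0"
  shows "u ^ n \<le> fact n * exp u"
proof -
  have "u ^ n /\<^sub>R fact n \<le> exp u"
    using sum_le_suminf[of "\<lambda>n. u ^ n /\<^sub>R fact n" "{n}"] summable_exp_generic[of u] assms
    by (simp add: exp_def)
  then show ?thesis by (simp add: divide_simps mult.commute)
qed

text \<open>With \<open>u = 1 + (Re z)^2\<close>, the polynomial factor is \<open>O(u^2)\<close> and
  the Gaussian is \<open>O(exp (- u))\<close> in the strip, since \<open>pi > 1\<close>; then
  \<open>u^(n + 2) <= (n + 2)! exp u\<close> gives any power of decay.\<close>

lemma theta_kernel_decay:
  "\<exists>C>0. \<forall>z. \<bar>Im z\<bar> \<le> B \<longrightarrow> norm (theta_kernel od z) \<le> C / (1 + (Re z)\<^sup>2) ^ n"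
proof -
  define C where "C = 1 + 10 * (1 + B\<^sup>2)\<^sup>2 * exp (pi * B\<^sup>2) * exp 1 * fact (n + 2)"
  have bnd: "norm (theta_kernel od z) \<le> C / (1 + (Re z)\<^sup>2) ^ n" if B: "\<bar>Im z\<bar> \<le> B" for z
  proof -
    define u where "u = 1 + (Re z)\<^sup>2"
    have u: "u \<ge> 1" by (simp add: u_def)
    have Im2: "(Im z)\<^sup>2 \<le> B\<^sup>2" using power_mono[OF B, of 2] by simp
    have "norm (if od then z else of_real (pi\<^sup>2) * z ^ 4 - of_real (3 / 2 * pi) * z\<^sup>2) \<le> 10 * (1 + (norm z)\<^sup>2)\<^sup>2"
    proof (cases od)
      case True
      have "norm z \<le> 1 + (norm z)\<^sup>2"
        using sum_squares_ge_zero[of "norm z - 1" 0] norm_ge_zero[of z]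
        by (simp only: power2_eq_square ring_distribs left_diff_distrib right_diff_distrib)
      also have "\<dots> \<le> (1 + (norm z)\<^sup>2)\<^sup>2" by (rule self_le_power) auto
      also have "\<dots> \<le> 10 * (1 + (norm z)\<^sup>2)\<^sup>2" by simp
      finally show ?thesis using True by (simp only: if_True)
    next
      case False
      have pi4: "pi\<^sup>2 \<le> 10" using pi_approx power_mono[of pi "3.15" 2] by (simp add: power2_eq_square)
      have p5: "3 / 2 * pi \<le> 20" using pi_approx by simp
      have "norm (of_real (pi\<^sup>2) * z ^ 4 - of_real (3 / 2 * pi) * z\<^sup>2) \<le> norm (of_real (pi\<^sup>2) * z ^ 4) + norm (of_real (3 / 2 * pi) * z\<^sup>2)"
        by (rule norm_triangle_ineq4)
      also have "\<dots> = pi\<^sup>2 * (norm z) ^ 4 + 3 / 2 * pi * (norm z)\<^sup>2"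
        by (simp add: norm_mult norm_power)
      also have "\<dots> \<le> 10 * (norm z) ^ 4 + 20 * (norm z)\<^sup>2"
        using pi4 p5 by (intro add_mono mult_right_mono) auto
      also have "\<dots> \<le> 10 * (1 + (norm z)\<^sup>2)\<^sup>2"
        by (simp add: power2_eq_square power4_eq_xxxx algebra_simps)
      finally show ?thesis using False by simp
    qed
    also have "(1 + (norm z)\<^sup>2)\<^sup>2 \<le> ((1 + B\<^sup>2) * u)\<^sup>2"
    proof (rule power_mono)
      have "1 + (norm z)\<^sup>2 \<le> 1 + (Re z)\<^sup>2 + B\<^sup>2" using Im2 by (simp add: cmod_power2)
      also have "\<dots> \<le> (1 + B\<^sup>2) * u" by (simp add: u_def algebra_simps)
      finally show "1 + (norm z)\<^sup>2 \<le> (1 + B\<^sup>2) * u" .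
    qed auto
    finally have 1: "norm (if od then z else of_real (pi\<^sup>2) * z ^ 4 - of_real (3 / 2 * pi) * z\<^sup>2) \<le> 10 * ((1 + B\<^sup>2) * u)\<^sup>2"
      by simp
    have "Re (- of_real pi * z\<^sup>2) = pi * (Im z)\<^sup>2 - pi * (Re z)\<^sup>2"
      by (simp add: power2_eq_square algebra_simps)
    also have "\<dots> \<le> pi * B\<^sup>2 + 1 - u"
    proof -
      have "1 * (Re z)\<^sup>2 \<le> pi * (Re z)\<^sup>2" using pi_ge_two by (intro mult_right_mono) auto
      moreover have "pi * (Im z)\<^sup>2 \<le> pi * B\<^sup>2" using Im2 by (intro mult_left_mono) auto
      ultimately show ?thesis unfolding u_def by linarith
    qed
    finally have 2: "norm (exp (- of_real pi * z\<^sup>2)) \<le> exp (pi * B\<^sup>2) * exp 1 / exp u"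
      by (simp add: exp_add[symmetric] exp_diff[symmetric])
    have "norm (theta_kernel od z) \<le> 10 * ((1 + B\<^sup>2) * u)\<^sup>2 * (exp (pi * B\<^sup>2) * exp 1 / exp u)"
      unfolding theta_kernel_def norm_mult using 1 2 by (intro mult_mono) auto
    also have "\<dots> = 10 * (1 + B\<^sup>2)\<^sup>2 * exp (pi * B\<^sup>2) * exp 1 * (u\<^sup>2 / exp u)"
      by (simp add: power_mult_distrib)
    also have "u\<^sup>2 / exp u \<le> fact (n + 2) / u ^ n"
      using power_le_fact_exp[of u "n + 2"] u by (simp add: divide_simps power_add mult_ac power2_eq_square)
    also have "10 * (1 + B\<^sup>2)\<^sup>2 * exp (pi * B\<^sup>2) * exp 1 * (fact (n + 2) / u ^ n) \<le> C / u ^ n"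
      using u by (simp add: C_def divide_right_mono)
    finally show ?thesis by (simp add: u_def mult_left_mono)
  qed
  have "C > 0" unfolding C_def by (intro add_pos_nonneg) auto
  with bnd show ?thesis by blast
qed

text \<open>The Gaussian is the normal density of variance \<open>1 / (2 pi)\<close>, for which the
  normalizing factor is \<open>1\<close>.\<close>

lemma gaussian_moments:
  "has_bochner_integral lborel (\<lambda>x. exp (- pi * x\<^sup>2) * x ^ (2 * k)) (fact (2 * k) / ((4 * pi) ^ k * fact k))"
  "has_bochner_integral lborel (\<lambda>x. exp (- pi * x\<^sup>2) * x ^ (2 * k + 1)) 0"
proof -
  define \<sigma> where "\<sigma> = 1 / sqrt (2 * pi)"
  have \<sigma>: "\<sigma> > 0" "\<sigma>\<^sup>2 = 1 / (2 * pi)" by (auto simp: \<sigma>_def power_divide)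
  have dens: "normal_density 0 \<sigma> x = exp (- pi * x\<^sup>2)" for x
    unfolding normal_density_def \<sigma>(2) by (simp add: field_simps)
  have "2 / \<sigma>\<^sup>2 = 4 * pi" by (simp add: \<sigma>(2))
  then show "has_bochner_integral lborel (\<lambda>x. exp (- pi * x\<^sup>2) * x ^ (2 * k)) (fact (2 * k) / ((4 * pi) ^ k * fact k))"
    using normal_moment_even[OF \<sigma>(1), of 0 k] unfolding dens by simp
  show "has_bochner_integral lborel (\<lambda>x. exp (- pi * x\<^sup>2) * x ^ (2 * k + 1)) 0"
    using normal_moment_odd[OF \<sigma>(1), of 0 k] unfolding dens by simp
qed

text \<open>After the rotation \<open>z = - i s\<close> the real axis becomes the line
  \<open>Re s = 0\<close>. Moving it to \<open>Re s = \<xi>\<close> completes the square and splits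
  the exponential into \<open>exp (- pi t^2)\<close> and \<open>exp (- pi \<xi>^2)\<close>; what
  remains are Gaussian moments up to order 4.\<close>

lemma theta_kernel_fourier:
  "(LINT x|lborel. theta_kernel od (of_real x) * unity_exp (- of_real \<xi> * of_real x))
     = theta_sign od * theta_kernel od (of_real \<xi>)"
proof -
  define F where "F = (\<lambda>z. theta_kernel od z * unity_exp (- of_real \<xi> * z))"
  define B where "B = \<bar>\<xi>\<bar> + 1"
  have holF: "(\<lambda>s. F (- \<i> * s)) holomorphic_on {s. - B < Re s \<and> Re s < B}"
    unfolding F_def
    by (intro holomorphic_intros holomorphic_on_compose_gen[OF _ holomorphic_theta_kernel, unfolded comp_def]) auto
  obtain C where C: "C > 0" "\<And>z. \<bar>Im z\<bar> \<le> B \<Longrightarrow> norm (theta_kernel od z) \<le> C / (1 + (Re z)\<^sup>2) ^ 1"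
    using theta_kernel_decay by blast
  have bnd: "norm (F (- \<i> * s)) \<le> (C * exp (2 * pi * (\<bar>\<xi>\<bar> * B))) / (1 + (Im s)\<^sup>2)" if "- B < Re s" "Re s < B" for s
  proof -
    have "norm (unity_exp (- of_real \<xi> * (- \<i> * s))) = exp (2 * pi * (- \<xi> * Re s))"
      by (simp add: unity_exp_def mult_ac)
    also have "- \<xi> * Re s \<le> \<bar>\<xi>\<bar> * B"
      using that abs_le_D1[of "- \<xi> * Re s" "\<bar>\<xi>\<bar> * B"] by (simp add: abs_mult mult_left_mono abs_le_iff)
    then have "exp (2 * pi * (- \<xi> * Re s)) \<le> exp (2 * pi * (\<bar>\<xi>\<bar> * B))" by (simp only: exp_le_cancel_iff, intro mult_left_mono, auto)
    finally have "norm (unity_exp (- of_real \<xi> * (- \<i> * s))) \<le> exp (2 * pi * (\<bar>\<xi>\<bar> * B))" .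
    moreover have "norm (theta_kernel od (- \<i> * s)) \<le> C / (1 + (Im s)\<^sup>2)"
      using C(2)[of "- \<i> * s"] that by simp
    ultimately have "norm (F (- \<i> * s)) \<le> C / (1 + (Im s)\<^sup>2) * exp (2 * pi * (\<bar>\<xi>\<bar> * B))"
      unfolding F_def norm_mult using C(1) by (intro mult_mono) (auto simp: add_nonneg_nonneg)
    then show ?thesis by simp
  qed
  have B: "- B < 0" "0 < B" "- B < \<xi>" "\<xi> < B" by (auto simp: B_def)
  have sh: "(LINT t|lborel. F (- \<i> * Complex 0 t)) = (LINT t|lborel. F (- \<i> * Complex \<xi> t))"
    by (rule vertical_integral_shift(1)[OF holF bnd B])
  define M where "M = (\<lambda>k x. exp (- pi * x\<^sup>2) * x ^ k :: real)"
  have M: "has_bochner_integral lborel (M 0) 1" "has_bochner_integral lborel (M 1) 0"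
     "has_bochner_integral lborel (M 2) (1 / (2 * pi))" "has_bochner_integral lborel (M 3) 0"
     "has_bochner_integral lborel (M 4) (3 / (4 * pi\<^sup>2))"
    using gaussian_moments(1)[of 0] gaussian_moments(2)[of 0] gaussian_moments(1)[of 1] gaussian_moments(2)[of 1]
      gaussian_moments(1)[of 2]
    by (simp_all add: M_def[abs_def] fact_numeral power_mult_distrib power2_eq_square power3_eq_cube field_simps)
  have Mi: "integrable lborel (\<lambda>x. complex_of_real (M k x))" "(LINT x|lborel. complex_of_real (M k x)) = of_real (LINT x|lborel. M k x)"
    if "k \<le> 4" for k
  proof -
    have "k = 0 \<or> k = 1 \<or> k = 2 \<or> k = 3 \<or> k = 4" using that by auto
    then have "integrable lborel (M k)" using M by (auto simp: has_bochner_integral_iff)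
    then show "integrable lborel (\<lambda>x. complex_of_real (M k x))" by simp
  qed simp
  have Mv: "(LINT x|lborel. M 0 x) = 1" "(LINT x|lborel. M 1 x) = 0" "(LINT x|lborel. M 2 x) = 1 / (2 * pi)"
     "(LINT x|lborel. M 3 x) = 0" "(LINT x|lborel. M 4 x) = 3 / (4 * pi\<^sup>2)"
    using M by (auto simp: has_bochner_integral_iff)
  have ex: "exp (- of_real pi * (of_real t - \<i> * of_real \<xi>)\<^sup>2) * unity_exp (- of_real \<xi> * (of_real t - \<i> * of_real \<xi>))
      = of_real (exp (- pi * t\<^sup>2)) * exp (- of_real pi * (of_real \<xi>)\<^sup>2)" for t :: real
  proof -
    have "- of_real pi * (of_real t - \<i> * of_real \<xi>)\<^sup>2 + 2 * of_real pi * \<i> * (- of_real \<xi> * (of_real t - \<i> * of_real \<xi>))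
      = of_real (- pi * t\<^sup>2) + - of_real pi * (of_real \<xi>)\<^sup>2"
      by (simp add: power2_eq_square algebra_simps)
    then show ?thesis unfolding unity_exp_def by (simp only: exp_add[symmetric] exp_of_real[symmetric])
  qed
  have arg0: "- \<i> * Complex 0 t = of_real t" for t by (simp add: complex_eq_iff)
  have arg1: "- \<i> * Complex \<xi> t = of_real t - \<i> * of_real \<xi>" for t by (simp add: complex_eq_iff)
  define x' where "x' = complex_of_real \<xi>"
  have "(LINT t|lborel. F (- \<i> * Complex \<xi> t)) = theta_sign od * theta_kernel od (of_real \<xi>)"
  proof (cases od)
    case True
    have "F (- \<i> * Complex \<xi> t) = exp (- of_real pi * x'\<^sup>2) * (of_real (M 1 t) - \<i> * x' * of_real (M 0 t))" for t
    proof -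
      have "F (- \<i> * Complex \<xi> t) = (of_real t - \<i> * of_real \<xi>) * (of_real (exp (- pi * t\<^sup>2)) * exp (- of_real pi * (of_real \<xi>)\<^sup>2))"
        unfolding arg1 F_def theta_kernel_def using True by (simp only: ex[symmetric] if_True mult.assoc)
      then show ?thesis by (simp add: M_def x'_def algebra_simps)
    qed
    then have "(LINT t|lborel. F (- \<i> * Complex \<xi> t)) = exp (- of_real pi * x'\<^sup>2) * (of_real 0 - \<i> * x' * of_real 1)"
      using Mi[of 0] Mi[of 1] Mv by (simp del: of_real_power of_real_mult add: Bochner_Integration.integral_diff)
    then show ?thesis using True by (simp add: theta_sign_def theta_kernel_def x'_def)
  next
    case False
    \<comment> \<open>The coefficients come from expanding the fourth and second powers of
      \<open>t - i x'\<close>, collected by powers of \<open>t\<close>.\<close>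
    have "F (- \<i> * Complex \<xi> t) = exp (- of_real pi * x'\<^sup>2) *
       (of_real (pi\<^sup>2) * of_real (M 4 t) + (- 4 * \<i> * of_real (pi\<^sup>2) * x') * of_real (M 3 t)
         + (- 6 * of_real (pi\<^sup>2) * x'\<^sup>2 - of_real (3 / 2 * pi)) * of_real (M 2 t)
         + (4 * \<i> * of_real (pi\<^sup>2) * x' ^ 3 + 2 * \<i> * of_real (3 / 2 * pi) * x') * of_real (M 1 t)
         + (of_real (pi\<^sup>2) * x' ^ 4 + of_real (3 / 2 * pi) * x'\<^sup>2) * of_real (M 0 t))" for t
    proof -
      have i4: "(\<i> * x') ^ 4 = x' ^ 4" "(\<i> * x') ^ 3 = - \<i> * x' ^ 3" "(\<i> * x')\<^sup>2 = - x'\<^sup>2"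
      proof -
        have "\<i> ^ 4 = 1" "\<i> ^ 3 = - \<i>" "\<i>\<^sup>2 = - 1" by (simp_all add: power3_eq_cube power4_eq_xxxx)
        then show "(\<i> * x') ^ 4 = x' ^ 4" "(\<i> * x') ^ 3 = - \<i> * x' ^ 3" "(\<i> * x')\<^sup>2 = - x'\<^sup>2"
          unfolding power_mult_distrib by simp_all
      qed
      have p4: "(of_real t - \<i> * x') ^ 4 = of_real (t ^ 4) - 4 * \<i> * x' * of_real (t ^ 3) - 6 * x'\<^sup>2 * of_real (t ^ 2)
          + 4 * \<i> * x' ^ 3 * of_real (t ^ 1) + x' ^ 4"
      proof -
        have "(a - b) ^ 4 = a ^ 4 - 4 * b * a ^ 3 + 6 * b\<^sup>2 * a\<^sup>2 - 4 * b ^ 3 * a + b ^ 4" for a b :: complex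
          by (simp add: eval_nat_numeral algebra_simps)
        from this[of "of_real t" "\<i> * x'"] show ?thesis unfolding i4 by (simp add: mult_ac)
      qed
      have p2: "(of_real t - \<i> * x')\<^sup>2 = of_real (t ^ 2) - 2 * \<i> * x' * of_real (t ^ 1) - x'\<^sup>2"
        by (simp add: power2_eq_square algebra_simps)
      have "F (- \<i> * Complex \<xi> t) = (of_real (pi\<^sup>2) * (of_real t - \<i> * x') ^ 4 - of_real (3 / 2 * pi) * (of_real t - \<i> * x')\<^sup>2)
          * (of_real (exp (- pi * t\<^sup>2)) * exp (- of_real pi * x'\<^sup>2))"
        unfolding arg1 F_def theta_kernel_def x'_def using False by (simp only: ex[symmetric] if_False mult.assoc)
      also have "\<dots> = exp (- of_real pi * x'\<^sup>2) *
       (of_real (pi\<^sup>2) * of_real (M 4 t) + (- 4 * \<i> * of_real (pi\<^sup>2) * x') * of_real (M 3 t)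
         + (- 6 * of_real (pi\<^sup>2) * x'\<^sup>2 - of_real (3 / 2 * pi)) * of_real (M 2 t)
         + (4 * \<i> * of_real (pi\<^sup>2) * x' ^ 3 + 2 * \<i> * of_real (3 / 2 * pi) * x') * of_real (M 1 t)
         + (of_real (pi\<^sup>2) * x' ^ 4 + of_real (3 / 2 * pi) * x'\<^sup>2) * of_real (M 0 t))"
        unfolding p4 p2 M_def of_real_mult[of "exp (- pi * t\<^sup>2)"] power_0 of_real_1
        by (simp only: ring_distribs mult_ac minus_mult_left[symmetric] mult_minus_right mult_minus_left diff_conv_add_uminus minus_add_distrib minus_minus mult_1_left mult_1_right) (simp add: algebra_simps)
      finally show ?thesis .
    qed
    note val = this
    have "(LINT t|lborel. F (- \<i> * Complex \<xi> t)) = exp (- of_real pi * x'\<^sup>2) *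
       (of_real (pi\<^sup>2) * of_real (3 / (4 * pi\<^sup>2)) + (- 4 * \<i> * of_real (pi\<^sup>2) * x') * of_real 0
         + (- 6 * of_real (pi\<^sup>2) * x'\<^sup>2 - of_real (3 / 2 * pi)) * of_real (1 / (2 * pi))
         + (4 * \<i> * of_real (pi\<^sup>2) * x' ^ 3 + 2 * \<i> * of_real (3 / 2 * pi) * x') * of_real 0
         + (of_real (pi\<^sup>2) * x' ^ 4 + of_real (3 / 2 * pi) * x'\<^sup>2) * of_real 1)"
    proof -
      have le: "(0::nat) \<le> 4" "(1::nat) \<le> 4" "(2::nat) \<le> 4" "(3::nat) \<le> 4" "(4::nat) \<le> 4" by simp_all
      note mom = Mi[OF le(1)] Mi[OF le(2)] Mi[OF le(3)] Mi[OF le(4)] Mi[OF le(5)]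
      show "?thesis"
        by (simp only: val Bochner_Integration.integral_add integral_mult_right_zero mom Mv
            Bochner_Integration.integrable_add integrable_mult_right)
    qed
    also have "\<dots> = theta_sign od * theta_kernel od (of_real \<xi>)"
      using False by (simp add: theta_sign_def theta_kernel_def x'_def power2_eq_square field_simps)
    finally show ?thesis .
  qed
  then show ?thesis using sh unfolding arg0 F_def by simp
qed

lemma infsum_finite_sum:
  fixes f :: "'a \<Rightarrow> 'b \<Rightarrow> complex"
  assumes "finite A" "\<And>a. a \<in> A \<Longrightarrow> f a summable_on B"
  shows "infsum (\<lambda>m. \<Sum>a\<in>A. f a m) B = (\<Sum>a\<in>A. infsum (f a) B)"
proof -
  have "((\<lambda>m. \<Sum>a\<in>A. f a m) has_sum (\<Sum>a\<in>A. infsum (f a) B)) B"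
    using assms
  proof (induction A rule: finite_induct)
    case (insert a A)
    then show ?case by (simp add: has_sum_add)
  qed (simp add: has_sum_0)
  then show ?thesis by (rule infsumI)
qed

text \<open>Poisson summation is applied to the kernel composed with \<open>z -> r (z + b)\<close>.
  As the kernel is an eigenfunction, the transform is the kernel at scale \<open>1 / r\<close>, and
  the shift \<open>b\<close> turns into a phase.\<close>

lemma poisson_theta_kernel:
  fixes r b :: real
  assumes r: "r > 0"
  shows "(\<lambda>k::int. norm (theta_kernel od (of_real (r * (of_int k + b))))) summable_on UNIV"
    and "(\<lambda>m::int. norm (unity_exp (of_real (of_int m * b)) * theta_kernel od (of_real (of_int m / r)))) summable_on UNIV"
    and "(\<Sum>\<^sub>\<infinity>k::int. theta_kernel od (of_real (r * (of_int k + b))))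
      = theta_sign od / of_real r * (\<Sum>\<^sub>\<infinity>m::int. unity_exp (of_real (of_int m * b)) * theta_kernel od (of_real (of_int m / r)))"
proof -
  define f where "f = (\<lambda>z. theta_kernel od (of_real r * (z + of_real b)))"
  have hol: "f holomorphic_on UNIV"
    unfolding f_def by (intro holomorphic_on_compose_gen[OF _ holomorphic_theta_kernel, unfolded comp_def] holomorphic_intros) auto
  have decay: "\<exists>C. \<forall>z. \<bar>Im z\<bar> \<le> B \<longrightarrow> norm (f z) \<le> C / (1 + (Re z)\<^sup>2)" for B
  proof -
    obtain C where C: "C > 0" "\<And>z. \<bar>Im z\<bar> \<le> r * B \<Longrightarrow> norm (theta_kernel od z) \<le> C / (1 + (Re z)\<^sup>2) ^ 1"
      using theta_kernel_decay by blast
    define D where "D = (2 + 2 * b\<^sup>2) / min (r\<^sup>2) 1"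
    have "norm (f z) \<le> (C * D) / (1 + (Re z)\<^sup>2)" if "\<bar>Im z\<bar> \<le> B" for z
    proof -
      have m: "min (r\<^sup>2) 1 > 0" using r by simp
      have "min (r\<^sup>2) 1 * (1 + (b + Re z)\<^sup>2) \<le> 1 + (r * (Re z + b))\<^sup>2"
      proof -
        have "min (r\<^sup>2) 1 * (b + Re z)\<^sup>2 \<le> r\<^sup>2 * (b + Re z)\<^sup>2" by (intro mult_right_mono) auto
        moreover have "min (r\<^sup>2) 1 \<le> 1" by simp
        moreover have "(r * (Re z + b))\<^sup>2 = r\<^sup>2 * (b + Re z)\<^sup>2" by (simp only: power_mult_distrib add.commute)
        moreover have "min (r\<^sup>2) 1 * (1 + (b + Re z)\<^sup>2) = min (r\<^sup>2) 1 + min (r\<^sup>2) 1 * (b + Re z)\<^sup>2"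
          by (simp only: ring_distribs mult_1_right)
        ultimately show ?thesis by linarith
      qed
      then have "1 / (1 + (r * (Re z + b))\<^sup>2) \<le> 1 / (min (r\<^sup>2) 1 * (1 + (b + Re z)\<^sup>2))"
        using m by (intro divide_left_mono mult_pos_pos add_pos_nonneg) auto
      also have "\<dots> = 1 / min (r\<^sup>2) 1 * (1 / (1 + (b + Re z)\<^sup>2))" by simp
      also have "\<dots> \<le> 1 / min (r\<^sup>2) 1 * ((2 + 2 * \<bar>b\<bar>\<^sup>2) / (1 + (Re z)\<^sup>2))"
        using m by (intro mult_left_mono shifted_square_bound) auto
      also have "\<dots> = D / (1 + (Re z)\<^sup>2)" by (simp add: D_def)
      finally have *: "1 / (1 + (r * (Re z + b))\<^sup>2) \<le> D / (1 + (Re z)\<^sup>2)" .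
      have "norm (f z) \<le> C * (1 / (1 + (r * (Re z + b))\<^sup>2))"
        using C(2)[of "of_real r * (z + of_real b)"] that r by (simp add: f_def abs_mult mult_left_mono)
      also have "\<dots> \<le> C * (D / (1 + (Re z)\<^sup>2))" using * C(1) by (intro mult_left_mono) auto
      finally show ?thesis by simp
    qed
    then show ?thesis by blast
  qed
  show "(\<lambda>k::int. norm (theta_kernel od (of_real (r * (of_int k + b))))) summable_on UNIV"
    using poisson_summation(1)[OF hol decay] by (simp add: f_def)
  have ft: "(LINT x|lborel. f (of_real x) * unity_exp (- of_int m * of_real x))
     = theta_sign od / of_real r * (unity_exp (of_real (of_int m * b)) * theta_kernel od (of_real (of_int m / r)))" for m :: int
  proof -
    have "(LINT x|lborel. f (of_real x) * unity_exp (- of_int m * of_real x)) =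
       \<bar>1 / r\<bar> *\<^sub>R (LINT y|lborel. f (of_real (- b + 1 / r * y)) * unity_exp (- of_int m * of_real (- b + 1 / r * y)))"
      using r by (intro lborel_integral_real_affine) auto
    also have "(\<lambda>y. f (of_real (- b + 1 / r * y)) * unity_exp (- of_int m * of_real (- b + 1 / r * y))) =
       (\<lambda>y. unity_exp (of_real (of_int m * b)) * (theta_kernel od (of_real y) * unity_exp (- of_real (of_int m / r) * of_real y)))"
    proof
      fix y :: real
      have "- of_int m * of_real (- b + 1 / r * y) = of_real (of_int m * b) + - of_real (of_int m / r) * complex_of_real y"
        by (simp add: algebra_simps)
      moreover have "complex_of_real r * (of_real (- b + 1 / r * y) + of_real b) = of_real y" using r by simp
      ultimately show "f (of_real (- b + 1 / r * y)) * unity_exp (- of_int m * of_real (- b + 1 / r * y)) =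
         unity_exp (of_real (of_int m * b)) * (theta_kernel od (of_real y) * unity_exp (- of_real (of_int m / r) * of_real y))"
        unfolding f_def by (simp only: unity_exp_add mult_ac)
    qed
    finally show ?thesis
      using r by (simp only: integral_mult_right_zero theta_kernel_fourier) (simp add: scaleR_conv_of_real)
  qed
  obtain C where C: "C > 0" "\<And>z. \<bar>Im z\<bar> \<le> 0 \<Longrightarrow> norm (theta_kernel od z) \<le> C / (1 + (Re z)\<^sup>2) ^ 1"
    using theta_kernel_decay by blast
  have ub: "norm (unity_exp (of_real (of_int m * b)) * theta_kernel od (of_real (of_int m / r))) \<le> (C * max 1 (r\<^sup>2)) / (1 + (of_int m)\<^sup>2)" for m :: int
  proof -
    have "1 + (real_of_int m)\<^sup>2 \<le> max 1 (r\<^sup>2) * (1 + (of_int m / r)\<^sup>2)"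
    proof -
      have "(real_of_int m)\<^sup>2 = r\<^sup>2 * (of_int m / r)\<^sup>2" using r by (simp add: power_divide)
      also have "\<dots> \<le> max 1 (r\<^sup>2) * (of_int m / r)\<^sup>2" by (intro mult_right_mono) auto
      finally show ?thesis by (simp add: ring_distribs add_mono)
    qed
    then have "1 / (1 + (of_int m / r)\<^sup>2) \<le> max 1 (r\<^sup>2) / (1 + (of_int m)\<^sup>2)"
      by (simp add: divide_simps add_pos_nonneg not_less) (smt (verit) zero_le_power2)
    then have "C * (1 / (1 + (of_int m / r)\<^sup>2)) \<le> C * (max 1 (r\<^sup>2) / (1 + (of_int m)\<^sup>2))"
      using C(1) by (intro mult_left_mono) auto
    moreover have "norm (unity_exp (of_real (of_int m * b)) * theta_kernel od (of_real (of_int m / r))) \<le> C * (1 / (1 + (of_int m / r)\<^sup>2))"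
      using C(2)[of "of_real (of_int m / r)"] by (simp add: norm_mult del: of_real_mult of_real_divide)
    ultimately show ?thesis by simp
  qed
  show summ: "(\<lambda>m::int. norm (unity_exp (of_real (of_int m * b)) * theta_kernel od (of_real (of_int m / r)))) summable_on UNIV"
    by (rule summable_on_comparison_test[OF summable_on_int_inverse_square[of "C * max 1 (r\<^sup>2)"]]) (use ub in auto)
  define K where "K = theta_sign od / of_real r"
  define R where "R = (\<lambda>m::int. unity_exp (of_real (of_int m * b)) * theta_kernel od (of_real (of_int m / r)))"
  \<comment> \<open>The dual series converges absolutely, so its unordered sum agrees with the limit
    of symmetric partial sums that Poisson summation provides.\<close>
  have "(R has_sum infsum R UNIV) UNIV"
    using abs_summable_summable[OF summ] unfolding R_def by (rule has_sum_infsum)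
  then have "((\<lambda>m. K * R m) has_sum (K * infsum R UNIV)) UNIV" by (rule has_sum_cmult_right)
  then have "(\<lambda>N::nat. \<Sum>m\<in>{- int N..int N}. K * R m) \<longlonglongrightarrow> K * infsum R UNIV"
    unfolding has_sum_def using filterlim_symmetric_int_intervals filterlim_compose by blast
  moreover have "(\<lambda>N::nat. \<Sum>m\<in>{- int N..int N}. K * R m) \<longlonglongrightarrow> (\<Sum>\<^sub>\<infinity>k::int. f (of_int k))"
    using poisson_summation(2)[OF hol decay] unfolding ft K_def R_def .
  ultimately have "(\<Sum>\<^sub>\<infinity>k::int. f (of_int k)) = K * infsum R UNIV" by (rule LIMSEQ_unique[rotated])
  then show "(\<Sum>\<^sub>\<infinity>k::int. theta_kernel od (of_real (r * (of_int k + b))))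
      = theta_sign od / of_real r * (\<Sum>\<^sub>\<infinity>m::int. unity_exp (of_real (of_int m * b)) * theta_kernel od (of_real (of_int m / r)))"
    by (simp add: f_def K_def R_def)
qed

text \<open>The sum runs over all integers. If \<open>od\<close> does not match the parity of chi,
  the terms for \<open>n\<close> and \<open>- n\<close> cancel; the functional equation below makes
  no distinction.\<close>

definition char_theta :: "(int \<Rightarrow> complex) \<Rightarrow> bool \<Rightarrow> real \<Rightarrow> complex" where
  "char_theta chi od r = (\<Sum>\<^sub>\<infinity>n::int. chi n * theta_kernel od (of_real (r * of_int n)))"

lemma char_theta_summable:
  assumes dc: "dirichlet_character q chi" and r: "r > 0"
  shows "(\<lambda>n::int. norm (chi n * theta_kernel od (of_real (r * of_int n)))) summable_on UNIV"
proof (rule summable_on_comparison_test)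
  show "(\<lambda>n::int. norm (theta_kernel od (of_real (r * of_int n)))) summable_on UNIV"
    using poisson_theta_kernel(1)[OF r, of od 0] by simp
  show "norm (chi n * theta_kernel od (of_real (r * of_int n))) \<le> norm (theta_kernel od (of_real (r * of_int n)))" for n
    using norm_char_le[OF dc, of n] by (simp add: norm_mult mult_left_le_one_le)
qed auto

text \<open>The integers are split into residue classes modulo \<open>q\<close>, and Poisson
  summation is applied to each class. On the dual side the values \<open>chi b\<close> combine to a
  Gauss sum at frequency \<open>m\<close>, which \<open>gauss_sum_separable\<close> turns into a
  constant times the conjugate character.\<close>

theorem char_theta_functional_equation:
  assumes prim: "primitive_dirichlet_character q chi" and r: "r > 0"
  shows "char_theta chi od r = theta_sign od * gauss_sum q chi 1 / of_real (r * real q)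
           * char_theta (\<lambda>n. cnj (chi n)) od (1 / (r * real q))"
proof -
  have dc: "dirichlet_character q chi" using prim by (simp add: primitive_dirichlet_character_def)
  note q = char_modulus_pos[OF dc]
  have rq: "r * real q > 0" using r q by simp
  define h where "h = (\<lambda>n::int. chi n * theta_kernel od (of_real (r * of_int n)))"
  have bij: "bij_betw (\<lambda>(b, k). k * int q + b) ({0..<int q} \<times> UNIV) UNIV"
    by (rule bij_betwI[where g = "\<lambda>n. (n mod int q, n div int q)"]) (use q in auto)
  have hs: "h summable_on UNIV"
    using abs_summable_summable[OF char_theta_summable[OF dc r]] by (simp add: h_def)
  have "char_theta chi od r = infsum h UNIV" by (simp add: char_theta_def h_def)
  also have "\<dots> = (\<Sum>\<^sub>\<infinity>(b, k)\<in>{0..<int q} \<times> UNIV. h (k * int q + b))"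
    using infsum_reindex_bij_betw[OF bij, of h] by (simp add: case_prod_unfold)
  also have "\<dots> = (\<Sum>\<^sub>\<infinity>b\<in>{0..<int q}. \<Sum>\<^sub>\<infinity>k. h (k * int q + b))"
  proof (rule infsum_Sigma'_banach[symmetric])
    show "(\<lambda>(b, k). h (k * int q + b)) summable_on {0..<int q} \<times> UNIV"
      using summable_on_reindex_bij_betw[OF bij, of h] hs by (simp add: case_prod_unfold)
  qed
  also have "\<dots> = (\<Sum>b\<in>{0..<int q}. \<Sum>\<^sub>\<infinity>k. h (k * int q + b))" by simp
  also have "\<dots> = (\<Sum>b\<in>{0..<int q}. chi b * (theta_sign od / of_real (r * real q) *
       (\<Sum>\<^sub>\<infinity>m. unity_exp (of_real (of_int m * (of_int b / real q))) * theta_kernel od (of_real (of_int m / (r * real q))))))"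
  proof (intro sum.cong refl)
    fix b
    have "h (k * int q + b) = chi b * theta_kernel od (of_real (r * real q * (of_int k + of_int b / real q)))" for k
    proof -
      have "chi (k * int q + b) = chi b" using char_add_mult[OF dc, of b k] by (simp add: add.commute)
      moreover have "r * of_int (k * int q + b) = r * real q * (of_int k + of_int b / real q)"
        using q by (simp add: field_simps)
      ultimately show ?thesis by (simp only: h_def)
    qed
    then have "(\<Sum>\<^sub>\<infinity>k. h (k * int q + b)) = chi b * (\<Sum>\<^sub>\<infinity>k. theta_kernel od (of_real (r * real q * (of_int k + of_int b / real q))))"
      by (simp only: infsum_cmult_right')
    then show "(\<Sum>\<^sub>\<infinity>k. h (k * int q + b)) = chi b * (theta_sign od / of_real (r * real q) *
       (\<Sum>\<^sub>\<infinity>m. unity_exp (of_real (of_int m * (of_int b / real q))) * theta_kernel od (of_real (of_int m / (r * real q)))))"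
      by (simp only: poisson_theta_kernel(3)[OF rq])
  qed
  also have "\<dots> = theta_sign od / of_real (r * real q) * (\<Sum>b\<in>{0..<int q}. \<Sum>\<^sub>\<infinity>m. chi b * (unity_exp (of_real (of_int m * (of_int b / real q))) * theta_kernel od (of_real (of_int m / (r * real q)))))"
    by (simp only: infsum_cmult_right' sum_distrib_left mult_ac)
  also have "(\<Sum>b\<in>{0..<int q}. \<Sum>\<^sub>\<infinity>m. chi b * (unity_exp (of_real (of_int m * (of_int b / real q))) * theta_kernel od (of_real (of_int m / (r * real q)))))
     = (\<Sum>\<^sub>\<infinity>m. \<Sum>b\<in>{0..<int q}. chi b * (unity_exp (of_real (of_int m * (of_int b / real q))) * theta_kernel od (of_real (of_int m / (r * real q)))))"
    by (rule infsum_finite_sum[symmetric], simp, rule summable_on_cmult_right, rule abs_summable_summable[OF poisson_theta_kernel(2)[OF rq]])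
  also have "(\<lambda>m::int. \<Sum>b\<in>{0..<int q}. chi b * (unity_exp (of_real (of_int m * (of_int b / real q))) * theta_kernel od (of_real (of_int m / (r * real q)))))
     = (\<lambda>m. gauss_sum q chi 1 * (cnj (chi m) * theta_kernel od (of_real (1 / (r * real q) * of_int m))))"
  proof
    fix m :: int
    have "(\<Sum>b\<in>{0..<int q}. chi b * (unity_exp (of_real (of_int m * (of_int b / real q))) * theta_kernel od (of_real (of_int m / (r * real q)))))
      = gauss_sum q chi m * theta_kernel od (of_real (of_int m / (r * real q)))"
      unfolding gauss_sum_def sum_distrib_right by (intro sum.cong) (auto simp: mult_ac)
    then show "(\<Sum>b\<in>{0..<int q}. chi b * (unity_exp (of_real (of_int m * (of_int b / real q))) * theta_kernel od (of_real (of_int m / (r * real q)))))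
     = gauss_sum q chi 1 * (cnj (chi m) * theta_kernel od (of_real (1 / (r * real q) * of_int m)))"
      by (simp add: gauss_sum_separable[OF prim, of m] mult_ac)
  qed
  finally show ?thesis
    by (simp only: infsum_cmult_right' char_theta_def mult.assoc times_divide_eq_left times_divide_eq_right)
qed

section \<open>Mellin transforms as two-sided Laplace transforms\<close>

lemma absolutely_integrable_imp_lborel:
  fixes f :: "real \<Rightarrow> complex"
  assumes "f absolutely_integrable_on UNIV" "continuous_on UNIV f"
  shows "has_bochner_integral lborel f (integral UNIV f)"
proof -
  have m: "f \<in> borel_measurable lborel" using assms(2) by (simp add: borel_measurable_continuous_onI)
  have "integrable lebesgue f" using assms(1) by (simp add: set_integrable_def)
  then have "integrable lborel f" using integrable_completion[OF m] by simp
  then show ?thesis using integral_lborel[of f] by (simp add: has_bochner_integral_iff)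
qed

text \<open>Euler's integral after the substitution \<open>t = exp u\<close>, in the form of a
  two-sided Laplace transform over the whole line.\<close>

lemma Gamma_lborel:
  assumes z: "Re z > 0"
  shows "has_bochner_integral lborel (\<lambda>u. exp (of_real u * z) * of_real (exp (- exp u))) (Gamma z)"
proof -
  define f where "f = (\<lambda>t. complex_of_real t powr (z - 1) / of_real (exp t))"
  have r: "range exp = {0::real<..}"
  proof -
    have "x \<in> range exp" if "x > 0" for x :: real using exp_ln[OF that] by (metis rangeI)
    then show ?thesis by auto
  qed
  have "f absolutely_integrable_on (range exp) \<and> integral (range exp) f = Gamma z"
    unfolding r f_def using absolutely_integrable_Gamma_integral'[OF z] integral_unique[OF Gamma_integral_complex'[OF z]] by simp
  then have 1: "(\<lambda>u. \<bar>exp u\<bar> *\<^sub>R f (exp u)) absolutely_integrable_on UNIV \<and> integral UNIV (\<lambda>u. \<bar>exp u\<bar> *\<^sub>R f (exp u)) = Gamma z"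
    by (subst has_absolute_integral_change_of_variables_real) (auto intro!: derivative_eq_intros inj_onI)
  have eq: "\<bar>exp u\<bar> *\<^sub>R f (exp u) = exp (of_real u * z) * of_real (exp (- exp u))" for u :: real
  proof -
    have "complex_of_real (exp u) powr (z - 1) = exp ((z - 1) * of_real u)"
      by (simp add: powr_def Ln_of_real)
    moreover have "of_real (exp u) * exp ((z - 1) * of_real u) = exp (of_real u * z)"
      by (simp add: exp_of_real[symmetric] exp_add[symmetric] algebra_simps)
    ultimately show ?thesis by (simp add: f_def scaleR_conv_of_real exp_minus divide_inverse mult.assoc[symmetric])
  qed
  have c: "continuous_on UNIV (\<lambda>u. exp (of_real u * z) * of_real (exp (- exp u)))" by (intro continuous_intros)
  show ?thesis using absolutely_integrable_imp_lborel[OF _ c] 1 unfolding eq by simp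
qed

lemma gaussian_mellin:
  assumes z: "Re z > 0"
  shows "has_bochner_integral lborel (\<lambda>w. exp (of_real (2 * w) * z) * of_real (exp (- pi * exp (2 * w))))
            (of_real pi powr (- z) * Gamma z / 2)"
proof -
  define F where "F = (\<lambda>u::real. exp (of_real u * z) * complex_of_real (exp (- exp u)))"
  have F: "integrable lborel F" "integral\<^sup>L lborel F = Gamma z"
    using Gamma_lborel[OF z] by (auto simp: F_def has_bochner_integral_iff)
  \<comment> \<open>The substitution \<open>u = ln pi + 2 w\<close> absorbs both the factor
    \<open>pi\<close> and the square in the Gaussian.\<close>
  have eq: "F (ln pi + 2 * w) = of_real pi powr z * (exp (of_real (2 * w) * z) * of_real (exp (- pi * exp (2 * w))))" for w
    by (simp add: F_def exp_add powr_def Ln_of_real algebra_simps)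
  have "integrable lborel (\<lambda>w. F (ln pi + 2 * w))" using lborel_integrable_real_affine[OF F(1), of 2 "ln pi"] by simp
  then have i: "integrable lborel (\<lambda>w. of_real pi powr (- z) * F (ln pi + 2 * w))" by (rule integrable_mult_right)
  have "Gamma z = \<bar>2::real\<bar> *\<^sub>R (LINT w|lborel. F (ln pi + 2 * w))"
    using lborel_integral_real_affine[of 2 F "ln pi"] F by simp
  then have v: "(LINT w|lborel. of_real pi powr (- z) * F (ln pi + 2 * w)) = of_real pi powr (- z) * Gamma z / 2"
    by (simp add: scaleR_conv_of_real)
  have "of_real pi powr (- z) * F (ln pi + 2 * w) = exp (of_real (2 * w) * z) * of_real (exp (- pi * exp (2 * w)))" for w
    unfolding eq by (simp add: powr_minus)
  then show ?thesis using i v by (simp only: has_bochner_integral_iff)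
qed

text \<open>The archimedean factor of the completed function. In the even case
  \<open>Gamma (s/2 + 1)\<close> has absorbed a factor \<open>s/2\<close>, and the formula is
  Riemann's \<open>s (s - 1) pi^(-s/2) Gamma (s/2)\<close> up to the constant
  \<open>1/8\<close>.\<close>

definition kernel_mellin :: "bool \<Rightarrow> complex \<Rightarrow> complex" where
  "kernel_mellin od s = (if od then of_real pi powr (- ((s + 1) / 2)) * Gamma ((s + 1) / 2) / 2
     else of_real pi powr (- (s / 2)) * Gamma (s / 2 + 1) * (s - 1) / 4)"

lemma theta_kernel_mellin:
  assumes s: "Re s > 0"
  shows "has_bochner_integral lborel (\<lambda>w. theta_kernel od (of_real (exp w)) * exp (of_real w * s)) (kernel_mellin od s)"
proof -
  have ker: "exp (- of_real pi * (complex_of_real (exp w))\<^sup>2) = of_real (exp (- pi * exp (2 * w)))" for w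
    by (simp add: exp_of_real[symmetric] exp_double)
  show ?thesis
  proof (cases od)
    case True
    have "theta_kernel od (of_real (exp w)) * exp (of_real w * s)
        = exp (of_real (2 * w) * ((s + 1) / 2)) * of_real (exp (- pi * exp (2 * w)))" for w
    proof -
      have "of_real (exp w) * exp (of_real w * s) = exp (of_real w + of_real w * s)"
        by (simp only: exp_add exp_of_real)
      also have "of_real w + of_real w * s = of_real (2 * w) * ((s + 1) / 2)" by (simp add: field_simps)
      finally have "of_real (exp w) * exp (of_real w * s) = exp (of_real (2 * w) * ((s + 1) / 2))" .
      then show ?thesis unfolding theta_kernel_def ker using True by (simp add: mult_ac)
    qed
    then show ?thesis
      using gaussian_mellin[of "(s + 1) / 2"] s True by (simp add: kernel_mellin_def)
  next
    case False
    have e4: "complex_of_real (exp w) ^ 4 * exp (of_real w * s) = exp (of_real (2 * w) * (s / 2 + 2))"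
      and e2: "(complex_of_real (exp w))\<^sup>2 * exp (of_real w * s) = exp (of_real (2 * w) * (s / 2 + 1))" for w
      by (simp_all add: exp_of_real[symmetric] exp_of_nat_mult[symmetric] exp_add[symmetric] algebra_simps)
    have eq: "theta_kernel od (of_real (exp w)) * exp (of_real w * s)
        = of_real (pi\<^sup>2) * (exp (of_real (2 * w) * (s / 2 + 2)) * of_real (exp (- pi * exp (2 * w))))
         - of_real (3 / 2 * pi) * (exp (of_real (2 * w) * (s / 2 + 1)) * of_real (exp (- pi * exp (2 * w))))" for w
      unfolding theta_kernel_def ker e4[symmetric] e2[symmetric] using False
      by (simp only: if_False) (simp only: left_diff_distrib right_diff_distrib mult_ac)
    have "has_bochner_integral lborel (\<lambda>w. theta_kernel od (of_real (exp w)) * exp (of_real w * s))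
      (of_real (pi\<^sup>2) * (of_real pi powr (- (s / 2 + 2)) * Gamma (s / 2 + 2) / 2)
        - of_real (3 / 2 * pi) * (of_real pi powr (- (s / 2 + 1)) * Gamma (s / 2 + 1) / 2))"
      unfolding eq using s
      by (intro has_bochner_integral_diff has_bochner_integral_mult_right gaussian_mellin) auto
    also have "of_real (pi\<^sup>2) * (of_real pi powr (- (s / 2 + 2)) * Gamma (s / 2 + 2) / 2)
        - of_real (3 / 2 * pi) * (of_real pi powr (- (s / 2 + 1)) * Gamma (s / 2 + 1) / 2) = kernel_mellin od s"
    proof -
      have "s / 2 + 1 \<notin> \<int>\<^sub>\<le>\<^sub>0" using s by (auto elim!: nonpos_Ints_cases simp: complex_eq_iff)
      \<comment> \<open>This produces the factor \<open>s - 1\<close>: after cancelling the powers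
        of \<open>pi\<close>, the two terms combine to
        \<open>(s/2 + 1) - 3/2 = (s - 1)/2\<close>.\<close>
      then have G: "Gamma (s / 2 + 2) = (s / 2 + 1) * Gamma (s / 2 + 1)"
        using Gamma_plus1[of "s / 2 + 1"] by (simp add: add.assoc)
      have p1: "of_real pi powr (- (s / 2 + 1)) = of_real pi powr (- (s / 2)) / complex_of_real pi"
      proof -
        have "- (s / 2 + 1) = - (s / 2) - 1" by simp
        then show ?thesis by (simp only: powr_diff) simp
      qed
      have p2: "of_real pi powr (- (s / 2 + 2)) = of_real pi powr (- (s / 2)) / (complex_of_real pi)\<^sup>2"
      proof -
        have "- (s / 2 + 2) = - (s / 2) - 2" by simp
        then show ?thesis by (simp only: powr_diff) (simp add: powr_numeral)
      qed
      show ?thesis unfolding G p1 p2 kernel_mellin_def using False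
        by (simp add: field_simps power2_eq_square)
    qed
    finally show ?thesis .
  qed
qed

section \<open>The completed L-function\<close>

lemma theta_kernel_0 [simp]: "theta_kernel od 0 = 0"
  by (simp add: theta_kernel_def)

lemma theta_kernel_uminus: "theta_kernel od (- z) = (if od then - theta_kernel od z else theta_kernel od z)"
  by (simp add: theta_kernel_def)

text \<open>For matching parity the terms \<open>n\<close> and \<open>- n\<close> agree, and the
  term \<open>0\<close> vanishes with the kernel.\<close>

lemma char_theta_sums:
  assumes dc: "dirichlet_character q chi" and r: "r > 0" and par: "chi (-1) = (if od then -1 else 1)"
  shows "(\<lambda>n. chi (int (Suc n)) * theta_kernel od (of_real (r * real (Suc n)))) sums (char_theta chi od r / 2)"
    and "summable (\<lambda>n. norm (chi (int (Suc n)) * theta_kernel od (of_real (r * real (Suc n)))))"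
proof -
  define h where "h = (\<lambda>n::int. chi n * theta_kernel od (of_real (r * of_int n)))"
  have abs: "(\<lambda>n. norm (h n)) summable_on A" for A
    using char_theta_summable[OF dc r, of od] summable_on_subset_banach[of _ UNIV A] by (auto simp: h_def)
  have hs: "h summable_on A" for A using abs_summable_summable[OF abs] .
  have h_neg: "h (- n) = h n" for n
    using char_uminus[OF dc, of n] par by (auto simp: h_def theta_kernel_uminus)
  have un: "UNIV - {0} = {0<..} \<union> {..<0::int}" by auto
  have "char_theta chi od r = infsum h UNIV" by (simp add: char_theta_def h_def)
  also have "\<dots> = infsum h (UNIV - {0})" by (rule infsum_cong_neutral) (auto simp: h_def)
  also have "\<dots> = infsum h {0<..} + infsum h {..<0}"
    unfolding un by (rule infsum_Un_disjoint[OF hs hs]) auto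
  also have "infsum h {..<0} = infsum (\<lambda>n. h (- n)) {0<..}"
    by (rule infsum_reindex_bij_betw[symmetric]) (rule bij_betwI[where g = uminus], auto)
  finally have 1: "char_theta chi od r = 2 * infsum h {0<..}" by (simp add: h_neg)
  have bij: "bij_betw (\<lambda>n. int (Suc n)) UNIV {0<..}"
    by (rule bij_betwI[where g = "\<lambda>n. nat n - 1"]) auto
  have "(h has_sum infsum h {0<..}) {0<..}" using hs by (rule has_sum_infsum)
  then have "((\<lambda>n. h (int (Suc n))) has_sum infsum h {0<..}) UNIV"
    using has_sum_reindex_bij_betw[OF bij, of h] by simp
  then have "(\<lambda>n. h (int (Suc n))) sums infsum h {0<..}" by (rule has_sum_imp_sums)
  then show "(\<lambda>n. chi (int (Suc n)) * theta_kernel od (of_real (r * real (Suc n)))) sums (char_theta chi od r / 2)"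
    using 1 by (simp add: h_def)
  have "((\<lambda>n. norm (h n)) has_sum infsum (\<lambda>n. norm (h n)) {0<..}) {0<..}" using abs by (rule has_sum_infsum)
  then have "((\<lambda>n. norm (h (int (Suc n)))) has_sum infsum (\<lambda>n. norm (h n)) {0<..}) UNIV"
    using has_sum_reindex_bij_betw[OF bij, of "\<lambda>n. norm (h n)"] by simp
  then have "(\<lambda>n. norm (h (int (Suc n)))) sums infsum (\<lambda>n. norm (h n)) {0<..}" by (rule has_sum_imp_sums)
  then show "summable (\<lambda>n. norm (chi (int (Suc n)) * theta_kernel od (of_real (r * real (Suc n)))))"
    by (simp add: sums_iff h_def)
qed

text \<open>The term \<open>n = 0\<close> vanishes, so no constant survives and the sum decays like
  any power of \<open>r\<close>. Each remaining term carries the factor \<open>n^(-2 N)\<close>, at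
  most \<open>n^(-2)\<close>, which makes the sum over \<open>n\<close> converge.\<close>

lemma char_theta_bound:
  assumes dc: "dirichlet_character q chi" and N: "N \<ge> 1"
  shows "\<exists>K>0. \<forall>r>0. norm (char_theta chi od r) \<le> K / r ^ (2 * N)"
proof -
  obtain C where C: "C > 0" "\<And>z. \<bar>Im z\<bar> \<le> 0 \<Longrightarrow> norm (theta_kernel od z) \<le> C / (1 + (Re z)\<^sup>2) ^ N"
    using theta_kernel_decay by blast
  define S where "S = (\<Sum>\<^sub>\<infinity>n::int. 2 / (1 + (real_of_int n)\<^sup>2))"
  have S: "S \<ge> 0" unfolding S_def by (rule infsum_nonneg) auto
  have "norm (char_theta chi od r) \<le> (C * S + 1) / r ^ (2 * N)" if r: "r > 0" for r
  proof -
    have summand: "norm (chi n * theta_kernel od (of_real (r * of_int n))) \<le> C / r ^ (2 * N) * (2 / (1 + (real_of_int n)\<^sup>2))" for n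
    proof (cases "n = 0")
      case True
      then show ?thesis using C(1) r by simp
    next
      case False
      then have n1: "1 \<le> (real_of_int n)\<^sup>2" using one_le_power[of "\<bar>real_of_int n\<bar>" 2] by simp
      have "norm (chi n * theta_kernel od (of_real (r * of_int n))) \<le> 1 * norm (theta_kernel od (of_real (r * of_int n)))"
        unfolding norm_mult using norm_char_le[OF dc] by (intro mult_right_mono) auto
      also have "\<dots> \<le> C / (1 + (r * of_int n)\<^sup>2) ^ N" using C(2)[of "of_real (r * of_int n)"] by simp
      also have "\<dots> \<le> C / ((r * of_int n)\<^sup>2) ^ N"
      proof -
        have p: "(r * of_int n)\<^sup>2 > 0" using r False by simp
        then have p1: "1 + (r * of_int n)\<^sup>2 > 0" by (rule add_pos_pos[OF zero_less_one])
        show ?thesis using C(1) by (intro divide_left_mono power_mono mult_pos_pos[OF zero_less_power[OF p1] zero_less_power[OF p]]) auto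
      qed
      also have "((r * of_int n)\<^sup>2) ^ N = r ^ (2 * N) * ((real_of_int n)\<^sup>2) ^ N"
        by (simp add: power_mult_distrib power_mult)
      also have "C / (r ^ (2 * N) * ((real_of_int n)\<^sup>2) ^ N) \<le> C / (r ^ (2 * N) * ((1 + (real_of_int n)\<^sup>2) / 2))"
      proof -
        have "(1 + (real_of_int n)\<^sup>2) / 2 \<le> (real_of_int n)\<^sup>2" using n1 by simp
        also have "\<dots> \<le> ((real_of_int n)\<^sup>2) ^ N" using n1 N by (intro self_le_power) auto
        finally have "r ^ (2 * N) * ((1 + (real_of_int n)\<^sup>2) / 2) \<le> r ^ (2 * N) * ((real_of_int n)\<^sup>2) ^ N"
          using r by (intro mult_left_mono) auto
        moreover have "0 < r ^ (2 * N) * ((1 + (real_of_int n)\<^sup>2) / 2)" using r by (intro mult_pos_pos) (auto simp: add_pos_nonneg)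
        ultimately show ?thesis using C(1) by (intro divide_left_mono) (auto intro: mult_pos_pos order.strict_trans2)
      qed
      finally show ?thesis by simp
    qed
    have "norm (char_theta chi od r) \<le> (\<Sum>\<^sub>\<infinity>n::int. C / r ^ (2 * N) * (2 / (1 + (real_of_int n)\<^sup>2)))"
      unfolding char_theta_def
    proof (rule norm_infsum_le)
      show "((\<lambda>n::int. chi n * theta_kernel od (of_real (r * of_int n))) has_sum
        (\<Sum>\<^sub>\<infinity>n::int. chi n * theta_kernel od (of_real (r * of_int n)))) UNIV"
        by (rule has_sum_infsum, rule abs_summable_summable, rule char_theta_summable[OF dc r])
      show "((\<lambda>n::int. C / r ^ (2 * N) * (2 / (1 + (real_of_int n)\<^sup>2))) has_sum
         (\<Sum>\<^sub>\<infinity>n::int. C / r ^ (2 * N) * (2 / (1 + (real_of_int n)\<^sup>2)))) UNIV"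
        by (rule has_sum_infsum, rule summable_on_cmult_right, rule summable_on_int_inverse_square)
    qed (use summand in auto)
    also have "\<dots> = C / r ^ (2 * N) * S" unfolding S_def by (rule infsum_cmult_right')
    also have "\<dots> \<le> (C * S + 1) / r ^ (2 * N)" using r by (simp add: divide_right_mono)
    finally show ?thesis .
  qed
  moreover have "C * S + 1 > 0" using C(1) S by (simp add: add_nonneg_pos)
  ultimately show ?thesis by blast
qed

lemma char_theta_measurable:
  assumes dc: "dirichlet_character q chi" and c: "c > 0"
  shows "(\<lambda>v. char_theta chi od (exp v * c)) \<in> borel_measurable lborel"
proof (rule borel_measurable_LIMSEQ_metric)
  show "(\<lambda>v. \<Sum>n\<in>{- int N..int N}. chi n * theta_kernel od (of_real (exp v * c * of_int n))) \<in> borel_measurable lborel" for N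
  proof -
    have "continuous_on UNIV (\<lambda>v. \<Sum>n\<in>{- int N..int N}. chi n * theta_kernel od (of_real (exp v * c * of_int n)))"
      by (intro continuous_intros continuous_on_compose2[OF holomorphic_on_imp_continuous_on[OF holomorphic_theta_kernel]]) auto
    then show ?thesis by (simp add: borel_measurable_continuous_onI)
  qed
  show "(\<lambda>N. \<Sum>n\<in>{- int N..int N}. chi n * theta_kernel od (of_real (exp v * c * of_int n))) \<longlonglongrightarrow> char_theta chi od (exp v * c)" for v
  proof -
    have "exp v * c > 0" using c by simp
    then have "((\<lambda>n::int. chi n * theta_kernel od (of_real (exp v * c * of_int n))) has_sum char_theta chi od (exp v * c)) UNIV"
      unfolding char_theta_def by (intro has_sum_infsum, intro abs_summable_summable[OF char_theta_summable[OF dc]])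
    then show ?thesis unfolding has_sum_def using filterlim_symmetric_int_intervals filterlim_compose by blast
  qed
qed

text \<open>In the variable \<open>r = exp v / sqrt q\<close> the functional equation of the theta
  function becomes the reflection \<open>v -> - v\<close>, and the integral is a two-sided Laplace
  transform.\<close>

definition completed_L :: "nat \<Rightarrow> (int \<Rightarrow> complex) \<Rightarrow> bool \<Rightarrow> complex \<Rightarrow> complex" where
  "completed_L q chi od s = (LINT v|lborel. char_theta chi od (exp v / sqrt (real q)) * exp (of_real v * s))"

lemma char_theta_reflect:
  assumes prim: "primitive_dirichlet_character q chi"
  shows "char_theta chi od (exp v / sqrt (real q)) =
    theta_sign od * gauss_sum q chi 1 / of_real (sqrt (real q)) * of_real (exp (- v)) * char_theta (\<lambda>n. cnj (chi n)) od (exp (- v) / sqrt (real q))"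
proof -
  have q: "q > 0" using prim by (auto simp: primitive_dirichlet_character_def dirichlet_character_def)
  have sq: "sqrt (real q) * sqrt (real q) = real q" by simp
  have 1: "exp v / sqrt (real q) * real q = sqrt (real q) * exp v"
    using q by (subst sq[symmetric]) (simp add: field_simps)
  have 2: "1 / (sqrt (real q) * exp v) = exp (- v) / sqrt (real q)" by (simp add: exp_minus field_simps)
  have "exp v / sqrt (real q) > 0" using q by simp
  from char_theta_functional_equation[OF prim this, of od]
  show ?thesis unfolding 1 2 by (simp add: exp_minus field_simps)
qed

text \<open>For \<open>v >= 0\<close> this is \<open>char_theta_bound\<close> with a large exponent.
  For \<open>v < 0\<close> the reflection formula carries the bound over from the conjugate
  character at the price of a factor \<open>exp (- v)\<close>; hence the exponent
  \<open>2 N - 1\<close>.\<close>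

lemma char_theta_exp_decay:
  assumes prim: "primitive_dirichlet_character q chi"
  shows "\<exists>K>0. \<forall>v. norm (char_theta chi od (exp v / sqrt (real q))) \<le> K * exp (- A * \<bar>v\<bar>)"
proof -
  have dc: "dirichlet_character q chi" using prim by (simp add: primitive_dirichlet_character_def)
  have q: "q > 0" using char_modulus_pos[OF dc] .
  obtain N0 where N0: "A \<le> real N0" using real_arch_simple by blast
  define N where "N = N0 + 1"
  have N: "N \<ge> 1" "A \<le> 2 * real N - 1" "A \<le> 2 * real N" using N0 by (auto simp: N_def)
  obtain K1 where K1: "K1 > 0" "\<And>r. r > 0 \<Longrightarrow> norm (char_theta chi od r) \<le> K1 / r ^ (2 * N)"
    using char_theta_bound[OF dc N(1)] by blast
  obtain K2 where K2: "K2 > 0" "\<And>r. r > 0 \<Longrightarrow> norm (char_theta (\<lambda>n. cnj (chi n)) od r) \<le> K2 / r ^ (2 * N)"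
    using char_theta_bound[OF cnj_dirichlet_character[OF dc] N(1)] by blast
  define c where "c = norm (theta_sign od * gauss_sum q chi 1 / of_real (sqrt (real q)))"
  define K where "K = (K1 + c * K2) * real q ^ N"
  have c0: "c \<ge> 0" by (simp add: c_def)
  have pw: "D / (exp v / sqrt (real q)) ^ (2 * N) = D * real q ^ N * exp (- (2 * real N) * v)" for D v
    by (simp add: power_divide power_mult exp_of_nat_mult[symmetric] exp_minus divide_simps)
  have "norm (char_theta chi od (exp v / sqrt (real q))) \<le> K * exp (- A * \<bar>v\<bar>)" for v
  proof (cases "v \<ge> 0")
    case True
    have "norm (char_theta chi od (exp v / sqrt (real q))) \<le> K1 * real q ^ N * exp (- (2 * real N) * v)"
      using K1(2)[of "exp v / sqrt (real q)"] q unfolding pw by simp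
    also have "\<dots> \<le> K * exp (- A * \<bar>v\<bar>)"
      unfolding K_def using True N K1 K2 c0 by (intro mult_mono) (auto simp: mult_right_mono intro!: add_nonneg_nonneg mult_nonneg_nonneg)
    finally show ?thesis .
  next
    case False
    have "norm (char_theta chi od (exp v / sqrt (real q))) = c * exp (- v) * norm (char_theta (\<lambda>n. cnj (chi n)) od (exp (- v) / sqrt (real q)))"
      unfolding char_theta_reflect[OF prim, of od v] by (simp only: norm_mult c_def norm_of_real) simp
    also have "\<dots> \<le> c * exp (- v) * (K2 * real q ^ N * exp (- (2 * real N) * (- v)))"
      using K2(2)[of "exp (- v) / sqrt (real q)"] q c0 unfolding pw by (intro mult_left_mono) auto
    also have "\<dots> = c * K2 * real q ^ N * exp ((2 * real N - 1) * v)"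
      by (simp add: exp_add[symmetric] algebra_simps exp_diff exp_minus field_simps)
    also have "\<dots> \<le> K * exp (- A * \<bar>v\<bar>)"
    proof (unfold K_def, intro mult_mono)
      have "(2 * real N - 1) * v \<le> A * v" using False N by (intro mult_right_mono_neg) auto
      then show "exp ((2 * real N - 1) * v) \<le> exp (- A * \<bar>v\<bar>)" using False by simp
    qed (use K1 K2 c0 in auto)
    finally show ?thesis .
  qed
  moreover have "K > 0" unfolding K_def using K1 K2 c0 q by (intro mult_pos_pos add_pos_nonneg mult_nonneg_nonneg zero_less_power) auto
  ultimately show ?thesis by blast
qed

lemma exp_neg_abs_le: "exp (- \<bar>v\<bar>) \<le> 2 / (1 + (v::real)\<^sup>2)"
proof -
  have "1 + \<bar>v\<bar> + \<bar>v\<bar>\<^sup>2 / 2 \<le> exp \<bar>v\<bar>" by (rule exp_lower_Taylor_quadratic) simp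
  then have "(1 + v\<^sup>2) / 2 \<le> exp \<bar>v\<bar>" by simp
  then show ?thesis by (simp add: exp_minus divide_simps add_pos_nonneg mult.commute)
qed

lemma holomorphic_completed_L:
  assumes prim: "primitive_dirichlet_character q chi"
  shows "completed_L q chi od holomorphic_on UNIV"
  unfolding completed_L_def[abs_def]
proof (rule holomorphic_on_lebesgue_integral(1))
  have dc: "dirichlet_character q chi" using prim by (simp add: primitive_dirichlet_character_def)
  have q: "q > 0" using char_modulus_pos[OF dc] .
  show "(\<lambda>v. char_theta chi od (exp v / sqrt (real q)) * exp (of_real v * s)) \<in> borel_measurable lborel" for s
  proof -
    have "(\<lambda>v. char_theta chi od (exp v / sqrt (real q))) \<in> borel_measurable lborel"
      using char_theta_measurable[OF dc, of "1 / sqrt (real q)" od] q by simp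
    moreover have "(\<lambda>v. exp (complex_of_real v * s)) \<in> borel_measurable lborel" by (simp add: borel_measurable_continuous_onI continuous_intros)
    ultimately show ?thesis by (rule borel_measurable_times)
  qed
  show "\<exists>r>0. \<exists>g. ball s r \<subseteq> UNIV \<and> integrable lborel g \<and>
       (\<forall>z\<in>ball s r. \<forall>v\<in>space lborel. norm (char_theta chi od (exp v / sqrt (real q)) * exp (of_real v * z)) \<le> g v)" for s
  proof -
    \<comment> \<open>On the unit ball around \<open>s\<close> the exponential grows at most with
      rate \<open>|Re s| + 1\<close>; the extra unit of decay leaves the majorant
      \<open>exp (- |v|)\<close>.\<close>
    obtain K where K: "K > 0" "\<And>v. norm (char_theta chi od (exp v / sqrt (real q))) \<le> K * exp (- (\<bar>Re s\<bar> + 2) * \<bar>v\<bar>)"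
      using char_theta_exp_decay[OF prim] by blast
    have "norm (char_theta chi od (exp v / sqrt (real q)) * exp (of_real v * z)) \<le> 2 * K / (1 + (0 + v)\<^sup>2)" if "z \<in> ball s 1" for z v
    proof -
      have "\<bar>Re z\<bar> \<le> \<bar>Re s\<bar> + 1" using that abs_Re_le_cmod[of "z - s"] by (simp add: dist_norm norm_minus_commute)
      then have "v * Re z \<le> (\<bar>Re s\<bar> + 1) * \<bar>v\<bar>"
        using abs_ge_self[of "v * Re z"] mult_right_mono[of "\<bar>Re z\<bar>" "\<bar>Re s\<bar> + 1" "\<bar>v\<bar>"] by (simp add: abs_mult mult.commute)
      then have "norm (exp (of_real v * z)) \<le> exp ((\<bar>Re s\<bar> + 1) * \<bar>v\<bar>)" by simp
      then have "norm (char_theta chi od (exp v / sqrt (real q)) * exp (of_real v * z)) \<le> K * exp (- (\<bar>Re s\<bar> + 2) * \<bar>v\<bar>) * exp ((\<bar>Re s\<bar> + 1) * \<bar>v\<bar>)"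
        unfolding norm_mult using K by (intro mult_mono) auto
      also have "\<dots> = K * exp (- \<bar>v\<bar>)" by (simp add: mult.assoc exp_add[symmetric] algebra_simps)
      also have "\<dots> \<le> K * (2 / (1 + v\<^sup>2))" using K(1) exp_neg_abs_le by (intro mult_left_mono) auto
      finally show ?thesis by (simp add: mult.commute)
    qed
    then show ?thesis
      by (intro exI[of _ 1] conjI exI[of _ "\<lambda>v. 2 * K / (1 + (0 + v)\<^sup>2)"] inverse_1_plus_shifted_square_integrable) auto
  qed
qed (intro holomorphic_intros)

theorem completed_L_functional_equation:
  assumes prim: "primitive_dirichlet_character q chi"
  shows "completed_L q chi od s = theta_sign od * gauss_sum q chi 1 / of_real (sqrt (real q)) * completed_L q (\<lambda>n. cnj (chi n)) od (1 - s)"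
proof -
  have "completed_L q chi od s = \<bar>-1::real\<bar> *\<^sub>R (LINT v|lborel. char_theta chi od (exp (0 + -1 * v) / sqrt (real q)) * exp (of_real (0 + -1 * v) * s))"
    unfolding completed_L_def by (rule lborel_integral_real_affine) simp
  also have "\<dots> = (LINT v|lborel. theta_sign od * gauss_sum q chi 1 / of_real (sqrt (real q)) *
      (char_theta (\<lambda>n. cnj (chi n)) od (exp v / sqrt (real q)) * exp (of_real v * (1 - s))))"
  proof -
    have "char_theta chi od (exp (0 + -1 * v) / sqrt (real q)) * exp (of_real (0 + -1 * v) * s) =
       theta_sign od * gauss_sum q chi 1 / of_real (sqrt (real q)) *
      (char_theta (\<lambda>n. cnj (chi n)) od (exp v / sqrt (real q)) * exp (of_real v * (1 - s)))" for v
    proof -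
      have "of_real (exp v) * exp (- (of_real v * s)) = exp (of_real v * (1 - s))"
        by (simp add: exp_of_real[symmetric] exp_add[symmetric] algebra_simps)
      then show ?thesis using char_theta_reflect[OF prim, of od "- v"] by (simp add: mult_ac)
    qed
    then show ?thesis by simp
  qed
  also have "\<dots> = theta_sign od * gauss_sum q chi 1 / of_real (sqrt (real q)) * completed_L q (\<lambda>n. cnj (chi n)) od (1 - s)"
    unfolding completed_L_def by (rule integral_mult_right_zero)
  finally show ?thesis .
qed

section \<open>The completed function in terms of the Dirichlet series\<close>

definition dirichlet_series :: "(nat \<Rightarrow> complex) \<Rightarrow> complex \<Rightarrow> complex" where
  "dirichlet_series a s = (\<Sum>n. a (Suc n) * of_nat (Suc n) powr (- s))"

lemma norm_nat_powr: "norm (of_nat (Suc n) powr s :: complex) = real (Suc n) powr (Re s)"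
  by (subst norm_powr_real_powr) simp_all

lemma dirichlet_series_abs_summable:
  assumes a: "\<And>n. norm (a n) \<le> 1" and s: "Re s > 1"
  shows "summable (\<lambda>n. norm (a (Suc n) * of_nat (Suc n) powr (- s)))"
proof (rule summable_comparison_test')
  show "summable (\<lambda>n. real (Suc n) powr (- Re s))"
    using s by (subst summable_Suc_iff) (simp add: summable_real_powr_iff)
  show "norm (norm (a (Suc n) * of_nat (Suc n) powr (- s))) \<le> real (Suc n) powr (- Re s)" if "n \<ge> 0" for n
    using mult_right_mono[OF a[of "Suc n"], of "real (Suc n) powr (- Re s)"]
    by (simp add: norm_mult norm_nat_powr del: of_nat_Suc)
qed

text \<open>Integrating term by term, the \<open>n\<close>-th term is the kernel translated by
  \<open>b n = ln ((n + 1) / sqrt q)\<close>, which yields \<open>q^(s/2) (n + 1)^(- s)\<close>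
  times the common transform \<open>kernel_mellin\<close>. The factor \<open>2\<close> comes from
  summing over both signs.\<close>

theorem completed_L_eq:
  assumes dc: "dirichlet_character q chi" and par: "chi (-1) = (if od then -1 else 1)" and s: "Re s > 1"
  shows "completed_L q chi od s = 2 * of_nat q powr (s / 2) * kernel_mellin od s * dirichlet_series (\<lambda>n. chi (int n)) s"
proof -
  have q: "q > 0" using char_modulus_pos[OF dc] .
  define G where "G = (\<lambda>w. theta_kernel od (of_real (exp w)) * exp (of_real w * s))"
  have G: "has_bochner_integral lborel G (kernel_mellin od s)"
    unfolding G_def using s by (intro theta_kernel_mellin) auto
  then have Gi: "integrable lborel G" and Gv: "integral\<^sup>L lborel G = kernel_mellin od s" by (auto simp: has_bochner_integral_iff)
  define b where "b = (\<lambda>n. ln (real (Suc n) / sqrt (real q)))"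
  have eb: "exp (b n) = real (Suc n) / sqrt (real q)" for n using q by (simp add: b_def)
  have ebs: "exp (- (of_real (b n) * s)) = of_nat q powr (s / 2) * of_nat (Suc n) powr (- s)" for n
  proof -
    have "b n = ln (real (Suc n)) - ln (real q) / 2" using q by (simp add: b_def ln_div ln_sqrt del: of_nat_Suc)
    then have bc: "complex_of_real (b n) = of_real (ln (real (Suc n))) - of_real (ln (real q)) / 2"
      by (simp only: of_real_diff of_real_divide of_real_numeral)
    have "- (of_real (b n) * s) = of_real (ln (real q)) * (s / 2) + - of_real (ln (real (Suc n))) * s"
      by (simp only: bc) (simp add: field_simps del: of_nat_Suc)
    then have "exp (- (of_real (b n) * s)) = exp (of_real (ln (real q)) * (s / 2)) * exp (- of_real (ln (real (Suc n))) * s)"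
      by (simp only: exp_add)
    then show ?thesis using q by (simp add: powr_def Ln_of_nat mult.commute del: of_nat_Suc)
  qed
  define f where "f = (\<lambda>n v. chi (int (Suc n)) * theta_kernel od (of_real (exp v / sqrt (real q) * real (Suc n))) * exp (of_real v * s))"
  have fG: "f n v = chi (int (Suc n)) * exp (- (of_real (b n) * s)) * G (b n + 1 * v)" for n v
  proof -
    have "exp (b n + 1 * v) = exp v / sqrt (real q) * real (Suc n)" by (simp add: exp_add eb)
    moreover have "exp (of_real v * s) = exp (- (of_real (b n) * s)) * exp (of_real (b n + 1 * v) * s)"
      by (simp add: exp_add[symmetric] algebra_simps)
    ultimately show ?thesis by (simp add: f_def G_def)
  qed
  have Gt: "integrable lborel (\<lambda>v. G (b n + 1 * v))" for n by (rule lborel_integrable_real_affine[OF Gi]) simp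
  have Gtv: "(LINT v|lborel. G (b n + 1 * v)) = kernel_mellin od s" for n
    using lborel_integral_real_affine[of 1 G "b n"] Gv by simp
  have Gtn: "(LINT v|lborel. norm (G (b n + 1 * v))) = (LINT v|lborel. norm (G v))" for n
    using lborel_integral_real_affine[of 1 "\<lambda>v. norm (G v)" "b n"] by simp
  have fi: "integrable lborel (f n)" for n
    unfolding fG[abs_def] by (intro integrable_mult_right Gt)
  have fv: "integral\<^sup>L lborel (f n) = of_nat q powr (s / 2) * kernel_mellin od s * (chi (int (Suc n)) * of_nat (Suc n) powr (- s))" for n
    unfolding fG[abs_def] ebs integral_mult_right_zero Gtv by (simp add: mult_ac)
  have fn: "(LINT v|lborel. norm (f n v)) = norm (of_nat q powr (s / 2)) * (LINT v|lborel. norm (G v)) * norm (chi (int (Suc n)) * of_nat (Suc n) powr (- s))" for n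
    unfolding fG norm_mult integral_mult_right_zero Gtn ebs by (simp add: mult_ac)
  have dsum: "summable (\<lambda>n. norm (chi (int (Suc n)) * of_nat (Suc n) powr (- s)))"
    by (rule dirichlet_series_abs_summable[of "\<lambda>n. chi (int n)"]) (use norm_char_le[OF dc] s in auto)
  have pos: "exp v / sqrt (real q) > 0" for v using q by simp
  have sm: "summable (\<lambda>n. norm (f n v))" for v
    unfolding f_def norm_mult[of _ "exp (of_real v * s)"]
    by (intro summable_mult2 char_theta_sums(2)[OF dc pos par])
  have sums: "(\<lambda>n. integral\<^sup>L lborel (f n)) sums (LINT v|lborel. (\<Sum>n. f n v))"
  proof (rule sums_integral)
    show "summable (\<lambda>n. LINT v|lborel. norm (f n v))" unfolding fn by (intro summable_mult dsum)
  qed (use fi sm in auto)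
  have "(\<Sum>n. f n v) = char_theta chi od (exp v / sqrt (real q)) * exp (of_real v * s) / 2" for v
    using sums_mult2[OF char_theta_sums(1)[OF dc pos par], of v "exp (of_real v * s)"]
    by (simp add: f_def sums_iff)
  then have "(\<lambda>n. integral\<^sup>L lborel (f n)) sums (completed_L q chi od s / 2)"
    using sums by (simp only: completed_L_def integral_divide_zero)
  moreover have "(\<lambda>n. integral\<^sup>L lborel (f n)) sums (of_nat q powr (s / 2) * kernel_mellin od s * dirichlet_series (\<lambda>n. chi (int n)) s)"
    unfolding fv dirichlet_series_def by (intro sums_mult summable_sums summable_norm_cancel[OF dsum])
  ultimately have "completed_L q chi od s / 2 = of_nat q powr (s / 2) * kernel_mellin od s * dirichlet_series (\<lambda>n. chi (int n)) s"
    by (rule sums_unique2)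
  then show ?thesis by simp
qed

section \<open>Continuation to the right half-plane by partial summation\<close>

lemma primitive_char_modulus_1:
  assumes "dirichlet_character 1 chi"
  shows "chi n = 1"
  using char_add_mult[OF assms, of 1 "n - 1"] char_1[OF assms] by simp

text \<open>By periodicity every block of \<open>q\<close> consecutive values has the sum of a full
  period, which is \<open>0\<close>; removing such blocks leaves fewer than \<open>q\<close> terms
  of modulus at most \<open>1\<close>.\<close>

lemma char_partial_sum_bound:
  assumes prim: "primitive_dirichlet_character q chi" and q1: "q \<noteq> 1"
  shows "norm (\<Sum>i<N. chi (int i + 1)) \<le> real q"
proof -
  have dc: "dirichlet_character q chi" using prim by (simp add: primitive_dirichlet_character_def)
  have q: "q > 0" using char_modulus_pos[OF dc] .
  define P where "P = (\<lambda>a::nat. \<Sum>i<q. chi (int (a + i)))"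
  have step: "P (Suc a) = P a" for a
  proof -
    have "P (Suc a) + chi (int a) = (\<Sum>i<Suc q. chi (int (a + i)))"
      unfolding P_def sum.lessThan_Suc_shift by simp
    also have "\<dots> = P a + chi (int a)"
      using char_periodic[OF dc, of "int a"] by (simp add: P_def)
    finally show ?thesis by simp
  qed
  have P0: "P a = 0" for a
  proof (induction a)
    case 0
    have "P 0 = (\<Sum>b\<in>{0..<int q}. chi b)"
      unfolding P_def by (rule sum.reindex_bij_witness[of _ nat int]) auto
    then show ?case using primitive_sum_period[OF prim q1] by simp
  qed (simp add: step)
  show ?thesis
  proof (induction N rule: less_induct)
    case (less N)
    show ?case
    proof (cases "N < q")
      case True
      have "norm (\<Sum>i<N. chi (int i + 1)) \<le> (\<Sum>i<N. 1)"
        by (rule order_trans[OF norm_sum]) (intro sum_mono norm_char_le[OF dc])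
      then show ?thesis using True by simp
    next
      case False
      define M where "M = N - q"
      have N: "N = M + q" "M < N" using False q by (auto simp: M_def)
      have "(\<Sum>i<N. chi (int i + 1)) = (\<Sum>i<M. chi (int i + 1)) + (\<Sum>i<q. chi (int (M + i) + 1))"
      proof -
        have "(\<Sum>i<M + r. chi (int i + 1)) = (\<Sum>i<M. chi (int i + 1)) + (\<Sum>i<r. chi (int (M + i) + 1))" for r
          by (induction r) (simp_all add: add.assoc)
        then show ?thesis unfolding N(1) .
      qed
      also have "(\<Sum>i<q. chi (int (M + i) + 1)) = P (Suc M)" by (simp add: P_def algebra_simps)
      finally show ?thesis using less[OF N(2)] P0 by simp
    qed
  qed
qed

lemma exp_halfline_integral:
  assumes s: "Re s > 0"
  shows "has_bochner_integral lborel (\<lambda>u. indicator {c<..} u *\<^sub>R exp (- (of_real u * s))) (exp (- (of_real c * s)) / s)"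
proof -
  have s0: "s \<noteq> 0" using s by auto
  have int0: "set_integrable lborel {0<..} (\<lambda>u. exp (- (of_real u * s)))"
    unfolding set_integrable_def
  proof (rule Bochner_Integration.integrable_bound)
    show "integrable lborel (\<lambda>u. indicator {0<..} u *\<^sub>R exp (- (u * Re s)))"
      using integrable_I0i_exp_mscale[OF s] by (simp add: set_integrable_def)
    show "(\<lambda>u. indicator {0<..} u *\<^sub>R exp (- (of_real u * s))) \<in> borel_measurable lborel"
      by (intro borel_measurable_scaleR borel_measurable_indicator) (auto simp: borel_measurable_continuous_onI continuous_intros)
  qed (auto simp: indicator_def)
  have "(LBINT u=0..\<infinity>. exp (- (of_real u * s))) = 0 - (- (1 / s))"
  proof (rule interval_integral_FTC_integrable)
    show "((\<lambda>u. - exp (- (of_real u * s)) / s) has_vector_derivative exp (- (of_real u * s))) (at u)" for u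
    proof -
      have "((\<lambda>z. - exp (- (z * s)) / s) has_field_derivative exp (- (of_real u * s))) (at (of_real u))"
        using s0 by (auto intro!: derivative_eq_intros)
      from has_vector_derivative_real_field[OF this, of UNIV] show ?thesis by simp
    qed
    show "isCont (\<lambda>u. exp (- (of_real u * s))) u" for u by (intro continuous_intros)
    show "set_integrable lborel (einterval 0 \<infinity>) (\<lambda>u. exp (- (of_real u * s)))"
      using int0 by (simp add: zero_ereal_def)
    have "((\<lambda>u. - exp (- (of_real u * s)) / s) \<longlongrightarrow> - exp (- (of_real 0 * s)) / s) (at_right 0)"
      using s0 by (intro tendsto_intros)
    then show "(((\<lambda>u. - exp (- (of_real u * s)) / s) \<circ> real_of_ereal) \<longlongrightarrow> - (1 / s)) (at_right 0)"
      unfolding zero_ereal_def by (simp add: ereal_tendsto_simps1)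
    have "((\<lambda>u. - exp (- (of_real u * s)) / s) \<longlongrightarrow> 0) at_top"
    proof (rule Lim_null_comparison)
      have "((\<lambda>u. exp (- (u * Re s)) / norm s) \<longlongrightarrow> 0 / norm s) at_top"
      proof (intro tendsto_divide tendsto_const)
        show "((\<lambda>u. exp (- (u * Re s))) \<longlongrightarrow> 0) at_top" using s by real_asymp
      qed (use s0 in auto)
      then show "((\<lambda>u. exp (- (u * Re s)) / norm s) \<longlongrightarrow> 0) at_top" by simp
    qed (auto simp: norm_divide)
    then show "(((\<lambda>u. - exp (- (of_real u * s)) / s) \<circ> real_of_ereal) \<longlongrightarrow> 0) (at_left \<infinity>)"
      by (simp add: ereal_tendsto_simps1)
  qed simp
  then have v0: "(LINT u|lborel. indicator {0<..} u *\<^sub>R exp (- (of_real u * s))) = 1 / s"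
    by (simp add: interval_lebesgue_integral_0_infty set_lebesgue_integral_def)
  define g where "g = (\<lambda>u::real. indicator {0<..} u *\<^sub>R exp (- (of_real u * s)))"
  have gi: "integrable lborel g" "integral\<^sup>L lborel g = 1 / s" using int0 v0 by (auto simp: g_def set_integrable_def)
  have eq: "exp (- (of_real c * s)) * g (- c + 1 * u) = indicator {c<..} u *\<^sub>R exp (- (of_real u * s))" for u
    by (auto simp: g_def indicator_def exp_add[symmetric] algebra_simps)
  have "integrable lborel (\<lambda>u. exp (- (of_real c * s)) * g (- c + 1 * u))"
    by (intro integrable_mult_right lborel_integrable_real_affine gi) simp
  moreover have "(LINT u|lborel. exp (- (of_real c * s)) * g (- c + 1 * u)) = exp (- (of_real c * s)) * (1 / s)"
    using lborel_integral_real_affine[of 1 g "- c"] gi(2) by (subst integral_mult_right_zero) simp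
  ultimately show ?thesis unfolding eq by (simp add: has_bochner_integral_iff)
qed

definition pole_order :: "nat \<Rightarrow> nat" where "pole_order q = (if q = 1 then 1 else 0)"

text \<open>The counting variable is \<open>u = ln x\<close>. For \<open>q = 1\<close> the partial
  sums grow like \<open>exp u\<close>, and this main term is subtracted; for other primitive
  characters they are bounded already.\<close>

definition summatory_error :: "nat \<Rightarrow> (int \<Rightarrow> complex) \<Rightarrow> real \<Rightarrow> complex" where
  "summatory_error q chi u = indicator {0<..} u *\<^sub>R
     ((\<Sum>n. indicator {ln (real (Suc n))<..} u *\<^sub>R chi (int (Suc n))) - of_nat (pole_order q) * of_real (exp u))"

text \<open>The rays are open to match \<open>exp_halfline_integral\<close>, so the positive
  integers strictly below \<open>exp u\<close> are counted; there are
  \<open>ceiling (exp u) - 1\<close> of them.\<close>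

lemma summatory_eq:
  assumes u: "u > 0"
  shows "(\<Sum>n. indicator {ln (real (Suc n))<..} u *\<^sub>R f n) = (\<Sum>n<nat \<lceil>exp u\<rceil> - 1. f n :: complex)"
    and "summable (\<lambda>n. norm (indicator {ln (real (Suc n))<..} u *\<^sub>R f n))"
proof -
  have iff: "ln (real (Suc n)) < u \<longleftrightarrow> n < nat \<lceil>exp u\<rceil> - 1" for n
  proof -
    have "ln (real (Suc n)) < u \<longleftrightarrow> real (Suc n) < exp u" by (metis exp_less_cancel_iff exp_ln of_nat_0_less_iff zero_less_Suc)
    also have "\<dots> \<longleftrightarrow> int (Suc n) < \<lceil>exp u\<rceil>" by (simp only: less_ceiling_iff of_int_of_nat_eq)
    also have "\<dots> \<longleftrightarrow> n < nat \<lceil>exp u\<rceil> - 1" by linarith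
    finally show ?thesis .
  qed
  show "(\<Sum>n. indicator {ln (real (Suc n))<..} u *\<^sub>R f n) = (\<Sum>n<nat \<lceil>exp u\<rceil> - 1. f n)"
    by (subst suminf_finite[of "{..<nat \<lceil>exp u\<rceil> - 1}"]) (auto simp: iff indicator_def simp del: of_nat_Suc)
  show "summable (\<lambda>n. norm (indicator {ln (real (Suc n))<..} u *\<^sub>R f n))"
    by (rule summable_finite[of "{..<nat \<lceil>exp u\<rceil> - 1}"]) (auto simp: iff indicator_def simp del: of_nat_Suc)
qed

lemma summatory_error_bound:
  assumes prim: "primitive_dirichlet_character q chi"
  shows "norm (summatory_error q chi u) \<le> (real q + 1) * indicator {0<..} u"
proof (cases "u > 0")
  case True
  define N where "N = nat \<lceil>exp u\<rceil> - 1"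
  have eq: "summatory_error q chi u = (\<Sum>n<N. chi (int n + 1)) - of_nat (pole_order q) * of_real (exp u)"
  proof -
    have "summatory_error q chi u = (\<Sum>n<N. chi (int (Suc n))) - of_nat (pole_order q) * of_real (exp u)"
      using True summatory_eq(1)[OF True, of "\<lambda>n. chi (int (Suc n))"] by (simp add: summatory_error_def N_def del: of_nat_Suc)
    then show ?thesis by (simp add: add.commute)
  qed
  show ?thesis
  proof (cases "q = 1")
    case q1: True
    have dc: "dirichlet_character 1 chi" using prim q1 by (simp add: primitive_dirichlet_character_def)
    have "exp u > 1" using True by simp
    then have "real N \<le> exp u" "exp u \<le> real N + 1" unfolding N_def by linarith+
    then have "\<bar>real N - exp u\<bar> \<le> 2" by simp
    moreover have "summatory_error q chi u = of_real (real N - exp u)"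
      unfolding eq using primitive_char_modulus_1[OF dc] q1 by (simp add: pole_order_def)
    ultimately show ?thesis using True q1 by (simp only: norm_of_real) simp
  next
    case False
    then show ?thesis using char_partial_sum_bound[OF prim False, of N] True unfolding eq by (simp add: pole_order_def)
  qed
qed (simp add: summatory_error_def)

lemma summatory_error_measurable: "summatory_error q chi \<in> borel_measurable lborel"
  unfolding summatory_error_def[abs_def]
  by (intro borel_measurable_scaleR borel_measurable_indicator borel_measurable_diff borel_measurable_suminf)
     (auto intro!: borel_measurable_scaleR borel_measurable_indicator simp: borel_measurable_continuous_onI continuous_intros)

definition error_transform :: "nat \<Rightarrow> (int \<Rightarrow> complex) \<Rightarrow> complex \<Rightarrow> complex" where
  "error_transform q chi s = (LINT u|lborel. summatory_error q chi u * exp (- (of_real u * s)))"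

lemma error_transform_integrand_bound:
  assumes prim: "primitive_dirichlet_character q chi" and "d \<le> Re z"
  shows "norm (summatory_error q chi u * exp (- (of_real u * z))) \<le> (real q + 1) * (indicator {0<..} u *\<^sub>R exp (- (u * d)))"
proof (cases "u > 0")
  case True
  have "norm (summatory_error q chi u * exp (- (of_real u * z))) \<le> (real q + 1) * exp (- (u * d))"
    unfolding norm_mult using summatory_error_bound[OF prim, of u] True assms(2) by (intro mult_mono) auto
  then show ?thesis using True by simp
qed (simp add: summatory_error_def)

lemma holomorphic_error_transform:
  assumes prim: "primitive_dirichlet_character q chi"
  shows "error_transform q chi holomorphic_on {s. Re s > 0}"
    and "\<And>s. Re s > 0 \<Longrightarrow> integrable lborel (\<lambda>u. summatory_error q chi u * exp (- (of_real u * s)))"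
proof -
  have 1: "(\<lambda>s. summatory_error q chi u * exp (- (of_real u * s))) holomorphic_on {s. Re s > 0}" for u
    by (intro holomorphic_intros)
  have 2: "(\<lambda>u. summatory_error q chi u * exp (- (of_real u * s))) \<in> borel_measurable lborel" for s
    by (intro borel_measurable_times summatory_error_measurable) (simp add: borel_measurable_continuous_onI continuous_intros)
  have 3: "\<exists>r>0. \<exists>g. ball s r \<subseteq> {s. Re s > 0} \<and> integrable lborel g \<and>
       (\<forall>z\<in>ball s r. \<forall>u\<in>space lborel. norm (summatory_error q chi u * exp (- (of_real u * z))) \<le> g u)" if s: "s \<in> {s. Re s > 0}" for s
  proof (intro exI[of _ "Re s / 2"] conjI exI[of _ "\<lambda>u. (real q + 1) * (indicator {0<..} u *\<^sub>R exp (- (u * (Re s / 2))))"] ballI)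
    have near: "Re s / 2 < Re z" if "z \<in> ball s (Re s / 2)" for z
      using that abs_Re_le_cmod[of "s - z"] by (auto simp: dist_norm)
    show "ball s (Re s / 2) \<subseteq> {s. Re s > 0}" using near s by force
    show "integrable lborel (\<lambda>u. (real q + 1) * (indicator {0<..} u *\<^sub>R exp (- (u * (Re s / 2)))))"
      using integrable_I0i_exp_mscale[of "Re s / 2"] s by (intro integrable_mult_right) (simp add: set_integrable_def)
    show "norm (summatory_error q chi u * exp (- (of_real u * z))) \<le> (real q + 1) * (indicator {0<..} u *\<^sub>R exp (- (u * (Re s / 2))))"
      if "z \<in> ball s (Re s / 2)" for z u
      using near[OF that] by (intro error_transform_integrand_bound[OF prim]) simp
  qed (use s in auto)
  show "error_transform q chi holomorphic_on {s. Re s > 0}"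
    unfolding error_transform_def[abs_def] by (rule holomorphic_on_lebesgue_integral(1)[OF 1 2 3])
  show "\<And>s. Re s > 0 \<Longrightarrow> integrable lborel (\<lambda>u. summatory_error q chi u * exp (- (of_real u * s)))"
    using holomorphic_on_lebesgue_integral(2)[OF 1 2 3] by simp
qed

lemma error_transform_bound:
  assumes prim: "primitive_dirichlet_character q chi" and s: "Re s > 0"
  shows "norm (error_transform q chi s) \<le> (real q + 1) / Re s"
proof -
  have "norm (error_transform q chi s) \<le> (LINT u|lborel. (real q + 1) * (indicator {0<..} u *\<^sub>R exp (- (u * Re s))))"
    unfolding error_transform_def
  proof (rule Bochner_Integration.integral_norm_bound_integral)
    show "integrable lborel (\<lambda>u. (real q + 1) * (indicator {0<..} u *\<^sub>R exp (- (u * Re s))))"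
      using integrable_I0i_exp_mscale[OF s] by (intro integrable_mult_right) (simp add: set_integrable_def)
  qed (use holomorphic_error_transform(2)[OF prim s] error_transform_integrand_bound[OF prim order_refl] in auto)
  also have "\<dots> = (real q + 1) * (1 / Re s)"
    using LBINT_I0i_exp_mscale[OF s]
    by (subst integral_mult_right_zero) (simp add: interval_lebesgue_integral_0_infty set_lebesgue_integral_def)
  finally show ?thesis by simp
qed

text \<open>The power \<open>n^(- s)\<close> is \<open>s\<close> times the integral of
  \<open>exp (- u s)\<close> over \<open>u > ln n\<close>, so the series is \<open>s\<close> times
  the Laplace transform of the summatory function. The main term \<open>exp u\<close> transforms to
  \<open>1 / (s - 1)\<close>, and the bounded rest has a transform that is holomorphic for
  \<open>Re s > 0\<close>.\<close>

theorem dirichlet_series_eq_error_transform: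
  assumes prim: "primitive_dirichlet_character q chi" and s: "Re s > 1"
  shows "dirichlet_series (\<lambda>n. chi (int n)) s = of_nat (pole_order q) * s / (s - 1) + s * error_transform q chi s"
proof -
  have dc: "dirichlet_character q chi" using prim by (simp add: primitive_dirichlet_character_def)
  have s0: "s \<noteq> 0" "Re s > 0" "s \<noteq> 1" using s by auto
  define f where "f = (\<lambda>n u. chi (int (Suc n)) * (indicator {ln (real (Suc n))<..} u *\<^sub>R exp (- (of_real u * s))))"
  have es: "exp (- (of_real (ln (real (Suc n))) * s)) = of_nat (Suc n) powr (- s)" for n
    by (simp add: powr_def Ln_of_nat mult.commute del: of_nat_Suc)
  have f: "has_bochner_integral lborel (f n) (chi (int (Suc n)) * (of_nat (Suc n) powr (- s) / s))" for n
    unfolding f_def es[symmetric] by (intro has_bochner_integral_mult_right exp_halfline_integral s0)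
  have fn: "(LINT u|lborel. norm (f n u)) = norm (chi (int (Suc n)) * of_nat (Suc n) powr (- s)) / Re s" for n
  proof -
    have "complex_of_real (LINT u|lborel. norm (f n u)) = (LINT u|lborel. of_real (norm (chi (int (Suc n)))) * (indicator {ln (real (Suc n))<..} u *\<^sub>R exp (- (of_real u * of_real (Re s)))))"
      unfolding f_def norm_mult norm_scaleR by (subst integral_complex_of_real[symmetric]) (simp add: scaleR_conv_of_real exp_of_real[symmetric])
    also have "\<dots> = of_real (norm (chi (int (Suc n)))) * (exp (- (of_real (ln (real (Suc n))) * of_real (Re s))) / of_real (Re s))"
      using has_bochner_integral_integral_eq[OF exp_halfline_integral[of "of_real (Re s)" "ln (real (Suc n))"]] s0
      by (subst integral_mult_right_zero) simp
    also have "\<dots> = of_real (norm (chi (int (Suc n)) * of_nat (Suc n) powr (- s)) / Re s)"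
    proof -
      have "exp (- (complex_of_real (ln (real (Suc n))) * of_real (Re s))) = of_real (norm (of_nat (Suc n) powr (- s) :: complex))"
        unfolding norm_nat_powr by (simp add: powr_def exp_of_real[symmetric] mult.commute del: of_nat_Suc)
      then show ?thesis by (simp add: norm_mult del: of_nat_Suc)
    qed
    finally show ?thesis by (simp only: of_real_eq_iff)
  qed
  have dsum: "summable (\<lambda>n. norm (chi (int (Suc n)) * of_nat (Suc n) powr (- s)))"
    by (rule dirichlet_series_abs_summable[of "\<lambda>n. chi (int n)"]) (use norm_char_le[OF dc] s in auto)
  have fz: "f n u = 0" if "u \<le> 0" for n u
    using that by (auto simp: f_def indicator_def not_less intro: order_trans[OF that] simp del: of_nat_Suc)
  have fs: "summable (\<lambda>n. norm (f n u))" for u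
  proof (cases "u > 0")
    case True
    have "summable (\<lambda>n. norm (indicator {ln (real (Suc n))<..} u *\<^sub>R (chi (int (Suc n)) * exp (- (of_real u * s)))))"
      by (rule summatory_eq(2)[OF True])
    then show ?thesis by (simp add: f_def del: of_nat_Suc)
  qed (simp add: fz)
  have F: "(LINT u|lborel. (\<Sum>n. f n u)) = (\<Sum>n. integral\<^sup>L lborel (f n))" "integrable lborel (\<lambda>u. (\<Sum>n. f n u))"
  proof -
    have a: "\<And>n. integrable lborel (f n)" using f by (simp add: has_bochner_integral_iff)
    have b: "AE u in lborel. summable (\<lambda>n. norm (f n u))" using fs by simp
    have c: "summable (\<lambda>n. LINT u|lborel. norm (f n u))" unfolding fn by (intro summable_divide dsum)
    show "(LINT u|lborel. (\<Sum>n. f n u)) = (\<Sum>n. integral\<^sup>L lborel (f n))" by (rule integral_suminf[OF a b c])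
    show "integrable lborel (\<lambda>u. (\<Sum>n. f n u))" by (rule integrable_suminf[OF a b c])
  qed
  have "(\<Sum>n. integral\<^sup>L lborel (f n)) = dirichlet_series (\<lambda>n. chi (int n)) s / s"
  proof -
    have "(\<lambda>n. integral\<^sup>L lborel (f n)) = (\<lambda>n. chi (int (Suc n)) * of_nat (Suc n) powr (- s) / s)"
      using f by (auto simp: has_bochner_integral_iff)
    then show ?thesis unfolding dirichlet_series_def using suminf_divide[OF summable_norm_cancel[OF dsum]] by simp
  qed
  note F1 = F(1)[unfolded this]
  have e1: "has_bochner_integral lborel (\<lambda>u. indicator {0<..} u *\<^sub>R exp (- (of_real u * (s - 1)))) (1 / (s - 1))"
    using exp_halfline_integral[of "s - 1" 0] s by simp
  have "summatory_error q chi u * exp (- (of_real u * s)) = (\<Sum>n. f n u) - of_nat (pole_order q) * (indicator {0<..} u *\<^sub>R exp (- (of_real u * (s - 1))))" for u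
  proof (cases "u > 0")
    case True
    have "(\<Sum>n. f n u) = (\<Sum>n. indicator {ln (real (Suc n))<..} u *\<^sub>R chi (int (Suc n))) * exp (- (of_real u * s))"
      using suminf_mult2[OF summable_norm_cancel[OF summatory_eq(2)[OF True, of "\<lambda>n. chi (int (Suc n))"]], of "exp (- (of_real u * s))"]
      by (simp add: f_def scaleR_conv_of_real mult_ac del: of_nat_Suc)
    moreover have "of_real (exp u) * exp (- (of_real u * s)) = exp (- (of_real u * (s - 1)))"
      by (simp add: exp_of_real[symmetric] exp_add[symmetric] algebra_simps)
    ultimately show ?thesis using True by (simp add: summatory_error_def algebra_simps del: of_nat_Suc)
  qed (simp add: summatory_error_def fz)
  note eq = this
  have "has_bochner_integral lborel (\<lambda>u. \<Sum>n. f n u) (dirichlet_series (\<lambda>n. chi (int n)) s / s)"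
    using F(2) F1 by (simp add: has_bochner_integral_iff)
  from has_bochner_integral_diff[OF this has_bochner_integral_mult_right[OF e1, of "of_nat (pole_order q)"]]
  have "error_transform q chi s = dirichlet_series (\<lambda>n. chi (int n)) s / s - of_nat (pole_order q) * (1 / (s - 1))"
    unfolding error_transform_def eq by (rule has_bochner_integral_integral_eq)
  then show ?thesis using s0 by (simp add: field_simps)
qed

section \<open>The L-function of a primitive character\<close>

lemma holomorphic_kernel_mellin: "kernel_mellin od holomorphic_on {s. Re s > 0}"
  unfolding kernel_mellin_def[abs_def]
  by (cases od) (auto intro!: holomorphic_intros elim!: nonpos_Ints_cases simp: complex_eq_iff)

lemma kernel_mellin_nonzero:
  assumes "Re s > 0" "s \<noteq> 1"
  shows "kernel_mellin od s \<noteq> 0"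
proof -
  have "(s + 1) / 2 \<notin> \<int>\<^sub>\<le>\<^sub>0" "s / 2 + 1 \<notin> \<int>\<^sub>\<le>\<^sub>0"
    using assms(1) by (auto elim!: nonpos_Ints_cases simp: complex_eq_iff)
  then show ?thesis using assms(2) by (simp add: kernel_mellin_def Gamma_eq_zero_iff)
qed

lemma entire_eqI:
  assumes "f holomorphic_on UNIV" "g holomorphic_on UNIV" "\<And>s. Re s > 1 \<Longrightarrow> f s = g s"
  shows "f = g"
proof
  fix z
  show "f z = g z"
  proof (rule analytic_continuation_open[of "{s. Re s > 1}" UNIV f g])
    have "2 \<in> {s. Re s > 1}" by simp
    then show "{s. Re s > 1} \<noteq> {}" by blast
  qed (use assms in \<open>auto simp: open_halfspace_Re_gt\<close>)
qed

lemma halfplane_eqI: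
  assumes "f holomorphic_on {s. Re s > 0}" "g holomorphic_on {s. Re s > 0}" "\<And>s. Re s > 1 \<Longrightarrow> f s = g s"
    and "Re z > 0"
  shows "f z = g z"
proof (rule analytic_continuation_open[of "{s. Re s > 1}" "{s. Re s > 0}" f g])
  have "2 \<in> {s. Re s > 1}" by simp
  then show "{s. Re s > 1} \<noteq> {}" by blast
  show "connected {s. 0 < Re s}" by (intro convex_connected convex_halfspace_Re_gt)
qed (use assms in \<open>auto simp: open_halfspace_Re_gt\<close>)

text \<open>The completed function is divided by its gamma factor, that is, multiplied by the entire
  function \<open>rGamma\<close>. In the even case a factor \<open>s - 1\<close> remains: for
  \<open>q = 1\<close> it is the wanted one, otherwise it has to be cancelled. The zero at
  \<open>-2\<close> is recorded here because it can be read off from this formula.\<close>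

theorem regular_L_exists:
  assumes prim: "primitive_dirichlet_character q chi"
  shows "\<exists>E. E holomorphic_on UNIV \<and> (\<forall>s. Re s > 1 \<longrightarrow> E s = (s - 1) ^ pole_order q * dirichlet_series (\<lambda>n. chi (int n)) s)
             \<and> (q = 1 \<longrightarrow> E (-2) = 0)"
proof -
  have dc: "dirichlet_character q chi" using prim by (simp add: primitive_dirichlet_character_def)
  have q: "q > 0" using char_modulus_pos[OF dc] .
  have qp: "of_nat q powr (s / 2) * of_nat q powr (- (s / 2)) = (1 :: complex)" for s
    using q by (simp add: powr_add[symmetric])
  have pp: "of_real pi powr (- s) * of_real pi powr s = (1 :: complex)" for s
    by (simp add: powr_add[symmetric])
  show ?thesis
  proof (cases "chi (-1) = 1")
    case False
    then have par: "chi (-1) = (if True then -1 else 1)" using char_minus_1[OF dc] by auto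
    have "q \<noteq> 1" using primitive_char_modulus_1[of chi "-1"] dc False by auto
    define E where "E = (\<lambda>s. completed_L q chi True s * of_real pi powr ((s + 1) / 2) * of_nat q powr (- (s / 2)) * rGamma ((s + 1) / 2))"
    have "E s = dirichlet_series (\<lambda>n. chi (int n)) s" if s: "Re s > 1" for s
    proof -
      have "(s + 1) / 2 \<notin> \<int>\<^sub>\<le>\<^sub>0" using s by (auto elim!: nonpos_Ints_cases simp: complex_eq_iff)
      then have G: "Gamma ((s + 1) / 2) * rGamma ((s + 1) / 2) = 1" by (simp add: rGamma_inverse_Gamma Gamma_eq_zero_iff)
      have "E s = (of_nat q powr (s / 2) * of_nat q powr (- (s / 2))) * (of_real pi powr (- ((s + 1) / 2)) * of_real pi powr ((s + 1) / 2))
           * (Gamma ((s + 1) / 2) * rGamma ((s + 1) / 2)) * dirichlet_series (\<lambda>n. chi (int n)) s"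
        unfolding E_def completed_L_eq[OF dc par s] kernel_mellin_def by simp
      then show ?thesis unfolding qp pp G by simp
    qed
    moreover have "E holomorphic_on UNIV"
      unfolding E_def using q by (intro holomorphic_intros holomorphic_on_subset[OF holomorphic_completed_L[OF prim]]) auto
    ultimately show ?thesis using \<open>q \<noteq> 1\<close> by (intro exI[of _ E]) (simp add: pole_order_def)
  next
    case True
    then have par: "chi (-1) = (if False then -1 else 1)" by simp
    define M where "M = (\<lambda>s. completed_L q chi False s * 2 * of_real pi powr (s / 2) * of_nat q powr (- (s / 2)) * rGamma (s / 2 + 1))"
    have M: "M s = (s - 1) * dirichlet_series (\<lambda>n. chi (int n)) s" if s: "Re s > 1" for s
    proof -
      have "s / 2 + 1 \<notin> \<int>\<^sub>\<le>\<^sub>0" using s by (auto elim!: nonpos_Ints_cases simp: complex_eq_iff)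
      then have G: "Gamma (s / 2 + 1) * rGamma (s / 2 + 1) = 1" by (simp add: rGamma_inverse_Gamma Gamma_eq_zero_iff)
      have "M s = (of_nat q powr (s / 2) * of_nat q powr (- (s / 2))) * (of_real pi powr (- (s / 2)) * of_real pi powr (s / 2))
           * (Gamma (s / 2 + 1) * rGamma (s / 2 + 1)) * (s - 1) * dirichlet_series (\<lambda>n. chi (int n)) s"
        unfolding M_def completed_L_eq[OF dc par s] kernel_mellin_def by simp
      then show ?thesis unfolding qp pp G by simp
    qed
    have Mh: "M holomorphic_on UNIV"
      unfolding M_def using q by (intro holomorphic_intros holomorphic_on_subset[OF holomorphic_completed_L[OF prim]]) auto
    show ?thesis
    proof (cases "q = 1")
      case True
      \<comment> \<open>At this point the factor \<open>rGamma (s / 2 + 1)\<close> is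
        \<open>rGamma 0 = 0\<close>; this is the first trivial zero of zeta.\<close>
      have "M (-2) = 0" by (simp add: M_def)
      then show ?thesis using M Mh True by (intro exI[of _ M]) (simp add: pole_order_def)
    next
      case False
      \<comment> \<open>Partial summation shows that for \<open>q \<noteq> 1\<close> the Dirichlet
        series stays finite at \<open>1\<close>, so the left-over factor \<open>s - 1\<close> is a
        genuine zero and can be divided out.\<close>
      have "M 1 = 0"
      proof -
        have "M 1 = (\<lambda>s. (s - 1) * (s * error_transform q chi s)) 1"
        proof (rule halfplane_eqI[of M "\<lambda>s. (s - 1) * (s * error_transform q chi s)"])
          show "M s = (s - 1) * (s * error_transform q chi s)" if "Re s > 1" for s
            using M[OF that] dirichlet_series_eq_error_transform[OF prim that] False by (simp add: pole_order_def)
        qed (use Mh in \<open>auto intro!: holomorphic_intros holomorphic_error_transform(1)[OF prim] intro: holomorphic_on_subset\<close>)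
        then show ?thesis by simp
      qed
      then obtain g where g: "g holomorphic_on UNIV" "\<And>z. M z = (z - 1) * g z"
        using entire_factor_zero[OF Mh] by blast
      have "g s = dirichlet_series (\<lambda>n. chi (int n)) s" if "Re s > 1" for s
        using M[OF that] g(2)[of s] that by auto
      then show ?thesis using g(1) False by (intro exI[of _ g]) (simp add: pole_order_def)
    qed
  qed
qed

text \<open>\<open>L(s, \<chi>)\<close>, multiplied by \<open>s - 1\<close> when \<open>q = 1\<close>.\<close>

definition regular_L :: "nat \<Rightarrow> (int \<Rightarrow> complex) \<Rightarrow> complex \<Rightarrow> complex" where
  "regular_L q chi = (SOME E. E holomorphic_on UNIV \<and>
     (\<forall>s. Re s > 1 \<longrightarrow> E s = (s - 1) ^ pole_order q * dirichlet_series (\<lambda>n. chi (int n)) s) \<and> (q = 1 \<longrightarrow> E (-2) = 0))"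

lemma regular_L:
  assumes "primitive_dirichlet_character q chi"
  shows holomorphic_regular_L: "regular_L q chi holomorphic_on A"
    and regular_L_eq: "Re s > 1 \<Longrightarrow> regular_L q chi s = (s - 1) ^ pole_order q * dirichlet_series (\<lambda>n. chi (int n)) s"
    and regular_L_trivial_zero: "q = 1 \<Longrightarrow> regular_L q chi (-2) = 0"
  using someI_ex[OF regular_L_exists[OF assms]] unfolding regular_L_def[symmetric]
  by (auto intro: holomorphic_on_subset)

lemma regular_L_halfplane:
  assumes prim: "primitive_dirichlet_character q chi" and s: "Re s > 0"
  shows "regular_L q chi s = of_nat (pole_order q) * s + (s - 1) ^ pole_order q * s * error_transform q chi s"
proof (rule halfplane_eqI[of "regular_L q chi" "\<lambda>s. of_nat (pole_order q) * s + (s - 1) ^ pole_order q * s * error_transform q chi s"])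
  show "regular_L q chi s = of_nat (pole_order q) * s + (s - 1) ^ pole_order q * s * error_transform q chi s" if "Re s > 1" for s
  proof -
    have "s \<noteq> 1" using that by auto
    then show ?thesis
      unfolding regular_L_eq[OF prim that] dirichlet_series_eq_error_transform[OF prim that]
      by (cases "q = 1") (auto simp: pole_order_def field_simps)
  qed
qed (use s in \<open>auto intro!: holomorphic_intros holomorphic_error_transform(1)[OF prim] holomorphic_regular_L[OF prim]\<close>)

lemma regular_L_at_1: "primitive_dirichlet_character q chi \<Longrightarrow> q = 1 \<Longrightarrow> regular_L q chi 1 = 1"
  using regular_L_halfplane[of q chi 1] by (simp add: pole_order_def)

text \<open>One factor \<open>norm s\<close> comes from the partial summation formula and one from
  \<open>(s - 1) ^ pole_order q\<close>. The bound serves as the upper bound in the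
  Borel-Caratheodory argument.\<close>

lemma regular_L_growth:
  assumes prim: "primitive_dirichlet_character q chi" and s: "Re s \<ge> 1 / 2"
  shows "norm (regular_L q chi s) \<le> (2 * real q + 3) * (1 + norm s)\<^sup>2"
proof -
  have s0: "Re s > 0" using s by simp
  have J: "norm (error_transform q chi s) \<le> 2 * (real q + 1)"
  proof -
    have "norm (error_transform q chi s) \<le> (real q + 1) / Re s" by (rule error_transform_bound[OF prim s0])
    also have "\<dots> \<le> (real q + 1) / (1 / 2)" using s by (intro divide_left_mono) auto
    finally show ?thesis by simp
  qed
  have p: "norm ((s - 1) ^ pole_order q) \<le> 1 + norm s"
    using norm_triangle_ineq4[of s 1] by (simp add: pole_order_def)
  have "norm (regular_L q chi s) \<le> norm s + (1 + norm s) * norm s * (2 * (real q + 1))"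
    unfolding regular_L_halfplane[OF prim s0]
  proof (rule order_trans[OF norm_triangle_ineq add_mono])
    show "norm (of_nat (pole_order q) * s) \<le> norm s" by (simp add: pole_order_def)
    show "norm ((s - 1) ^ pole_order q * s * error_transform q chi s) \<le> (1 + norm s) * norm s * (2 * (real q + 1))"
      unfolding norm_mult using J p by (intro mult_mono) auto
  qed
  also have "\<dots> \<le> 1 * (1 + norm s)\<^sup>2 + (1 + norm s)\<^sup>2 * (2 * (real q + 1))"
    by (intro add_mono mult_right_mono) (auto simp: power2_eq_square algebra_simps)
  finally show ?thesis by (simp add: algebra_simps)
qed

lemma is_dirichlet_L_regular_L:
  assumes prim: "primitive_dirichlet_character q chi"
  shows "is_dirichlet_L chi (\<lambda>s. regular_L q chi s / (s - 1) ^ pole_order q)"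
proof -
  let ?f = "\<lambda>s. regular_L q chi s / (s - 1) ^ pole_order q"
  have hol: "?f holomorphic_on - {1}"
    by (intro holomorphic_intros holomorphic_regular_L[OF prim]) auto
  have lim: "?f \<midarrow>z\<rightarrow> ?f z" if "z \<noteq> 1" for z
  proof -
    have "isCont ?f z"
      using holomorphic_on_imp_continuous_on[OF hol] that
      by (simp add: continuous_on_eq_continuous_at open_Compl)
    then show ?thesis by (simp add: isCont_def)
  qed
  have "?f nicely_meromorphic_on UNIV"
    unfolding nicely_meromorphic_on_def
  proof (intro conjI ballI)
    have "regular_L q chi analytic_on UNIV"
      using holomorphic_regular_L[OF prim, of UNIV] by (simp add: analytic_on_open)
    then show "?f meromorphic_on UNIV"
      by (intro meromorphic_intros analytic_on_imp_meromorphic_on) auto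
    show "is_pole ?f z \<and> ?f z = 0 \<or> ?f \<midarrow>z\<rightarrow> ?f z" for z
    proof (cases "z = 1")
      case True
      have cont: "isCont (regular_L q chi) z" for z
        using holomorphic_on_imp_continuous_on[OF holomorphic_regular_L[OF prim, of UNIV]]
        by (simp add: continuous_on_eq_continuous_at)
      show ?thesis
      proof (cases "q = 1")
        case q1: True
        have "filterlim (\<lambda>s::complex. s - 1) (at 0) (at 1)"
          by (auto simp: filterlim_at eventually_at_filter intro!: tendsto_eq_intros)
        \<comment> \<open>At \<open>1\<close> the quotient is a division by \<open>0\<close>, hence
          has the value \<open>0\<close>, as \<open>nicely_meromorphic_on\<close> demands at a
          pole.\<close>
        then have "is_pole (\<lambda>s. regular_L q chi s / (s - 1)) 1"
          using cont regular_L_at_1[OF prim q1] by (intro is_pole_divide) auto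
        then show ?thesis using q1 True by (simp add: pole_order_def)
      next
        case False
        then show ?thesis using cont[of z] by (simp add: pole_order_def isCont_def)
      qed
    qed (use lim in auto)
  qed
  moreover have "?f s = (\<Sum>n. chi (int (Suc n)) * of_nat (Suc n) powr (- s))" if "Re s > 1" for s
  proof -
    have "s \<noteq> 1" using that by auto
    then show ?thesis using regular_L_eq[OF prim that] by (simp add: dirichlet_series_def)
  qed
  ultimately show ?thesis using hol unfolding is_dirichlet_L_def by blast
qed

lemma dirichlet_L_eq:
  assumes prim: "primitive_dirichlet_character q chi"
  shows "dirichlet_L chi s = regular_L q chi s / (s - 1) ^ pole_order q"
proof -
  have "dirichlet_L chi = (\<lambda>s. regular_L q chi s / (s - 1) ^ pole_order q)"
    unfolding dirichlet_L_def
    using is_dirichlet_L_regular_L[OF prim] is_dirichlet_L_unique by (intro the_equality) auto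
  then show ?thesis by simp
qed

lemma GRH_iff_regular_L:
  assumes prim: "primitive_dirichlet_character q chi"
  shows "GRH chi \<longleftrightarrow> (\<forall>s. 0 < Re s \<and> Re s < 1 \<and> regular_L q chi s = 0 \<longrightarrow> Re s = 1 / 2)"
proof -
  have "dirichlet_L chi s = 0 \<longleftrightarrow> regular_L q chi s = 0" if "Re s < 1" for s
    using that by (auto simp: dirichlet_L_eq[OF prim])
  then show ?thesis by (auto simp: GRH_def nontrivial_zeros_def)
qed

lemma regular_L_cnj:
  assumes prim: "primitive_dirichlet_character q chi"
  shows "regular_L q (\<lambda>n. cnj (chi n)) s = cnj (regular_L q chi (cnj s))"
proof -
  have dc: "dirichlet_character q chi" using prim by (simp add: primitive_dirichlet_character_def)
  note cprim = cnj_primitive_character[OF prim]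
  have "regular_L q (\<lambda>n. cnj (chi n)) = cnj \<circ> regular_L q chi \<circ> cnj"
  proof (rule entire_eqI)
    show "regular_L q (\<lambda>n. cnj (chi n)) holomorphic_on UNIV" by (rule holomorphic_regular_L[OF cprim])
    show "cnj \<circ> regular_L q chi \<circ> cnj holomorphic_on UNIV"
      by (intro holomorphic_on_compose_cnj_cnj holomorphic_regular_L[OF prim]) auto
    fix s :: complex assume s: "Re s > 1"
    have summand: "cnj (chi (int (Suc n)) * of_nat (Suc n) powr (- cnj s)) = cnj (chi (int (Suc n))) * of_nat (Suc n) powr (- s)" for n
      by (simp add: powr_def exp_cnj Ln_of_nat del: of_nat_Suc)
    have "summable (\<lambda>n. norm (chi (int (Suc n)) * of_nat (Suc n) powr (- cnj s)))"
      by (rule dirichlet_series_abs_summable[of "\<lambda>n. chi (int n)"]) (use norm_char_le[OF dc] s in auto)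
    then have "(\<lambda>n. chi (int (Suc n)) * of_nat (Suc n) powr (- cnj s)) sums dirichlet_series (\<lambda>n. chi (int n)) (cnj s)"
      unfolding dirichlet_series_def by (rule summable_sums[OF summable_norm_cancel])
    then have "(\<lambda>n. cnj (chi (int (Suc n)) * of_nat (Suc n) powr (- cnj s))) sums cnj (dirichlet_series (\<lambda>n. chi (int n)) (cnj s))"
      by (simp only: sums_cnj)
    then have "dirichlet_series (\<lambda>n. cnj (chi (int n))) s = cnj (dirichlet_series (\<lambda>n. chi (int n)) (cnj s))"
      unfolding summand dirichlet_series_def by (simp add: sums_iff)
    then show "regular_L q (\<lambda>n. cnj (chi n)) s = (cnj \<circ> regular_L q chi \<circ> cnj) s"
      using s by (simp add: regular_L_eq[OF cprim] regular_L_eq[OF prim])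
  qed
  then show ?thesis by simp
qed

text \<open>The identity continues from \<open>Re s > 1\<close>. In the critical strip all factors
  apart from the two functions are non-zero, so zeros can be transferred between them.\<close>

lemma completed_L_eq_regular_L:
  assumes prim: "primitive_dirichlet_character q chi" and par: "chi (-1) = (if od then -1 else 1)" and s: "Re s > 0"
  shows "completed_L q chi od s * (s - 1) ^ pole_order q = 2 * of_nat q powr (s / 2) * kernel_mellin od s * regular_L q chi s"
proof -
  have dc: "dirichlet_character q chi" using prim by (simp add: primitive_dirichlet_character_def)
  have q: "q > 0" using char_modulus_pos[OF dc] .
  show ?thesis
    by (rule halfplane_eqI[of "\<lambda>s. completed_L q chi od s * (s - 1) ^ pole_order q" "\<lambda>s. 2 * of_nat q powr (s / 2) * kernel_mellin od s * regular_L q chi s"])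
       (use s q in \<open>auto simp: completed_L_eq[OF dc par] regular_L_eq[OF prim]
          intro!: holomorphic_intros holomorphic_regular_L[OF prim] holomorphic_kernel_mellin
            holomorphic_on_subset[OF holomorphic_completed_L[OF prim]]\<close>)
qed

text \<open>The functional equation links \<open>s\<close> with \<open>1 - s\<close> for the
  conjugate character, and conjugation returns to chi at \<open>1 - cnj s\<close>, the mirror image
  of \<open>s\<close> in the critical line.\<close>

theorem regular_L_zero_symmetry:
  assumes prim: "primitive_dirichlet_character q chi" and s: "0 < Re s" "Re s < 1"
    and zero: "regular_L q chi s = 0" and nz: "\<exists>s. regular_L q chi s \<noteq> 0"
  shows "regular_L q chi (1 - cnj s) = 0"
proof -
  have dc: "dirichlet_character q chi" using prim by (simp add: primitive_dirichlet_character_def)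
  have q: "q > 0" using char_modulus_pos[OF dc] .
  note cprim = cnj_primitive_character[OF prim]
  define od where "od = (chi (-1) \<noteq> 1)"
  have par: "chi (-1) = (if od then -1 else 1)" using char_minus_1[OF dc] by (auto simp: od_def)
  have cpar: "cnj (chi (-1)) = (if od then -1 else 1)" using par by auto
  define c where "c = theta_sign od * gauss_sum q chi 1 / of_real (sqrt (real q))"
  have fe: "completed_L q chi od z = c * completed_L q (\<lambda>n. cnj (chi n)) od (1 - z)" for z
    unfolding c_def by (rule completed_L_functional_equation[OF prim])
  \<comment> \<open>The modulus of the Gauss sum is not evaluated: if the constant vanished, the
    completed function and with it \<open>regular_L\<close> would be identically zero.\<close>
  have c0: "c \<noteq> 0"
  proof
    assume "c = 0"
    then have "regular_L q chi z = 0" if "Re z > 1" for z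
    proof -
      have "z \<noteq> 1" using that by auto
      then show ?thesis
        using completed_L_eq_regular_L[OF prim par, of z] fe[of z] kernel_mellin_nonzero[of z od] that q \<open>c = 0\<close> by auto
    qed
    then have "regular_L q chi = (\<lambda>_. 0)" by (intro entire_eqI holomorphic_regular_L[OF prim]) auto
    then show False using nz by simp
  qed
  have "completed_L q chi od s = 0"
    using completed_L_eq_regular_L[OF prim par s(1)] zero s by auto
  then have 0: "completed_L q (\<lambda>n. cnj (chi n)) od (1 - s) = 0" using fe[of s] c0 by simp
  have "kernel_mellin od (1 - s) \<noteq> 0" using s by (intro kernel_mellin_nonzero) auto
  then have "regular_L q (\<lambda>n. cnj (chi n)) (1 - s) = 0"
    using completed_L_eq_regular_L[OF cprim cpar, of "1 - s"] 0 s q by auto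
  then show ?thesis by (simp add: regular_L_cnj[OF prim])
qed

section \<open>Non-vanishing on the line \<open>Re s = 1\<close>\<close>

definition dirichlet_convergent :: "(nat \<Rightarrow> complex) \<Rightarrow> bool" where
  "dirichlet_convergent a \<longleftrightarrow> (\<forall>\<sigma>>1. summable (\<lambda>n. norm (a (Suc n)) * real (Suc n) powr (- \<sigma>)))"

lemma dirichlet_convergent_abs_summable:
  assumes "dirichlet_convergent a" "Re s > 1"
  shows "summable (\<lambda>n. norm (a (Suc n) * of_nat (Suc n) powr (- s)))"
  using assms unfolding dirichlet_convergent_def by (simp add: norm_mult norm_nat_powr del: of_nat_Suc)

lemma dirichlet_convergent_sums:
  assumes "dirichlet_convergent a" "Re s > 1"
  shows "(\<lambda>n. a (Suc n) * of_nat (Suc n) powr (- s)) sums dirichlet_series a s"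
  unfolding dirichlet_series_def
  by (rule summable_sums[OF summable_norm_cancel[OF dirichlet_convergent_abs_summable[OF assms]]])

lemma dirichlet_convergent_bounded:
  assumes "\<And>n. norm (a n) \<le> 1"
  shows "dirichlet_convergent a"
  unfolding dirichlet_convergent_def
proof (intro allI impI)
  fix \<sigma> :: real assume "\<sigma> > 1"
  then have "summable (\<lambda>n. norm (a (Suc n) * of_nat (Suc n) powr (- of_real \<sigma>)))"
    by (intro dirichlet_series_abs_summable[OF assms]) simp
  then show "summable (\<lambda>n. norm (a (Suc n)) * real (Suc n) powr (- \<sigma>))"
    by (simp add: norm_mult norm_nat_powr del: of_nat_Suc)
qed

text \<open>The excess \<open>\<sigma> - 1\<close> is halved: one half pays for
  \<open>ln n <= n^d / d\<close>, the other keeps the series convergent. So the class is closed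
  under termwise differentiation, which bounded coefficients would not be.\<close>

lemma dirichlet_convergent_ln:
  assumes a: "dirichlet_convergent a"
    and b: "\<And>n. n > 0 \<Longrightarrow> norm (b n) \<le> norm (a n) * ln (real n)"
  shows "dirichlet_convergent b"
  unfolding dirichlet_convergent_def
proof (intro allI impI)
  fix \<sigma> :: real assume \<sigma>: "\<sigma> > 1"
  define d where "d = (\<sigma> - 1) / 2"
  have d: "d > 0" "1 + d > 1" "\<sigma> = 1 + d + d" using \<sigma> by (auto simp: d_def)
  have s: "summable (\<lambda>n. norm (a (Suc n)) * real (Suc n) powr (- (1 + d)) * (1 / d))"
    using a d unfolding dirichlet_convergent_def by (intro summable_mult2) blast
  show "summable (\<lambda>n. norm (b (Suc n)) * real (Suc n) powr (- \<sigma>))"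
  proof (rule summable_comparison_test'[OF s])
    fix n :: nat assume "n \<ge> 0"
    let ?x = "real (Suc n)"
    have "norm (b (Suc n)) * ?x powr (- \<sigma>) \<le> (norm (a (Suc n)) * ln ?x) * ?x powr (- \<sigma>)"
      by (intro mult_right_mono b) auto
    also have "\<dots> \<le> (norm (a (Suc n)) * (?x powr d / d)) * ?x powr (- \<sigma>)"
      using d by (intro mult_right_mono mult_left_mono ln_powr_bound) auto
    also have "\<dots> = norm (a (Suc n)) * (?x powr d * ?x powr (- \<sigma>)) * (1 / d)" by simp
    also have "?x powr d * ?x powr (- \<sigma>) = ?x powr (- (1 + d))"
      unfolding powr_add[symmetric] d(3) by (simp add: algebra_simps)
    finally show "norm (norm (b (Suc n)) * ?x powr (- \<sigma>)) \<le> norm (a (Suc n)) * ?x powr (- (1 + d)) * (1 / d)"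
      by simp
  qed
qed

lemma dirichlet_convergent_times_ln:
  "dirichlet_convergent a \<Longrightarrow> dirichlet_convergent (\<lambda>n. - a n * of_real (ln (real n)))"
  by (rule dirichlet_convergent_ln) (auto simp: norm_mult)

lemma dirichlet_series_deriv:
  assumes a: "dirichlet_convergent a" and s: "Re s > 1"
  shows "(dirichlet_series a has_field_derivative dirichlet_series (\<lambda>n. - a n * of_real (ln (real n))) s) (at s)"
proof -
  define \<sigma> where "\<sigma> = (1 + Re s) / 2"
  have \<sigma>: "\<sigma> > 1" "\<sigma> < Re s" using s by (auto simp: \<sigma>_def)
  define S where "S = {z. \<sigma> < Re z}"
  have oS: "open S" "convex S" "s \<in> S" using \<sigma> by (auto simp: S_def open_halfspace_Re_gt convex_halfspace_Re_gt)
  define b where "b = (\<lambda>n. - a n * of_real (ln (real n)))"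
  have b: "dirichlet_convergent b" unfolding b_def by (rule dirichlet_convergent_times_ln[OF a])
  have "((\<lambda>z. \<Sum>n. a (Suc n) * of_nat (Suc n) powr (- z)) has_field_derivative
         (\<Sum>n. b (Suc n) * of_nat (Suc n) powr (- s))) (at s)"
  proof (rule has_field_derivative_series'(2))
    show "((\<lambda>z. a (Suc n) * of_nat (Suc n) powr (- z)) has_field_derivative b (Suc n) * of_nat (Suc n) powr (- z)) (at z within S)" for n z
      by (auto simp: b_def powr_def Ln_of_nat algebra_simps simp del: of_nat_Suc intro!: derivative_eq_intros)
    show "uniformly_convergent_on S (\<lambda>n z. \<Sum>i<n. b (Suc i) * of_nat (Suc i) powr (- z))"
    proof (rule Weierstrass_m_test')
      show "summable (\<lambda>n. norm (b (Suc n)) * real (Suc n) powr (- \<sigma>))"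
        using b \<sigma> unfolding dirichlet_convergent_def by blast
      show "norm (b (Suc n) * of_nat (Suc n) powr (- z)) \<le> norm (b (Suc n)) * real (Suc n) powr (- \<sigma>)" if "z \<in> S" for n z
        using that unfolding norm_mult norm_nat_powr by (intro mult_left_mono powr_mono) (auto simp: S_def)
    qed
    show "summable (\<lambda>n. a (Suc n) * of_nat (Suc n) powr (- s))"
      using dirichlet_convergent_sums[OF a s] by (simp add: sums_iff)
  qed (use oS interior_open in auto)
  then show ?thesis by (simp add: dirichlet_series_def[abs_def] b_def)
qed

lemma holomorphic_dirichlet_series:
  "dirichlet_convergent a \<Longrightarrow> dirichlet_series a holomorphic_on {s. Re s > 1}"
  using dirichlet_series_deriv
  by (auto simp: holomorphic_on_def field_differentiable_def intro: has_field_derivative_at_within)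

lemma dirichlet_series_higher_deriv:
  assumes "dirichlet_convergent a" "Re s > 1"
  shows "(deriv ^^ k) (dirichlet_series a) s = dirichlet_series (\<lambda>n. a n * (- of_real (ln (real n))) ^ k) s"
  using assms
proof (induction k arbitrary: a s)
  case (Suc k)
  let ?b = "\<lambda>n. - a n * of_real (ln (real n))"
  have b: "dirichlet_convergent ?b" by (rule dirichlet_convergent_times_ln[OF Suc.prems(1)])
  have "(deriv ^^ Suc k) (dirichlet_series a) s = (deriv ^^ k) (deriv (dirichlet_series a)) s"
    by (simp add: funpow_Suc_right del: funpow.simps)
  also have "\<dots> = (deriv ^^ k) (dirichlet_series ?b) s"
  proof (rule higher_deriv_transform_within_open[of _ "{s. Re s > 1}"])
    show "deriv (dirichlet_series a) holomorphic_on {s. 1 < Re s}"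
      by (intro holomorphic_deriv holomorphic_dirichlet_series Suc.prems) (simp add: open_halfspace_Re_gt)
    show "deriv (dirichlet_series a) z = dirichlet_series ?b z" if "z \<in> {s. Re s > 1}" for z
      using dirichlet_series_deriv[OF Suc.prems(1), of z] that by (intro DERIV_imp_deriv) auto
  qed (use Suc.prems b holomorphic_dirichlet_series in \<open>auto simp: open_halfspace_Re_gt\<close>)
  also have "\<dots> = dirichlet_series (\<lambda>n. ?b n * (- of_real (ln (real n))) ^ k) s"
    by (rule Suc.IH[OF b Suc.prems(2)])
  finally show ?case by (simp add: mult_ac)
qed simp

lemma nat_powr_mult:
  assumes "d > 0" "e > 0"
  shows "of_nat (d * e) powr z = of_nat d powr z * (of_nat e powr z :: complex)"
proof -
  have "ln (real (d * e)) = ln (real d) + ln (real e)" using assms by (simp add: ln_mult)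
  then show ?thesis using assms by (simp add: powr_def Ln_of_nat exp_add ring_distribs del: of_nat_mult)
qed

lemma dirichlet_series_mult:
  assumes a: "dirichlet_convergent a" and b: "dirichlet_convergent b" and s: "Re s > 1"
  shows "dirichlet_series a s * dirichlet_series b s = dirichlet_series (\<lambda>n. \<Sum>d | d dvd n. a d * b (n div d)) s"
proof -
  have "(\<lambda>n. \<Sum>d | d dvd Suc n. (a d * of_nat d powr (- s)) * (b (Suc n div d) * of_nat (Suc n div d) powr (- s)))
      sums (dirichlet_series a s * dirichlet_series b s)"
    unfolding dirichlet_series_def
    by (rule dirichlet_product_suminf[of "\<lambda>n. a n * of_nat n powr (- s)" "\<lambda>n. b n * of_nat n powr (- s)"])
       (intro dirichlet_convergent_abs_summable a b s)+
  also have "(\<lambda>n. \<Sum>d | d dvd Suc n. (a d * of_nat d powr (- s)) * (b (Suc n div d) * of_nat (Suc n div d) powr (- s)))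
     = (\<lambda>n. (\<Sum>d | d dvd Suc n. a d * b (Suc n div d)) * of_nat (Suc n) powr (- s))"
  proof
    fix n
    have "(a d * of_nat d powr (- s)) * (b (Suc n div d) * of_nat (Suc n div d) powr (- s)) = a d * b (Suc n div d) * of_nat (Suc n) powr (- s)"
      if "d dvd Suc n" for d
    proof -
      have "d > 0" "Suc n div d > 0" using that by (auto intro!: Nat.gr0I simp: dvd_div_eq_0_iff)
      from nat_powr_mult[OF this, of "- s"] show ?thesis using that by (simp add: mult_ac del: of_nat_Suc)
    qed
    then show "(\<Sum>d | d dvd Suc n. (a d * of_nat d powr (- s)) * (b (Suc n div d) * of_nat (Suc n div d) powr (- s)))
       = (\<Sum>d | d dvd Suc n. a d * b (Suc n div d)) * of_nat (Suc n) powr (- s)"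
      unfolding sum_distrib_right by (intro sum.cong) auto
  qed
  finally show ?thesis by (simp add: dirichlet_series_def sums_iff)
qed

section \<open>Completely multiplicative coefficients: inverse and logarithmic derivative\<close>

definition completely_mult :: "(nat \<Rightarrow> complex) \<Rightarrow> bool" where
  "completely_mult f \<longleftrightarrow> f 1 = 1 \<and> (\<forall>m n. f (m * n) = f m * f n) \<and> (\<forall>n. norm (f n) \<le> 1)"

lemma completely_mult_divisor:
  "completely_mult f \<Longrightarrow> d dvd n \<Longrightarrow> f d * f (n div d) = f n"
  unfolding completely_mult_def by (metis dvd_mult_div_cancel)

lemma completely_mult_convergent: "completely_mult f \<Longrightarrow> dirichlet_convergent f"
  by (rule dirichlet_convergent_bounded) (simp add: completely_mult_def)

lemma moebius_convergent:
  assumes f: "completely_mult f"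
  shows "dirichlet_convergent (\<lambda>n. f n * of_int (moebius n))"
proof (rule dirichlet_convergent_bounded)
  fix n
  have "norm (of_int (moebius n) :: complex) \<le> 1" using abs_moebius_le[of n] by simp
  then show "norm (f n * of_int (moebius n)) \<le> 1"
    using f mult_mono[of "norm (f n)" 1 "norm (of_int (moebius n) :: complex)" 1] by (simp add: completely_mult_def norm_mult)
qed

text \<open>Complete multiplicativity takes \<open>f\<close> out of the convolution, and the divisor
  sum of \<open>moebius\<close> leaves only the first coefficient.\<close>

lemma dirichlet_series_moebius:
  assumes f: "completely_mult f" and s: "Re s > 1"
  shows "dirichlet_series (\<lambda>n. f n * of_int (moebius n)) s * dirichlet_series f s = 1"
proof -
  have f1: "f 1 = 1" using f by (simp add: completely_mult_def)
  have "dirichlet_series (\<lambda>n. f n * of_int (moebius n)) s * dirichlet_series f s =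
    dirichlet_series (\<lambda>n. \<Sum>d | d dvd n. f d * of_int (moebius d) * f (n div d)) s"
    by (intro dirichlet_series_mult moebius_convergent f completely_mult_convergent s)
  also have "\<dots> = (\<Sum>n. if n = 0 then 1 else 0)"
    unfolding dirichlet_series_def
  proof (rule suminf_cong)
    fix n
    have "(\<Sum>d | d dvd Suc n. f d * of_int (moebius d) * f (Suc n div d)) = (\<Sum>d | d dvd Suc n. f (Suc n) * of_int (moebius d))"
      by (intro sum.cong refl) (use completely_mult_divisor[OF f] in \<open>auto simp: mult_ac\<close>)
    also have "\<dots> = f (Suc n) * of_int (\<Sum>d | d dvd Suc n. moebius d)" by (simp add: sum_distrib_left)
    also have "\<dots> = (if n = 0 then 1 else 0)"
      using f1 by (subst sum_moebius_divisors) auto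
    finally show "(\<Sum>d | d dvd Suc n. f d * of_int (moebius d) * f (Suc n div d)) * of_nat (Suc n) powr (- s) = (if n = 0 then 1 else 0)"
      by simp
  qed
  also have "\<dots> = 1" using sums_single[of 0 "\<lambda>_. 1 :: complex"] by (simp add: sums_iff)
  finally show ?thesis .
qed

lemma dirichlet_series_nonzero: "completely_mult f \<Longrightarrow> Re s > 1 \<Longrightarrow> dirichlet_series f s \<noteq> 0"
  using dirichlet_series_moebius by fastforce

lemma mangoldt_nonneg: "(mangoldt n :: real) \<ge> 0"
proof (cases "primepow n")
  case True
  then have "prime (aprimedivisor n)" using primepow_gt_Suc_0[OF True] by (intro prime_aprimedivisor') auto
  then show ?thesis using True prime_ge_1_nat[of "aprimedivisor n"] by (simp add: mangoldt_def)
qed (simp add: mangoldt_def)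

lemma mangoldt_le_ln:
  assumes "n > 0"
  shows "(mangoldt n :: real) \<le> ln (real n)"
proof -
  have "mangoldt n \<le> (\<Sum>d | d dvd n. mangoldt d :: real)"
    using assms by (intro member_le_sum) (auto simp: mangoldt_nonneg)
  also have "\<dots> = ln (real n)" using mangoldt_sum[of n, where ?'a = real] assms by simp
  finally show ?thesis .
qed

lemma mangoldt_convergent:
  assumes f: "\<And>n. norm (f n) \<le> 1"
  shows "dirichlet_convergent (\<lambda>n. f n * of_real (mangoldt n))"
proof (rule dirichlet_convergent_ln[OF dirichlet_convergent_bounded])
  show "norm (f n * of_real (mangoldt n)) \<le> norm (1::complex) * ln (real n)" if "n > 0" for n
    using mult_mono[OF f[of n] mangoldt_le_ln[OF that]] mangoldt_nonneg[of n] by (simp add: norm_mult)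
qed simp

text \<open>Convolving \<open>f n * mangoldt n\<close> with \<open>f\<close> gives
  \<open>f n * ln n\<close>, because \<open>f\<close> factors out of the divisor sum of
  \<open>mangoldt\<close>. The relation for the logarithmic derivative is kept in multiplied
  form.\<close>

lemma dirichlet_series_log_deriv:
  assumes f: "completely_mult f" and s: "Re s > 1"
  shows "(dirichlet_series f has_field_derivative - (dirichlet_series (\<lambda>n. f n * of_real (mangoldt n)) s * dirichlet_series f s)) (at s)"
proof -
  have fb: "\<And>n. norm (f n) \<le> 1" using f by (simp add: completely_mult_def)
  have "dirichlet_series (\<lambda>n. f n * of_real (mangoldt n)) s * dirichlet_series f s
     = dirichlet_series (\<lambda>n. \<Sum>d | d dvd n. f d * of_real (mangoldt d) * f (n div d)) s"
    by (intro dirichlet_series_mult mangoldt_convergent fb completely_mult_convergent f s)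
  also have "\<dots> = dirichlet_series (\<lambda>n. f n * of_real (ln (real n))) s"
    unfolding dirichlet_series_def
  proof (rule suminf_cong)
    fix n
    have "(\<Sum>d | d dvd Suc n. f d * of_real (mangoldt d) * f (Suc n div d)) = (\<Sum>d | d dvd Suc n. f (Suc n) * of_real (mangoldt d))"
      by (intro sum.cong refl) (use completely_mult_divisor[OF f] in \<open>auto simp: mult_ac\<close>)
    also have "\<dots> = f (Suc n) * of_real (\<Sum>d | d dvd Suc n. mangoldt d)" by (simp add: sum_distrib_left del: of_real_mangoldt)
    also have "(\<Sum>d | d dvd Suc n. mangoldt d) = ln (real (Suc n))" using mangoldt_sum[of "Suc n", where ?'a = real] by simp
    finally show "(\<Sum>d | d dvd Suc n. f d * of_real (mangoldt d) * f (Suc n div d)) * of_nat (Suc n) powr (- s)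
       = f (Suc n) * of_real (ln (real (Suc n))) * of_nat (Suc n) powr (- s)" by simp
  qed
  also have "- \<dots> = dirichlet_series (\<lambda>n. - f n * of_real (ln (real n))) s"
    using suminf_minus[of "\<lambda>n. f (Suc n) * of_real (ln (real (Suc n))) * of_nat (Suc n) powr (- s)"]
      dirichlet_convergent_sums[OF dirichlet_convergent_times_ln[OF completely_mult_convergent[OF f]] s]
    unfolding dirichlet_series_def by (simp add: sums_iff summable_minus_iff del: of_nat_Suc)
  finally show ?thesis using dirichlet_series_deriv[OF completely_mult_convergent[OF f] s] by simp
qed

section \<open>Non-vanishing by positivity of Taylor coefficients\<close>

definition alternating_derivs :: "(complex \<Rightarrow> complex) \<Rightarrow> bool" where
  "alternating_derivs f \<longleftrightarrow> (\<forall>k. \<exists>r\<ge>0. (-1) ^ k * (deriv ^^ k) f 2 = of_real r)"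

text \<open>Each derivative of \<open>n^(- s)\<close> brings a factor \<open>- ln n\<close>, so the
  sign \<open>(-1) ^ k\<close> makes every term nonnegative at the real point
  \<open>2\<close>.\<close>

lemma alternating_derivs_dirichlet_series:
  assumes c: "dirichlet_convergent (\<lambda>n. of_real (c n))" and nonneg: "\<And>n. c n \<ge> 0"
  shows "alternating_derivs (dirichlet_series (\<lambda>n. of_real (c n)))"
  unfolding alternating_derivs_def
proof
  fix k
  define a where "a = (\<lambda>n. c (Suc n) * ln (real (Suc n)) ^ k * real (Suc n) powr (-2))"
  have conv: "dirichlet_convergent (\<lambda>n. complex_of_real (c n) * (- of_real (ln (real n))) ^ k)"
  proof (induction k)
    case (Suc k)
    from dirichlet_convergent_times_ln[OF this] show ?case by (simp add: mult_ac)
  qed (use c in simp)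
  have "(\<lambda>n. complex_of_real (c (Suc n)) * (- of_real (ln (real (Suc n)))) ^ k * of_nat (Suc n) powr (- 2))
      sums (deriv ^^ k) (dirichlet_series (\<lambda>n. of_real (c n))) 2"
    using dirichlet_convergent_sums[OF conv, of 2] dirichlet_series_higher_deriv[OF c, of 2 k] by simp
  then have "(\<lambda>n. (-1) ^ k * (complex_of_real (c (Suc n)) * (- of_real (ln (real (Suc n)))) ^ k * of_nat (Suc n) powr (- 2)))
      sums ((-1) ^ k * (deriv ^^ k) (dirichlet_series (\<lambda>n. of_real (c n))) 2)"
    by (rule sums_mult)
  also have "(\<lambda>n. (-1) ^ k * (complex_of_real (c (Suc n)) * (- of_real (ln (real (Suc n)))) ^ k * of_nat (Suc n) powr (- 2)))
     = (\<lambda>n. of_real (a n))"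
  proof
    fix n
    have "of_nat (Suc n) powr (- 2) = complex_of_real (real (Suc n) powr (-2))"
      using powr_of_real[of "real (Suc n)" "-2"] by (simp del: of_nat_Suc)
    moreover have "(-1) ^ k * (- complex_of_real (ln (real (Suc n)))) ^ k = of_real (ln (real (Suc n)) ^ k)"
      by (subst power_mult_distrib[symmetric]) simp
    ultimately show "(-1) ^ k * (complex_of_real (c (Suc n)) * (- of_real (ln (real (Suc n)))) ^ k * of_nat (Suc n) powr (- 2)) = of_real (a n)"
      unfolding a_def by (simp only: of_real_mult mult_ac) (metis mult.assoc mult.commute)
  qed
  finally have s: "(\<lambda>n. complex_of_real (a n)) sums ((-1) ^ k * (deriv ^^ k) (dirichlet_series (\<lambda>n. of_real (c n))) 2)" .
  then have "summable (\<lambda>n. complex_of_real (a n))" by (simp add: sums_iff)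
  then have "summable a" by (simp only: summable_of_real_iff)
  then have "(\<lambda>n. complex_of_real (a n)) sums of_real (suminf a)"
    by (intro sums_of_real summable_sums)
  then have "(-1) ^ k * (deriv ^^ k) (dirichlet_series (\<lambda>n. of_real (c n))) 2 = of_real (suminf a)"
    using s sums_unique2 by blast
  moreover have "suminf a \<ge> 0" using \<open>summable a\<close> nonneg by (intro suminf_nonneg) (auto simp: a_def)
  ultimately show "\<exists>r\<ge>0. (-1) ^ k * (deriv ^^ k) (dirichlet_series (\<lambda>n. of_real (c n))) 2 = of_real r" by blast
qed

text \<open>By Leibniz's rule applied to \<open>Z' = - D Z\<close>, the signed derivative of
  \<open>Z\<close> of order \<open>m + 1\<close> is a sum of products of signed derivatives of
  \<open>D\<close> and signed derivatives of \<open>Z\<close> of order at most \<open>m\<close>;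
  induction applies. No logarithm of \<open>Z\<close> is formed.\<close>

lemma alternating_derivs_exponential:
  assumes D: "alternating_derivs D" "D holomorphic_on {s. Re s > 1}"
    and Z: "Z holomorphic_on UNIV" "Z 2 = of_real r" "r \<ge> 0"
    and ode: "\<And>s. Re s > 1 \<Longrightarrow> (Z has_field_derivative - (D s * Z s)) (at s)"
  shows "alternating_derivs Z"
  unfolding alternating_derivs_def
proof
  fix k
  have oS: "open {s. Re s > (1::real)}" by (rule open_halfspace_Re_gt)
  have Zh: "Z holomorphic_on A" for A using Z(1) holomorphic_on_subset by blast
  show "\<exists>r\<ge>0. (-1) ^ k * (deriv ^^ k) Z 2 = of_real r"
  proof (induction k rule: less_induct)
    case (less k)
    show ?case
    proof (cases k)
      case 0
      then show ?thesis using Z by auto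
    next
      case (Suc m)
      have "(deriv ^^ k) Z 2 = (deriv ^^ m) (deriv Z) 2"
        unfolding Suc by (simp add: funpow_Suc_right del: funpow.simps)
      also have "\<dots> = (deriv ^^ m) (\<lambda>s. (- D s) * Z s) 2"
      proof (rule higher_deriv_transform_within_open[OF _ _ oS])
        show "deriv Z holomorphic_on {s. 1 < Re s}" using Zh oS by (intro holomorphic_deriv)
        show "deriv Z s = - D s * Z s" if "s \<in> {s. 1 < Re s}" for s
          using ode[of s] that by (intro DERIV_imp_deriv) simp
      qed (use D(2) Zh in \<open>auto intro!: holomorphic_intros\<close>)
      also have "\<dots> = (\<Sum>i=0..m. of_nat (m choose i) * (deriv ^^ i) (\<lambda>s. - D s) 2 * (deriv ^^ (m - i)) Z 2)"
        by (rule higher_deriv_mult[OF _ Zh oS]) (use D(2) in \<open>auto intro!: holomorphic_intros\<close>)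
      finally have eq: "(-1) ^ k * (deriv ^^ k) Z 2 = (\<Sum>i=0..m. of_nat (m choose i) * ((-1) ^ i * (deriv ^^ i) D 2) * ((-1) ^ (m - i) * (deriv ^^ (m - i)) Z 2))"
      proof -
        assume a: "(deriv ^^ k) Z 2 = (\<Sum>i=0..m. of_nat (m choose i) * (deriv ^^ i) (\<lambda>s. - D s) 2 * (deriv ^^ (m - i)) Z 2)"
        show ?thesis unfolding a sum_distrib_left
        proof (rule sum.cong[OF refl])
          fix i assume i: "i \<in> {0..m}"
          have m: "(-1 :: complex) ^ k = - ((-1) ^ i * (-1) ^ (m - i))"
            using i unfolding Suc by (simp add: power_add[symmetric])
          have n: "(deriv ^^ i) (\<lambda>s. - D s) 2 = - (deriv ^^ i) D 2"
            by (rule higher_deriv_uminus[OF D(2) oS]) simp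
          show "(-1) ^ k * (of_nat (m choose i) * (deriv ^^ i) (\<lambda>s. - D s) 2 * (deriv ^^ (m - i)) Z 2)
             = of_nat (m choose i) * ((-1) ^ i * (deriv ^^ i) D 2) * ((-1) ^ (m - i) * (deriv ^^ (m - i)) Z 2)"
            unfolding m n by simp
        qed
      qed
      have "\<exists>r\<ge>0. of_nat (m choose i) * ((-1) ^ i * (deriv ^^ i) D 2) * ((-1) ^ (m - i) * (deriv ^^ (m - i)) Z 2) = complex_of_real r"
        if i: "i \<in> {0..m}" for i
      proof -
        obtain r1 where "r1 \<ge> 0" "(-1) ^ i * (deriv ^^ i) D 2 = of_real r1"
          using D(1) by (auto simp: alternating_derivs_def)
        moreover obtain r2 where "r2 \<ge> 0" "(-1) ^ (m - i) * (deriv ^^ (m - i)) Z 2 = of_real r2"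
        proof -
          have "m - i < k" using Suc by simp
          from less[OF this] show ?thesis using that by blast
        qed
        ultimately show ?thesis by (intro exI[of _ "real (m choose i) * r1 * r2"]) auto
      qed
      then obtain \<rho> where \<rho>: "\<And>i. i \<in> {0..m} \<Longrightarrow> \<rho> i \<ge> 0 \<and> of_nat (m choose i) * ((-1) ^ i * (deriv ^^ i) D 2) * ((-1) ^ (m - i) * (deriv ^^ (m - i)) Z 2) = complex_of_real (\<rho> i)"
        by metis
      show ?thesis unfolding eq
        using \<rho> by (intro exI[of _ "\<Sum>i=0..m. \<rho> i"]) (auto intro!: sum_nonneg)
    qed
  qed
qed

text \<open>At \<open>-2\<close> the powers \<open>(-4)^n\<close> cancel the alternating signs, so
  every term of the Taylor series at \<open>2\<close> is nonnegative, and the term of order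
  \<open>0\<close> is \<open>Z 2 > 0\<close>.\<close>

lemma alternating_derivs_nonzero:
  assumes Z: "Z holomorphic_on UNIV" "Z 2 = of_real r" "r > 0" and alt: "alternating_derivs Z"
  shows "Z (-2) \<noteq> 0"
proof
  assume z0: "Z (-2) = 0"
  \<comment> \<open>The disc of radius \<open>5\<close> about \<open>2\<close> contains
    \<open>-2\<close>; as \<open>Z\<close> is entire, the expansion is valid that far out.\<close>
  have "(\<lambda>n. (deriv ^^ n) Z 2 / fact n * (-2 - 2) ^ n) sums Z (-2)"
    by (rule holomorphic_power_series[of Z 2 5]) (use Z in \<open>auto intro: holomorphic_on_subset simp: dist_norm\<close>)
  moreover obtain \<rho> where \<rho>: "\<And>k. \<rho> k \<ge> 0 \<and> (-1) ^ k * (deriv ^^ k) Z 2 = complex_of_real (\<rho> k)"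
    using alt unfolding alternating_derivs_def by metis
  moreover have "(deriv ^^ n) Z 2 / fact n * (-2 - 2) ^ n = of_real (\<rho> n / fact n * 4 ^ n)" for n
  proof -
    have "(-2 - 2 :: complex) ^ n = (-1) ^ n * 4 ^ n" by (simp add: power_mult_distrib[symmetric])
    then show ?thesis using \<rho>[of n] by (simp add: mult_ac)
  qed
  ultimately have s: "(\<lambda>n. complex_of_real (\<rho> n / fact n * 4 ^ n)) sums of_real 0" using z0 by simp
  then have s': "(\<lambda>n. \<rho> n / fact n * 4 ^ n) sums 0" by (simp only: sums_of_real_iff)
  have "(\<Sum>n\<in>{0}. \<rho> n / fact n * 4 ^ n) \<le> (\<Sum>n. \<rho> n / fact n * 4 ^ n)"
    using s' \<rho> by (intro sum_le_suminf) (auto simp: sums_iff)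
  then have "\<rho> 0 \<le> 0" using s' by (simp add: sums_iff)
  moreover have "of_real (\<rho> 0) = Z 2" using \<rho>[of 0] by simp
  ultimately show False using Z by (simp only: of_real_eq_iff)
qed

lemma completely_mult_char:
  assumes dc: "dirichlet_character q chi"
  shows "completely_mult (\<lambda>n. chi (int n))"
  using char_1[OF dc] char_mult[OF dc] norm_char_le[OF dc] by (simp add: completely_mult_def)

lemma primitive_trivial_character: "primitive_dirichlet_character 1 (\<lambda>_. 1)"
  by (auto simp: primitive_dirichlet_character_def dirichlet_character_def)

text \<open>\<open>Z(s) = \<zeta>(s)\<^sup>2 L(s + it, \<chi>) L(s - it, \<chi>\<^sup>-)\<close> has alternating derivatives at \<open>2\<close>. If it is
  entire, its Taylor series at \<open>2\<close> gives \<open>Z(-2) \<ge> Z(2) > 0\<close>, contradicting \<open>\<zeta>(-2) = 0\<close>.\<close>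

lemma entire_product_nonzero:
  assumes f: "completely_mult f" and Z: "Z holomorphic_on UNIV"
    and eq: "\<And>s. Re s > 1 \<Longrightarrow> Z s = (dirichlet_series (\<lambda>_. 1) s)\<^sup>2 * dirichlet_series f s * dirichlet_series (\<lambda>n. cnj (f n)) s"
  shows "Z (-2) \<noteq> 0"
proof -
  define g where "g = (\<lambda>n. cnj (f n))"
  have g: "completely_mult g" using f by (simp add: completely_mult_def g_def)
  have one: "completely_mult (\<lambda>_. 1)" by (simp add: completely_mult_def)
  have b: "\<And>n. norm (f n) \<le> 1" "\<And>n. norm (g n) \<le> 1" using f g by (auto simp: completely_mult_def)
  \<comment> \<open>These are the coefficients of \<open>- Z' / Z\<close>;
    \<open>norm (f n) \<le> 1\<close> makes \<open>2 + 2 * Re (f n)\<close> nonnegative.\<close>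
  define c where "c = (\<lambda>n. (2 + 2 * Re (f n)) * mangoldt n :: real)"
  have c0: "c n \<ge> 0" for n
    using b(1)[of n] abs_Re_le_cmod[of "f n"] mangoldt_nonneg[of n] by (auto simp: c_def intro!: mult_nonneg_nonneg)
  have cc: "dirichlet_convergent (\<lambda>n. of_real (c n))"
  proof (rule dirichlet_convergent_ln[of "\<lambda>_. 4"])
    show "dirichlet_convergent (\<lambda>_. 4)"
      using dirichlet_convergent_bounded[of "\<lambda>_. 1"] unfolding dirichlet_convergent_def by (auto intro: summable_mult)
    show "norm (complex_of_real (c n)) \<le> norm (4::complex) * ln (real n)" if n: "n > 0" for n
    proof -
      have "c n \<le> 4 * ln (real n)"
        unfolding c_def using b(1)[of n] abs_Re_le_cmod[of "f n"] mangoldt_nonneg[of n] mangoldt_le_ln[OF n]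
        by (intro mult_mono) auto
      then show ?thesis using c0[of n] by (simp only: norm_of_real abs_of_nonneg norm_numeral)
    qed
  qed
  define D where "D = dirichlet_series (\<lambda>n. of_real (c n))"
  define DL where "DL = (\<lambda>h. dirichlet_series (\<lambda>n. h n * of_real (mangoldt n)))"
  have D_eq: "D s = 2 * DL (\<lambda>_. 1) s + DL f s + DL g s" if s: "Re s > 1" for s
  proof -
    have "(\<lambda>n. 2 * (1 * of_real (mangoldt (Suc n)) * of_nat (Suc n) powr (- s)) + f (Suc n) * of_real (mangoldt (Suc n)) * of_nat (Suc n) powr (- s)
        + g (Suc n) * of_real (mangoldt (Suc n)) * of_nat (Suc n) powr (- s)) sums (2 * DL (\<lambda>_. 1) s + DL f s + DL g s)"
      unfolding DL_def using b s
      by (intro sums_add sums_mult dirichlet_convergent_sums[OF mangoldt_convergent]) auto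
    also have "(\<lambda>n. 2 * (1 * of_real (mangoldt (Suc n)) * of_nat (Suc n) powr (- s)) + f (Suc n) * of_real (mangoldt (Suc n)) * of_nat (Suc n) powr (- s)
        + g (Suc n) * of_real (mangoldt (Suc n)) * of_nat (Suc n) powr (- s)) = (\<lambda>n. of_real (c (Suc n)) * of_nat (Suc n) powr (- s))"
    proof
      fix n
      have "2 + f (Suc n) + g (Suc n) = of_real (2 + 2 * Re (f (Suc n)))" by (simp add: g_def complex_eq_iff)
      then have "of_real (c (Suc n)) = (2 + f (Suc n) + g (Suc n)) * of_real (mangoldt (Suc n))" by (simp add: c_def del: of_real_mangoldt)
      then show "2 * (1 * of_real (mangoldt (Suc n)) * of_nat (Suc n) powr (- s)) + f (Suc n) * of_real (mangoldt (Suc n)) * of_nat (Suc n) powr (- s)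
        + g (Suc n) * of_real (mangoldt (Suc n)) * of_nat (Suc n) powr (- s) = of_real (c (Suc n)) * of_nat (Suc n) powr (- s)"
        by (simp only: ring_distribs mult_1_left mult.assoc)
    qed
    finally show ?thesis by (simp add: D_def dirichlet_series_def sums_iff)
  qed
  have ode: "(Z has_field_derivative - (D s * Z s)) (at s)" if s: "Re s > 1" for s
  proof -
    have "((\<lambda>s. (dirichlet_series (\<lambda>_. 1) s)\<^sup>2 * dirichlet_series f s * dirichlet_series g s) has_field_derivative - (D s * Z s)) (at s)"
      by (auto intro!: derivative_eq_intros dirichlet_series_log_deriv f g one s
            simp: D_eq[OF s] eq[OF s] DL_def g_def[symmetric] power2_eq_square algebra_simps)
    then show ?thesis
      by (rule has_field_derivative_transform_within_open[of _ _ _ "{s. Re s > 1}"])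
         (use s eq in \<open>auto simp: open_halfspace_Re_gt g_def\<close>)
  qed
  define r where "r = norm ((dirichlet_series (\<lambda>_. 1) 2)\<^sup>2) * norm (dirichlet_series f 2) ^ 2"
  have cnj_ds: "dirichlet_series (\<lambda>n. cnj (h n)) 2 = cnj (dirichlet_series h 2)" if "completely_mult h" for h
  proof -
    have "(\<lambda>n. h (Suc n) * of_nat (Suc n) powr (- 2)) sums dirichlet_series h 2"
      by (intro dirichlet_convergent_sums completely_mult_convergent that) simp
    then have "(\<lambda>n. cnj (h (Suc n) * of_nat (Suc n) powr (- 2))) sums cnj (dirichlet_series h 2)"
      by (simp only: sums_cnj)
    moreover have "(\<lambda>n. cnj (h (Suc n) * of_nat (Suc n) powr (- 2))) = (\<lambda>n. cnj (h (Suc n)) * of_nat (Suc n) powr (- 2))"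
      by (rule ext) (simp add: powr_def exp_cnj Ln_of_nat del: of_nat_Suc)
    ultimately have "(\<lambda>n. cnj (h (Suc n)) * of_nat (Suc n) powr (- 2)) sums cnj (dirichlet_series h 2)" by (simp only:)
    then show ?thesis unfolding dirichlet_series_def[of "\<lambda>n. cnj (h n)"] by (rule sums_unique[symmetric])
  qed
  have "Z 2 = of_real r"
  proof -
    have "dirichlet_series (\<lambda>_. 1) 2 = cnj (dirichlet_series (\<lambda>_. 1) 2)" using cnj_ds[OF one] by simp
    then have "(dirichlet_series (\<lambda>_. 1) 2)\<^sup>2 = of_real (norm ((dirichlet_series (\<lambda>_. 1) 2)\<^sup>2))"
      using complex_norm_square[of "dirichlet_series (\<lambda>_. 1) 2"] by (simp add: power2_eq_square norm_mult)
    moreover have "dirichlet_series f 2 * dirichlet_series (\<lambda>n. cnj (f n)) 2 = of_real (norm (dirichlet_series f 2) ^ 2)"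
      using cnj_ds[OF f] complex_norm_square[of "dirichlet_series f 2"] by simp
    ultimately show ?thesis unfolding r_def using eq[of 2] by (simp add: mult.assoc)
  qed
  moreover have "r > 0"
    unfolding r_def using dirichlet_series_nonzero[OF one, of 2] dirichlet_series_nonzero[OF f, of 2] by simp
  ultimately show ?thesis
    using alternating_derivs_nonzero[OF Z] alternating_derivs_exponential[OF _ _ Z _ _ ode, of r]
      alternating_derivs_dirichlet_series[OF cc c0] holomorphic_dirichlet_series[OF cc] unfolding D_def by auto
qed

text \<open>A zero at \<open>1 + i t\<close> gives \<open>A 1 = 0\<close> and, by conjugation,
  \<open>B 1 = 0\<close>; together they cancel the double pole of the squared zeta function at
  \<open>1\<close>. The product is then entire and vanishes at \<open>-2\<close> together with zeta,
  against \<open>entire_product_nonzero\<close>. For \<open>q = 1\<close> the shifted zeta functions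
  have poles of their own, which zeros of zeta cancel.\<close>

theorem regular_L_nonzero_line:
  assumes prim: "primitive_dirichlet_character q chi"
  shows "regular_L q chi (1 + \<i> * of_real t) \<noteq> 0"
proof
  assume zero: "regular_L q chi (1 + \<i> * of_real t) = 0"
  have dc: "dirichlet_character q chi" using prim by (simp add: primitive_dirichlet_character_def)
  note cprim = cnj_primitive_character[OF prim]
  define w where "w = \<i> * complex_of_real t"
  define f where "f = (\<lambda>n. chi (int n) * (if n = 0 then 0 else of_nat n powr (- w)))"
  have f: "completely_mult f"
    unfolding completely_mult_def
  proof (intro conjI allI)
    show "f 1 = 1" using char_1[OF dc] by (simp add: f_def)
    show "f (m * n) = f m * f n" for m n
      using char_mult[OF dc] nat_powr_mult[of m n "- w"] by (auto simp: f_def)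
    show "norm (f n) \<le> 1" for n
      using norm_char_le[OF dc, of "int n"] norm_nat_powr[of "n - 1" "- w"]
      by (cases n) (auto simp: f_def norm_mult w_def)
  qed
  have fs: "dirichlet_series f s = dirichlet_series (\<lambda>n. chi (int n)) (s + w)" for s
    unfolding dirichlet_series_def by (intro suminf_cong) (simp add: f_def powr_add[symmetric] add.commute del: of_nat_Suc)
  have gs: "dirichlet_series (\<lambda>n. cnj (f n)) s = dirichlet_series (\<lambda>n. cnj (chi (int n))) (s - w)" for s
  proof -
    have "cnj (of_nat (Suc n) powr (- w)) = of_nat (Suc n) powr w" for n
      by (simp add: powr_def exp_cnj Ln_of_nat w_def del: of_nat_Suc)
    then show ?thesis unfolding dirichlet_series_def
      by (intro suminf_cong) (simp add: f_def powr_add[symmetric] mult.assoc del: of_nat_Suc)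
  qed
  define \<zeta> where "\<zeta> = regular_L 1 (\<lambda>_. 1)"
  have \<zeta>h: "\<zeta> holomorphic_on UNIV" and \<zeta>0: "\<zeta> (-2) = 0"
    using holomorphic_regular_L[OF primitive_trivial_character] regular_L_trivial_zero[OF primitive_trivial_character] by (auto simp: \<zeta>_def)
  have \<zeta>s: "\<zeta> s = (s - 1) * dirichlet_series (\<lambda>_. 1) s" if "Re s > 1" for s
    using regular_L_eq[OF primitive_trivial_character that] by (simp add: \<zeta>_def pole_order_def)
  define A where "A = (\<lambda>s. regular_L q chi (s + w))"
  define B where "B = (\<lambda>s. regular_L q (\<lambda>n. cnj (chi n)) (s - w))"
  have Ah: "A holomorphic_on UNIV"
    unfolding A_def by (intro holomorphic_on_compose_gen[OF _ holomorphic_regular_L[OF prim], unfolded comp_def] holomorphic_intros) auto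
  have Bh: "B holomorphic_on UNIV"
    unfolding B_def by (intro holomorphic_on_compose_gen[OF _ holomorphic_regular_L[OF cprim], unfolded comp_def] holomorphic_intros) auto
  have A1: "A 1 = 0" using zero by (simp add: A_def w_def)
  have B1: "B 1 = 0" using zero unfolding B_def regular_L_cnj[OF prim] by (simp add: w_def)
  obtain A' where A': "A' holomorphic_on UNIV" "\<And>z. A z = (z - 1) * A' z" using entire_factor_zero[OF Ah A1] by blast
  obtain B' where B': "B' holomorphic_on UNIV" "\<And>z. B z = (z - 1) * B' z" using entire_factor_zero[OF Bh B1] by blast
  have As: "A s = (s + w - 1) ^ pole_order q * dirichlet_series f s" if "Re s > 1" for s
    using regular_L_eq[OF prim, of "s + w"] that by (simp add: A_def fs w_def)
  have Bs: "B s = (s - w - 1) ^ pole_order q * dirichlet_series (\<lambda>n. cnj (f n)) s" if "Re s > 1" for s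
    using regular_L_eq[OF cprim, of "s - w"] that by (simp add: B_def gs w_def)
  show False
  proof (cases "q = 1")
    case False
    define Z where "Z = (\<lambda>s. (\<zeta> s)\<^sup>2 * A' s * B' s)"
    have "Z (-2) \<noteq> 0"
    proof (rule entire_product_nonzero[OF f])
      show "Z holomorphic_on UNIV" unfolding Z_def by (intro holomorphic_intros \<zeta>h A' B')
      show "Z s = (dirichlet_series (\<lambda>_. 1) s)\<^sup>2 * dirichlet_series f s * dirichlet_series (\<lambda>n. cnj (f n)) s" if s: "Re s > 1" for s
        using As[OF s] Bs[OF s] A'(2)[of s] B'(2)[of s] False
        by (simp add: Z_def \<zeta>s[OF s] pole_order_def power2_eq_square) (metis mult.assoc mult.commute mult.left_commute)
    qed
    then show False by (simp add: Z_def \<zeta>0)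
  next
    case True
    \<comment> \<open>Hence \<open>1 + w\<close> and \<open>1 - w\<close> are distinct zeros of
      \<open>\<zeta>\<close>, and both linear factors can be split off.\<close>
    have t0: "t \<noteq> 0" using zero regular_L_at_1[OF prim True] by auto
    have chi1: "chi = (\<lambda>_. 1)" using primitive_char_modulus_1[of chi] dc True by auto
    have z1: "\<zeta> (1 + w) = 0" using zero True chi1 by (simp add: \<zeta>_def w_def)
    have z2: "\<zeta> (1 - w) = 0" using z1 regular_L_cnj[OF primitive_trivial_character, of "1 - w"] by (simp add: \<zeta>_def w_def)
    obtain \<zeta>1 where \<zeta>1: "\<zeta>1 holomorphic_on UNIV" "\<And>z. \<zeta> z = (z - (1 + w)) * \<zeta>1 z" using entire_factor_zero[OF \<zeta>h z1] by blast
    have "\<zeta>1 (1 - w) = 0" using z2 \<zeta>1(2)[of "1 - w"] t0 by (simp add: w_def)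
    then obtain \<zeta>2 where \<zeta>2: "\<zeta>2 holomorphic_on UNIV" "\<And>z. \<zeta>1 z = (z - (1 - w)) * \<zeta>2 z" using entire_factor_zero[OF \<zeta>1(1)] by blast
    have \<zeta>12: "\<zeta> z = (z - 1 - w) * ((z - 1 + w) * \<zeta>2 z)" for z
      using \<zeta>1(2)[of z] \<zeta>2(2)[of z] by (simp add: algebra_simps)
    \<comment> \<open>The square of \<open>\<zeta>\<close> has each linear factor twice. One copy
      cancels the pole of a shifted zeta function at \<open>1 - w\<close> or \<open>1 + w\<close>,
      the other remains here.\<close>
    define Z where "Z = (\<lambda>s. (\<zeta>2 s)\<^sup>2 * (s - 1 - w) * (s - 1 + w) * A' s * B' s)"
    have "Z (-2) \<noteq> 0"
    proof (rule entire_product_nonzero[OF f])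
      show "Z holomorphic_on UNIV" unfolding Z_def by (intro holomorphic_intros \<zeta>2 A' B')
      fix s assume s: "Re s > 1"
      let ?u = "s - 1 - w" let ?v = "s - 1 + w"
      let ?F = "dirichlet_series f s" let ?G = "dirichlet_series (\<lambda>n. cnj (f n)) s" let ?o = "dirichlet_series (\<lambda>_. 1) s"
      have nz: "?u \<noteq> 0" "?v \<noteq> 0" "s - 1 \<noteq> 0" using s by (auto simp: w_def complex_eq_iff)
      have a: "(s - 1) * A' s = ?v * ?F" "(s - 1) * B' s = ?u * ?G"
        using As[OF s] Bs[OF s] A'(2)[of s] B'(2)[of s] True by (auto simp: pole_order_def algebra_simps)
      have o: "?u * (?v * \<zeta>2 s) = (s - 1) * ?o" using \<zeta>s[OF s] \<zeta>12[of s] by simp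
      have "(s - 1)\<^sup>2 * (?u * ?v) * Z s = (?u * (?v * \<zeta>2 s))\<^sup>2 * ((s - 1) * A' s) * ((s - 1) * B' s)"
        by (simp add: Z_def power2_eq_square mult_ac)
      also have "\<dots> = (s - 1)\<^sup>2 * (?u * ?v) * (?o\<^sup>2 * ?F * ?G)"
        unfolding a o by (simp add: power2_eq_square mult_ac)
      finally show "Z s = ?o\<^sup>2 * ?F * ?G" using nz by simp
    qed
    moreover have "- 2 - 1 - w \<noteq> 0" "- 2 - 1 + w \<noteq> 0" by (auto simp: w_def complex_eq_iff)
    then have "\<zeta>2 (-2) = 0" using \<zeta>0 \<zeta>12[of "-2"] by (metis mult_eq_0_iff)
    ultimately show False by (simp add: Z_def)
  qed
qed

lemma regular_L_nonzero_ge_1: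
  assumes prim: "primitive_dirichlet_character q chi" and s: "Re s \<ge> 1"
  shows "regular_L q chi s \<noteq> 0"
proof (cases "Re s = 1")
  case True
  then have "s = 1 + \<i> * of_real (Im s)" by (simp add: complex_eq_iff)
  then show ?thesis using regular_L_nonzero_line[OF prim, of "Im s"] by simp
next
  case False
  have dc: "dirichlet_character q chi" using prim by (simp add: primitive_dirichlet_character_def)
  have "Re s > 1" "s \<noteq> 1" using False s by auto
  then show ?thesis using dirichlet_series_nonzero[OF completely_mult_char[OF dc]] by (simp add: regular_L_eq[OF prim])
qed

section \<open>Newman's Tauberian theorem\<close>

lemma powr_mvt:
  fixes x :: real
  assumes "m > 0" "x \<noteq> 0"
  shows "\<exists>\<xi>. m < \<xi> \<and> \<xi> < m + 1 \<and> (m + 1) powr x - m powr x = x * \<xi> powr (x - 1)"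
proof -
  have "\<exists>\<xi>. m < \<xi> \<and> \<xi> < m + 1 \<and> (m + 1) powr x - m powr x = (m + 1 - m) * (x * \<xi> powr (x - 1))"
    using assms by (intro MVT2) (auto intro!: derivative_eq_intros)
  then show ?thesis by simp
qed

text \<open>By the mean value theorem each term is at most a difference of consecutive values of
  \<open>n^(- x) / x\<close>, so the tail telescopes.\<close>

lemma powr_tail_bound:
  fixes x :: real
  assumes x: "x > 0" and N: "N \<ge> 1"
  shows "summable (\<lambda>n. real (Suc (n + N)) powr (- x - 1))"
    and "(\<Sum>n. real (Suc (n + N)) powr (- x - 1)) \<le> real N powr (- x) / x"
proof -
  have step: "real (Suc (n + N)) powr (- x - 1) \<le> real (n + N) powr (- x) / x - real (Suc n + N) powr (- x) / x" for n
  proof -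
    obtain \<xi> where \<xi>: "real (n + N) < \<xi>" "\<xi> < real (n + N) + 1"
      "(real (n + N) + 1) powr (- x) - real (n + N) powr (- x) = - x * \<xi> powr (- x - 1)"
      using powr_mvt[of "real (n + N)" "- x"] x N by auto
    have "real (Suc (n + N)) powr (- x - 1) \<le> \<xi> powr (- x - 1)"
      using \<xi> x by (intro powr_mono2') auto
    moreover have "real (n + N) powr (- x) - real (Suc n + N) powr (- x) = x * \<xi> powr (- x - 1)"
      using \<xi>(3) by (simp add: algebra_simps)
    ultimately show ?thesis using x by (simp add: diff_divide_distrib[symmetric])
  qed
  have lim: "(\<lambda>n. real (n + N) powr (- x) / x) \<longlonglongrightarrow> 0"
  proof -
    have "(\<lambda>n. real n powr (- x) / x) \<longlonglongrightarrow> 0" using x by real_asymp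
    then show ?thesis by (rule LIMSEQ_ignore_initial_segment)
  qed
  have tele: "(\<lambda>n. real (n + N) powr (- x) / x - real (Suc n + N) powr (- x) / x) sums (real N powr (- x) / x)"
    using telescope_sums'[OF lim] by simp
  show s: "summable (\<lambda>n. real (Suc (n + N)) powr (- x - 1))"
    using tele step by (intro summable_comparison_test'[OF sums_summable[OF tele], of 0]) auto
  show "(\<Sum>n. real (Suc (n + N)) powr (- x - 1)) \<le> real N powr (- x) / x"
    using suminf_le[OF step s sums_summable[OF tele]] tele by (simp add: sums_iff)
qed

text \<open>The same comparison with \<open>n^x / x\<close>. For \<open>x <= 1\<close> the terms do
  not increase and the first summand alone is a bound; for \<open>x > 1\<close> they increase, the
  comparison is off by one index, and the last term of the sum remains.\<close>

lemma powr_partial_sum_bound: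
  fixes x :: real
  assumes x: "x > 0" and N: "N \<ge> 1"
  shows "(\<Sum>n<N. real (Suc n) powr (x - 1)) \<le> real N powr x / x + real N powr (x - 1)"
proof (cases "x \<le> 1")
  case True
  have "(\<Sum>n<N. real (Suc n) powr (x - 1)) \<le> real N powr x / x"
  proof (induction N)
    case (Suc N)
    have "real (Suc N) powr (x - 1) \<le> (real (Suc N) powr x - real N powr x) / x"
    proof (cases "N = 0")
      case False
      then obtain \<xi> where \<xi>: "real N < \<xi>" "\<xi> < real N + 1" "(real N + 1) powr x - real N powr x = x * \<xi> powr (x - 1)"
        using powr_mvt[of "real N" x] x by auto
      have "real (Suc N) powr (x - 1) \<le> \<xi> powr (x - 1)" using \<xi> True by (intro powr_mono2') auto
      also have "\<dots> = (real (Suc N) powr x - real N powr x) / x" using \<xi>(3) x by (simp add: add.commute)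
      finally show ?thesis .
    qed (use x True in auto)
    then show ?case using Suc by (simp add: diff_divide_distrib)
  qed simp
  then show ?thesis by (simp add: add_increasing2)
next
  case False
  show ?thesis using N
  proof (induction N rule: dec_induct)
    case base
    then show ?case using x by simp
  next
    case (step N)
    then obtain \<xi> where \<xi>: "real N < \<xi>" "\<xi> < real N + 1" "(real N + 1) powr x - real N powr x = x * \<xi> powr (x - 1)"
      using powr_mvt[of "real N" x] x by auto
    have "real N powr (x - 1) \<le> \<xi> powr (x - 1)" using \<xi> False by (intro powr_mono2) auto
    also have "\<dots> = (real (Suc N) powr x - real N powr x) / x" using \<xi>(3) x by (simp add: add.commute)
    finally show ?case using step by (simp add: diff_divide_distrib)
  qed
qed

section \<open>Contours and kernel for Newman's argument\<close>

lemma contour_integral_part_circle_inverse: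
  assumes "R > 0" "s < t"
  shows "((\<lambda>z. 1 / z) has_contour_integral (\<i> * of_real (t - s))) (part_circlepath 0 R s t)"
proof -
  have "((\<lambda>x. 1 / (0 + of_real R * exp (\<i> * of_real x)) * of_real R * \<i> * exp (\<i> * of_real x)) has_integral (\<i> * of_real (t - s))) {s..t}"
  proof -
    have "((\<lambda>x::real. \<i>) has_integral (t - s) *\<^sub>R \<i>) {s..t}" using has_integral_const_real[of \<i> s t] assms by simp
    then show ?thesis using assms by (simp add: scaleR_conv_of_real mult.commute)
  qed
  then show ?thesis using assms by (subst has_contour_integral_part_circlepath_iff) (auto simp: mult_ac)
qed

text \<open>Cauchy's formula at \<open>0\<close> for a closed path made of two arcs, each of which contributes \<open>i \<pi>\<close>
  to the integral of \<open>1/z\<close>; this avoids winding numbers.\<close>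

lemma cauchy_formula_two_halves:
  assumes V: "open V" "convex V" "0 \<in> V" and G: "G holomorphic_on V"
    and g: "valid_path g1" "valid_path g2" "path_image g1 \<subseteq> V - {0}" "path_image g2 \<subseteq> V - {0}"
      "pathfinish g1 = pathstart g2" "pathfinish g2 = pathstart g1"
    and i: "((\<lambda>z. 1 / z) has_contour_integral (\<i> * pi)) g1" "((\<lambda>z. 1 / z) has_contour_integral (\<i> * pi)) g2"
  shows "contour_integral g1 (\<lambda>z. G z / z) + contour_integral g2 (\<lambda>z. G z / z) = 2 * \<i> * pi * G 0"
    and "(\<lambda>z. G z / z) contour_integrable_on g1" "(\<lambda>z. G z / z) contour_integrable_on g2"
proof -
  define Q where "Q = (\<lambda>z. if z = 0 then deriv G 0 else (G z - G 0) / (z - 0))"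
  have Q: "Q holomorphic_on V" unfolding Q_def by (rule pole_lemma_open[OF G V(1)])
  have vp: "valid_path (g1 +++ g2)" using g by simp
  have pi: "path_image (g1 +++ g2) \<subseteq> V" using g path_image_join[of g1 g2] by auto
  have Qi: "Q contour_integrable_on g1" "Q contour_integrable_on g2"
    using g by (auto intro!: contour_integrable_holomorphic_simple[OF Q V(1)])
  have "(Q has_contour_integral 0) (g1 +++ g2)"
    by (rule Cauchy_theorem_convex_simple[OF Q V(2) vp pi]) (use g in simp)
  then have 0: "contour_integral g1 Q + contour_integral g2 Q = 0"
    using contour_integral_unique contour_integral_join[OF Qi g(1,2)] by simp
  have part: "((\<lambda>z. G z / z) has_contour_integral (contour_integral \<gamma> Q + G 0 * (\<i> * pi))) \<gamma>"
    if \<gamma>: "path_image \<gamma> \<subseteq> V - {0}" "Q contour_integrable_on \<gamma>" "((\<lambda>z. 1 / z) has_contour_integral (\<i> * pi)) \<gamma>" for \<gamma>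
  proof -
    have "((\<lambda>z. Q z + G 0 * (1 / z)) has_contour_integral (contour_integral \<gamma> Q + G 0 * (\<i> * pi))) \<gamma>"
      by (intro has_contour_integral_add has_contour_integral_lmul \<gamma> has_contour_integral_integral)
    then show ?thesis
      by (rule has_contour_integral_eq) (use \<gamma>(1) in \<open>auto simp: Q_def diff_divide_distrib\<close>)
  qed
  note p1 = part[OF g(3) Qi(1) i(1)] and p2 = part[OF g(4) Qi(2) i(2)]
  show "contour_integral g1 (\<lambda>z. G z / z) + contour_integral g2 (\<lambda>z. G z / z) = 2 * \<i> * pi * G 0"
    unfolding contour_integral_unique[OF p1] contour_integral_unique[OF p2] using 0
    by (simp add: algebra_simps)
  show "(\<lambda>z. G z / z) contour_integrable_on g1" "(\<lambda>z. G z / z) contour_integrable_on g2"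
    using p1 p2 by (auto simp: contour_integrable_on_def)
qed

text \<open>In the interior of the segment the real part is negative, so the exponential tends to
  \<open>0\<close> pointwise, with modulus at most \<open>1\<close>. An end point may lie on the
  imaginary axis, which is why the integral is taken over the open interval.\<close>

lemma powr_segment_integral_tendsto_0:
  assumes g: "continuous_on (closed_segment a b) g" and ab: "Re a \<le> 0" "Re b \<le> 0" "Re a < 0 \<or> Re b < 0"
  shows "(\<lambda>N. contour_integral (linepath a b) (\<lambda>z. g z * exp (z * of_real (ln (real (Suc N)))))) \<longlonglongrightarrow> 0"
proof -
  define p where "p = (\<lambda>x::real. linepath a b x)"
  have pim: "p x \<in> closed_segment a b" if "x \<in> {0..1}" for x
    using that linepath_image_01[of a b] by (auto simp: p_def)
  have contp: "continuous_on A p" for A unfolding p_def by (rule continuous_on_linepath)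
  have cont: "continuous_on {0..1} (\<lambda>x. g (p x))"
    by (rule continuous_on_compose2[OF g contp]) (use pim in auto)
  then have "compact ((\<lambda>x. g (p x)) ` {0..1})" by (intro compact_continuous_image) auto
  then obtain M where M: "\<And>x. x \<in> {0..1} \<Longrightarrow> norm (g (p x)) \<le> M"
    by (metis bounded_iff compact_imp_bounded image_eqI)
  have M0: "M \<ge> 0" using order_trans[OF norm_ge_zero M[of 0]] by simp
  define f where "f = (\<lambda>N x. g (p x) * exp (p x * of_real (ln (real (Suc N)))) * (b - a))"
  have Rep: "Re (p x) = (1 - x) * Re a + x * Re b" for x by (simp add: p_def linepath_def)
  have Rep0: "Re (p x) \<le> 0" if "x \<in> {0..1}" for x
    using that ab by (auto simp: Rep intro!: add_nonpos_nonpos mult_nonneg_nonpos)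
  have Repneg: "Re (p x) < 0" if "x \<in> {0<..<1}" for x
  proof (cases "Re a < 0")
    case True
    have "(1 - x) * Re a < 0" using that True by (intro mult_pos_neg) auto
    moreover have "x * Re b \<le> 0" using that ab by (intro mult_nonneg_nonpos) auto
    ultimately show ?thesis unfolding Rep by linarith
  next
    case False
    have "x * Re b < 0" using that ab False by (intro mult_pos_neg) auto
    moreover have "(1 - x) * Re a \<le> 0" using that ab by (intro mult_nonneg_nonpos) auto
    ultimately show ?thesis unfolding Rep by linarith
  qed
  have fi: "f N integrable_on {0<..<1}" for N
  proof -
    have "f N integrable_on {0..1}"
      unfolding f_def by (intro integrable_continuous_interval continuous_intros cont contp)
    then show ?thesis by (simp add: integrable_on_Icc_iff_Ioo)
  qed
  have "(\<lambda>N. integral {0<..<1} (f N)) \<longlonglongrightarrow> integral {0<..<1} (\<lambda>_::real. 0 :: complex)"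
  proof (rule dominated_convergence(2)[OF fi])
    show "(\<lambda>_. M * norm (b - a)) integrable_on {0<..<1::real}"
      using integrable_const_ivl[of "M * norm (b - a)" 0 1] by (simp add: integrable_on_Icc_iff_Ioo[symmetric])
    show "norm (f N x) \<le> M * norm (b - a)" if x: "x \<in> {0<..<1}" for N x
    proof -
      have "norm (exp (p x * of_real (ln (real (Suc N))))) \<le> 1"
        using Rep0[of x] x by (simp add: mult_nonpos_nonneg)
      then have "norm (g (p x)) * norm (exp (p x * of_real (ln (real (Suc N))))) \<le> M * 1"
        using M[of x] M0 x by (intro mult_mono) auto
      then show ?thesis unfolding f_def norm_mult by (intro mult_right_mono) auto
    qed
    show "(\<lambda>N. f N x) \<longlonglongrightarrow> 0" if x: "x \<in> {0<..<1}" for x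
    proof -
      have r: "Re (p x) < 0" using Repneg[OF x] .
      have "(\<lambda>N. exp (Re (p x) * ln (real (Suc N)))) \<longlonglongrightarrow> 0"
        using r by real_asymp
      then have "(\<lambda>N. norm (exp (p x * of_real (ln (real (Suc N)))))) \<longlonglongrightarrow> 0" by simp
      then have "(\<lambda>N. exp (p x * of_real (ln (real (Suc N))))) \<longlonglongrightarrow> 0" by (rule tendsto_norm_zero_cancel)
      then have "(\<lambda>N. f N x) \<longlonglongrightarrow> g (p x) * 0 * (b - a)" unfolding f_def by (intro tendsto_intros)
      then show ?thesis by simp
    qed
  qed
  moreover have "contour_integral (linepath a b) (\<lambda>z. g z * exp (z * of_real (ln (real (Suc N))))) = integral {0<..<1} (f N)" for N
    unfolding contour_integral_integral integral_open_interval_real f_def p_def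
    by (intro integral_cong) (simp add: vector_derivative_linepath_within mult_ac)
  ultimately show ?thesis by simp
qed

text \<open>On the circle \<open>z^2 / R^2 = z / cnj z\<close>. This is Newman's kernel: it is real
  and proportional to \<open>Re z\<close>, which compensates the factor \<open>1 / Re z\<close> in
  the bounds for tails and partial sums.\<close>

lemma on_circle_identity:
  assumes "norm z = R" "R > 0"
  shows "(1 + z\<^sup>2 / (of_real R)\<^sup>2) / z = of_real (2 * Re z / R\<^sup>2)"
proof -
  have z0: "z \<noteq> 0" using assms by auto
  have "(of_real R)\<^sup>2 = z * cnj z" using assms complex_norm_square[of z] by simp
  then have "1 + z\<^sup>2 / (of_real R)\<^sup>2 = (z * cnj z + z * z) / (of_real R)\<^sup>2"
    using assms z0 by (simp add: field_simps power2_eq_square)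
  also have "z * cnj z + z * z = z * of_real (2 * Re z)"
    using complex_add_cnj[of z] by (simp add: ring_distribs[symmetric] add.commute)
  finally show ?thesis using z0 by simp
qed

text \<open>On the right half of a circle of radius \<open>R\<close> the error is a tail of the
  series, on the left half a partial sum, and each contributes \<open>O(1/R)\<close>. The
  continuation \<open>F\<close> is integrated along a path just to the left of the imaginary axis,
  where the factor \<open>exp (z ln N)\<close> makes the integral tend to \<open>0\<close>. Finally
  \<open>R\<close> is arbitrary.\<close>

theorem newman_tauberian:
  fixes a :: "nat \<Rightarrow> complex"
  assumes a: "\<And>n. norm (a n) \<le> 1" and U: "open U" "{s. Re s \<ge> 1} \<subseteq> U" and F: "F holomorphic_on U"
    and eq: "\<And>s. Re s > 1 \<Longrightarrow> F s = dirichlet_series a s"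
  shows "(\<lambda>n. a (Suc n) / of_nat (Suc n)) sums F 1"
proof -
  define S where "S = (\<lambda>n. \<Sum>m<Suc n. a (Suc m) / of_nat (Suc m))"
  have main: "\<exists>E :: nat \<Rightarrow> complex. E \<longlonglongrightarrow> 0 \<and> (\<forall>n. norm (F 1 - S n) \<le> 2 / R + 1 / real (Suc n) + norm (E n))" if R: "R > 0" for R :: real
  proof -
    define U' where "U' = {z. 1 + z \<in> U}"
    have oU': "open U'" unfolding U'_def using U(1) by (intro open_vimage[unfolded vimage_def] continuous_intros)
    have U'0: "z \<in> U'" if "Re z \<ge> 0" for z using that U(2) by (auto simp: U'_def)
    have "closed_segment (- \<i> * of_real (R + 1)) (\<i> * of_real (R + 1)) \<subseteq> U'"
      by (auto simp: closed_segment_def intro!: U'0)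
    then obtain e where e: "e > 0" "(\<Union>x\<in>closed_segment (- \<i> * of_real (R + 1)) (\<i> * of_real (R + 1)). ball x e) \<subseteq> U'"
      by (rule compact_subset_open_imp_ball_epsilon_subset[OF compact_segment oU'])
    \<comment> \<open>The box \<open>V\<close> extends to real part
      \<open>- 2 \<delta> = - e\<close>, within the neighbourhood of the segment, while the vertical
      side of \<open>B\<close> runs at \<open>- \<delta>\<close>, well inside.\<close>
    define \<delta> where "\<delta> = e / 2"
    have \<delta>: "\<delta> > 0" using e by (simp add: \<delta>_def)
    define V where "V = {z. - 2 * \<delta> < Re z} \<inter> {z. Im z < R + 1} \<inter> {z. - (R + 1) < Im z}"
    have V: "open V" "convex V" "0 \<in> V"
      using \<delta> R by (auto simp: V_def open_halfspace_Re_gt open_halfspace_Im_lt open_halfspace_Im_gt convex_halfspace_Re_gt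
          convex_halfspace_Im_lt convex_halfspace_Im_gt intro!: convex_Int open_Int)
    have VU: "V \<subseteq> U'"
    proof
      fix z assume z: "z \<in> V"
      show "z \<in> U'"
      proof (cases "Re z \<ge> 0")
        case False
        define u where "u = (Im z / (R + 1) + 1) / 2"
        have u: "0 \<le> u" "u \<le> 1" using z R by (auto simp: u_def V_def field_simps)
        have "\<i> * of_real (Im z) = (1 - u) *\<^sub>R (- \<i> * of_real (R + 1)) + u *\<^sub>R (\<i> * of_real (R + 1))"
        proof -
          define v where "v = Im z / (R + 1)"
          have "2 * u - 1 = v" by (simp add: u_def v_def[symmetric] add_divide_distrib)
          then have "Im z = (R + 1) * (2 * u - 1)" using R by (simp add: v_def)
          then have "Im z = (1 - u) * - (R + 1) + u * (R + 1)" by (simp add: algebra_simps)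
          then show ?thesis by (simp add: complex_eq_iff algebra_simps)
        qed
        then have "\<i> * of_real (Im z) \<in> closed_segment (- \<i> * of_real (R + 1)) (\<i> * of_real (R + 1))"
          using u unfolding closed_segment_def by blast
        moreover have "z \<in> ball (\<i> * of_real (Im z)) e"
        proof -
          have "\<i> * of_real (Im z) - z = of_real (- Re z)" by (simp add: complex_eq_iff)
          then show ?thesis using z False by (simp add: dist_norm V_def \<delta>_def del: of_real_minus)
        qed
        ultimately show ?thesis using e(2) by blast
      qed (rule U'0)
    qed
    define A where "A = part_circlepath 0 R (- (pi / 2)) (pi / 2)"
    define A' where "A' = part_circlepath 0 R (pi / 2) (3 / 2 * pi)"
    define p1 where "p1 = \<i> * complex_of_real R"
    define p2 where "p2 = - complex_of_real \<delta> + \<i> * complex_of_real R"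
    define p3 where "p3 = - complex_of_real \<delta> - \<i> * complex_of_real R"
    define p4 where "p4 = - (\<i> * complex_of_real R)"
    define B where "B = linepath p1 p2 +++ linepath p2 p3 +++ linepath p3 p4"
    have ends: "pathstart A = p4" "pathfinish A = p1" "pathstart A' = p1" "pathfinish A' = p4"
      using sin_3over2_pi cos_3over2_pi
      by (simp_all add: A_def A'_def p1_def p4_def complex_eq_iff Re_exp Im_exp)
    have endsB: "pathstart B = p1" "pathfinish B = p4" by (simp_all add: B_def)
    have imA: "norm z = R" "Re z \<ge> 0" if zA: "z \<in> path_image A" for z
    proof -
      obtain x where x: "z = of_real R * cis x" "- (pi / 2) \<le> x" "x \<le> pi / 2"
      proof -
        have "z \<in> (\<lambda>x. 0 + of_real R * cis x) ` closed_segment (- (pi / 2)) (pi / 2)"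
          using zA unfolding A_def path_image_part_circlepath' .
        then obtain x where "x \<in> closed_segment (- (pi / 2)) (pi / 2)" "z = of_real R * cis x" by auto
        then show ?thesis using that[of x] by (simp add: closed_segment_eq_real_ivl split: if_splits)
      qed
      show "norm z = R" using x R by (simp add: norm_mult)
      show "Re z \<ge> 0" using x R cos_ge_zero[of x] by simp
    qed
    have imA': "norm z = R" "Re z \<le> 0" if zA: "z \<in> path_image A'" for z
    proof -
      obtain x where x: "z = of_real R * cis x" "pi / 2 \<le> x" "x \<le> 3 / 2 * pi"
      proof -
        have "z \<in> (\<lambda>x. 0 + of_real R * cis x) ` closed_segment (pi / 2) (3 / 2 * pi)"
          using zA unfolding A'_def path_image_part_circlepath' .
        then obtain x where "x \<in> closed_segment (pi / 2) (3 / 2 * pi)" "z = of_real R * cis x" by auto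
        then show ?thesis using that[of x] by (simp add: closed_segment_eq_real_ivl split: if_splits)
      qed
      show "norm z = R" using x R by (simp add: norm_mult)
      have "cos (x - pi) \<ge> 0" using x by (intro cos_ge_zero) auto
      then show "Re z \<le> 0" using x R by (simp add: mult_nonneg_nonpos)
    qed
    have segs: "closed_segment p1 p2 \<subseteq> V - {z. z \<in> \<real>\<^sub>\<ge>\<^sub>0}" "closed_segment p2 p3 \<subseteq> V - {z. z \<in> \<real>\<^sub>\<ge>\<^sub>0}" "closed_segment p3 p4 \<subseteq> V - {z. z \<in> \<real>\<^sub>\<ge>\<^sub>0}"
    proof -
      define W where "W = {z. - \<delta> \<le> Re z} \<inter> {z. Re z \<le> 0} \<inter> {z. Im z \<le> R} \<inter> {z. - R \<le> Im z}"
      have "convex W" unfolding W_def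
        by (intro convex_Int convex_halfspace_Re_ge convex_halfspace_Re_le convex_halfspace_Im_le convex_halfspace_Im_ge)
      moreover have "W \<subseteq> V" using \<delta> by (auto simp: W_def V_def)
      moreover have "{p1, p2, p3, p4} \<subseteq> W" using \<delta> R by (auto simp: W_def p1_def p2_def p3_def p4_def)
      ultimately have 1: "closed_segment p1 p2 \<subseteq> V" "closed_segment p2 p3 \<subseteq> V" "closed_segment p3 p4 \<subseteq> V"
        by (meson closed_segment_subset insert_subset order_trans)+
      have "closed_segment p1 p2 \<subseteq> {z. Im z > 0}"
        by (rule closed_segment_subset[OF _ _ convex_halfspace_Im_gt]) (use \<delta> R in \<open>auto simp: p1_def p2_def\<close>)
      moreover have "closed_segment p2 p3 \<subseteq> {z. Re z < 0}"
        by (rule closed_segment_subset[OF _ _ convex_halfspace_Re_lt]) (use \<delta> R in \<open>auto simp: p2_def p3_def\<close>)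
      moreover have "closed_segment p3 p4 \<subseteq> {z. Im z < 0}"
        by (rule closed_segment_subset[OF _ _ convex_halfspace_Im_lt]) (use \<delta> R in \<open>auto simp: p3_def p4_def\<close>)
      ultimately
      show "closed_segment p1 p2 \<subseteq> V - {z. z \<in> \<real>\<^sub>\<ge>\<^sub>0}" "closed_segment p2 p3 \<subseteq> V - {z. z \<in> \<real>\<^sub>\<ge>\<^sub>0}" "closed_segment p3 p4 \<subseteq> V - {z. z \<in> \<real>\<^sub>\<ge>\<^sub>0}"
        using 1 by (force simp: complex_nonneg_Reals_iff)+
    qed
    have imB: "path_image B \<subseteq> V - {z. z \<in> \<real>\<^sub>\<ge>\<^sub>0}"
      unfolding B_def using segs by (auto simp: path_image_join)
    have vB: "valid_path B" unfolding B_def by simp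
    have iB: "((\<lambda>z. 1 / z) has_contour_integral (\<i> * of_real pi)) B"
    proof -
      \<comment> \<open>The path \<open>B\<close> avoids the nonnegative real axis, so
        \<open>Ln (- z)\<close> is a primitive along it; its change from \<open>i R\<close> to
        \<open>- i R\<close> is \<open>i pi\<close>.\<close>
      have "((\<lambda>z. 1 / z) has_contour_integral (Ln (- pathfinish B) - Ln (- pathstart B))) B"
      proof (rule contour_integral_primitive[where S = "- {z. z \<in> \<real>\<^sub>\<ge>\<^sub>0}" and f = "\<lambda>z. Ln (- z)"])
        show "((\<lambda>z. Ln (- z)) has_field_derivative 1 / z) (at z within - {z. z \<in> \<real>\<^sub>\<ge>\<^sub>0})" if "z \<in> - {z. z \<in> \<real>\<^sub>\<ge>\<^sub>0}" for z
        proof -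
          have "- z \<notin> \<real>\<^sub>\<le>\<^sub>0" "z \<noteq> 0" using that by (auto simp: complex_nonneg_Reals_iff complex_nonpos_Reals_iff)
          then show ?thesis by (auto intro!: derivative_eq_intros simp: divide_simps)
        qed
      qed (use vB imB in auto)
      moreover have "Ln (\<i> * of_real R) = of_real (ln R) + \<i> * of_real (pi / 2)"
        using R Ln_times_of_real[of R \<i>] by (simp add: mult.commute Ln_of_real)
      moreover have "Ln (- (\<i> * of_real R)) = of_real (ln R) - \<i> * of_real (pi / 2)"
        using R Ln_times_of_real[of R "- \<i>"] by (simp add: mult.commute Ln_of_real)
      ultimately show ?thesis by (simp add: endsB p1_def p4_def)
    qed
    have iA: "((\<lambda>z. 1 / z) has_contour_integral (\<i> * of_real pi)) A"
      using contour_integral_part_circle_inverse[OF R, of "- (pi / 2)" "pi / 2"] by (simp add: A_def)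
    have iA': "((\<lambda>z. 1 / z) has_contour_integral (\<i> * of_real pi)) A'"
    proof -
      have *: "3 / 2 * pi - pi / 2 = pi" by simp
      show ?thesis using contour_integral_part_circle_inverse[OF R, of "pi / 2" "3 / 2 * pi"] unfolding A'_def * by simp
    qed
    have vA: "valid_path A" "valid_path A'" by (simp_all add: A_def A'_def)
    have imAV: "path_image A \<subseteq> V - {0}"
    proof
      fix z assume "z \<in> path_image A"
      note z = imA[OF this]
      show "z \<in> V - {0}" using z \<delta> R abs_Im_le_cmod[of z] by (auto simp: V_def)
    qed
    have imA0: "path_image A \<subseteq> UNIV - {0}" "path_image A' \<subseteq> UNIV - {0}"
      using imA(1) imA'(1) R by force+
    define h where "h = (\<lambda>z. F (1 + z))"
    have h: "h holomorphic_on V"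
      unfolding h_def using VU by (intro holomorphic_on_compose_gen[OF _ F, unfolded comp_def] holomorphic_intros) (auto simp: U'_def)
    define L where "L = (\<lambda>n. complex_of_real (ln (real (Suc n))))"
    define c where "c = (\<lambda>z. 1 + z\<^sup>2 / (complex_of_real R)\<^sup>2)"
    define G where "G = (\<lambda>n z. h z * exp (z * L n) * c z)"
    define P where "P = (\<lambda>n z. \<Sum>m<Suc n. a (Suc m) * of_nat (Suc m) powr (- (1 + z)))"
    \<comment> \<open>The truncated series is entire, so its contour may be closed by the whole left
      semicircle, whereas the contour of \<open>G\<close> has to stay inside
      \<open>V\<close>.\<close>
    define s where "s = (\<lambda>n z. P n z * exp (z * L n) * c z)"
    have Gh: "G n holomorphic_on V" for n unfolding G_def c_def using R by (intro holomorphic_intros h) auto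
    have sh: "s n holomorphic_on UNIV" for n unfolding s_def P_def c_def using R by (intro holomorphic_intros) auto
    have imBV: "path_image B \<subseteq> V - {0}" using imB by auto
    note cG = cauchy_formula_two_halves[OF V Gh vA(1) vB imAV imBV _ _ iA iB, unfolded ends endsB, OF refl refl]
    note cs = cauchy_formula_two_halves[OF open_UNIV convex_UNIV UNIV_I sh vA imA0 _ _ iA iA', unfolded ends, OF refl refl]
    have G0: "G n 0 = F 1" "s n 0 = S n" for n
      by (auto simp: G_def s_def h_def c_def P_def S_def powr_minus divide_inverse simp del: of_nat_Suc sum.lessThan_Suc)
    have nexp: "norm (exp (z * L n)) = real (Suc n) powr (Re z)" for z n
      by (simp add: L_def powr_def del: of_nat_Suc)
    \<comment> \<open>With \<open>N = n + 1\<close> and \<open>x = Re z\<close>, the tail is at most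
      \<open>N^(- x) / x\<close>. The power is cancelled by the modulus \<open>N^x\<close> of the
      exponential and the factor \<open>1 / x\<close> by the kernel
      \<open>2 x / R^2\<close>.\<close>
    have bA: "norm (G n z / z - s n z / z) \<le> 2 / R\<^sup>2" if z: "z \<in> path_image A" for n z
    proof -
      have "G n z / z - s n z / z = (h z - P n z) * exp (z * L n) * (c z / z)" by (simp add: G_def s_def algebra_simps diff_divide_distrib)
      also have "c z / z = of_real (2 * Re z / R\<^sup>2)" unfolding c_def by (rule on_circle_identity[OF imA(1)[OF z] R])
      finally have e: "norm (G n z / z - s n z / z) = norm (h z - P n z) * real (Suc n) powr (Re z) * (2 * Re z / R\<^sup>2)"
        using imA(2)[OF z] by (simp only: norm_mult nexp norm_of_real) simp
      show ?thesis
      proof (cases "Re z = 0")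
        case False
        then have x: "Re z > 0" using imA(2)[OF z] by simp
        define t where "t = (\<lambda>m. a (Suc m) * of_nat (Suc m) powr (- (1 + z)))"
        have ts: "summable (\<lambda>m. norm (t m))" unfolding t_def by (rule dirichlet_series_abs_summable[OF a]) (use x in simp)
        have nt: "norm (t m) \<le> real (Suc m) powr (- Re z - 1)" for m
        proof -
          have "Re (- (1 + z)) = - Re z - 1" by simp
          then have "norm (t m) = norm (a (Suc m)) * real (Suc m) powr (- Re z - 1)"
            unfolding t_def norm_mult norm_nat_powr by (simp only:)
          then show ?thesis using mult_right_mono[OF a[of "Suc m"], of "real (Suc m) powr (- Re z - 1)"] by simp
        qed
        have "h z = suminf t" unfolding h_def t_def using eq[of "1 + z"] x by (simp add: dirichlet_series_def)
        then have "h z - P n z = (\<Sum>m. t (m + Suc n))"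
          unfolding P_def using suminf_minus_initial_segment[OF summable_norm_cancel[OF ts], of "Suc n"] by (simp add: t_def del: of_nat_Suc sum.lessThan_Suc)
        also have "norm \<dots> \<le> (\<Sum>m. norm (t (m + Suc n)))"
          by (intro summable_norm summable_ignore_initial_segment ts)
        also have "\<dots> \<le> (\<Sum>m. real (Suc (m + Suc n)) powr (- Re z - 1))"
          by (intro suminf_le nt summable_ignore_initial_segment[OF ts] powr_tail_bound(1)[OF x]) auto
        also have "\<dots> \<le> real (Suc n) powr (- Re z) / Re z" by (rule powr_tail_bound(2)[OF x]) simp
        finally have "norm (h z - P n z) \<le> real (Suc n) powr (- Re z) / Re z" .
        then have "norm (G n z / z - s n z / z) \<le> real (Suc n) powr (- Re z) / Re z * real (Suc n) powr (Re z) * (2 * Re z / R\<^sup>2)"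
          unfolding e using x by (intro mult_right_mono) auto
        also have "\<dots> = (real (Suc n) powr (- Re z) * real (Suc n) powr (Re z)) * (2 / R\<^sup>2)" using x by simp
        also have "real (Suc n) powr (- Re z) * real (Suc n) powr (Re z) = 1" by (simp add: powr_add[symmetric])
        finally show ?thesis by simp
      qed (subst e, simp)
    qed
    \<comment> \<open>The same cancellation with \<open>x = - Re z\<close>; the second summand of
      the partial sum bound leaves the extra \<open>2 / (R N)\<close>, where
      \<open>N = n + 1\<close>.\<close>
    have bA': "norm (s n z / z) \<le> 2 / R\<^sup>2 + 2 / (R * real (Suc n))" if z: "z \<in> path_image A'" for n z
    proof -
      define x where "x = - Re z"
      have "s n z / z = P n z * exp (z * L n) * (c z / z)" by (simp add: s_def)
      also have "c z / z = of_real (2 * Re z / R\<^sup>2)" unfolding c_def by (rule on_circle_identity[OF imA'(1)[OF z] R])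
      finally have e: "norm (s n z / z) = norm (P n z) * real (Suc n) powr (- x) * (2 * x / R\<^sup>2)"
        using imA'(2)[OF z] by (simp only: norm_mult nexp norm_of_real) (simp add: x_def abs_mult)
      show ?thesis
      proof (cases "x = 0")
        case False
        then have x: "x > 0" using imA'(2)[OF z] by (simp add: x_def)
        have xR: "x \<le> R" using abs_Re_le_cmod[of z] imA'(1)[OF z] by (simp add: x_def)
        let ?N = "real (Suc n)"
        have "norm (P n z) \<le> (\<Sum>m<Suc n. real (Suc m) powr (x - 1))"
          unfolding P_def
        proof (rule sum_norm_le)
          fix m assume "m \<in> {..<Suc n}"
          show "norm (a (Suc m) * of_nat (Suc m) powr (- (1 + z))) \<le> real (Suc m) powr (x - 1)"
          proof -
            have "Re (- (1 + z)) = x - 1" by (simp add: x_def)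
            then have "norm (a (Suc m) * of_nat (Suc m) powr (- (1 + z))) = norm (a (Suc m)) * real (Suc m) powr (x - 1)"
              unfolding norm_mult norm_nat_powr by (simp only:)
            then show ?thesis using mult_right_mono[OF a[of "Suc m"], of "real (Suc m) powr (x - 1)"] by simp
          qed
        qed
        also have "\<dots> \<le> ?N powr x / x + ?N powr (x - 1)" by (rule powr_partial_sum_bound[OF x]) simp
        finally have "norm (s n z / z) \<le> (?N powr x / x + ?N powr (x - 1)) * ?N powr (- x) * (2 * x / R\<^sup>2)"
          unfolding e using x by (intro mult_right_mono) auto
        also have "\<dots> = ((?N powr x * ?N powr (- x)) / x + ?N powr (x - 1) * ?N powr (- x)) * (2 * x / R\<^sup>2)"
          by (simp add: ring_distribs del: of_nat_Suc)
        also have "?N powr x * ?N powr (- x) = 1" by (subst powr_add[symmetric]) simp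
        also have "?N powr (x - 1) * ?N powr (- x) = 1 / ?N"
        proof -
          have "?N powr (x - 1) * ?N powr (- x) = ?N powr (-1)" by (subst powr_add[symmetric]) simp
          then show ?thesis by (simp add: powr_minus_divide del: of_nat_Suc)
        qed
        also have "(1 / x + 1 / ?N) * (2 * x / R\<^sup>2) = 2 / R\<^sup>2 + 2 * x / (?N * R\<^sup>2)" using x by (simp add: ring_distribs add_divide_distrib del: of_nat_Suc)
        also have "2 * x / (?N * R\<^sup>2) \<le> 2 * R / (?N * R\<^sup>2)" using xR R by (intro divide_right_mono) auto
        also have "2 * R / (?N * R\<^sup>2) = 2 / (R * ?N)" using R by (simp add: power2_eq_square del: of_nat_Suc)
        finally show ?thesis by simp
      qed (subst e, use R in simp)
    qed
    define E where "E = (\<lambda>n. contour_integral B (\<lambda>z. G n z / z))"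
    have "E \<longlonglongrightarrow> 0"
    proof -
      define g where "g = (\<lambda>z. h z * c z / z)"
      have Gg: "G n z / z = g z * exp (z * of_real (ln (real (Suc n))))" for n z by (simp add: G_def g_def L_def mult_ac)
      have hc: "continuous_on V h" by (rule holomorphic_on_imp_continuous_on[OF h])
      have gc: "continuous_on W g" if "W \<subseteq> V - {z. z \<in> \<real>\<^sub>\<ge>\<^sub>0}" for W
        unfolding g_def c_def using that R by (intro continuous_intros continuous_on_subset[OF hc]) auto
      have int: "(\<lambda>z. G n z / z) contour_integrable_on linepath p p'" if "closed_segment p p' \<subseteq> V - {z. z \<in> \<real>\<^sub>\<ge>\<^sub>0}" for n p p'
        unfolding Gg by (intro contour_integrable_continuous_linepath continuous_intros gc that)
      have "E = (\<lambda>n. contour_integral (linepath p1 p2) (\<lambda>z. g z * exp (z * of_real (ln (real (Suc n)))))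
          + (contour_integral (linepath p2 p3) (\<lambda>z. g z * exp (z * of_real (ln (real (Suc n)))))
          + contour_integral (linepath p3 p4) (\<lambda>z. g z * exp (z * of_real (ln (real (Suc n)))))))"
        unfolding E_def B_def Gg[symmetric] using int[OF segs(1)] int[OF segs(2)] int[OF segs(3)] by (simp add: fun_eq_iff)
      moreover have "\<dots> \<longlonglongrightarrow> 0 + (0 + 0)"
        using \<delta> by (intro tendsto_add powr_segment_integral_tendsto_0 gc segs) (auto simp: p1_def p2_def p3_def p4_def)
      ultimately show ?thesis by simp
    qed
    moreover have "norm (F 1 - S n) \<le> 2 / R + 1 / real (Suc n) + norm (E n)" for n
    proof -
      have iGs: "((\<lambda>z. G n z / z - s n z / z) has_contour_integral (contour_integral A (\<lambda>z. G n z / z) - contour_integral A (\<lambda>z. s n z / z))) A"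
        by (intro has_contour_integral_diff has_contour_integral_integral cG cs)
      have 1: "norm (contour_integral A (\<lambda>z. G n z / z) - contour_integral A (\<lambda>z. s n z / z)) \<le> 2 / R\<^sup>2 * R * (pi / 2 - (- (pi / 2)))"
        by (rule has_contour_integral_bound_part_circlepath[OF iGs[unfolded A_def], folded A_def]) (use R bA in auto)
      have 2: "norm (contour_integral A' (\<lambda>z. s n z / z)) \<le> (2 / R\<^sup>2 + 2 / (R * real (Suc n))) * R * (3 / 2 * pi - pi / 2)"
        by (rule has_contour_integral_bound_part_circlepath[OF has_contour_integral_integral[OF cs(3)[unfolded A'_def]], folded A'_def]) (use R bA' in auto)
      define X where "X = contour_integral A (\<lambda>z. G n z / z) - contour_integral A (\<lambda>z. s n z / z)"
      define Y where "Y = contour_integral A' (\<lambda>z. s n z / z)"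
      have eq: "2 * \<i> * pi * (F 1 - S n) = X + E n - Y"
        using cG(1)[of n] cs(1)[of n] unfolding G0 E_def X_def Y_def by (simp add: algebra_simps)
      have "norm (2 * \<i> * pi * (F 1 - S n)) \<le> norm X + norm (E n) + norm Y"
        unfolding eq using norm_triangle_ineq4[of "X + E n" Y] norm_triangle_ineq[of X "E n"] by linarith
      also have "\<dots> \<le> 2 / R\<^sup>2 * R * (pi / 2 - (- (pi / 2))) + norm (E n) + (2 / R\<^sup>2 + 2 / (R * real (Suc n))) * R * (3 / 2 * pi - pi / 2)"
        using 1 2 unfolding X_def[symmetric] Y_def[symmetric] by (intro add_mono order_refl)
      also have "2 / R\<^sup>2 * R * (pi / 2 - (- (pi / 2))) = 2 * pi * (1 / R)" using R by (simp add: power2_eq_square)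
      also have "(2 / R\<^sup>2 + 2 / (R * real (Suc n))) * R * (3 / 2 * pi - pi / 2) = 2 * pi * (1 / R + 1 / real (Suc n))"
      proof -
        have "(2 / R\<^sup>2 + 2 / (R * N)) * R * (3 / 2 * pi - pi / 2) = 2 * pi * (1 / R + 1 / N)" if "N > 0" for N
          using R that by (simp add: power2_eq_square field_simps)
        then show ?thesis by (simp del: of_nat_Suc)
      qed
      also have "norm (2 * \<i> * pi * (F 1 - S n)) = 2 * pi * norm (F 1 - S n)" by (simp add: norm_mult)
      finally have "2 * pi * norm (F 1 - S n) \<le> 2 * pi * (2 / R + 1 / real (Suc n)) + norm (E n)" by (simp add: algebra_simps)
      also have "\<dots> \<le> 2 * pi * (2 / R + 1 / real (Suc n)) + 2 * pi * norm (E n)"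
        using pi_ge_two mult_right_mono[of 1 "2 * pi" "norm (E n)"] by simp
      also have "\<dots> = 2 * pi * (2 / R + 1 / real (Suc n) + norm (E n))" by (simp only: ring_distribs)
      finally show ?thesis by (rule mult_left_le_imp_le) simp
    qed
    ultimately show ?thesis by blast
  qed
  have "S \<longlonglongrightarrow> F 1"
  proof (rule LIMSEQ_I)
    fix r :: real assume r: "r > 0"
    \<comment> \<open>With \<open>R = 6 / r\<close> the term \<open>2 / R\<close> is
      \<open>r / 3\<close>; the terms that tend to \<open>0\<close> are kept below
      \<open>r / 2\<close>, and \<open>r / 3 + r / 2 < r\<close>.\<close>
    obtain E :: "nat \<Rightarrow> complex" where E: "E \<longlonglongrightarrow> 0" "\<And>n. norm (F 1 - S n) \<le> 2 / (6 / r) + 1 / real (Suc n) + norm (E n)"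
      using main[of "6 / r"] r by auto
    have "(\<lambda>n. 1 / real (Suc n) + norm (E n)) \<longlonglongrightarrow> 0 + 0"
      by (intro tendsto_add LIMSEQ_Suc[OF lim_1_over_n] tendsto_norm_zero E)
    then have "\<forall>\<^sub>F n in sequentially. 1 / real (Suc n) + norm (E n) < r / 2"
      using r by (intro order_tendstoD(2)[of _ 0]) auto
    then have "\<forall>\<^sub>F n in sequentially. norm (S n - F 1) < r"
    proof eventually_elim
      case (elim n)
      then show ?case using E(2)[of n] r by (simp add: norm_minus_commute)
    qed
    then show "\<exists>no. \<forall>n\<ge>no. norm (S n - F 1) < r" by (simp add: eventually_sequentially)
  qed
  then show ?thesis unfolding sums_def S_def by (rule LIMSEQ_imp_Suc)
qed

section \<open>The reciprocal of the L-function\<close>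

text \<open>For \<open>q = 1\<close> the numerator \<open>s - 1\<close> makes the function
  holomorphic at \<open>1\<close> with value \<open>0\<close>, as befits the reciprocal of a
  pole.\<close>

definition recip_L :: "nat \<Rightarrow> (int \<Rightarrow> complex) \<Rightarrow> complex \<Rightarrow> complex" where
  "recip_L q chi s = (s - 1) ^ pole_order q / regular_L q chi s"

lemma recip_L_eq:
  assumes prim: "primitive_dirichlet_character q chi" and s: "Re s > 1"
  shows "recip_L q chi s = dirichlet_series (\<lambda>n. chi (int n) * of_int (moebius n)) s"
proof -
  have dc: "dirichlet_character q chi" using prim by (simp add: primitive_dirichlet_character_def)
  define A where "A = dirichlet_series (\<lambda>n. chi (int n) * of_int (moebius n)) s"
  define B where "B = dirichlet_series (\<lambda>n. chi (int n)) s"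
  have AB: "A * B = 1" unfolding A_def B_def by (rule dirichlet_series_moebius[OF completely_mult_char[OF dc] s])
  then have "B \<noteq> 0" "A = 1 / B" by (auto simp: eq_divide_eq)
  moreover have "s - 1 \<noteq> 0" using s by auto
  ultimately show ?thesis unfolding recip_L_def regular_L_eq[OF prim s] A_def[symmetric] B_def[symmetric] by simp
qed

lemma norm_moebius_char_le:
  assumes prim: "primitive_dirichlet_character q chi"
  shows "norm (chi (int n) * of_int (moebius n)) \<le> 1"
proof -
  have dc: "dirichlet_character q chi" using prim by (simp add: primitive_dirichlet_character_def)
  have "norm (of_int (moebius n) :: complex) \<le> 1" using abs_moebius_le[of n] by simp
  then show ?thesis
    using norm_char_le[OF dc, of "int n"] mult_mono[of "norm (chi (int n))" 1 "norm (of_int (moebius n) :: complex)" 1] by (simp add: norm_mult)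
qed

lemma holomorphic_recip_L:
  assumes prim: "primitive_dirichlet_character q chi" and nz: "\<And>s. s \<in> A \<Longrightarrow> regular_L q chi s \<noteq> 0"
  shows "recip_L q chi holomorphic_on A"
  unfolding recip_L_def[abs_def] using nz by (intro holomorphic_intros holomorphic_regular_L[OF prim])

text \<open>For \<open>k > 1\<close> the convergence is absolute. At \<open>k = 1\<close> Newman's
  theorem applies on the open set where \<open>regular_L\<close> does not vanish, which contains the
  closed half-plane \<open>Re s >= 1\<close>.\<close>

theorem moebius_series_sums:
  assumes prim: "primitive_dirichlet_character q chi" and k: "k \<ge> (1::real)"
  shows "(\<lambda>n. chi (int (Suc n)) * of_int (moebius (Suc n)) * of_real (real (Suc n) powr (- k))) sums recip_L q chi (of_real k)"
proof -
  have eq: "complex_of_real (real (Suc n) powr (- k)) = of_nat (Suc n) powr (- of_real k)" for n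
    using powr_of_real[of "real (Suc n)" "- k"] by (simp del: of_nat_Suc)
  show ?thesis
  proof (cases "k = 1")
    case False
    then have "Re (of_real k) > 1" using k by simp
    then show ?thesis
      using dirichlet_convergent_sums[OF dirichlet_convergent_bounded[OF norm_moebius_char_le[OF prim]]]
      unfolding eq by (simp only: recip_L_eq[OF prim])
  next
    case True
    define U where "U = {s. regular_L q chi s \<noteq> 0}"
    have "open U"
    proof -
      have "U = regular_L q chi -` (- {0})" by (auto simp: U_def)
      then show ?thesis
        using holomorphic_on_imp_continuous_on[OF holomorphic_regular_L[OF prim, of UNIV]]
        by (auto intro!: open_vimage)
    qed
    moreover have "{s. Re s \<ge> 1} \<subseteq> U" using regular_L_nonzero_ge_1[OF prim] by (auto simp: U_def)
    moreover have "recip_L q chi holomorphic_on U" by (rule holomorphic_recip_L[OF prim]) (simp add: U_def)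
    ultimately have "(\<lambda>n. chi (int (Suc n)) * of_int (moebius (Suc n)) / of_nat (Suc n)) sums recip_L q chi 1"
      by (rule newman_tauberian[OF norm_moebius_char_le[OF prim] _ _ _ recip_L_eq[OF prim]])
    moreover have "real (Suc n) powr (- k) = 1 / real (Suc n)" for n using True by (simp add: powr_minus_divide)
    ultimately show ?thesis using True by (simp add: divide_inverse del: of_nat_Suc)
  qed
qed

section \<open>The function P as a power series\<close>

lemma exp_minus_one_has_sum:
  "((\<lambda>m. z ^ Suc m / fact (Suc m)) has_sum (exp z - 1)) (UNIV :: nat set)" for z :: complex
proof (rule norm_summable_imp_has_sum)
  have s: "(\<lambda>m. z ^ m / fact m) sums exp z" using exp_converges[of z] by (simp add: scaleR_conv_of_real field_simps)
  then show "(\<lambda>m. z ^ Suc m / fact (Suc m)) sums (exp z - 1)" using sums_Suc_iff[of "\<lambda>m. z ^ m / fact m" "exp z - 1"] by simp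
  have "summable (\<lambda>m. norm (z ^ m /\<^sub>R fact m))" by (rule summable_norm_exp)
  then have "summable (\<lambda>m. norm (z ^ m / fact m))" by (simp add: norm_mult norm_inverse divide_inverse mult.commute)
  then show "summable (\<lambda>m. norm (z ^ Suc m / fact (Suc m)))" by (subst summable_Suc_iff)
qed

text \<open>Subtracting \<open>1\<close> from the exponential gains a factor \<open>y n\<close>, so
  the double series over \<open>n\<close> and the positive powers converges absolutely although the
  series of \<open>t\<close> itself need not. Its two iterated sums therefore agree.\<close>

lemma double_exponential_series:
  fixes t :: "nat \<Rightarrow> complex" and y :: "nat \<Rightarrow> real"
  assumes y: "\<And>n. 0 \<le> y n" "\<And>n. y n \<le> 1" and s: "summable (\<lambda>n. norm (t n) * y n)"
  shows "\<exists>S. (\<lambda>n. t n * (exp (of_real (x * y n)) - 1)) sums S \<and>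
             (\<lambda>m. (\<Sum>n. t n * of_real (y n ^ Suc m)) * of_real x ^ Suc m / fact (Suc m)) sums S"
proof -
  define u where "u = (\<lambda>(n, m). t n * (of_real (x * y n) ^ Suc m / fact (Suc m)))"
  have row: "((\<lambda>m. u (n, m)) has_sum (t n * (exp (of_real (x * y n)) - 1))) UNIV" for n
    unfolding u_def prod.case by (intro has_sum_cmult_right exp_minus_one_has_sum)
  have nrow: "((\<lambda>m. norm (u (n, m))) has_sum (norm (t n) * (exp (\<bar>x\<bar> * y n) - 1))) UNIV" for n
  proof -
    define v where "v = \<bar>x\<bar> * y n"
    have "((\<lambda>m. Re (of_real v ^ Suc m / fact (Suc m))) has_sum Re (exp (of_real v) - 1)) UNIV"
      by (rule has_sum_Re[OF exp_minus_one_has_sum])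
    moreover have "Re (of_real v ^ Suc m / fact (Suc m)) = v ^ Suc m / fact (Suc m)" for m
    proof -
      have "of_real v ^ Suc m / fact (Suc m) = complex_of_real (v ^ Suc m / fact (Suc m))" by (simp del: power_Suc fact_Suc)
      then show ?thesis by (simp only: Re_complex_of_real)
    qed
    moreover have "Re (exp (of_real v) - 1) = exp v - 1" by (simp add: Re_exp)
    ultimately have "((\<lambda>m. (\<bar>x\<bar> * y n) ^ Suc m / fact (Suc m)) has_sum (exp (\<bar>x\<bar> * y n) - 1)) UNIV"
      unfolding v_def by (simp only:)
    then have "((\<lambda>m. norm (t n) * ((\<bar>x\<bar> * y n) ^ Suc m / fact (Suc m))) has_sum (norm (t n) * (exp (\<bar>x\<bar> * y n) - 1))) UNIV"
      by (rule has_sum_cmult_right)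
    moreover have "norm (u (n, m)) = norm (t n) * ((\<bar>x\<bar> * y n) ^ Suc m / fact (Suc m))" for m
      using y(1)[of n] by (simp add: u_def norm_mult norm_divide norm_power abs_mult del: power_Suc fact_Suc)
    ultimately show ?thesis by (simp only:)
  qed
  have expb: "exp (\<bar>x\<bar> * v) - 1 \<le> \<bar>x\<bar> * exp \<bar>x\<bar> * v" if "0 \<le> v" "v \<le> 1" for v :: real
  proof -
    have "1 - \<bar>x\<bar> * v \<le> exp (- (\<bar>x\<bar> * v))" using exp_ge_add_one_self[of "- (\<bar>x\<bar> * v)"] by simp
    then have "exp (\<bar>x\<bar> * v) * (1 - \<bar>x\<bar> * v) \<le> 1"
      using mult_left_mono[of "1 - \<bar>x\<bar> * v" "exp (- (\<bar>x\<bar> * v))" "exp (\<bar>x\<bar> * v)"] by (simp add: exp_minus)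
    then have "exp (\<bar>x\<bar> * v) - 1 \<le> exp (\<bar>x\<bar> * v) * (\<bar>x\<bar> * v)" by (simp add: right_diff_distrib)
    also have "\<dots> \<le> exp \<bar>x\<bar> * (\<bar>x\<bar> * v)" using that by (intro mult_right_mono) (auto simp: mult_left_le)
    finally show ?thesis by (simp add: mult_ac)
  qed
  have colsum: "summable (\<lambda>n. norm (t n) * (exp (\<bar>x\<bar> * y n) - 1))"
  proof (rule summable_comparison_test'[of "\<lambda>n. \<bar>x\<bar> * exp \<bar>x\<bar> * (norm (t n) * y n)" 0])
    show "summable (\<lambda>n. \<bar>x\<bar> * exp \<bar>x\<bar> * (norm (t n) * y n))" by (intro summable_mult s)
    show "norm (norm (t n) * (exp (\<bar>x\<bar> * y n) - 1)) \<le> \<bar>x\<bar> * exp \<bar>x\<bar> * (norm (t n) * y n)" for n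
      using mult_left_mono[OF expb[OF y(1)[of n] y(2)[of n]], of "norm (t n)"] y(1)[of n] by (simp add: abs_mult mult_ac)
  qed
  have nonneg: "norm (t n) * (exp (\<bar>x\<bar> * y n) - 1) \<ge> 0" for n using y(1)[of n] by simp
  have "(\<lambda>p. norm (u p)) summable_on (UNIV \<times> UNIV)"
    unfolding Infinite_Sum.abs_summable_on_Sigma_iff
  proof (intro conjI ballI)
    show "(\<lambda>m. norm (u (n, m))) summable_on UNIV" for n using nrow by (auto simp: summable_on_def)
    have "(\<lambda>n. norm (t n) * (exp (\<bar>x\<bar> * y n) - 1)) summable_on UNIV"
      by (rule norm_summable_imp_summable_on) (use colsum nonneg in simp)
    then show "(\<lambda>n. norm (\<Sum>\<^sub>\<infinity>m. norm (u (n, m)))) summable_on UNIV"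
      using infsumI[OF nrow] nonneg by simp
  qed
  then have "u summable_on (UNIV \<times> UNIV)" by (rule abs_summable_summable)
  then obtain S where S: "(u has_sum S) (UNIV \<times> UNIV)" by (auto simp: summable_on_def)
  have "((\<lambda>n. t n * (exp (of_real (x * y n)) - 1)) has_sum S) UNIV"
    by (rule has_sum_SigmaD[OF S]) (use row in auto)
  then have 1: "(\<lambda>n. t n * (exp (of_real (x * y n)) - 1)) sums S" by (rule has_sum_imp_sums)
  have bij: "bij_betw prod.swap (UNIV \<times> UNIV) (UNIV \<times> UNIV :: (nat \<times> nat) set)"
    by (rule bij_betwI[where g = prod.swap]) auto
  have S': "((\<lambda>p. u (prod.swap p)) has_sum S) (UNIV \<times> UNIV)"
    using has_sum_reindex_bij_betw[OF bij, of u] S by simp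
  have col: "((\<lambda>n. u (n, m)) has_sum ((\<Sum>n. t n * of_real (y n ^ Suc m)) * of_real x ^ Suc m / fact (Suc m))) UNIV" for m
  proof -
    have ns: "summable (\<lambda>n. norm (t n * of_real (y n ^ Suc m)))"
    proof (rule summable_comparison_test'[OF s, of 0])
      show "norm (norm (t n * of_real (y n ^ Suc m))) \<le> norm (t n) * y n" for n
      proof -
        have "y n ^ Suc m \<le> y n" using y[of n] power_le_one[of "y n" m] by (simp add: mult_left_le)
        then show ?thesis using y(1)[of n] by (simp add: norm_mult norm_power mult_left_mono del: power_Suc)
      qed
    qed
    have "((\<lambda>n. t n * of_real (y n ^ Suc m)) has_sum (\<Sum>n. t n * of_real (y n ^ Suc m))) UNIV"
      by (rule norm_summable_imp_has_sum[OF ns summable_sums[OF summable_norm_cancel[OF ns]]])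
    from has_sum_cmult_left[OF this, of "of_real x ^ Suc m / fact (Suc m)"]
    show ?thesis by (simp add: u_def power_mult_distrib mult_ac del: power_Suc fact_Suc)
  qed
  have "((\<lambda>m. (\<Sum>n. t n * of_real (y n ^ Suc m)) * of_real x ^ Suc m / fact (Suc m)) has_sum S) UNIV"
    by (rule has_sum_SigmaD[OF S']) (use col in auto)
  then have 2: "(\<lambda>m. (\<Sum>n. t n * of_real (y n ^ Suc m)) * of_real x ^ Suc m / fact (Suc m)) sums S" by (rule has_sum_imp_sums)
  show ?thesis using 1 2 by blast
qed

text \<open>The term \<open>m = 0\<close> is the value at \<open>k\<close>, supplied by
  \<open>moebius_series_sums\<close> as an ordered limit. All terms with \<open>m >= 1\<close> come
  from \<open>double_exponential_series\<close> with \<open>y n = (n + 1)^(- l)\<close> and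
  \<open>- x\<close> in place of \<open>x\<close>.\<close>

theorem riesz_P_power_series:
  assumes prim: "primitive_dirichlet_character q chi" and k: "k \<ge> 1" and l: "l > 0"
  shows "(\<lambda>m. recip_L q chi (of_real (k + l * real m)) * (- of_real x) ^ m / fact m) sums riesz_P k l chi x"
    and "(\<lambda>n. chi (int (Suc n)) * of_int (moebius (Suc n)) * of_real (real (Suc n) powr (- k)) * (exp (- of_real (x * real (Suc n) powr (- l))) - 1))
           sums (riesz_P k l chi x - recip_L q chi (of_real k))"
proof -
  define t where "t = (\<lambda>n. chi (int (Suc n)) * of_int (moebius (Suc n)) * complex_of_real (real (Suc n) powr (- k)))"
  define y where "y = (\<lambda>n. real (Suc n) powr (- l))"
  have y: "0 \<le> y n" "y n \<le> 1" for n
    using l ge_one_powr_ge_zero[of "real (Suc n)" l] by (auto simp: y_def powr_minus_divide simp del: of_nat_Suc)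
  have nt: "norm (t n) \<le> real (Suc n) powr (- k)" for n
    using mult_right_mono[OF norm_moebius_char_le[OF prim, of "Suc n"], of "real (Suc n) powr (- k)"]
    by (simp add: t_def norm_mult del: of_nat_Suc)
  have s: "summable (\<lambda>n. norm (t n) * y n)"
  proof (rule summable_comparison_test'[of "\<lambda>n. real (Suc n) powr (- (k + l))" 0])
    show "summable (\<lambda>n. real (Suc n) powr (- (k + l)))"
      using k l by (subst summable_Suc_iff) (simp add: summable_real_powr_iff)
    show "norm (norm (t n) * y n) \<le> real (Suc n) powr (- (k + l))" for n
    proof -
      have "norm (t n) * y n \<le> real (Suc n) powr (- k) * real (Suc n) powr (- l)"
        unfolding y_def by (intro mult_right_mono nt) auto
      then show ?thesis using y(1)[of n] by (simp add: powr_add[symmetric] add.commute del: of_nat_Suc)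
    qed
  qed
  have tR: "(\<Sum>n. t n * of_real (y n ^ Suc m)) = recip_L q chi (of_real (k + l * real (Suc m)))" for m
  proof -
    have "t n * of_real (y n ^ Suc m) = chi (int (Suc n)) * of_int (moebius (Suc n)) * of_real (real (Suc n) powr (- (k + l * real (Suc m))))" for n
    proof -
      have "y n ^ Suc m = real (Suc n) powr (- l * real (Suc m))"
        unfolding y_def by (simp add: powr_realpow[symmetric] powr_powr del: of_nat_Suc power_Suc)
      then have "real (Suc n) powr (- k) * y n ^ Suc m = real (Suc n) powr (- (k + l * real (Suc m)))"
        by (simp add: powr_add[symmetric] algebra_simps del: of_nat_Suc power_Suc)
      then show ?thesis unfolding t_def by (simp only: of_real_mult[symmetric] mult.assoc)
    qed
    moreover have "k + l * real (Suc m) \<ge> 1" using k l by (simp add: add_increasing2)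
    ultimately show ?thesis using moebius_series_sums[OF prim, of "k + l * real (Suc m)"] by (simp add: sums_iff)
  qed
  obtain S where S: "(\<lambda>n. t n * (exp (of_real (- x * y n)) - 1)) sums S"
     "(\<lambda>m. recip_L q chi (of_real (k + l * real (Suc m))) * of_real (- x) ^ Suc m / fact (Suc m)) sums S"
    using double_exponential_series[OF y s, of "- x"] unfolding tR by blast
  have t0: "t sums recip_L q chi (of_real k)" unfolding t_def by (rule moebius_series_sums[OF prim k])
  have P: "riesz_P k l chi x = recip_L q chi (of_real k) + S"
  proof -
    have "(\<lambda>n. t n + t n * (exp (of_real (- x * y n)) - 1)) sums (recip_L q chi (of_real k) + S)"
      by (rule sums_add[OF t0 S(1)])
    moreover have "t n + t n * (exp (of_real (- x * y n)) - 1) =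
       chi (int (Suc n)) * of_int (moebius (Suc n)) / of_real (real (Suc n) powr k) * of_real (exp (- (x / real (Suc n) powr l)))" for n
    proof -
      have e1: "t n + t n * (exp (of_real (- x * y n)) - 1) = t n * exp (of_real (- x * y n))" by (simp add: algebra_simps)
      have e2: "- x * y n = - (x / real (Suc n) powr l)" by (simp add: y_def powr_minus_divide del: of_nat_Suc)
      show ?thesis unfolding e1 unfolding e2 exp_of_real unfolding t_def powr_minus_divide by (simp del: of_nat_Suc)
    qed
    ultimately show ?thesis unfolding riesz_P_def by (simp add: sums_iff)
  qed
  have "(\<lambda>n. t n * (exp (of_real (- x * y n)) - 1)) sums (riesz_P k l chi x - recip_L q chi (of_real k))"
    using S(1) P by simp
  then show "(\<lambda>n. chi (int (Suc n)) * of_int (moebius (Suc n)) * of_real (real (Suc n) powr (- k)) * (exp (- of_real (x * real (Suc n) powr (- l))) - 1))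
           sums (riesz_P k l chi x - recip_L q chi (of_real k))"
    by (simp add: t_def y_def)
  have "(\<lambda>m. recip_L q chi (of_real (k + l * real m)) * of_real (- x) ^ m / fact m) sums (S + recip_L q chi (of_real k))"
    using S(2) sums_Suc_iff[of "\<lambda>m. recip_L q chi (of_real (k + l * real m)) * of_real (- x) ^ m / fact m" S] by simp
  then show "(\<lambda>m. recip_L q chi (of_real (k + l * real m)) * (- of_real x) ^ m / fact m) sums riesz_P k l chi x"
    unfolding P by (simp add: add.commute)
qed

section \<open>Bounds for the reciprocal under the Riemann hypothesis\<close>

text \<open>Absolute convergence gives one bound for the whole half-plane; it is taken at least
  \<open>1\<close> so that its logarithm is nonnegative.\<close>

lemma recip_L_bounded:
  assumes prim: "primitive_dirichlet_character q chi" and c: "c > 1"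
  shows "\<exists>K\<ge>1. \<forall>s. Re s \<ge> c \<longrightarrow> norm (recip_L q chi s) \<le> K"
proof -
  define a where "a = (\<lambda>n. chi (int n) * of_int (moebius n))"
  have a1: "norm (a n) \<le> 1" for n unfolding a_def by (rule norm_moebius_char_le[OF prim])
  have s: "summable (\<lambda>n. real (Suc n) powr (- c))"
    using c by (subst summable_Suc_iff) (simp add: summable_real_powr_iff)
  define K where "K = 1 + (\<Sum>n. real (Suc n) powr (- c))"
  have "norm (recip_L q chi z) \<le> K" if z: "Re z \<ge> c" for z
  proof -
    have z1: "Re z > 1" using z c by simp
    have ds: "summable (\<lambda>n. norm (a (Suc n) * of_nat (Suc n) powr (- z)))" by (rule dirichlet_series_abs_summable[OF a1 z1])
    have le: "norm (a (Suc n) * of_nat (Suc n) powr (- z)) \<le> real (Suc n) powr (- c)" for n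
    proof -
      have "norm (a (Suc n) * of_nat (Suc n) powr (- z)) \<le> 1 * real (Suc n) powr (- c)"
        unfolding norm_mult norm_nat_powr using z by (intro mult_mono a1 powr_mono) auto
      then show ?thesis by simp
    qed
    have "norm (recip_L q chi z) \<le> (\<Sum>n. norm (a (Suc n) * of_nat (Suc n) powr (- z)))"
      unfolding recip_L_eq[OF prim z1] dirichlet_series_def a_def[symmetric] by (rule summable_norm[OF ds])
    also have "\<dots> \<le> (\<Sum>n. real (Suc n) powr (- c))" by (rule suminf_le[OF le ds s])
    finally show ?thesis by (simp add: K_def)
  qed
  moreover have "K \<ge> 1" using s by (simp add: K_def suminf_nonneg)
  ultimately show ?thesis by blast
qed

text \<open>The disc of radius \<open>3/2\<close> about \<open>z0 = 2 + i Im s\<close> touches the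
  line \<open>Re = 1/2\<close> and is zero-free by assumption. There \<open>regular_L\<close> is
  \<open>O(T^2)\<close>, and at the centre its modulus is at least \<open>1 / K\<close>, so the
  Borel-Caratheodory lemma bounds its reciprocal at \<open>s\<close> by a fixed power of
  \<open>T\<close>. The constant \<open>\<rho>\<close> is Harnack's for the inner radius
  \<open>3/2 - \<eta>\<close>.\<close>

theorem recip_L_polynomial_bound:
  assumes prim: "primitive_dirichlet_character q chi"
    and nz: "\<And>s. Re s > 1 / 2 \<Longrightarrow> regular_L q chi s \<noteq> 0" and \<eta>: "0 < \<eta>" "\<eta> < 3 / 2"
  shows "\<exists>C>0. \<exists>N. \<forall>s. Re s \<ge> 1 / 2 + \<eta> \<longrightarrow> norm (recip_L q chi s) \<le> C * (5 + \<bar>Im s\<bar>) ^ N"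
proof -
  obtain K where K: "K \<ge> 1" "\<And>s. Re s \<ge> 2 \<Longrightarrow> norm (recip_L q chi s) \<le> K" using recip_L_bounded[OF prim, of 2] by auto
  define \<rho> where "\<rho> = (3 / 2 + (3 / 2 - \<eta>)) / (3 / 2 - (3 / 2 - \<eta>))"
  have \<rho>: "\<rho> \<ge> 0" using \<eta> by (simp add: \<rho>_def)
  obtain n0 where n0: "\<rho> \<le> real n0" using real_arch_simple by blast
  \<comment> \<open>One more than the constant in \<open>regular_L_growth\<close>, because the
    Borel-Caratheodory lemma asks for a strict bound.\<close>
  define Q where "Q = 2 * real q + 4"
  have Q: "Q \<ge> 1" by (simp add: Q_def)
  define C where "C = (Q * K) ^ n0 + K"
  have C: "C > 0" unfolding C_def using Q K by (intro add_nonneg_pos) auto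
  have "norm (recip_L q chi s) \<le> C * (5 + \<bar>Im s\<bar>) ^ (2 * n0 + 1)" if s: "Re s \<ge> 1 / 2 + \<eta>" for s
  proof (cases "Re s \<ge> 2")
    case True
    have "norm (recip_L q chi s) \<le> K" by (rule K(2)[OF True])
    also have "\<dots> \<le> C" using Q K by (simp add: C_def)
    also have "\<dots> \<le> C * (5 + \<bar>Im s\<bar>) ^ (2 * n0 + 1)"
      using C one_le_power[of "5 + \<bar>Im s\<bar>" "2 * n0 + 1"] by (simp del: power_Suc power_add)
    finally show ?thesis .
  next
    case False
    define z0 where "z0 = Complex 2 (Im s)"
    \<comment> \<open>The centre has modulus at most \<open>2 + |Im s|\<close> and the radius is
      \<open>3/2\<close>, so \<open>1 + norm z < T\<close> on the disc.\<close>
    define T where "T = 5 + \<bar>Im s\<bar>"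
    define M where "M = Q * T\<^sup>2"
    have T: "T \<ge> 5" by (simp add: T_def)
    have M1: "M \<ge> 1" unfolding M_def using Q T one_le_power[of T 2] mult_mono[of 1 Q 1 "T\<^sup>2"] by simp
    have inball: "Re z > 1 / 2" "norm z < T - 1" if "z \<in> ball z0 (3 / 2)" for z
    proof -
      have d: "norm (z - z0) < 3 / 2" using that by (simp add: dist_norm norm_minus_commute)
      then show "Re z > 1 / 2" using abs_Re_le_cmod[of "z - z0"] by (simp add: z0_def)
      have "norm z0 \<le> 2 + \<bar>Im s\<bar>" using cmod_le[of z0] by (simp add: z0_def)
      then show "norm z < T - 1" using d norm_triangle_ineq2[of z z0] by (simp add: T_def)
    qed
    have "ln M - ln (norm (regular_L q chi s)) \<le> (3 / 2 + (3 / 2 - \<eta>)) / (3 / 2 - (3 / 2 - \<eta>)) * (ln M - ln (norm (regular_L q chi z0)))"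
    proof (rule borel_caratheodory_lower_bound[of "regular_L q chi" z0 "3 / 2" M s "3 / 2 - \<eta>"])
      show "regular_L q chi holomorphic_on ball z0 (3 / 2)" by (rule holomorphic_regular_L[OF prim])
      show "regular_L q chi z \<noteq> 0" if "z \<in> ball z0 (3 / 2)" for z using inball[OF that] by (intro nz)
      show "norm (regular_L q chi z) < M" if z: "z \<in> ball z0 (3 / 2)" for z
      proof -
        have "norm (regular_L q chi z) \<le> (2 * real q + 3) * (1 + norm z)\<^sup>2"
          using inball(1)[OF z] by (intro regular_L_growth[OF prim]) simp
        also have "\<dots> \<le> (2 * real q + 3) * T\<^sup>2"
          using inball(2)[OF z] by (intro mult_left_mono power_mono) auto
        also have "\<dots> < M" unfolding M_def Q_def using T by (intro mult_strict_right_mono) auto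
        finally show ?thesis .
      qed
      have "s - z0 = of_real (Re s - 2)" by (simp add: z0_def complex_eq_iff)
      then have "norm (s - z0) = \<bar>Re s - 2\<bar>" by (simp only: norm_of_real)
      then show "norm (s - z0) \<le> 3 / 2 - \<eta>" using s False by simp
    qed (use \<eta> in auto)
    then have bc: "ln M - ln (norm (regular_L q chi s)) \<le> \<rho> * (ln M - ln (norm (regular_L q chi z0)))"
      by (simp only: \<rho>_def)
    have z0nz: "regular_L q chi z0 \<noteq> 0" by (rule nz) (simp add: z0_def)
    have snz: "regular_L q chi s \<noteq> 0" using s \<eta> by (intro nz) simp
    have "1 / norm (regular_L q chi z0) \<le> K"
    proof -
      have "1 \<le> norm ((z0 - 1) ^ pole_order q)"
        using abs_Re_le_cmod[of "z0 - 1"] by (simp add: pole_order_def z0_def)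
      then have "1 / norm (regular_L q chi z0) \<le> norm ((z0 - 1) ^ pole_order q) / norm (regular_L q chi z0)"
        by (intro divide_right_mono) auto
      also have "\<dots> = norm (recip_L q chi z0)" by (simp add: recip_L_def norm_divide)
      also have "\<dots> \<le> K" by (rule K(2)) (simp add: z0_def)
      finally show ?thesis .
    qed
    then have "ln (1 / norm (regular_L q chi z0)) \<le> ln K" using z0nz K by (intro ln_mono) auto
    then have "- ln (norm (regular_L q chi z0)) \<le> ln K" using z0nz by (simp add: ln_div)
    then have "\<rho> * (ln M - ln (norm (regular_L q chi z0))) \<le> \<rho> * (ln M + ln K)" using \<rho> by (intro mult_left_mono) auto
    also have "\<dots> \<le> real n0 * (ln M + ln K)" using n0 M1 K by (intro mult_right_mono) auto
    finally have "- ln (norm (regular_L q chi s)) \<le> real n0 * (ln M + ln K)" using bc M1 by (smt (verit) ln_ge_zero)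
    then have "exp (- ln (norm (regular_L q chi s))) \<le> exp (real n0 * (ln M + ln K))" by simp
    also have "exp (real n0 * (ln M + ln K)) = (M * K) ^ n0"
      using M1 K by (simp add: exp_of_nat_mult exp_add)
    also have "exp (- ln (norm (regular_L q chi s))) = 1 / norm (regular_L q chi s)"
      using snz by (simp add: exp_minus inverse_eq_divide)
    finally have inv: "1 / norm (regular_L q chi s) \<le> (M * K) ^ n0" .
    have "norm ((s - 1) ^ pole_order q) \<le> T"
    proof -
      have "norm (s - 1) \<le> \<bar>Re s - 1\<bar> + \<bar>Im s\<bar>" using cmod_le[of "s - 1"] by simp
      moreover have "\<bar>Re s - 1\<bar> \<le> 1" unfolding abs_le_iff using s \<eta> False by linarith
      ultimately have "norm (s - 1) \<le> T" using T by (simp add: T_def)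
      then show ?thesis using T by (simp add: pole_order_def)
    qed
    then have "norm ((s - 1) ^ pole_order q) * (1 / norm (regular_L q chi s)) \<le> T * (M * K) ^ n0"
      using inv T by (intro mult_mono) auto
    then have "norm (recip_L q chi s) \<le> T * (M * K) ^ n0"
      by (simp add: recip_L_def norm_divide)
    \<comment> \<open>Each of the \<open>n0\<close> factors \<open>M\<close> contributes
      \<open>T^2\<close>, and the numerator of \<open>recip_L\<close> one more
      \<open>T\<close>.\<close>
    also have "\<dots> = (Q * K) ^ n0 * T ^ (2 * n0 + 1)"
      by (simp add: M_def power_mult_distrib power_mult[symmetric])
    also have "\<dots> \<le> C * T ^ (2 * n0 + 1)" using K T by (intro mult_right_mono) (auto simp: C_def)
    finally show ?thesis by (simp add: T_def)
  qed
  with C show ?thesis by blast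
qed

section \<open>Decay of the Gamma function on vertical lines\<close>

lemma Gamma_shift:
  assumes "s \<notin> \<int>\<^sub>\<le>\<^sub>0"
  shows "Gamma s = Gamma (s + of_nat n) / pochhammer s n"
proof -
  have "rGamma s = pochhammer s n * rGamma (s + of_nat n)" by (rule pochhammer_rGamma)
  then show ?thesis by (simp add: rGamma_inverse_Gamma inverse_eq_divide field_simps) (metis inverse_inverse_eq inverse_mult_distrib mult.commute divide_inverse inverse_eq_divide)
qed

lemma norm_Gamma_le:
  assumes "Re s > 0"
  shows "norm (Gamma s) \<le> Gamma (Re s)"
proof -
  have i: "has_bochner_integral lborel (\<lambda>u. exp (of_real u * s) * of_real (exp (- exp u))) (Gamma s)"
    by (rule Gamma_lborel[OF assms])
  have r: "has_bochner_integral lborel (\<lambda>u. exp (of_real u * of_real (Re s)) * of_real (exp (- exp u))) (Gamma (complex_of_real (Re s)))"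
    using assms by (intro Gamma_lborel) simp
  have eq: "exp (of_real u * of_real (Re s)) * of_real (exp (- exp u)) = complex_of_real (norm (exp (of_real u * s) * complex_of_real (exp (- exp u))))" for u
    by (simp add: norm_mult exp_of_real[symmetric])
  have "complex_of_real (LINT u|lborel. norm (exp (of_real u * s) * complex_of_real (exp (- exp u)))) = Gamma (complex_of_real (Re s))"
    using r unfolding eq by (simp only: has_bochner_integral_iff integral_complex_of_real)
  then have v: "(LINT u|lborel. norm (exp (of_real u * s) * complex_of_real (exp (- exp u)))) = Gamma (Re s)"
    by (simp only: Gamma_complex_of_real of_real_eq_iff)
  have "Gamma s = (LINT u|lborel. exp (of_real u * s) * of_real (exp (- exp u)))" using i by (simp add: has_bochner_integral_iff)
  also have "norm \<dots> \<le> (LINT u|lborel. norm (exp (of_real u * s) * complex_of_real (exp (- exp u))))" by (rule integral_norm_bound)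
  finally show ?thesis unfolding v .
qed

text \<open>Instead of Stirling's formula the recurrence is iterated: each factor of the Pochhammer
  symbol has modulus at least \<open>|Im s|\<close>, and the shifted Gamma is bounded by its values
  on a compact real interval. Any fixed power of decay can be reached in this way, which is enough
  against the polynomial growth of \<open>recip_L\<close>.\<close>

lemma Gamma_vertical_decay:
  "\<exists>G>0. \<forall>s. \<alpha> \<le> Re s \<and> Re s \<le> \<beta> \<and> \<bar>Im s\<bar> \<ge> 1 \<longrightarrow> norm (Gamma s) \<le> G / \<bar>Im s\<bar> ^ N"
proof -
  obtain m where m: "1 - \<alpha> \<le> real m" using real_arch_simple by blast
  \<comment> \<open>\<open>m\<close> brings the shifted real part to at least \<open>1\<close>;
    adding \<open>N\<close> guarantees at least \<open>N\<close> factors in the denominator.\<close>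
  define n where "n = m + N"
  have pos: "\<alpha> + real n \<ge> 1" using m by (simp add: n_def)
  define W where "W = {\<alpha> + real n..\<beta> + real n}"
  have "compact (Gamma ` W)"
    unfolding W_def using pos by (intro compact_continuous_image continuous_on_Gamma) (auto elim!: nonpos_Ints_cases)
  then obtain G0 where G0: "\<And>x. x \<in> W \<Longrightarrow> norm (Gamma x) \<le> G0"
    by (metis bounded_iff compact_imp_bounded image_eqI)
  define G where "G = \<bar>G0\<bar> + 1"
  have Gpos: "G > 0" by (simp add: G_def)
  have "norm (Gamma s) \<le> G / \<bar>Im s\<bar> ^ N" if s: "\<alpha> \<le> Re s" "Re s \<le> \<beta>" "\<bar>Im s\<bar> \<ge> 1" for s
  proof -
    have "s \<notin> \<int>\<^sub>\<le>\<^sub>0" using s(3) by (auto elim!: nonpos_Ints_cases)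
    then have eq: "Gamma s = Gamma (s + of_nat n) / pochhammer s n" by (rule Gamma_shift)
    have "\<bar>Im s\<bar> ^ n \<le> norm (pochhammer s n)"
    proof -
      have "(\<Prod>i<n. \<bar>Im s\<bar>) \<le> (\<Prod>i<n. norm (s + of_nat i))"
      proof (rule prod_mono)
        show "0 \<le> \<bar>Im s\<bar> \<and> \<bar>Im s\<bar> \<le> norm (s + of_nat i)" for i using abs_Im_le_cmod[of "s + of_nat i"] by simp
      qed
      then show ?thesis by (simp add: pochhammer_prod prod_norm lessThan_atLeast0)
    qed
    moreover have "\<bar>Im s\<bar> ^ N \<le> \<bar>Im s\<bar> ^ n" using s(3) by (intro power_increasing) (auto simp: n_def)
    ultimately have p: "\<bar>Im s\<bar> ^ N \<le> norm (pochhammer s n)" by simp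
    have "norm (Gamma (s + of_nat n)) \<le> Gamma (Re s + real n)"
      using norm_Gamma_le[of "s + of_nat n"] pos s by simp
    also have "\<dots> \<le> G" using G0[of "Re s + real n"] s by (simp add: W_def G_def)
    finally have g: "norm (Gamma (s + of_nat n)) \<le> G" .
    have "0 < \<bar>Im s\<bar> ^ N" using s(3) by (intro zero_less_power) simp
    then show ?thesis unfolding eq norm_divide using p g Gpos by (intro frac_le) auto
  qed
  with Gpos show ?thesis by blast
qed

section \<open>The Riesz function under the Riemann hypothesis\<close>

definition riesz_integrand :: "nat \<Rightarrow> (int \<Rightarrow> complex) \<Rightarrow> real \<Rightarrow> real \<Rightarrow> real \<Rightarrow> complex \<Rightarrow> complex" where
  "riesz_integrand q chi k l x s =
     Gamma s * exp (- (s * of_real (ln x))) * recip_L q chi (of_real k - of_real l * s)"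

lemma norm_exp_ln:
  assumes "x > 0"
  shows "norm (exp (- (s * complex_of_real (ln x)))) = x powr (- Re s)"
  using assms by (simp add: powr_def)

lemma riesz_integrand_bound:
  assumes prim: "primitive_dirichlet_character q chi"
    and nz: "\<And>s. Re s > 1 / 2 \<Longrightarrow> regular_L q chi s \<noteq> 0"
    and l: "l > 0" and x: "x > 0" and b: "k - l * b > 1 / 2"
  shows "\<exists>C. \<forall>s. a < Re s \<and> Re s < b \<and> \<bar>Im s\<bar> \<ge> 1 \<longrightarrow> norm (riesz_integrand q chi k l x s) \<le> C / (1 + (Im s)\<^sup>2)"
proof -
  define \<eta> where "\<eta> = min (k - l * b - 1 / 2) 1"
  have \<eta>: "0 < \<eta>" "\<eta> < 3 / 2" "1 / 2 + \<eta> \<le> k - l * b" using b by (auto simp: \<eta>_def min_def)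
  obtain C0 N where C0: "C0 > 0" "\<And>s. Re s \<ge> 1 / 2 + \<eta> \<Longrightarrow> norm (recip_L q chi s) \<le> C0 * (5 + \<bar>Im s\<bar>) ^ N"
    using recip_L_polynomial_bound[OF prim nz \<eta>(1,2)] by blast
  \<comment> \<open>\<open>N\<close> powers of decay absorb the growth of \<open>recip_L\<close>,
    and two more make the integrand integrable.\<close>
  obtain G where G: "G > 0" "\<And>s. a \<le> Re s \<Longrightarrow> Re s \<le> b \<Longrightarrow> \<bar>Im s\<bar> \<ge> 1 \<Longrightarrow> norm (Gamma s) \<le> G / \<bar>Im s\<bar> ^ (N + 2)"
    using Gamma_vertical_decay[of a b "N + 2"] by blast
  define E where "E = exp ((\<bar>a\<bar> + \<bar>b\<bar>) * \<bar>ln x\<bar>)"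
  define C where "C = G * E * (C0 * (5 + l) ^ N)"
  have "norm (riesz_integrand q chi k l x s) \<le> 2 * C / (1 + (Im s)\<^sup>2)" if s: "a < Re s" "Re s < b" "\<bar>Im s\<bar> \<ge> 1" for s
  proof -
    define t where "t = \<bar>Im s\<bar>"
    have t: "t \<ge> 1" using s by (simp add: t_def)
    have 1: "norm (Gamma s) \<le> G / t ^ (N + 2)" unfolding t_def using s by (intro G) auto
    have 2: "norm (exp (- (s * complex_of_real (ln x)))) \<le> E"
    proof -
      have "- (Re s * ln x) \<le> \<bar>Re s\<bar> * \<bar>ln x\<bar>" by (metis abs_ge_minus_self abs_mult)
      also have "\<dots> \<le> (\<bar>a\<bar> + \<bar>b\<bar>) * \<bar>ln x\<bar>" using s by (intro mult_right_mono) auto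
      finally show ?thesis by (simp add: E_def)
    qed
    have 3: "norm (recip_L q chi (of_real k - of_real l * s)) \<le> C0 * (5 + l) ^ N * t ^ N"
    proof -
      have "l * Re s \<le> l * b" using s l by simp
      then have "norm (recip_L q chi (of_real k - of_real l * s)) \<le> C0 * (5 + \<bar>Im (of_real k - of_real l * s)\<bar>) ^ N"
        using \<eta>(3) by (intro C0) simp
      also have "\<dots> = C0 * (5 + l * t) ^ N" using l by (simp add: t_def abs_mult)
      also have "\<dots> \<le> C0 * ((5 + l) * t) ^ N" using C0 l t by (intro mult_left_mono power_mono) (auto simp: algebra_simps)
      finally show ?thesis by (simp add: power_mult_distrib)
    qed
    have "norm (riesz_integrand q chi k l x s) \<le> (G / t ^ (N + 2)) * E * (C0 * (5 + l) ^ N * t ^ N)"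
      unfolding riesz_integrand_def norm_mult using 1 2 3 G C0 l t by (intro mult_mono) (auto simp: E_def)
    also have "\<dots> = C / t\<^sup>2" using t by (simp add: C_def power_add field_simps power2_eq_square)
    also have "\<dots> \<le> 2 * C / (1 + t\<^sup>2)"
    proof -
      have "C \<ge> 0" using G C0 l by (simp add: C_def E_def)
      moreover have "t\<^sup>2 \<ge> 1" using t by simp
      ultimately have "C * (1 + t\<^sup>2) \<le> 2 * C * t\<^sup>2" using mult_left_mono[of 1 "t\<^sup>2" C] by (simp add: algebra_simps)
      moreover have "0 < t\<^sup>2" "0 < 1 + t\<^sup>2" using \<open>t\<^sup>2 \<ge> 1\<close> by linarith+
      ultimately show ?thesis by (simp add: divide_simps)
    qed
    finally show ?thesis by (simp add: t_def)
  qed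
  then show ?thesis by blast
qed

text \<open>The strip from \<open>- m - 3/4\<close> to \<open>b\<close> contains only the pole of
  Gamma at \<open>- m\<close>: for \<open>m = 0\<close> there is none further right, and otherwise
  \<open>b <= 1 - m\<close> excludes the next one. The residue is the \<open>m\<close>-th term of
  the power series of \<open>riesz_P\<close>.\<close>

lemma riesz_integrand_crossing:
  assumes prim: "primitive_dirichlet_character q chi"
    and nz: "\<And>s. Re s > 1 / 2 \<Longrightarrow> regular_L q chi s \<noteq> 0"
    and l: "l > 0" and x: "x > 0" and b: "k - l * b > 1 / 2"
    and d: "- real m < d" "d < b" and m: "m = 0 \<or> b \<le> 1 - real m"
  shows "(LINT t|lborel. riesz_integrand q chi k l x (Complex d t)) =
         (LINT t|lborel. riesz_integrand q chi k l x (Complex (- real m - 1 / 2) t))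
         + 2 * of_real pi * (recip_L q chi (of_real (k + l * real m)) * (- of_real x) ^ m / fact m)"
proof -
  \<comment> \<open>The first factor is \<open>(s + m) Gamma s\<close> written without the pole:
    \<open>m + 1\<close> steps of the recurrence, with the factor \<open>s + m\<close> left out of
    the denominator.\<close>
  define H where "H = (\<lambda>s. Gamma (s + of_nat (Suc m)) / pochhammer s m * exp (- (s * of_real (ln x))) * recip_L q chi (of_real k - of_real l * s))"
  \<comment> \<open>Between the new line at \<open>- m - 1/2\<close> and the following pole at
    \<open>- m - 1\<close>.\<close>
  define a where "a = - real m - 3 / 4"
  have eq: "riesz_integrand q chi k l x s = H s / (s - of_real (- real m))" if "s \<notin> \<int>\<^sub>\<le>\<^sub>0" for s
    unfolding riesz_integrand_def H_def Gamma_shift[OF that, of "Suc m"] pochhammer_Suc by simp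
  have ni: "Complex c t \<notin> \<int>\<^sub>\<le>\<^sub>0" if "c \<notin> \<int>" for c t
  proof
    assume "Complex c t \<in> \<int>\<^sub>\<le>\<^sub>0"
    then obtain n :: int where "Complex c t = of_int n" by (elim nonpos_Ints_cases)
    then have "c = of_int n" by (simp add: complex_eq_iff)
    then show False using that by simp
  qed
  obtain C where C: "\<And>s. a < Re s \<Longrightarrow> Re s < b \<Longrightarrow> \<bar>Im s\<bar> \<ge> 1 \<Longrightarrow> norm (riesz_integrand q chi k l x s) \<le> C / (1 + (Im s)\<^sup>2)"
    using riesz_integrand_bound[OF prim nz l x b, of a] by blast
  have "(LINT t|lborel. H (Complex d t) / (Complex d t - of_real (- real m))) =
        (LINT t|lborel. H (Complex (- real m - 1 / 2) t) / (Complex (- real m - 1 / 2) t - of_real (- real m))) + 2 * of_real pi * H (of_real (- real m))"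
  proof (rule vertical_integral_crossing[where a = a and b = b and C = C])
    show "H holomorphic_on {z. a < Re z \<and> Re z < b}"
    proof -
      have "recip_L q chi \<circ> (\<lambda>s. of_real k - of_real l * s) holomorphic_on {z. a < Re z \<and> Re z < b}"
      proof (rule holomorphic_on_compose_gen)
        show "recip_L q chi holomorphic_on {s. Re s > 1 / 2}" by (rule holomorphic_recip_L[OF prim]) (simp add: nz)
        show "(\<lambda>s. of_real k - of_real l * s) ` {z. a < Re z \<and> Re z < b} \<subseteq> {s. Re s > 1 / 2}"
        proof safe
          fix s assume "Re s < b"
          then have "l * Re s \<le> l * b" using l by simp
          then show "1 / 2 < Re (of_real k - of_real l * s)" using b by simp
        qed
      qed (intro holomorphic_intros)
      moreover have "s + of_nat (Suc m) \<notin> \<int>\<^sub>\<le>\<^sub>0" if "a < Re s" for s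
      proof
        assume "s + of_nat (Suc m) \<in> \<int>\<^sub>\<le>\<^sub>0"
        then obtain n :: int where n: "s + of_nat (Suc m) = of_int n" "n \<le> 0" by (elim nonpos_Ints_cases)
        have "Re s + 1 + real m = of_int n" using arg_cong[OF n(1), of Re] by simp
        moreover have "real_of_int n \<le> 0" using n by simp
        ultimately show False using that by (simp add: a_def)
      qed
      moreover have "pochhammer s m \<noteq> 0" if "Re s < b" for s
      proof
        assume "pochhammer s m = 0"
        then obtain j where j: "j < m" "s = - of_nat j" by (auto simp: pochhammer_eq_0_iff)
        then have "Re s = - real j" by simp
        moreover have "real j \<le> real m - 1" using j by linarith
        ultimately show False using that m j by auto
      qed
      moreover have "(\<lambda>s. pochhammer s m) holomorphic_on A" for A
        unfolding pochhammer_prod by (intro holomorphic_intros)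
      ultimately show ?thesis unfolding H_def comp_def by (intro holomorphic_intros) auto
    qed
    show "norm (H z / (z - of_real (- real m))) \<le> C / (1 + (Im z)\<^sup>2)" if z: "a < Re z" "Re z < b" "\<bar>Im z\<bar> \<ge> 1" for z
    proof -
      have "z \<notin> \<int>\<^sub>\<le>\<^sub>0" using z(3) by (auto elim!: nonpos_Ints_cases)
      from eq[OF this] C[OF z] show ?thesis by simp
    qed
  qed (use d in \<open>auto simp: a_def\<close>)
  moreover have "H (of_real (- real m)) = recip_L q chi (of_real (k + l * real m)) * (- of_real x) ^ m / fact m"
  proof -
    \<comment> \<open>The residue \<open>(-1)^m / m!\<close> of Gamma at \<open>- m\<close> appears
      as \<open>Gamma 1 = 1\<close> over this Pochhammer symbol.\<close>
    have "pochhammer (- of_nat m :: complex) m = (- 1) ^ m * fact m" by (simp add: pochhammer_same)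
    moreover have "exp (of_nat m * complex_of_real (ln x)) = of_real x ^ m"
      using x by (simp add: exp_of_nat_mult exp_of_real)
    moreover have "(- complex_of_real x) ^ m = of_real x ^ m / (- 1) ^ m"
      by (subst power_minus) (simp add: divide_inverse power_inverse[symmetric])
    ultimately show ?thesis by (simp add: H_def Gamma_fact[symmetric] algebra_simps)
  qed
  moreover have "(LINT t|lborel. H (Complex (- real m - 1 / 2) t) / (Complex (- real m - 1 / 2) t - of_real (- real m)))
      = (LINT t|lborel. riesz_integrand q chi k l x (Complex (- real m - 1 / 2) t))"
  proof (intro Bochner_Integration.integral_cong refl)
    fix t
    have "- real m - 1 / 2 \<notin> \<int>"
    proof
      assume "- real m - 1 / 2 \<in> \<int>"
      then obtain n where "- real m - 1 / 2 = of_int n" by (elim Ints_cases)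
      then have "real_of_int (2 * (- int m - n)) = real_of_int 1" by simp
      then have "2 * (- int m - n) = 1" by (simp only: of_int_eq_iff)
      then show False by presburger
    qed
    from eq[OF ni[OF this, of t]]
    show "H (Complex (- real m - 1 / 2) t) / (Complex (- real m - 1 / 2) t - of_real (- real m)) = riesz_integrand q chi k l x (Complex (- real m - 1 / 2) t)" by simp
  qed
  moreover have "(LINT t|lborel. H (Complex d t) / (Complex d t - of_real (- real m))) = (LINT t|lborel. riesz_integrand q chi k l x (Complex d t))"
  proof (intro Bochner_Integration.integral_cong refl)
    fix t
    have "Complex d t \<notin> \<int>\<^sub>\<le>\<^sub>0"
    proof
      assume "Complex d t \<in> \<int>\<^sub>\<le>\<^sub>0"
      then obtain n :: int where n: "Complex d t = of_int n" "n \<le> 0" by (elim nonpos_Ints_cases)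
      then have dn: "d = of_int n" by (simp add: complex_eq_iff)
      then have "real_of_int (- int m) < of_int n" using d by simp
      then have n1: "- int m < n" by (simp only: of_int_less_iff)
      then have "m \<noteq> 0" using n by auto
      then have "real_of_int n < real_of_int (1 - int m)" using m d dn by simp
      then show False using n1 by (simp only: of_int_less_iff)
    qed
    from eq[OF this] show "H (Complex d t) / (Complex d t - of_real (- real m)) = riesz_integrand q chi k l x (Complex d t)" by simp
  qed
  ultimately show ?thesis by simp
qed

text \<open>After \<open>m + 3\<close> steps of the recurrence the real part is \<open>5/2\<close>.
  Of the factors in the denominator, the first \<open>m + 1\<close> have real parts of modulus
  \<open>m + 1/2\<close> down to \<open>1/2\<close>, with product at least \<open>m! / 2\<close>;
  the last two, \<open>1/2 + i t\<close> and \<open>3/2 + i t\<close>, give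
  \<open>(1 + t^2) / 4\<close>. Hence the constant \<open>8\<close>.\<close>

lemma norm_Gamma_left_le:
  "norm (Gamma (Complex (- real m - 1 / 2) t)) \<le> 8 * Gamma (5 / 2) / fact m * (1 / (1 + t\<^sup>2))"
proof -
  define s where "s = Complex (- real m - 1 / 2) t"
  have "s \<notin> \<int>\<^sub>\<le>\<^sub>0"
  proof
    assume "s \<in> \<int>\<^sub>\<le>\<^sub>0"
    then obtain n :: int where "s = of_int n" by (elim nonpos_Ints_cases)
    then have "- real m - 1 / 2 = of_int n" by (simp add: complex_eq_iff s_def)
    then have "real_of_int (2 * (- int m - n)) = real_of_int 1" by simp
    then have "2 * (- int m - n) = 1" by (simp only: of_int_eq_iff)
    then show False by presburger
  qed
  then have eq: "Gamma s = Gamma (s + of_nat (m + 3)) / pochhammer s (m + 3)" by (rule Gamma_shift)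
  have "norm (Gamma (s + of_nat (m + 3))) \<le> Gamma (Re (s + of_nat (m + 3)))"
    by (rule norm_Gamma_le) (simp add: s_def)
  then have 1: "norm (Gamma (s + of_nat (m + 3))) \<le> Gamma (5 / 2)" by (simp add: s_def)
  have fac: "fact n / 2 \<le> norm (pochhammer (Complex (- real n - 1 / 2) t) (Suc n))" for n
  proof (induction n)
    case 0
    show ?case using abs_Re_le_cmod[of "Complex (-1/2) t"] by simp
  next
    case (Suc n)
    have *: "Complex (- real (Suc n) - 1 / 2) t + 1 = Complex (- real n - 1 / 2) t" by (simp add: complex_eq_iff)
    have "real (Suc n) * (fact n / 2) \<le> norm (Complex (- real (Suc n) - 1 / 2) t) * norm (pochhammer (Complex (- real n - 1 / 2) t) (Suc n))"
      using Suc abs_Re_le_cmod[of "Complex (- real (Suc n) - 1 / 2) t"] by (intro mult_mono) auto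
    then show ?case unfolding pochhammer_rec[of _ "Suc n"] * norm_mult by simp
  qed
  have "norm (pochhammer s (m + 3)) = norm (pochhammer s (Suc m)) * (norm (Complex (1 / 2) t) * norm (Complex (3 / 2) t))"
  proof -
    have e: "s + of_nat (Suc m) = Complex (1 / 2) t" "s + of_nat (Suc (Suc m)) = Complex (3 / 2) t" by (auto simp: s_def complex_eq_iff)
    have "m + 3 = Suc (Suc (Suc m))" by simp
    then show ?thesis unfolding pochhammer_Suc[of s "Suc (Suc m)"] pochhammer_Suc[of s "Suc m"] norm_mult e[symmetric]
      by (simp only: pochhammer_Suc[of s "Suc (Suc m)"] pochhammer_Suc[of s "Suc m"] norm_mult mult.assoc)
  qed
  moreover have "(1 + t\<^sup>2) / 4 \<le> norm (Complex (1 / 2) t) * norm (Complex (3 / 2) t)"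
  proof -
    have "(norm (Complex (1 / 2) t))\<^sup>2 = 1 / 4 + t\<^sup>2" by (simp add: cmod_power2) (simp add: power2_eq_square)
    moreover have "norm (Complex (1 / 2) t) \<le> norm (Complex (3 / 2) t)" by (auto simp: cmod_def power2_eq_square)
    then have "(norm (Complex (1 / 2) t))\<^sup>2 \<le> norm (Complex (1 / 2) t) * norm (Complex (3 / 2) t)"
      unfolding power2_eq_square by (intro mult_left_mono) auto
    moreover have "(1 + t\<^sup>2) / 4 \<le> 1 / 4 + t\<^sup>2" by simp
    ultimately show ?thesis by linarith
  qed
  ultimately have "fact m / 2 * ((1 + t\<^sup>2) / 4) \<le> norm (pochhammer s (m + 3))"
    using mult_mono[OF fac[of m], of "(1 + t\<^sup>2) / 4" "norm (Complex (1 / 2) t) * norm (Complex (3 / 2) t)"]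
    by (simp only: s_def) (simp add: add_nonneg_nonneg)
  moreover have "0 < fact m / 2 * ((1 + t\<^sup>2) / 4)" using add_pos_nonneg[of 1 "t\<^sup>2"] by simp
  ultimately have "norm (Gamma s) \<le> Gamma (5 / 2) / (fact m / 2 * ((1 + t\<^sup>2) / 4))"
    unfolding eq norm_divide using 1 by (intro frac_le) auto
  then show ?thesis by (simp add: s_def mult_ac)
qed

text \<open>Crossing the poles from \<open>0\<close> to \<open>- M\<close> collects the first
  \<open>M + 1\<close> terms of the power series, and the integral over the last line is
  \<open>O(x^(M + 1/2) / M!)\<close>, which tends to \<open>0\<close> for fixed
  \<open>x\<close>.\<close>

lemma riesz_integral:
  assumes prim: "primitive_dirichlet_character q chi"
    and nz: "\<And>s. Re s > 1 / 2 \<Longrightarrow> regular_L q chi s \<noteq> 0"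
    and k: "k \<ge> 1" and l: "l > 0" and x: "x > 0" and d: "0 < d" "k - l * d > 1 / 2"
  shows "(LINT t|lborel. riesz_integrand q chi k l x (Complex d t)) = 2 * of_real pi * riesz_P k l chi x"
proof -
  define I where "I = (\<lambda>c. LINT t|lborel. riesz_integrand q chi k l x (Complex c t))"
  define p where "p = (\<lambda>m. recip_L q chi (of_real (k + l * real m)) * (- complex_of_real x) ^ m / fact m)"
  have left: "I d = I (- real M - 1 / 2) + 2 * of_real pi * (\<Sum>m\<le>M. p m)" for M
  proof (induction M)
    case 0
    define e where "e = (k - 1 / 2) / l"
    \<comment> \<open>The strip has to extend beyond \<open>d\<close> and still satisfy
      \<open>Re (k - l s) > 1/2\<close>; \<open>e\<close> is the abscissa of that edge.\<close>
    define b where "b = (d + e) / 2"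
    have "d < e" using d l by (simp add: e_def pos_less_divide_eq mult.commute)
    then have "d < b" "b < e" by (auto simp: b_def)
    then have "k - l * b > 1 / 2" using l by (simp add: e_def pos_less_divide_eq mult.commute)
    from riesz_integrand_crossing[OF prim nz l x this, of 0 d] d \<open>d < b\<close> show ?case
      by (simp add: I_def p_def)
  next
    case (Suc M)
    have "0 \<le> l * real M" using l by simp
    \<comment> \<open>The right edge of the next strip is the pole \<open>- M\<close> crossed last,
      which the open strip just leaves out.\<close>
    then have kk: "1 / 2 < k - l * (- real M)" using k by linarith
    have "I (- real M - 1 / 2) = I (- real (Suc M) - 1 / 2) + 2 * of_real pi * p (Suc M)"
      unfolding I_def p_def by (rule riesz_integrand_crossing[OF prim nz l x kk, of "Suc M"]) auto
    then show ?case using Suc by (simp add: ring_distribs del: of_nat_Suc)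
  qed
  \<comment> \<open>On every line \<open>Re s = - M - 1/2\<close> the point \<open>k - l s\<close>
    has real part at least \<open>1 + l / 2\<close>, inside the region of absolute
    convergence.\<close>
  obtain K where K: "K \<ge> 1" "\<And>s. Re s \<ge> 1 + l / 2 \<Longrightarrow> norm (recip_L q chi s) \<le> K"
    using recip_L_bounded[OF prim, of "1 + l / 2"] l by auto
  have bound: "norm (I (- real M - 1 / 2)) \<le> 8 * Gamma (5 / 2) * K * pi * x powr (1 / 2) * (x ^ M / fact M)" for M
  proof -
    have xp: "x powr (real M + 1 / 2) = x powr (1 / 2) * x ^ M" using x by (simp add: powr_add powr_realpow)
    define B where "B = 8 * Gamma (5 / 2) / fact M * x powr (real M + 1 / 2) * K"
    have "norm (I (- real M - 1 / 2)) \<le> (LINT t|lborel. norm (riesz_integrand q chi k l x (Complex (- real M - 1 / 2) t)))"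
      unfolding I_def by (rule integral_norm_bound)
    also have "\<dots> \<le> (LINT t|lborel. B * (1 / (1 + t\<^sup>2)))"
    proof (rule integral_mono')
      show "integrable lborel (\<lambda>t. B * (1 / (1 + t\<^sup>2)))"
        using inverse_1_plus_square_lborel(1) by (intro integrable_mult_right) auto
      fix t :: real
      define s where "s = Complex (- real M - 1 / 2) t"
      have "Re (of_real k - of_real l * s) = k + l * (real M + 1 / 2)" by (simp add: s_def algebra_simps)
      also have "\<dots> \<ge> 1 + l / 2"
      proof -
        have "0 \<le> l * real M" using l by simp
        then show ?thesis using k by (simp add: ring_distribs)
      qed
      finally have "norm (recip_L q chi (of_real k - of_real l * s)) \<le> K" by (rule K(2))
      moreover have "norm (exp (- (s * complex_of_real (ln x)))) = x powr (real M + 1 / 2)"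
        unfolding norm_exp_ln[OF x] by (simp add: s_def add.commute)
      moreover have "0 \<le> Gamma (5 / 2 :: real)" by (intro less_imp_le Gamma_real_pos) simp
      ultimately have "norm (riesz_integrand q chi k l x s) \<le> (8 * Gamma (5 / 2) / fact M * (1 / (1 + t\<^sup>2))) * x powr (real M + 1 / 2) * K"
        unfolding riesz_integrand_def norm_mult using norm_Gamma_left_le[of M t, folded s_def] by (intro mult_mono) (auto simp: add_nonneg_nonneg)
      then show "norm (riesz_integrand q chi k l x s) \<le> B * (1 / (1 + t\<^sup>2))" by (simp add: B_def mult_ac)
      then show "0 \<le> B * (1 / (1 + t\<^sup>2))" by (rule order_trans[OF norm_ge_zero])
    qed
    also have "\<dots> = B * pi" by (simp only: integral_mult_right_zero inverse_1_plus_square_lborel(2))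
    finally show ?thesis by (simp only: B_def xp) (simp add: mult_ac)
  qed
  have "(\<lambda>M. I (- real M - 1 / 2)) \<longlonglongrightarrow> 0"
  proof (rule Lim_null_comparison[OF always_eventually[OF allI[OF bound]]])
    have "(\<lambda>M. x ^ M / fact M) \<longlonglongrightarrow> 0"
      using summable_LIMSEQ_zero[OF summable_exp[of x]] by (simp add: field_simps)
    then show "(\<lambda>M. 8 * Gamma (5 / 2) * K * pi * x powr (1 / 2) * (x ^ M / fact M)) \<longlonglongrightarrow> 0"
      by (rule tendsto_mult_right_zero)
  qed
  moreover have "(\<lambda>M. 2 * of_real pi * (\<Sum>m\<le>M. p m)) \<longlonglongrightarrow> 2 * of_real pi * riesz_P k l chi x"
    using riesz_P_power_series(1)[OF prim k l, of x] unfolding sums_def_le p_def[symmetric] by (intro tendsto_intros)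
  ultimately have "(\<lambda>M. I (- real M - 1 / 2) + 2 * of_real pi * (\<Sum>m\<le>M. p m)) \<longlonglongrightarrow> 0 + 2 * of_real pi * riesz_P k l chi x"
    by (rule tendsto_add)
  then have "(\<lambda>M. I d) \<longlonglongrightarrow> 2 * of_real pi * riesz_P k l chi x"
    unfolding left[symmetric] by simp
  then show ?thesis unfolding I_def by (simp add: LIMSEQ_const_iff)
qed

text \<open>On the line \<open>Re s = d\<close> the variable \<open>x\<close> enters the modulus of
  the integrand only through \<open>x^(- d)\<close>, which leaves the integral at
  \<open>x = 1\<close> as the constant.\<close>

theorem riesz_P_bigo:
  assumes prim: "primitive_dirichlet_character q chi" and GRH: "GRH chi"
    and k: "k \<ge> 1" and l: "l > 0" and \<epsilon>: "\<epsilon> > 0"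
  shows "riesz_P k l chi \<in> O[at_top](\<lambda>x. complex_of_real (x powr (- (k / l) + 1 / (2 * l) + \<epsilon>)))"
proof -
  have nz: "regular_L q chi s \<noteq> 0" if "Re s > 1 / 2" for s
  proof (cases "Re s \<ge> 1")
    case True
    then show ?thesis by (rule regular_L_nonzero_ge_1[OF prim])
  next
    case False
    with that GRH[unfolded GRH_iff_regular_L[OF prim], rule_format, of s] show ?thesis by auto
  qed
  \<comment> \<open>\<open>\<eta> <= \<epsilon> l\<close> gives the exponent, and
    \<open>\<eta> <= 1/4\<close> keeps \<open>d\<close> positive down to
    \<open>k = 1\<close>.\<close>
  define \<eta> where "\<eta> = min (\<epsilon> * l) (1 / 4)"
  have \<eta>: "0 < \<eta>" "\<eta> < 1 / 2" "\<eta> \<le> \<epsilon> * l" using \<epsilon> l by (auto simp: \<eta>_def min_def)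
  define d where "d = (k - 1 / 2 - \<eta>) / l"
  have d: "0 < d" "k - l * d > 1 / 2" using k l \<eta> by (auto simp: d_def)
  define J where "J = (LINT t|lborel. norm (riesz_integrand q chi k l 1 (Complex d t)))"
  have "norm (riesz_P k l chi x) \<le> J * norm (complex_of_real (x powr (- (k / l) + 1 / (2 * l) + \<epsilon>)))" if x: "x \<ge> 1" for x
  proof -
    have x0: "x > 0" using x by simp
    have "norm (riesz_integrand q chi k l x (Complex d t)) = x powr (- d) * norm (riesz_integrand q chi k l 1 (Complex d t))" for t
      unfolding riesz_integrand_def norm_mult norm_exp_ln[OF x0] by simp
    then have "(LINT t|lborel. norm (riesz_integrand q chi k l x (Complex d t))) = x powr (- d) * J"
      by (simp add: J_def)
    moreover have "norm (2 * of_real pi * riesz_P k l chi x) \<le> (LINT t|lborel. norm (riesz_integrand q chi k l x (Complex d t)))"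
    proof (subst riesz_integral[OF prim _ k l x0 d, symmetric])
      show "norm (LINT t|lborel. riesz_integrand q chi k l x (Complex d t)) \<le> (LINT t|lborel. norm (riesz_integrand q chi k l x (Complex d t)))"
        by (rule integral_norm_bound)
    qed (rule nz)
    moreover have "norm (riesz_P k l chi x) \<le> norm (2 * of_real pi * riesz_P k l chi x)"
      using mult_right_mono[of 1 "2 * pi" "norm (riesz_P k l chi x)"] pi_ge_two by (simp add: norm_mult)
    ultimately have "norm (riesz_P k l chi x) \<le> x powr (- d) * J" by linarith
    also have "\<dots> \<le> x powr (- (k / l) + 1 / (2 * l) + \<epsilon>) * J"
    proof (intro mult_right_mono powr_mono x)
      have "\<eta> / l \<le> \<epsilon>" using \<eta> l by (simp add: pos_divide_le_eq)
      then show "- d \<le> - (k / l) + 1 / (2 * l) + \<epsilon>" by (simp add: d_def diff_divide_distrib)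
    qed (simp add: J_def)
    finally show ?thesis by (simp add: mult.commute)
  qed
  then show ?thesis by (intro bigoI[of _ J] eventually_at_top_linorderI[of 1]) auto
qed

section \<open>Zeros from the size of the Riesz function\<close>

lemma not_nonpos_Int_if_Re_pos:
  assumes "Re z > 0"
  shows "z \<notin> \<int>\<^sub>\<le>\<^sub>0"
proof
  assume "z \<in> \<int>\<^sub>\<le>\<^sub>0"
  then obtain n :: int where n: "z = of_int n" "n \<le> 0" by (elim nonpos_Ints_cases)
  then have "Re z \<le> 0" by simp
  then show False using assms by simp
qed

lemma strip_not_nonpos_Int:
  assumes s: "-1 < Re s" "Re s < 0"
  shows "s \<notin> \<int>\<^sub>\<le>\<^sub>0"
proof
  assume "s \<in> \<int>\<^sub>\<le>\<^sub>0"
  then obtain n :: int where n: "s = of_int n" by (elim nonpos_Ints_cases)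
  then have "real_of_int (-1) < of_int n" "real_of_int n < of_int 0" using s by auto
  then show False by (simp only: of_int_less_iff)
qed

lemma exp_neg_abs_integrable:
  fixes c :: real
  assumes "c > 0"
  shows "integrable lborel (\<lambda>u. exp (- (c * \<bar>u\<bar>)))"
proof (rule Bochner_Integration.integrable_bound)
  show "integrable lborel (\<lambda>u. 2 / c\<^sup>2 * (1 / ((1 / c)\<^sup>2 + u\<^sup>2)))"
    using inverse_square_plus_square_lborel(1)[of "1 / c"] assms by (intro integrable_mult_right) auto
  have "exp (- (c * \<bar>u\<bar>)) \<le> 2 / c\<^sup>2 * (1 / ((1 / c)\<^sup>2 + u\<^sup>2))" for u
  proof -
    have "exp (- (c * \<bar>u\<bar>)) \<le> 2 / (1 + (c * u)\<^sup>2)" using exp_neg_abs_le[of "c * u"] assms by (simp add: abs_mult)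
    also have "1 + (c * u)\<^sup>2 = c\<^sup>2 * ((1 / c)\<^sup>2 + u\<^sup>2)" using assms by (simp add: power2_eq_square field_simps)
    finally show ?thesis by (simp add: mult.commute)
  qed
  then show "AE u in lborel. norm (exp (- (c * \<bar>u\<bar>))) \<le> norm (2 / c\<^sup>2 * (1 / ((1 / c)\<^sup>2 + u\<^sup>2)))"
    by (intro always_eventually allI) (metis norm_ge_zero norm_of_real exp_ge_zero real_norm_def abs_of_nonneg order_trans abs_ge_self)
qed simp

text \<open>The bound \<open>exp u\<close> at minus infinity yields convergence for
  \<open>Re s > -1\<close>. At plus infinity only rates strictly below \<open>D\<close> are
  available, so the rate is chosen after the point \<open>s\<close>, between the right edge of a
  ball around it and \<open>D\<close>.\<close>

lemma laplace_transform_holomorphic: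
  fixes g :: "real \<Rightarrow> complex"
  assumes meas: "g \<in> borel_measurable borel"
    and left: "\<And>u. u \<le> 0 \<Longrightarrow> norm (g u) \<le> C * exp u"
    and right: "\<And>\<delta>. \<delta> < D \<Longrightarrow> \<exists>B. \<forall>u>0. norm (g u) \<le> B * exp (- (\<delta> * u))"
  shows "(\<lambda>s. LINT u|lborel. exp (of_real u * s) * g u) holomorphic_on {s. -1 < Re s \<and> Re s < D}"
    and "-1 < Re s \<Longrightarrow> Re s < D \<Longrightarrow> integrable lborel (\<lambda>u. exp (of_real u * s) * g u)"
proof -
  have bnd: "\<exists>r>0. \<exists>h. ball s r \<subseteq> {s. -1 < Re s \<and> Re s < D} \<and> integrable lborel h \<and>
      (\<forall>z\<in>ball s r. \<forall>u\<in>space lborel. norm (exp (of_real u * z) * g u) \<le> h u)" if s: "s \<in> {s. -1 < Re s \<and> Re s < D}" for s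
  proof -
    define r where "r = min (Re s + 1) (D - Re s) / 2"
    have r: "r > 0" "Re s - r > -1" "Re s + r < D" using s by (auto simp: r_def min_def field_simps)
    have ReD: "Re s - r < Re z" "Re z < Re s + r" if "z \<in> ball s r" for z
      using that abs_Re_le_cmod[of "s - z"] by (auto simp: dist_norm)
    define \<delta> where "\<delta> = (Re s + r + D) / 2"
    have \<delta>: "\<delta> < D" "Re s + r < \<delta>" using r by (auto simp: \<delta>_def)
    obtain B where B: "\<And>u. u > 0 \<Longrightarrow> norm (g u) \<le> B * exp (- (\<delta> * u))" using right[OF \<delta>(1)] by blast
    \<comment> \<open>The smaller of the margins on the two sides; it gives the common majorant
      \<open>exp (- c |u|)\<close> on the whole ball.\<close>
    define c where "c = min (Re s - r + 1) (\<delta> - (Re s + r))"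
    have c: "c > 0" using r \<delta> by (simp add: c_def)
    define E where "E = max \<bar>C\<bar> \<bar>B\<bar>"
    have "norm (exp (of_real u * z) * g u) \<le> E * exp (- (c * \<bar>u\<bar>))" if z: "z \<in> ball s r" for z u
    proof (cases "u \<le> 0")
      case True
      have "u * (c - (Re z + 1)) \<ge> 0" using True ReD(1)[OF z] by (intro mult_nonpos_nonpos) (auto simp: c_def)
      then have "u * Re z + u \<le> - (c * \<bar>u\<bar>)" using True by (simp add: algebra_simps)
      then have "exp (u * Re z) * exp u \<le> exp (- (c * \<bar>u\<bar>))" by (simp add: exp_add[symmetric])
      moreover have "norm (exp (of_real u * z) * g u) \<le> exp (u * Re z) * (E * exp u)"
        unfolding norm_mult using order_trans[OF left[OF True] mult_right_mono[of C E "exp u"]]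
        by (intro mult_mono) (auto simp: E_def)
      moreover have "exp (u * Re z) * (E * exp u) \<le> E * exp (- (c * \<bar>u\<bar>))"
        using calculation(1) mult_left_mono[of "exp (u * Re z) * exp u" "exp (- (c * \<bar>u\<bar>))" E] by (simp add: E_def mult_ac)
      ultimately show ?thesis by linarith
    next
      case False
      have "u * (\<delta> - Re z - c) \<ge> 0" using False ReD(2)[OF z] by (intro mult_nonneg_nonneg) (auto simp: c_def)
      then have "u * Re z - \<delta> * u \<le> - (c * \<bar>u\<bar>)" using False by (simp add: algebra_simps)
      then have "exp (u * Re z) * exp (- (\<delta> * u)) \<le> exp (- (c * \<bar>u\<bar>))" by (simp add: exp_add[symmetric])
      moreover have "norm (exp (of_real u * z) * g u) \<le> exp (u * Re z) * (E * exp (- (\<delta> * u)))"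
        unfolding norm_mult using order_trans[OF B[of u] mult_right_mono[of B E "exp (- (\<delta> * u))"]] False
        by (intro mult_mono) (auto simp: E_def)
      moreover have "exp (u * Re z) * (E * exp (- (\<delta> * u))) \<le> E * exp (- (c * \<bar>u\<bar>))"
        using calculation(1) mult_left_mono[of "exp (u * Re z) * exp (- (\<delta> * u))" "exp (- (c * \<bar>u\<bar>))" E] by (simp add: E_def mult_ac)
      ultimately show ?thesis by linarith
    qed
    moreover have "integrable lborel (\<lambda>u. E * exp (- (c * \<bar>u\<bar>)))" by (intro integrable_mult_right exp_neg_abs_integrable[OF c])
    moreover have "ball s r \<subseteq> {s. -1 < Re s \<and> Re s < D}" using ReD r by fastforce
    ultimately show ?thesis using r(1) by blast
  qed
  have m: "(\<lambda>u. exp (of_real u * s) * g u) \<in> borel_measurable lborel" for s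
    using meas by (simp add: borel_measurable_times borel_measurable_continuous_onI continuous_intros)
  show "(\<lambda>s. LINT u|lborel. exp (of_real u * s) * g u) holomorphic_on {s. -1 < Re s \<and> Re s < D}"
    by (rule holomorphic_on_lebesgue_integral(1)[where f = "\<lambda>s u. exp (of_real u * s) * g u", OF _ m bnd]) (auto intro!: holomorphic_intros)
  show "-1 < Re s \<Longrightarrow> Re s < D \<Longrightarrow> integrable lborel (\<lambda>u. exp (of_real u * s) * g u)"
    by (rule holomorphic_on_lebesgue_integral(2)[where f = "\<lambda>s u. exp (of_real u * s) * g u", OF _ m bnd]) (auto intro!: holomorphic_intros)
qed

text \<open>A function that tends to \<open>- A\<close> at infinity decays after the step
  \<open>A\<close> is added. For \<open>Re s < 0\<close> the step has transform
  \<open>- A / s\<close>, so the simple pole of the continuation at \<open>0\<close> is split off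
  explicitly.\<close>

lemma laplace_transform_add_step:
  fixes A :: complex
  assumes s: "Re s < 0" and int: "integrable lborel (\<lambda>u. exp (of_real u * s) * (g u + A * of_real (indicator {0<..} u)))"
  shows "has_bochner_integral lborel (\<lambda>u. exp (of_real u * s) * g u)
           ((LINT u|lborel. exp (of_real u * s) * (g u + A * of_real (indicator {0<..} u))) + A / s)"
proof -
  have "has_bochner_integral lborel (\<lambda>u. A * (indicator {0<..} u *\<^sub>R exp (- (of_real u * - s)))) (A * (exp (- (of_real 0 * - s)) / - s))"
    using s by (intro has_bochner_integral_mult_right exp_halfline_integral) simp
  then have "has_bochner_integral lborel (\<lambda>u. exp (of_real u * s) * (g u + A * of_real (indicator {0<..} u)) - A * (indicator {0<..} u *\<^sub>R exp (- (of_real u * - s))))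
     ((LINT u|lborel. exp (of_real u * s) * (g u + A * of_real (indicator {0<..} u))) - A * (exp (- (of_real 0 * - s)) / - s))"
    using int by (intro has_bochner_integral_diff has_bochner_integral_integrable)
  then show ?thesis by (simp add: algebra_simps scaleR_conv_of_real)
qed

text \<open>The Cauchy-Saalschuetz form of Euler's integral. Adding a unit step gives a transform
  that is holomorphic for \<open>-1 < Re s < 1\<close> and equals \<open>Gamma s - 1 / s\<close> on
  the right half; multiplied by \<open>s\<close> this continues to the left half, where removing the
  step restores the missing \<open>1 / s\<close>.\<close>

lemma Gamma_lborel_left:
  assumes s: "-1 < Re s" "Re s < 0"
  shows "has_bochner_integral lborel (\<lambda>u. exp (of_real u * s) * (of_real (exp (- exp u)) - 1)) (Gamma s)"
proof -
  define g where "g = (\<lambda>u. (complex_of_real (exp (- exp u)) - 1) + 1 * of_real (indicator {0<..} u))"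
  define M where "M = (\<lambda>s::complex. LINT u|lborel. exp (of_real u * s) * g u)"
  have meas: "g \<in> borel_measurable borel"
  proof -
    have "(\<lambda>u. complex_of_real (exp (- exp u)) - 1) \<in> borel_measurable borel"
      by (intro borel_measurable_continuous_onI continuous_intros)
    then show ?thesis unfolding g_def by measurable
  qed
  have left: "norm (g u) \<le> 1 * exp u" if "u \<le> 0" for u
  proof -
    have "g u = of_real (exp (- exp u) - 1)" using that by (simp add: g_def)
    then have "norm (g u) = 1 - exp (- exp u)" by (simp only: norm_of_real) simp
    then show ?thesis using exp_ge_add_one_self[of "- exp u"] by simp
  qed
  have right: "\<exists>B. \<forall>u>0. norm (g u) \<le> B * exp (- (\<delta> * u))" if "\<delta> < 1" for \<delta>
  proof (intro exI[of _ 1] allI impI)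
    fix u :: real assume u: "u > 0"
    have "\<delta> * u \<le> exp u" using u that mult_right_mono[of \<delta> 1 u] exp_ge_add_one_self[of u] by linarith
    moreover have "g u = of_real (exp (- exp u))" using u by (simp add: g_def)
    then have "norm (g u) = exp (- exp u)" by (simp only: norm_of_real) simp
    ultimately show "norm (g u) \<le> 1 * exp (- (\<delta> * u))" by simp
  qed
  note LT = laplace_transform_holomorphic[OF meas left right]
  have hol: "M holomorphic_on {s. -1 < Re s \<and> Re s < 1}" unfolding M_def by (rule LT(1))
  have pos: "z * M z = Gamma (z + 1) - 1" if z: "0 < Re z" "Re z < 1" for z
  proof -
    have z0: "z \<noteq> 0" using z by auto
    have "has_bochner_integral lborel (\<lambda>u. indicator {0<..} u *\<^sub>R exp (- (of_real u * z))) (exp (- (of_real 0 * z)) / z)"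
      by (rule exp_halfline_integral[OF z(1)])
    then have "has_bochner_integral lborel (\<lambda>u. indicator {0<..} (0 + -1 * u) *\<^sub>R exp (- (of_real (0 + -1 * u) * z))) ((exp (- (of_real 0 * z)) / z) /\<^sub>R \<bar>-1\<bar>)"
      by (subst lborel_has_bochner_integral_real_affine_iff[symmetric]) auto
    then have 1: "has_bochner_integral lborel (\<lambda>u. exp (of_real u * z) * of_real (exp (- exp u)) - indicator {0<..} (- u) *\<^sub>R exp (of_real u * z)) (Gamma z - 1 / z)"
      by (intro has_bochner_integral_diff Gamma_lborel z) simp
    have 2: "AE u in lborel. exp (of_real u * z) * of_real (exp (- exp u)) - indicator {0<..} (- u) *\<^sub>R exp (of_real u * z) = exp (of_real u * z) * g u"
    \<comment> \<open>Equality fails only at \<open>u = 0\<close>, where both indicators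
      vanish.\<close>
    proof -
      have "AE u in lborel. u \<noteq> (0::real)" by (rule AE_lborel_singleton)
      then show ?thesis by eventually_elim (auto simp: g_def indicator_def algebra_simps)
    qed
    have 3: "(\<lambda>u. exp (of_real u * z) * g u) \<in> borel_measurable lborel"
      using LT(2)[where s = z] z by (intro borel_measurable_integrable) auto
    have "has_bochner_integral lborel (\<lambda>u. exp (of_real u * z) * g u) (Gamma z - 1 / z)"
      using 1 by (rule iffD1[OF has_bochner_integral_cong_AE[OF borel_measurable_has_bochner_integral[OF 1] 3 2]])
    then have "M z = Gamma z - 1 / z" unfolding M_def by (rule has_bochner_integral_integral_eq)
    moreover have "Gamma (z + 1) = z * Gamma z" using z by (intro Gamma_plus1) (rule not_nonpos_Int_if_Re_pos)
    ultimately show ?thesis using z0 by (simp add: right_diff_distrib)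
  qed
  have "s * M s = Gamma (s + 1) - 1"
  proof (rule analytic_continuation_open[where s = "{z. 0 < Re z \<and> Re z < 1}" and s' = "{z. -1 < Re z \<and> Re z < 1}"
        and f = "\<lambda>z. z * M z" and g = "\<lambda>z. Gamma (z + 1) - 1"])
    have "Complex (1 / 2) 0 \<in> {z. 0 < Re z \<and> Re z < 1}" by simp
    then show "{z. 0 < Re z \<and> Re z < 1} \<noteq> {}" by blast
    show "(\<lambda>z. Gamma (z + 1) - 1) holomorphic_on {z. -1 < Re z \<and> Re z < 1}"
    proof (intro holomorphic_intros)
      fix z assume "z \<in> {z. -1 < Re z \<and> Re z < 1}"
      then have "Re (z + 1) > 0" by simp
      then show "z + 1 \<notin> \<int>\<^sub>\<le>\<^sub>0" by (rule not_nonpos_Int_if_Re_pos)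
    qed
    show "(\<lambda>z. z * M z) holomorphic_on {z. -1 < Re z \<and> Re z < 1}" by (rule holomorphic_on_mult[OF holomorphic_on_ident hol])
    show "connected {z. -1 < Re z \<and> Re z < 1}" by (rule convex_connected[OF convex_vertical_strip])
    show "z * M z = Gamma (z + 1) - 1" if "z \<in> {z. 0 < Re z \<and> Re z < 1}" for z using that by (intro pos) auto
  qed (use s in \<open>auto simp: open_vertical_strip\<close>)
  moreover have "s \<noteq> 0" "Gamma (s + 1) = s * Gamma s"
  proof -
    show "s \<noteq> 0" using s by auto
    show "Gamma (s + 1) = s * Gamma s" by (rule Gamma_plus1[OF strip_not_nonpos_Int[OF s]])
  qed
  ultimately have "M s + 1 / s = Gamma s" by (simp add: field_simps)
  moreover have "has_bochner_integral lborel (\<lambda>u. exp (of_real u * s) * (of_real (exp (- exp u)) - 1)) (M s + 1 / s)"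
    unfolding M_def g_def using s LT(2)[where s = s] by (intro laplace_transform_add_step) (auto simp: g_def)
  ultimately show ?thesis by simp
qed

text \<open>The \<open>n\<close>-th term is \<open>h\<close> translated by
  \<open>l ln (n + 1)\<close>, and the translation multiplies its transform by
  \<open>(n + 1)^(l s)\<close>. So the transform is \<open>Gamma s\<close> times the Dirichlet
  series at \<open>k - l s\<close>, which converges absolutely because
  \<open>Re s < 0\<close>.\<close>

lemma riesz_P_exp_laplace:
  assumes prim: "primitive_dirichlet_character q chi" and k: "k \<ge> 1" and l: "l > 0"
    and s: "-1 < Re s" "Re s < 0"
  shows "(LINT u|lborel. exp (of_real u * s) * (riesz_P k l chi (exp u) - recip_L q chi (of_real k)))
           = Gamma s * recip_L q chi (of_real k - of_real l * s)"
proof -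
  define a where "a = (\<lambda>n. chi (int n) * of_int (moebius n))"
  have a1: "norm (a n) \<le> 1" for n unfolding a_def by (rule norm_moebius_char_le[OF prim])
  define L where "L = (\<lambda>n. l * ln (real (Suc n)))"
  define h where "h = (\<lambda>u. exp (of_real u * s) * (complex_of_real (exp (- exp u)) - 1))"
  define b where "b = (\<lambda>n. a (Suc n) * of_nat (Suc n) powr (- (of_real k - of_real l * s)))"
  define f where "f = (\<lambda>n u. b n * h (u - L n))"
  have hb: "has_bochner_integral lborel h (Gamma s)" unfolding h_def by (rule Gamma_lborel_left[OF s])
  have sh: "has_bochner_integral lborel (\<lambda>u. g (u - c)) v" if "has_bochner_integral lborel g v" for g :: "real \<Rightarrow> 'z :: {banach,second_countable_topology}" and c v
    using lborel_has_bochner_integral_real_affine_iff[of 1 g v "- c"] that by simp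
  have fb: "has_bochner_integral lborel (f n) (b n * Gamma s)" for n
    unfolding f_def by (intro has_bochner_integral_mult_right sh hb)
  have "l * Re s < 0" using l s by (intro mult_pos_neg)
  then have re1: "Re (of_real k - of_real l * s) > 1" using k by simp
  have bs: "summable (\<lambda>n. norm (b n))" unfolding b_def by (rule dirichlet_series_abs_summable[OF a1 re1])
  have b_sum: "b sums recip_L q chi (of_real k - of_real l * s)"
    unfolding recip_L_eq[OF prim re1] dirichlet_series_def b_def a_def[symmetric]
    using dirichlet_series_abs_summable[OF a1 re1] by (intro summable_sums) (rule summable_norm_cancel)
  have f_eq: "f n u = exp (of_real u * s) * (a (Suc n) * of_real (real (Suc n) powr (- k)) * (exp (- of_real (exp u * real (Suc n) powr (- l))) - 1))" for n u
  proof -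
    have "of_nat (Suc n) powr (- (of_real k - of_real l * s)) = exp (of_real (L n) * s) * complex_of_real (real (Suc n) powr (- k))"
    proof -
      have "of_nat (Suc n) powr (- (of_real k - of_real l * s)) = exp ((- (of_real k - of_real l * s)) * of_real (ln (real (Suc n))))"
        unfolding powr_def using Ln_of_nat[of "Suc n"] by (simp del: of_nat_Suc)
      also have "\<dots> = exp (of_real (L n) * s) * exp (of_real (- k * ln (real (Suc n))))"
        by (simp add: L_def exp_add[symmetric] algebra_simps del: of_nat_Suc)
      also have "exp (complex_of_real (- k * ln (real (Suc n)))) = of_real (real (Suc n) powr (- k))"
        by (simp add: powr_def exp_of_real[symmetric] del: of_nat_Suc)
      finally show ?thesis .
    qed
    moreover have "exp (u - L n) = exp u * real (Suc n) powr (- l)"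
      by (simp add: L_def powr_def exp_diff exp_minus divide_inverse del: of_nat_Suc)
    moreover have "exp (of_real (L n) * s) * exp (of_real (u - L n) * s) = exp (of_real u * s)"
      by (simp add: exp_add[symmetric] algebra_simps)
    ultimately show ?thesis unfolding f_def b_def h_def by (simp add: exp_of_real[symmetric] mult_ac del: of_nat_Suc)
  qed
  have pw: "(\<lambda>n. f n u) sums (exp (of_real u * s) * (riesz_P k l chi (exp u) - recip_L q chi (of_real k)))" for u
    unfolding f_eq a_def by (intro sums_mult riesz_P_power_series(2)[OF prim k l])
  have nf: "(LINT u|lborel. norm (f n u)) = norm (b n) * (LINT u|lborel. norm (h u))" for n
  proof -
    have "has_bochner_integral lborel (\<lambda>u. norm (h u)) (LINT u|lborel. norm (h u))"
      using hb by (intro has_bochner_integral_integrable integrable_norm) (simp add: has_bochner_integral_iff)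
    then have "has_bochner_integral lborel (\<lambda>u. norm (b n) * norm (h (u - L n))) (norm (b n) * (LINT u|lborel. norm (h u)))"
      by (intro has_bochner_integral_mult_right sh)
    then show ?thesis unfolding f_def norm_mult by (rule has_bochner_integral_integral_eq)
  qed
  have hbound: "norm (h u) \<le> exp (u * (Re s + 1))" for u
  proof -
    have "norm (complex_of_real (exp (- exp u)) - 1) = norm (complex_of_real (exp (- exp u) - 1))" by simp
    also have "\<dots> \<le> exp u" unfolding norm_of_real using exp_ge_add_one_self[of "- exp u"] by (simp add: abs_if)
    finally have "norm (h u) \<le> exp (u * Re s) * exp u" unfolding h_def norm_mult by (intro mult_mono) auto
    then show ?thesis by (simp add: exp_add[symmetric] algebra_simps)
  qed
  \<comment> \<open>As \<open>L n >= 0\<close> and \<open>Re s + 1 > 0\<close>, translating to the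
    right only lowers the bound \<open>exp (u (Re s + 1))\<close>, which thus serves for all
    \<open>n\<close>.\<close>
  have sumn: "summable (\<lambda>n. norm (f n u))" for u
  proof (rule summable_comparison_test')
    show "summable (\<lambda>n. norm (b n) * exp (u * (Re s + 1)))" by (rule summable_mult2[OF bs])
    fix n
    have "L n \<ge> 0" using l by (simp add: L_def del: of_nat_Suc)
    then have "(u - L n) * (Re s + 1) \<le> u * (Re s + 1)" using s by (intro mult_right_mono) auto
    then have "norm (h (u - L n)) \<le> exp (u * (Re s + 1))" using hbound[of "u - L n"] by (meson exp_le_cancel_iff order_trans)
    then show "norm (norm (f n u)) \<le> norm (b n) * exp (u * (Re s + 1))"
      unfolding f_def by (simp add: norm_mult mult_left_mono)
  qed
  have "(\<lambda>n. LINT u|lborel. f n u) sums (LINT u|lborel. (\<Sum>n. f n u))"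
  proof (rule sums_integral)
    show "integrable lborel (f n)" for n using fb[of n] by (simp add: has_bochner_integral_iff)
    show "summable (\<lambda>n. LINT u|lborel. norm (f n u))" unfolding nf by (rule summable_mult2[OF bs])
    show "AE u in lborel. summable (\<lambda>n. norm (f n u))" using sumn by simp
  qed
  moreover have "(\<lambda>n. LINT u|lborel. f n u) = (\<lambda>n. b n * Gamma s)" using fb by (simp add: has_bochner_integral_iff)
  moreover have "(\<Sum>n. f n u) = exp (of_real u * s) * (riesz_P k l chi (exp u) - recip_L q chi (of_real k))" for u
    using pw by (rule sums_unique[symmetric])
  ultimately have "(\<lambda>n. b n * Gamma s) sums (LINT u|lborel. exp (of_real u * s) * (riesz_P k l chi (exp u) - recip_L q chi (of_real k)))"
    by simp
  moreover have "(\<lambda>n. b n * Gamma s) sums (recip_L q chi (of_real k - of_real l * s) * Gamma s)" by (rule sums_mult2[OF b_sum])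
  ultimately show ?thesis by (simp add: sums_unique2 mult.commute)
qed

text \<open>Read off from the power series, which converges everywhere. Continuity later supplies
  measurability of the integrand and bounds on compact intervals.\<close>

lemma continuous_riesz_P:
  assumes prim: "primitive_dirichlet_character q chi" and k: "k \<ge> 1" and l: "l > 0"
  shows "continuous_on A (riesz_P k l chi)"
proof -
  define c where "c = (\<lambda>m. recip_L q chi (of_real (k + l * real m)) * (- 1) ^ m / fact m)"
  have ps: "(\<lambda>m. c m * of_real x ^ m) sums riesz_P k l chi x" for x
    using riesz_P_power_series(1)[OF prim k l, of x] by (simp add: c_def power_minus[of "of_real x"] mult_ac)
  have "isCont (\<lambda>y. \<Sum>m. c m * y ^ m) y" for y
  proof (rule isCont_powser)
    show "summable (\<lambda>m. c m * complex_of_real (norm y + 1) ^ m)" by (rule sums_summable[OF ps])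
    show "norm y < norm (complex_of_real (norm y + 1))" unfolding norm_of_real by simp
  qed
  then have "continuous_on UNIV (\<lambda>y. \<Sum>m. c m * y ^ m)" by (intro continuous_at_imp_continuous_on ballI)
  then have "continuous_on A (\<lambda>x. \<Sum>m. c m * complex_of_real x ^ m)"
    by (rule continuous_on_compose2) (auto intro!: continuous_intros)
  then show ?thesis using ps by (simp add: sums_iff)
qed

text \<open>From \<open>|exp (- y) - 1| <= y\<close>, with an absolutely convergent constant. The
  linear order at \<open>0\<close> is what lets the transform converge for
  \<open>Re s > -1\<close>.\<close>

lemma riesz_P_near_0:
  assumes prim: "primitive_dirichlet_character q chi" and k: "k \<ge> 1" and l: "l > 0"
  shows "\<exists>C. \<forall>x\<ge>0. norm (riesz_P k l chi x - recip_L q chi (of_real k)) \<le> C * x"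
proof -
  define a where "a = (\<lambda>n. chi (int n) * of_int (moebius n))"
  have a1: "norm (a n) \<le> 1" for n unfolding a_def by (rule norm_moebius_char_le[OF prim])
  have s: "summable (\<lambda>n. real (Suc n) powr (- (k + l)))"
    using k l by (subst summable_Suc_iff) (simp add: summable_real_powr_iff)
  have "norm (riesz_P k l chi x - recip_L q chi (of_real k)) \<le> (\<Sum>n. real (Suc n) powr (- (k + l))) * x" if x: "x \<ge> 0" for x
  proof -
    define f where "f = (\<lambda>n. a (Suc n) * of_real (real (Suc n) powr (- k)) * (exp (- of_real (x * real (Suc n) powr (- l))) - 1))"
    have f: "f sums (riesz_P k l chi x - recip_L q chi (of_real k))"
      unfolding f_def a_def by (rule riesz_P_power_series(2)[OF prim k l])
    have le: "norm (f n) \<le> real (Suc n) powr (- (k + l)) * x" for n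
    proof -
      define y where "y = x * real (Suc n) powr (- l)"
      have y: "y \<ge> 0" using x by (simp add: y_def)
      have "norm (exp (- of_real y) - 1 :: complex) = norm (complex_of_real (exp (- y) - 1))" by (simp add: exp_of_real[symmetric])
      also have "\<dots> \<le> y" unfolding norm_of_real using exp_ge_add_one_self[of "- y"] y by (simp add: abs_if)
      finally have "norm (exp (- of_real y) - 1 :: complex) \<le> y" .
      then have "norm (f n) \<le> 1 * real (Suc n) powr (- k) * y"
        unfolding f_def norm_mult y_def[symmetric] using a1[of "Suc n"] y by (intro mult_mono) (auto simp: a_def)
      also have "\<dots> = real (Suc n) powr (- (k + l)) * x" 
        using powr_add[of "real (Suc n)" "- k" "- l"] by (simp add: y_def mult_ac del: of_nat_Suc)
      finally show ?thesis .
    qed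
    have "norm (suminf f) \<le> (\<Sum>n. real (Suc n) powr (- (k + l)) * x)"
      using le summable_mult2[OF s, of x] by (rule norm_suminf_le)
    then show ?thesis using f suminf_mult2[OF s, of x] by (simp add: sums_iff)
  qed
  then show ?thesis by blast
qed

theorem GRH_if_riesz_P_bigo:
  assumes prim: "primitive_dirichlet_character q chi" and k: "k \<ge> 1" and l: "l > 0"
    and O: "\<And>\<epsilon>. \<epsilon> > 0 \<Longrightarrow> riesz_P k l chi \<in> O[at_top](\<lambda>x. complex_of_real (x powr (- (k / l) + 1 / (2 * l) + \<epsilon>)))"
  shows "GRH chi"
proof -
  define A where "A = recip_L q chi (of_real k)"
  \<comment> \<open>\<open>l * D = k - 1/2\<close>, so \<open>Re s < D\<close> is the half-plane
    \<open>Re (k - l s) > 1/2\<close>.\<close>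
  define D where "D = k / l - 1 / (2 * l)"
  have D: "D > 0" "l * D = k - 1 / 2" using k l by (auto simp: D_def field_simps)
  \<comment> \<open>For \<open>u > 0\<close> this is \<open>P\<close> itself and for
    \<open>u <= 0\<close> it is \<open>P - A\<close>. Both decay, so the transform converges across
    the line \<open>Re s = 0\<close>.\<close>
  define g where "g = (\<lambda>u. (riesz_P k l chi (exp u) - A) + A * of_real (indicator {0<..} u))"
  define M where "M = (\<lambda>s::complex. LINT u|lborel. exp (of_real u * s) * g u)"
  have cont: "continuous_on UNIV (\<lambda>u. riesz_P k l chi (exp u))"
    by (rule continuous_on_compose2[OF continuous_riesz_P[OF prim k l, of UNIV]]) (auto intro!: continuous_intros)
  have meas: "g \<in> borel_measurable borel"
  proof -
    have "(\<lambda>u. riesz_P k l chi (exp u) - A) \<in> borel_measurable borel"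
      by (intro borel_measurable_continuous_onI continuous_intros cont)
    then show ?thesis unfolding g_def by measurable
  qed
  obtain C where C: "\<And>x. x \<ge> 0 \<Longrightarrow> norm (riesz_P k l chi x - A) \<le> C * x"
    using riesz_P_near_0[OF prim k l] unfolding A_def by blast
  have left: "norm (g u) \<le> C * exp u" if "u \<le> 0" for u
    using C[of "exp u"] that by (simp add: g_def)
  have right: "\<exists>B. \<forall>u>0. norm (g u) \<le> B * exp (- (\<delta> * u))" if \<delta>: "\<delta> < D" for \<delta>
  proof -
    \<comment> \<open>With \<open>D - \<delta>\<close> in place of \<open>\<epsilon>\<close> the
      assumed power is exactly \<open>x^(- \<delta>)\<close>.\<close>
    obtain c where c: "c > 0" "\<forall>\<^sub>F x in at_top. norm (riesz_P k l chi x) \<le> c * norm (complex_of_real (x powr (- (k / l) + 1 / (2 * l) + (D - \<delta>))))"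
      using landau_o.bigE[OF O[of "D - \<delta>"]] \<delta> by auto
    then obtain X where X: "\<And>x. x \<ge> X \<Longrightarrow> norm (riesz_P k l chi x) \<le> c * x powr (- \<delta>)"
      unfolding eventually_at_top_linorder by (auto simp: D_def)
    \<comment> \<open>Beyond \<open>U\<close> one has \<open>exp u > u >= X\<close>; below it
      compactness replaces the asymptotic bound.\<close>
    define U where "U = \<bar>X\<bar>"
    have "compact ((\<lambda>u. exp (of_real (\<delta> * u)) * riesz_P k l chi (exp u)) ` {0..U})"
      by (intro compact_continuous_image continuous_intros continuous_on_subset[OF cont]) auto
    then obtain B where B: "\<And>u. u \<in> {0..U} \<Longrightarrow> norm (exp (of_real (\<delta> * u)) * riesz_P k l chi (exp u)) \<le> B"
      by (metis (no_types, lifting) bounded_iff compact_imp_bounded image_eqI)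
    have "norm (g u) \<le> max B c * exp (- (\<delta> * u))" if u: "u > 0" for u
    proof -
      have gu: "g u = riesz_P k l chi (exp u)" using u by (simp add: g_def)
      show ?thesis
      proof (cases "u \<le> U")
        case True
        then have "exp (\<delta> * u) * norm (g u) \<le> B" using B[of u] u unfolding gu by (simp add: norm_mult)
        then have "norm (g u) \<le> B * exp (- (\<delta> * u))" by (simp add: exp_minus field_simps)
        also have "\<dots> \<le> max B c * exp (- (\<delta> * u))" by (intro mult_right_mono) auto
        finally show ?thesis .
      next
        case False
        then have "X \<le> exp u" using exp_ge_add_one_self[of u] unfolding U_def by linarith
        then have "norm (g u) \<le> c * exp u powr (- \<delta>)" unfolding gu by (rule X)
        also have "exp u powr (- \<delta>) = exp (- (\<delta> * u))" by (simp add: powr_def)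
        also have "c * exp (- (\<delta> * u)) \<le> max B c * exp (- (\<delta> * u))" by (intro mult_right_mono) auto
        finally show ?thesis .
      qed
    qed
    then show ?thesis by blast
  qed
  note LT = laplace_transform_holomorphic[OF meas left right]
  have hol: "M holomorphic_on {s. -1 < Re s \<and> Re s < D}" unfolding M_def by (rule LT(1))
  \<comment> \<open>\<open>rGamma (s + 1)\<close> cancels \<open>s * Gamma s\<close>, and
    \<open>regular_L\<close> cancels the denominator of \<open>recip_L\<close>. Both are entire, so
    the product form can be continued past the line \<open>Re s = 0\<close>.\<close>
  have id: "(s * M s + A) * rGamma (s + 1) * regular_L q chi (of_real k - of_real l * s) = (of_real k - of_real l * s - 1) ^ pole_order q"
    if s: "-1 < Re s" "Re s < 0" for s
  proof -
    have "has_bochner_integral lborel (\<lambda>u. exp (of_real u * s) * (riesz_P k l chi (exp u) - A)) (M s + A / s)"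
      unfolding M_def g_def using s D LT(2)[where s = s] by (intro laplace_transform_add_step) (auto simp: g_def)
    then have "M s + A / s = Gamma s * recip_L q chi (of_real k - of_real l * s)"
      using riesz_P_exp_laplace[OF prim k l s] unfolding A_def[symmetric] by (simp add: has_bochner_integral_iff)
    moreover have s0: "s \<noteq> 0" using s by auto
    ultimately have "s * M s + A = (s * Gamma s) * recip_L q chi (of_real k - of_real l * s)" by (simp add: field_simps)
    moreover have "rGamma (s + 1) * (s * Gamma s) = 1"
    proof -
      have "s + 1 \<notin> \<int>\<^sub>\<le>\<^sub>0" using s by (intro not_nonpos_Int_if_Re_pos) simp
      then show ?thesis
        unfolding Gamma_plus1[OF strip_not_nonpos_Int[OF s], symmetric] by (simp add: rGamma_inverse_Gamma Gamma_eq_zero_iff)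
    qed
    moreover have "recip_L q chi (of_real k - of_real l * s) * regular_L q chi (of_real k - of_real l * s) = (of_real k - of_real l * s - 1) ^ pole_order q"
    proof -
      have "l * Re s \<le> 0" using l s by (intro mult_nonneg_nonpos) auto
      then have "regular_L q chi (of_real k - of_real l * s) \<noteq> 0" using k by (intro regular_L_nonzero_ge_1[OF prim]) simp
      then show ?thesis by (simp add: recip_L_def)
    qed
    ultimately show ?thesis by (metis mult.assoc mult.commute mult_1)
  qed
  have id2: "(s * M s + A) * rGamma (s + 1) * regular_L q chi (of_real k - of_real l * s) = (of_real k - of_real l * s - 1) ^ pole_order q"
    if s: "-1 < Re s" "Re s < D" for s
  proof (rule analytic_continuation_open[where s = "{z. -1 < Re z \<and> Re z < 0}" and s' = "{z. -1 < Re z \<and> Re z < D}"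
        and f = "\<lambda>s. (s * M s + A) * rGamma (s + 1) * regular_L q chi (of_real k - of_real l * s)"])
    have "Complex (- 1 / 2) 0 \<in> {z. -1 < Re z \<and> Re z < 0}" by simp
    then show "{z. -1 < Re z \<and> Re z < 0} \<noteq> {}" by blast
    have "regular_L q chi \<circ> (\<lambda>s. of_real k - of_real l * s) holomorphic_on {z. -1 < Re z \<and> Re z < D}"
      by (rule holomorphic_on_compose[OF _ holomorphic_regular_L[OF prim]]) (intro holomorphic_intros)
    then have "(\<lambda>s. regular_L q chi (of_real k - of_real l * s)) holomorphic_on {z. -1 < Re z \<and> Re z < D}"
      by (simp only: comp_def)
    moreover have "(\<lambda>s. s * M s + A) holomorphic_on {z. -1 < Re z \<and> Re z < D}"
      by (rule holomorphic_on_add[OF holomorphic_on_mult[OF holomorphic_on_ident hol] holomorphic_on_const])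
    moreover have "(\<lambda>s. rGamma (s + 1)) holomorphic_on {z. -1 < Re z \<and> Re z < D}" by (intro holomorphic_intros)
    ultimately show "(\<lambda>s. (s * M s + A) * rGamma (s + 1) * regular_L q chi (of_real k - of_real l * s)) holomorphic_on {z. -1 < Re z \<and> Re z < D}"
      by (intro holomorphic_on_mult)
    show "{z. -1 < Re z \<and> Re z < 0} \<subseteq> {z. -1 < Re z \<and> Re z < D}" using D by auto
    show "(\<lambda>s. (of_real k - of_real l * s - 1) ^ pole_order q) holomorphic_on {z. -1 < Re z \<and> Re z < D}" by (intro holomorphic_intros)
    show "connected {z. -1 < Re z \<and> Re z < D}" by (rule convex_connected[OF convex_vertical_strip])
    show "(z * M z + A) * rGamma (z + 1) * regular_L q chi (of_real k - of_real l * z) = (of_real k - of_real l * z - 1) ^ pole_order q"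
      if "z \<in> {z. -1 < Re z \<and> Re z < 0}" for z using that by (intro id) auto
  qed (use s in \<open>auto simp: open_vertical_strip\<close>)
  \<comment> \<open>A zero \<open>z\<close> corresponds to \<open>s = (k - z) / l\<close> in the
    strip of \<open>id2\<close>, where the right-hand side is a power of \<open>z - 1\<close> and
    cannot vanish since \<open>Re z < 1\<close>.\<close>
  have right_zero_free: "regular_L q chi z \<noteq> 0" if z: "1 / 2 < Re z" "Re z < 1" for z
  proof
    assume zero: "regular_L q chi z = 0"
    define s where "s = (of_real k - z) / of_real l"
    have ks: "of_real k - of_real l * s = z" using l by (simp add: s_def)
    have "Re s = (k - Re z) / l" by (simp add: s_def)
    then have ls: "l * Re s = k - Re z" using l by simp
    have "-1 < Re s"
    proof -
      have "l * Re s > 0" using ls k z by simp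
      then show ?thesis using l by (simp add: zero_less_mult_iff)
    qed
    moreover have "Re s < D"
    proof -
      have "l * Re s < l * D" using ls D z by simp
      then show ?thesis using l by simp
    qed
    ultimately have "(z - 1) ^ pole_order q = 0" using id2[of s] unfolding ks zero by simp
    then show False using z by auto
  qed
  have "Re s = 1 / 2" if s: "0 < Re s" "Re s < 1" "regular_L q chi s = 0" for s
  proof (rule ccontr)
    assume "Re s \<noteq> 1 / 2"
    then consider "Re s > 1 / 2" | "Re s < 1 / 2" by linarith
    then show False
    proof cases
      case 1
      then show False using right_zero_free s by blast
    next
      case 2
      \<comment> \<open>The zero symmetry asks that \<open>regular_L\<close> is not identically
        zero; the reflected zero \<open>1 - cnj s\<close> then has real part above
        \<open>1/2\<close>.\<close>
      have "regular_L q chi 2 \<noteq> 0" by (rule regular_L_nonzero_ge_1[OF prim]) simp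
      then have "regular_L q chi (1 - cnj s) = 0" using regular_L_zero_symmetry[OF prim s] by blast
      then show False using right_zero_free[of "1 - cnj s"] 2 s by simp
    qed
  qed
  then show ?thesis unfolding GRH_iff_regular_L[OF prim] by blast
qed

theorem theorem2p2:
  fixes q :: nat and chi :: "int \<Rightarrow> complex" and k l :: real
  assumes "primitive_dirichlet_character q chi"
    and "k \<ge> 1" and "l > 0"
  shows "GRH chi \<longleftrightarrow>
    (\<forall>\<epsilon>::real. \<epsilon> > 0 \<longrightarrow>
       riesz_P k l chi \<in> O[at_top](\<lambda>x. complex_of_real (x powr (- (k / l) + 1 / (2 * l) + \<epsilon>))))"
  using riesz_P_bigo[OF assms(1) _ assms(2,3)] GRH_if_riesz_P_bigo[OF assms] by blast

end
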